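(* Let $N=1$. Let $u$ be a solution of $\partial_t^2u=\partial_x^2u+|u|^{p-1}u\log^a(2+u^2)$ with blow-up graph $\Gamma=\{(x,T(x)) : x\in\mathbb{R}\}$, and let $x_0\in\mathbb{R}$ be a non characteristic point. Then, for a sufficiently large constant $\theta$ in the definition of the functional $L$, there exists $t_1(x_0)\in[0,T(x_0))$ such that, for all $T_0\in(t_1(x_0),T(x_0)]$ and all $s\ge-\log(T_0-t_1(x_0))$, $$L(w(s+1),s+1)-L(w(s),s)\le-\frac{2}{p-1}\int_s^{s+1}\int_{-1}^1(\partial_sw(y,\tau))^2\frac{\rho(y)}{1-y^2}\,dy\,d\tau,$$ where $w=w_{x_0,T_0}$.
   Context: Here $p>1$, $a\in\mathbb{R}$, $N=1$. The equation is the Cauchy problem $\partial_t^2u=\partial_x^2u+f(u)$, $f(u)=|u|^{p-1}u\log^a(2+u^2)$, for real-valued $u(x,t)$, with data $u(\cdot,0)\in H^1_{loc,u}(\mathbb{R})$ and $\partial_tu(\cdot,0)\in L^2_{loc,u}(\mathbb{R})$, where $L^2_{loc,u}(\mathbb{R})=\{v:\sup_{d\in\mathbb{R}}\int_{|x-d|\le1}|v(x)|^2dx<\infty\}$ and $H^1_{loc,u}=\{v\in L^2_{loc,u}: \partial_xv\in L^2_{loc,u}\}$. A blow-up solution $u$ is considered on its maximal influence domain $D=\{(x,t): t<T(x)\}$, where $x\mapsto T(x)$ is $1$-Lipschitz; its graph $\Gamma$ is the blow-up graph. A point $x_0$ is non characteristic if there are $\delta_0\in(0,1)$ and $t_0<T(x_0)$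 such that $u$ is defined on $\{(x,t): t<T(x_0)-\delta_0|x-x_0|\}\cap\{t\ge t_0\}$. Set $\psi_{T_0}(t)=(T_0-t)^{-\frac{2}{p-1}}(-\log(T_0-t))^{-\frac{a}{p-1}}$. For $0<T_0\le T(x_0)$, $w_{x_0,T_0}$ is defined by $y=\frac{x-x_0}{T_0-t}$, $s=-\log(T_0-t)$, $u(x,t)=\psi_{T_0}(t)\,w_{x_0,T_0}(y,s)$. Further, $\rho(y)=(1-y^2)^{\frac{2}{p-1}}$, $\phi=\phi(s)=e^{\frac{2s}{p-1}}s^{-\frac{a}{p-1}}$, $F(u)=\int_0^uf(v)\,dv$, and $$E_1(w(s),s)=\int_{-1}^1\Big(\tfrac12(\partial_sw)^2+\tfrac12(\partial_yw)^2(1-y^2)+\tfrac{p+1}{(p-1)^2}w^2-e^{-\frac{2(p+1)s}{p-1}}s^{\frac{2a}{p-1}}F(\phi w)\Big)\rho\,dy,$$ $$L_0(w(s),s)=E_1(w(s),s)-\frac{1}{s\sqrt s}\int_{-1}^1w\,\partial_sw\,\rho\,dy,\qquad L(w(s),s)=\exp\Big(\frac{p+3}{\sqrt s}\Big)L_0(w(s),s)+\theta e^{-s}$$ for $s\ge\max(1,-\log T_0)$, where $\theta$ is a sufficiently large constant. *)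

theory Defs
  imports "HOL-Analysis.Analysis"
begin

definition nonlin :: "real \<Rightarrow> real \<Rightarrow> real \<Rightarrow> real" where
  "nonlin p a v = \<bar>v\<bar> powr (p - 1) * v * ln (2 + v\<^sup>2) powr a"

definition nonlin_prim :: "real \<Rightarrow> real \<Rightarrow> real \<Rightarrow> real" where
  "nonlin_prim p a v = (LBINT z=0..ereal v. nonlin p a z)"

definition L2_locu :: "(real \<Rightarrow> real) set" where
  "L2_locu = {v. v \<in> borel_measurable lebesgue \<and>
     (SUP d. \<integral>\<^sup>+ x \<in> {x. \<bar>x - d\<bar> \<le> 1}. ennreal (\<bar>v x\<bar>\<^sup>2) \<partial>lebesgue) < \<infinity>}"

text \<open>Weak derivative on the line, tested against compactly supported functions of class C1.\<close>

definition weak_deriv :: "(real \<Rightarrow> real) \<Rightarrow> (real \<Rightarrow> real) \<Rightarrow> bool" where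
  "weak_deriv v g \<longleftrightarrow>
     (\<forall>\<xi>::real \<Rightarrow> real. \<xi> C1_differentiable_on UNIV \<and> (\<exists>R. \<forall>x. \<bar>x\<bar> > R \<longrightarrow> \<xi> x = 0) \<longrightarrow>
        (LINT x|lebesgue. v x * deriv \<xi> x) = - (LINT x|lebesgue. g x * \<xi> x))"

definition H1_locu :: "(real \<Rightarrow> real) set" where
  "H1_locu = {v \<in> L2_locu. \<exists>g \<in> L2_locu. weak_deriv v g}"

text \<open>Only times from the initial time 0 onwards are considered.\<close>

definition infl_dom :: "(real \<Rightarrow> real) \<Rightarrow> (real \<times> real) set" where
  "infl_dom T = {(x, t). 0 \<le> t \<and> t < T x}"

text \<open>
  Solutions with data \<open>(u\<^sub>0, u\<^sub>1)\<close> in the local energy space are understood in the integral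
  (Duhamel) sense used in the Cauchy theory, which in one space dimension is d'Alembert's formula.
  \<open>T\<close> is meant to be 1-Lipschitz, so that the backward light cone of each point of
  \<open>infl_dom T\<close>, cut at time 0, stays in \<open>infl_dom T\<close>.  Continuity of \<open>u\<close> is what
  local \<open>H\<^sup>1\<close> regularity, continuously in time, gives in one dimension.
\<close>

definition wave_solution ::
  "real \<Rightarrow> real \<Rightarrow> (real \<Rightarrow> real) \<Rightarrow> (real \<Rightarrow> real) \<Rightarrow> (real \<Rightarrow> real) \<Rightarrow> (real \<Rightarrow> real \<Rightarrow> real) \<Rightarrow> bool" where
  "wave_solution p a T u\<^sub>0 u\<^sub>1 u \<longleftrightarrow>
     continuous_on (infl_dom T) (\<lambda>(x, t). u x t) \<and>
     (\<forall>(x, t) \<in> infl_dom T.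
        u x t = (u\<^sub>0 (x + t) + u\<^sub>0 (x - t)) / 2
              + (LINT z:{x - t..x + t}|lebesgue. u\<^sub>1 z) / 2
              + (LINT \<tau>:{0..t}|lebesgue.
                  (LINT z:{x - (t - \<tau>)..x + (t - \<tau>)}|lebesgue. nonlin p a (u z \<tau>))) / 2)"

text \<open>
  \<open>infl_dom T\<close> is the greatest influence domain carrying a solution with the data of \<open>u\<close>.
  As \<open>T\<close> is real-valued, \<open>u\<close> blows up, with blow-up graph \<open>t = T x\<close>.  The competitors \<open>T'\<close> need
  not be positive everywhere; in particular they include single backward light cones.
\<close>

definition blowup_solution ::
  "real \<Rightarrow> real \<Rightarrow> (real \<Rightarrow> real) \<Rightarrow> (real \<Rightarrow> real \<Rightarrow> real) \<Rightarrow> bool" where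
  "blowup_solution p a T u \<longleftrightarrow>
     (\<forall>x. 0 < T x) \<and> 1-lipschitz_on UNIV T \<and>
     (\<exists>u\<^sub>0 \<in> H1_locu. \<exists>u\<^sub>1 \<in> L2_locu.
        wave_solution p a T u\<^sub>0 u\<^sub>1 u \<and>
        (\<forall>T' v. 1-lipschitz_on UNIV T' \<and> wave_solution p a T' u\<^sub>0 u\<^sub>1 v \<longrightarrow>
                infl_dom T' \<subseteq> infl_dom T))"

definition non_characteristic :: "(real \<Rightarrow> real) \<Rightarrow> real \<Rightarrow> bool" where
  "non_characteristic T x\<^sub>0 \<longleftrightarrow>
     (\<exists>\<delta>\<^sub>0 \<in> {0<..<1}. \<exists>t\<^sub>0 < T x\<^sub>0.
        {(x, t). t < T x\<^sub>0 - \<delta>\<^sub>0 * \<bar>x - x\<^sub>0\<bar>} \<inter> {(x, t). t\<^sub>0 \<le> t} \<subseteq> infl_dom T)"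

definition psi :: "real \<Rightarrow> real \<Rightarrow> real \<Rightarrow> real \<Rightarrow> real" where
  "psi p a T\<^sub>0 t = (T\<^sub>0 - t) powr (- 2 / (p - 1)) * (- ln (T\<^sub>0 - t)) powr (- a / (p - 1))"

text \<open>The change of variables is inverted: \<open>t = T\<^sub>0 - exp (-s)\<close> and \<open>x = x\<^sub>0 + y * exp (-s)\<close>.\<close>

definition sim_var ::
  "real \<Rightarrow> real \<Rightarrow> (real \<Rightarrow> real \<Rightarrow> real) \<Rightarrow> real \<Rightarrow> real \<Rightarrow> real \<Rightarrow> real \<Rightarrow> real" where
  "sim_var p a u x\<^sub>0 T\<^sub>0 y s =
     u (x\<^sub>0 + y * exp (- s)) (T\<^sub>0 - exp (- s)) / psi p a T\<^sub>0 (T\<^sub>0 - exp (- s))"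

definition rho :: "real \<Rightarrow> real \<Rightarrow> real" where
  "rho p y = (1 - y\<^sup>2) powr (2 / (p - 1))"

definition phi :: "real \<Rightarrow> real \<Rightarrow> real \<Rightarrow> real" where
  "phi p a s = exp (2 * s / (p - 1)) * s powr (- a / (p - 1))"

text \<open>
  The partial derivatives of \<open>w\<close> are taken classically.  For the solutions above, d'Alembert's
  formula shows that at every positive time \<open>t\<close> the function \<open>u\<close> is differentiable in \<open>(x, t)\<close> for
  almost every \<open>x\<close>, so under the integrals below these agree with the weak derivatives.
\<close>

definition d_s :: "(real \<Rightarrow> real \<Rightarrow> real) \<Rightarrow> real \<Rightarrow> real \<Rightarrow> real" where
  "d_s w y s = deriv (\<lambda>\<sigma>. w y \<sigma>) s"

definition d_y :: "(real \<Rightarrow> real \<Rightarrow> real) \<Rightarrow> real \<Rightarrow> real \<Rightarrow> real" where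
  "d_y w y s = deriv (\<lambda>\<eta>. w \<eta> s) y"

definition E1 :: "real \<Rightarrow> real \<Rightarrow> (real \<Rightarrow> real \<Rightarrow> real) \<Rightarrow> real \<Rightarrow> real" where
  "E1 p a w s = (LINT y:{-1..1}|lebesgue.
     (1/2 * (d_s w y s)\<^sup>2 + 1/2 * (d_y w y s)\<^sup>2 * (1 - y\<^sup>2) + (p + 1) / (p - 1)\<^sup>2 * (w y s)\<^sup>2
      - exp (- (2 * (p + 1) * s / (p - 1))) * s powr (2 * a / (p - 1))
          * nonlin_prim p a (phi p a s * w y s)) * rho p y)"

definition L0 :: "real \<Rightarrow> real \<Rightarrow> (real \<Rightarrow> real \<Rightarrow> real) \<Rightarrow> real \<Rightarrow> real" where
  "L0 p a w s = E1 p a w s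
     - 1 / (s * sqrt s) * (LINT y:{-1..1}|lebesgue. w y s * d_s w y s * rho p y)"

definition lyap :: "real \<Rightarrow> real \<Rightarrow> real \<Rightarrow> (real \<Rightarrow> real \<Rightarrow> real) \<Rightarrow> real \<Rightarrow> real" where
  "lyap p a \<theta> w s = exp ((p + 3) / sqrt s) * L0 p a w s + \<theta> * exp (- s)"

end

theory Submission
 imports Defs "HOL-Analysis.Analysis" "HOL-Real_Asymp.Real_Asymp"
begin

text \<open>
 In similarity variables \<open>u / phi\<close> becomes \<open>w\<close> and \<open>exp (-s) (u_t + j u_x) / phi\<close> becomes \<open>v j\<close> for \<open>j = 1, -1\<close>.
 The data only have finite local energy, so the equation is used as an ordinary differential equation for \<open>v j\<close>
 along the characteristics \<open>j y = 1 - c exp s\<close>. The density of \<open>ka E1 + mu \<integral> w w_s rho\<close> is a sum of quadratic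
 terms in \<open>(v 1, w)\<close>, \<open>(v (-1), w)\<close> and \<open>w\<close> alone; each is absolutely continuous along one family of curves, which gives an
 exact identity for the functional.

 With \<open>mu = - nu ka\<close> and \<open>ka' = - (p + 3) / 2 nu ka\<close> the dissipation controls \<open>nu\<close> times the whole energy density. For
 \<open>nu = beta / s\<close> with \<open>beta\<close> large nothing need be known about \<open>w\<close>; the resulting integrated energy bound, applied in cones
 with apex slightly above the point considered, and d'Alembert's formula in a small cone give \<open>abs w <= s powr q\<close> near a
 non characteristic point. Hence \<open>ln (2 + (phi w)^2) = 4 s / (p - 1) + O(ln s)\<close> wherever \<open>w\<close> is not small, so the logarithm
 perturbs the pure power law only by \<open>O(ln s / s^2)\<close>. Then \<open>nu = s powr (- 3 / 2)\<close> suffices, which is the functional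
 \<open>L\<close>, and \<open>theta exp (-s)\<close> absorbs the remaining \<open>O(exp (-s))\<close>.
\<close>

text \<open>Origin of \<open>(p + 3) / 2\<close>. The correction term produces
  \<open>nu * ((1 - y^2) wy^2 + 2 k0 w^2)\<close> with the wrong sign, and \<open>ka'\<close> times
  the energy beats it only with a factor above 2. The same factor multiplies \<open>G\<close> with
  the wrong sign, and since \<open>w g\<close> is close to \<open>(p + 1) G\<close>, the good term
  \<open>- nu w g\<close> wins only if the factor is below \<open>p + 1\<close>. The midpoint is
  taken. Reason for two rates. The derivative contains
  \<open>a / (p + 1) * (1 / s - 2 expo / ln (2 + (phi w)^2))\<close> times \<open>w g\<close>.
  Without a bound on \<open>w\<close> this factor is only \<open>O(1 / s)\<close>, so
  \<open>nu\<close> must be of order \<open>1 / s\<close>; then \<open>ka\<close> is a negative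
  power of \<open>s\<close>, and every bound obtained loses a power of \<open>s\<close>. Such bounds
  still bring the factor down to \<open>O(ln s / s^2)\<close>. The rate
  \<open>s powr (- 3 / 2)\<close> dominates this and the squares of the other
  \<open>O(1 / s)\<close> coefficients, and it is integrable, so that \<open>ka\<close> stays
  between two positive constants. Terms \<open>w^2 rho1\<close> lacking the factor
  \<open>1 - y^2\<close> are not controlled by the energy. As in Hardy's inequality, a multiple of
  \<open>ibp\<close> of size \<open>nu^2 + nu / s\<close> absorbs them.\<close>

abbreviation lborel2 :: "(real \<times> real) measure" where "lborel2 == lborel \<Otimes>\<^sub>M lborel"
abbreviation "sint f == set_integrable lborel {- 1<..<1::real} f"
abbreviation sint_value :: "(real => real) => real" (binder "SINT " 10)
 where "sint_value f == (LINT y:{- 1<..<1}|lborel. f y)"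
abbreviation "chr j c s == j * (1 - c * exp s :: real)"

text \<open>\<open>f\<close> is absolutely continuous on \<open>{a..b}\<close> with derivative \<open>f'\<close>.\<close>

definition acd :: "real => real => (real => real) => (real => real) => bool" where
 "acd a b f f' \<longleftrightarrow> f' absolutely_integrable_on {a..b} &
   (\<forall>x y. a <= x --> x <= y --> y <= b --> f y - f x = integral {x..y} f')"

section \<open>Calculus of absolutely continuous functions\<close>

lemma acd_abs_integrable: "acd a b f f' ==> f' absolutely_integrable_on {a..b}" by (simp add: acd_def)

lemma acd_integrable: "acd a b f f' ==> a <= x ==> y <= b ==> f' integrable_on {x..y}" unfolding acd_def
 by (meson absolutely_integrable_on_def atLeastatMost_subset_iff integrable_on_subinterval)

lemma acd_diff: "acd a b f f' ==> a <= x ==> x <= y ==> y <= b ==> f y - f x = integral {x..y} f'" by (simp add: acd_def)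

lemma acd_continuous:
 assumes "acd a b f f'"
 shows "continuous_on {a..b} f"
proof -
 have "continuous_on {a..b} (\<lambda>x. f a + integral {a..x} f')"
  by (intro continuous_intros indefinite_integral_continuous_1 acd_integrable[OF assms]) auto
 then show ?thesis by (rule continuous_on_eq) (use acd_diff[OF assms, of a] in force)
qed

lemma acd_cong:
 assumes "acd a b f f'" "!!x. a <= x ==> x <= b ==> f x = g x" "!!x. a <= x ==> x <= b ==> f' x = g' x"
 shows "acd a b g g'"
proof -
 have "g' absolutely_integrable_on {a..b}" using acd_abs_integrable[OF assms(1)] assms(3)
   set_integrable_cong[of lebesgue lebesgue "{a..b}" "{a..b}" f' g'] by auto
 moreover have "g y - g x = integral {x..y} g'" if "a <= x" "x <= y" "y <= b" for x y
 proof -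
  have "integral {x..y} g' = integral {x..y} f'" by (rule integral_cong) (use assms that in auto)
  then show ?thesis using acd_diff[OF assms(1) that] assms(2) that by auto
 qed
 ultimately show ?thesis by (simp add: acd_def)
qed

lemma acd_add:
 assumes "acd a b f f'" "acd a b g g'"
 shows "acd a b (\<lambda>x. f x + g x) (\<lambda>x. f' x + g' x)" unfolding acd_def
proof (intro conjI allI impI)
 show "(\<lambda>x. f' x + g' x) absolutely_integrable_on {a..b}" using assms by (auto simp: acd_def)
 fix x y assume *: "a <= x" "x <= y" "y <= b"
 then have "integral {x..y} (\<lambda>x. f' x + g' x) = integral {x..y} f' + integral {x..y} g'"
  using assms acd_integrable by (intro integral_add) blast+
 then show "f y + g y - (f x + g x) = integral {x..y} (\<lambda>x. f' x + g' x)"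
  using acd_diff[OF assms(1) *] acd_diff[OF assms(2) *] by simp
qed

lemma acd_cmult:
 assumes "acd a b f f'"
 shows "acd a b (\<lambda>x. c * f x) (\<lambda>x. c * f' x)" unfolding acd_def
proof (intro conjI allI impI)
 show "(\<lambda>x. c * f' x) absolutely_integrable_on {a..b}" using assms by (auto simp: acd_def)
 fix x y assume *: "a <= x" "x <= y" "y <= b"
 show "c * f y - c * f x = integral {x..y} (\<lambda>x. c * f' x)"
  using acd_diff[OF assms(1) *] by (simp add: algebra_simps flip: right_diff_distrib)
qed

lemma acd_minus:
 assumes "acd a b f f'"
 shows "acd a b (\<lambda>x. - f x) (\<lambda>x. - f' x)" using acd_cmult[OF assms, of "-1"] by simp

lemma acd_C1:
 assumes "!!x. a <= x ==> x <= b ==> (f has_real_derivative f' x) (at x within {a..b})" "continuous_on {a..b} f'"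
 shows "acd a b f f'" unfolding acd_def
proof (intro conjI allI impI)
 show "f' absolutely_integrable_on {a..b}" using assms(2) by (simp add: absolutely_integrable_continuous_real)
 fix x y assume *: "a <= x" "x <= y" "y <= b"
 have "(f' has_integral f y - f x) {x..y}"
 proof (rule fundamental_theorem_of_calculus[OF *(2)])
  fix t assume t: "t \<in> {x..y}"
  have "(f has_real_derivative f' t) (at t within {x..y})" by (rule DERIV_subset[OF assms(1)]) (use t * in auto)
  then show "(f has_vector_derivative f' t) (at t within {x..y})" by (simp add: has_real_derivative_iff_has_vector_derivative)
 qed
 then show "f y - f x = integral {x..y} f'" by (simp add: integral_unique)
qed

text \<open>The derivative may blow up at the ends of the interval; its sign turns the
  Henstock-Kurzweil integrability given by the fundamental theorem into absolute integrability. This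
  is how powers with exponent below 1 enter the calculus.\<close>

lemma acd_mono_interior:
 assumes "a <= b" "continuous_on {a..b} f"
  and "!!x. a < x ==> x < b ==> (f has_real_derivative f' x) (at x)"
  and "!!x. a <= x ==> x <= b ==> f' x >= 0"
 shows "acd a b f f'"
proof -
 have *: "(f' has_integral f y - f x) {x..y}" if "a <= x" "x <= y" "y <= b" for x y
 proof (rule fundamental_theorem_of_calculus_interior)
  show "continuous_on {x..y} f" using assms(2) continuous_on_subset that by fastforce
  show "(f has_vector_derivative f' t) (at t)" if "t \<in> {x<..<y}" for t
   using assms(3)[of t] that \<open>a <= x\<close> \<open>y <= b\<close> by (simp add: has_real_derivative_iff_has_vector_derivative)
 qed fact
 have "f' absolutely_integrable_on {a..b}" by (rule nonnegative_absolutely_integrable_1) (use * assms in auto)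
 then show ?thesis unfolding acd_def using *[THEN integral_unique] by metis
qed

lemma continuous_times_absolutely_integrable:
 fixes g f :: "real => real"
 assumes "continuous_on {a..b} g" "f absolutely_integrable_on {a..b}"
 shows "(\<lambda>x. g x * f x) absolutely_integrable_on {a..b}"
proof (rule absolutely_integrable_bounded_measurable_product_real)
 show "g \<in> borel_measurable (lebesgue_on {a..b})" using assms(1) by (simp add: continuous_imp_measurable_on_sets_lebesgue)
 show "bounded (g ` {a..b})" using assms(1) compact_continuous_image compact_imp_bounded by blast
qed (use assms in auto)

text \<open>On a short interval the mean value theorem gives
  \<open>K (f v) - K (f u) = K' \<zeta> * (f v - f u)\<close> with \<open>K'\<close> almost constant
  there, so the error is at most \<open>d\<close> times the integral of \<open>abs f'\<close>. This
  estimate adds up over adjacent intervals, hence \<open>Bolzano\<close> glues the local estimates.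
  Pointwise derivatives of \<open>f\<close> are never taken.\<close>

lemma acd_comp:
 assumes f: "acd a b f f'"
  and K: "!!x. (K has_real_derivative K' x) (at x)" "continuous_on UNIV K'"
 shows "acd a b (\<lambda>x. K (f x)) (\<lambda>x. K' (f x) * f' x)" unfolding acd_def
proof (intro conjI allI impI)
 have cf: "continuous_on {a..b} f" using acd_continuous[OF f] .
 have cKf: "continuous_on {a..b} (\<lambda>x. K' (f x))" using continuous_on_compose2[OF K(2) cf] by simp
 show ai: "(\<lambda>x. K' (f x) * f' x) absolutely_integrable_on {a..b}"
  by (rule continuous_times_absolutely_integrable[OF cKf acd_abs_integrable[OF f]])
 fix x y assume xy: "a <= x" "x <= y" "y <= b"
 let ?H = "\<lambda>x. K' (f x) * f' x"
 have iH: "?H integrable_on {u..v}" if "a <= u" "v <= b" for u v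
  using ai that by (meson absolutely_integrable_on_def atLeastatMost_subset_iff integrable_on_subinterval)
 have ia: "(\<lambda>x. abs (f' x)) integrable_on {u..v}" if "a <= u" "v <= b" for u v using acd_abs_integrable[OF f] that
  by (metis (no_types, lifting) absolutely_integrable_on_def atLeastatMost_subset_iff integrable_on_subinterval real_norm_def integrable_cong)
 have "\<bar>K (f y) - K (f x) - integral {x..y} ?H\<bar> <= e" if "e > 0" for e
 proof -
  define I where "I = integral {a..b} (\<lambda>x. abs (f' x))"
  have "I >= 0" unfolding I_def by (rule Henstock_Kurzweil_Integration.integral_nonneg) (use ia in auto)
  define d where "d = e / (I + 1)"
  have d: "d > 0" using \<open>I >= 0\<close> \<open>e > 0\<close> by (simp add: d_def)
  have "a <= x --> y <= b --> \<bar>K (f y) - K (f x) - integral {x..y} ?H\<bar> <= d * integral {x..y} (\<lambda>x. abs (f' x))"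
   using \<open>x <= y\<close>
  proof (induction rule: Bolzano)
   case (trans u v w)
   show ?case
   proof (intro impI)
    assume uw: "a <= u" "w <= b"
    have 1: "\<bar>K (f v) - K (f u) - integral {u..v} ?H\<bar> <= d * integral {u..v} (\<lambda>x. abs (f' x))"
     and 2: "\<bar>K (f w) - K (f v) - integral {v..w} ?H\<bar> <= d * integral {v..w} (\<lambda>x. abs (f' x))" using trans uw by auto
    have 3: "integral {u..w} ?H = integral {u..v} ?H + integral {v..w} ?H"
     using trans uw iH by (metis Henstock_Kurzweil_Integration.integral_combine)
    have 4: "integral {u..w} (\<lambda>x. abs (f' x)) = integral {u..v} (\<lambda>x. abs (f' x)) + integral {v..w} (\<lambda>x. abs (f' x))"
     using trans uw ia by (metis Henstock_Kurzweil_Integration.integral_combine)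
    show "\<bar>K (f w) - K (f u) - integral {u..w} ?H\<bar> <= d * integral {u..w} (\<lambda>x. abs (f' x))"
     using 1 2 unfolding 3 4 distrib_left by linarith
   qed
  next
   case (local t)
   have tab: "t \<in> {a..b}" using local xy by auto
   have "isCont K' (f t)" using K(2) by (simp add: continuous_on_eq_continuous_at)
   then obtain r where r: "r > 0" "!!z. \<bar>z - f t\<bar> < r ==> \<bar>K' z - K' (f t)\<bar> < d / 2"
    using d unfolding continuous_at_eps_delta dist_real_def by (meson half_gt_zero)
   obtain s where s: "s > 0" "!!z. z \<in> {a..b} ==> \<bar>z - t\<bar> < s ==> \<bar>f z - f t\<bar> < r"
    using cf r(1) tab unfolding continuous_on_iff dist_real_def by meson
   show ?case
   proof (intro exI[of _ s] conjI allI impI s(1))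
    fix u v assume uv: "u <= t & t <= v & v - u < s" and "a <= u" "v <= b"
    then have uv': "a <= u" "u <= v" "v <= b" "v - u < s" by auto
    have close: "\<bar>f z - f t\<bar> < r" if "u <= z" "z <= v" for z by (rule s(2)) (use that uv uv' in auto)
    obtain \<zeta> where z: "K (f v) - K (f u) = K' \<zeta> * (f v - f u)" "\<bar>\<zeta> - f t\<bar> < r"
    proof -
     consider "f u < f v" | "f v < f u" | "f u = f v" by linarith
     then show ?thesis
     proof cases
      case 1
      obtain z where "f u < z" "z < f v" "K (f v) - K (f u) = (f v - f u) * K' z" using MVT2[OF 1] K(1) by blast
      with close[of u] close[of v] uv' show ?thesis by (intro that[of z]) (auto simp: mult.commute)
     next
      case 2
      obtain z where "f v < z" "z < f u" "K (f u) - K (f v) = (f u - f v) * K' z" using MVT2[OF 2] K(1) by blast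
      with close[of u] close[of v] uv' show ?thesis by (intro that[of z]) (auto simp: algebra_simps)
     next
      case 3
      with close[of u] uv' show ?thesis by (intro that[of "f u"]) auto
     qed
    qed
    have if': "f' integrable_on {u..v}" using acd_integrable[OF f] uv' by auto
    have "K (f v) - K (f u) - integral {u..v} ?H = integral {u..v} (\<lambda>x. K' \<zeta> * f' x) - integral {u..v} ?H"
     using z acd_diff[OF f uv'(1,2,3)] by simp
    also have "... = integral {u..v} (\<lambda>x. K' \<zeta> * f' x - ?H x)"
     by (rule integral_diff[symmetric]) (use if' iH uv' in "auto intro: integrable_on_mult_right")
    also have "\<bar>...\<bar> <= integral {u..v} (\<lambda>x. d * abs (f' x))"
    proof -
     have "norm (integral {u..v} (\<lambda>x. K' \<zeta> * f' x - ?H x)) <= integral {u..v} (\<lambda>x. d * abs (f' x))"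
     proof (rule Henstock_Kurzweil_Integration.integral_norm_bound_integral)
      show "(\<lambda>x. K' \<zeta> * f' x - ?H x) integrable_on {u..v}"
       using if' iH uv' by (intro integrable_diff) (auto intro: integrable_on_mult_right)
      show "(\<lambda>x. d * abs (f' x)) integrable_on {u..v}" using ia uv' by (intro integrable_on_mult_right) auto
      fix x assume x: "x \<in> {u..v}"
      have "\<bar>K' \<zeta> - K' (f x)\<bar> <= d"
      proof -
       have "\<bar>f x - f t\<bar> < r" using close x by auto
       from r(2)[OF this] r(2)[OF z(2)] show ?thesis by linarith
      qed
      then have "\<bar>(K' \<zeta> - K' (f x)) * f' x\<bar> <= d * abs (f' x)" unfolding abs_mult by (rule mult_right_mono) simp
      then show "norm (K' \<zeta> * f' x - ?H x) <= d * abs (f' x)" by (simp add: left_diff_distrib)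
     qed
     then show ?thesis by simp
    qed
    finally show "\<bar>K (f v) - K (f u) - integral {u..v} ?H\<bar> <= d * integral {u..v} (\<lambda>x. abs (f' x))" by simp
   qed
  qed
  then have "\<bar>K (f y) - K (f x) - integral {x..y} ?H\<bar> <= d * integral {x..y} (\<lambda>x. abs (f' x))" using xy by auto
  also have "... <= d * I" unfolding I_def by (intro mult_left_mono integral_subset_le) (use xy ia d in auto)
  also have "... <= e" using \<open>I >= 0\<close> \<open>e > 0\<close> by (simp add: d_def field_simps)
  finally show ?thesis .
 qed
 then have "\<bar>K (f y) - K (f x) - integral {x..y} ?H\<bar> <= 0" by (rule field_le_epsilon) simp
 then show "K (f y) - K (f x) = integral {x..y} ?H" by simp
qed

text \<open>Polarization: the product is a difference of two values of \<open>x^2 / 4\<close>, so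
  the product rule follows from the chain rule.\<close>

lemma acd_mult:
 assumes f: "acd a b f f'" and g: "acd a b g g'"
 shows "acd a b (\<lambda>x. f x * g x) (\<lambda>x. f' x * g x + f x * g' x)"
proof -
 have K: "((\<lambda>x. x^2 / 4) has_real_derivative x / 2) (at x)" "continuous_on UNIV (\<lambda>x::real. x / 2)" for x :: real
  by (auto intro!: derivative_eq_intros continuous_intros)
 have "acd a b (\<lambda>x. (f x + g x)^2 / 4) (\<lambda>x. (f x + g x) / 2 * (f' x + g' x))" by (rule acd_comp[OF acd_add[OF f g] K])
 moreover have "acd a b (\<lambda>x. - ((f x + - g x)^2 / 4)) (\<lambda>x. - ((f x + - g x) / 2 * (f' x + - g' x)))"
  by (rule acd_minus[OF acd_comp[OF acd_add[OF f acd_minus[OF g]] K]])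
 ultimately have "acd a b (\<lambda>x. (f x + g x)^2 / 4 + - ((f x + - g x)^2 / 4))
   (\<lambda>x. (f x + g x) / 2 * (f' x + g' x) + - ((f x + - g x) / 2 * (f' x + - g' x)))" by (rule acd_add)
 then show ?thesis by (rule acd_cong) (auto simp: field_simps power2_eq_square)
qed

text \<open>A composition of absolutely continuous functions can fail to be absolutely continuous;
  monotonicity of the inner function prevents this although \<open>al\<close> is only integrable.
  The derivative \<open>g'\<close> may vanish identically, as it does along a characteristic for its
  own coordinate.\<close>

lemma acd_substitution_mono:
 assumes "a <= b"
  and A: "!!x y. x <= y ==> A y - A x = integral {x..y} al"
  and al: "!!x y. set_integrable lborel {x..y} al"
  and g: "!!x. a <= x ==> x <= b ==> (g has_real_derivative g' x) (at x)"
  and cg': "continuous_on {a..b} g'"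
  and nn: "!!x. a <= x ==> x <= b ==> g' x >= 0"
 shows "acd a b (\<lambda>x. A (g x)) (\<lambda>x. al (g x) * g' x)" unfolding acd_def
proof (intro conjI allI impI)
 have *: "set_integrable lborel {x..y} (\<lambda>x. al (g x) * g' x)"
  "(LBINT z. al z * indicator {g x..g y} z) = (LBINT z. al (g z) * g' z * indicator {x..y} z)"
  if "a <= x" "x <= y" "y <= b" for x y
 proof -
  have 1: "(g has_real_derivative g' z) (at z)" "0 <= g' z" if "z \<in> {x..y}" for z
   using g[of z] nn[of z] that \<open>a <= x\<close> \<open>y <= b\<close> by auto
  have 2: "continuous_on {x..y} g'" using continuous_on_subset[OF cg', of "{x..y}"] that by auto
  show "set_integrable lborel {x..y} (\<lambda>x. al (g x) * g' x)"
   "(LBINT z. al z * indicator {g x..g y} z) = (LBINT z. al (g z) * g' z * indicator {x..y} z)"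
   using integral_substitution[OF al 1(1) 2 1(2) that(2)] by simp_all
 qed
 show "(\<lambda>x. al (g x) * g' x) absolutely_integrable_on {a..b}"
  using *(1)[of a b] \<open>a <= b\<close> by (auto simp: set_integrable_def intro: integrable_completion[THEN iffD2])
 fix x y assume xy: "a <= x" "x <= y" "y <= b"
 have gm: "g x <= g y"
 proof (rule DERIV_nonneg_imp_nondecreasing[OF xy(2)])
  fix z assume "x <= z" "z <= y"
  then show "\<exists>l. (g has_real_derivative l) (at z) & 0 <= l" using g[of z] nn[of z] xy by auto
 qed
 have "A (g y) - A (g x) = (LBINT z:{g x..g y}. al z)" using A[OF gm] set_borel_integral_eq_integral(2)[OF al] by simp
 also have "... = (LBINT z:{x..y}. al (g z) * g' z)" using *(2)[OF xy] by (simp add: set_lebesgue_integral_def mult.commute)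
 also have "... = integral {x..y} (\<lambda>x. al (g x) * g' x)" using set_borel_integral_eq_integral(2)[OF *(1)[OF xy]] by simp
 finally show "A (g y) - A (g x) = integral {x..y} (\<lambda>x. al (g x) * g' x)" .
qed

lemma set_integrable_reflect:
 fixes f :: "real => real"
 assumes "set_integrable lborel {- y..- x} f"
 shows "set_integrable lborel {x..y} (\<lambda>z. f (- z))"
proof -
 have "integrable lborel (\<lambda>z. indicator {- y..- x} (0 + (-1) * z) *\<^sub>R f (0 + (-1) * z))"
  using assms unfolding set_integrable_def by (subst lborel_integrable_real_affine_iff) auto
 then show ?thesis unfolding set_integrable_def by (rule back_subst[where P="integrable lborel"]) (auto simp: fun_eq_iff indicator_def)
qed

lemma acd_substitution_antimono:
 assumes "a <= b"
  and A: "!!x y. x <= y ==> A y - A x = integral {x..y} al"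
  and al: "!!x y. set_integrable lborel {x..y} al"
  and g: "!!x. a <= x ==> x <= b ==> (g has_real_derivative g' x) (at x)"
  and cg': "continuous_on {a..b} g'"
  and np: "!!x. a <= x ==> x <= b ==> g' x <= 0"
 shows "acd a b (\<lambda>x. A (g x)) (\<lambda>x. al (g x) * g' x)"
proof -
 have "acd a b (\<lambda>x. (\<lambda>z. - A (- z)) (- g x)) (\<lambda>x. (\<lambda>z. al (- z)) (- g x) * (- g' x))"
 proof (rule acd_substitution_mono[where A="\<lambda>z. - A (- z)" and al="\<lambda>z. al (- z)" and g="\<lambda>x. - g x" and g'="\<lambda>x. - g' x", OF \<open>a <= b\<close>])
  show "- A (- y) - - A (- x) = integral {x..y} (\<lambda>z. al (- z))" if "x <= y" for x y
   using A[of "- y" "- x"] that Henstock_Kurzweil_Integration.integral_reflect_real[of "- x" "- y" al] by simp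
  show "set_integrable lborel {x..y} (\<lambda>z. al (- z))" for x y by (rule set_integrable_reflect[OF al])
  show "((\<lambda>x. - g x) has_real_derivative - g' x) (at x)" if "a <= x" "x <= b" for x using g[OF that] by (rule DERIV_minus)
 qed (use cg' np in "auto intro: continuous_intros")
 then have "acd a b (\<lambda>x. - A (g x)) (\<lambda>x. - (al (g x) * g' x))" by simp
 from acd_minus[OF this] show ?thesis by simp
qed

section \<open>Differentiability almost everywhere of indefinite integrals\<close>

lemma interval_as_cball:
 fixes u v :: real
 shows "cball ((u + v) / 2) ((v - u) / 2) = {u..v}" by (auto simp: cball_eq_atLeastAtMost field_simps)

text \<open>
 Henstock's lemma bounds the total length of disjoint short intervals on which the
 difference quotient is off; Vitali's theorem covers the exceptional set by such intervals.
\<close>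

lemma indefinite_integral_differentiable_ae_interval:
 fixes A al :: "real => real"
 assumes A: "!!x y. a <= x ==> x <= y ==> y <= b ==> A y - A x = integral {x..y} al"
  and int: "al integrable_on {a..b}"
 shows "negligible {x \<in> {a<..<b}. \<not> (A has_real_derivative al x) (at x)}"
proof -
 define bad where "bad n x u v \<longleftrightarrow> \<bar>A v - A u - al x * (v - u)\<bar> > (v - u) / real (Suc n)" for n x u v
 define E where "E n = {x \<in> {a<..<b}. \<forall>d>0. \<exists>u v. u < v & x \<in> {u..v} & v - u < d & bad n x u v}" for n
 have negE: "negligible (E n)" for n unfolding negligible_outer_le
 proof (intro allI impI)
  fix e :: real assume "e > 0"
  \<comment> \<open>A bad interval is shorter than \<open>Suc n\<close> times its deviation.
    Henstock's lemma keeps the sum of the deviations below \<open>e'\<close>, which leaves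
    \<open>e\<close> for the total length.\<close>
  define e' where "e' = e / real (Suc n)"
  have "e' > 0" using \<open>e > 0\<close> by (simp add: e'_def)
  obtain \<gamma> where \<gamma>: "gauge \<gamma>"
   "!!p. p tagged_partial_division_of cbox a b ==> \<gamma> fine p ==>
       sum (\<lambda>(x,k). norm (measure lborel k *\<^sub>R al x - integral k al)) p < e'"
   using Henstock_lemma[of al a b e'] int \<open>e' > 0\<close> by auto
  \<comment> \<open>A triple keeps the tag together with its interval: the disjoint intervals that
    Vitali's theorem selects then form, with their tags, a partial division to which Henstock's
    lemma applies.\<close>
  define K where "K = {(x, u, v). x \<in> E n & u < v & x \<in> {u..v} & {u..v} \<subseteq> \<gamma> x & {u..v} \<subseteq> {a..b} & bad n x u v}"
  define c :: "real \<times> real \<times> real => real" where "c i = (fst (snd i) + snd (snd i)) / 2" for i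
  define r :: "real \<times> real \<times> real => real" where "r i = (snd (snd i) - fst (snd i)) / 2" for i
  have cb: "cball (c i) (r i) = {fst (snd i)..snd (snd i)}" for i unfolding c_def r_def by (rule interval_as_cball)
  have r: "r i > 0" if "i \<in> K" for i using that by (auto simp: K_def r_def)
  have S: "\<exists>i. i \<in> K & x \<in> cball (c i) (r i) & r i < d" if x: "x \<in> E n" and "d > 0" for x d
  proof -
   have "x \<in> \<gamma> x" "open (\<gamma> x)" using \<gamma>(1) by (auto simp: gauge_def)
   then have "open (\<gamma> x \<inter> {a<..<b})" "x \<in> \<gamma> x \<inter> {a<..<b}" using x by (auto simp: E_def)
   then obtain h where h: "h > 0" "ball x h \<subseteq> \<gamma> x \<inter> {a<..<b}" using open_contains_ball by blast
   have "min h d > 0" using h \<open>d > 0\<close> by auto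
   then obtain u v where uv: "u < v" "x \<in> {u..v}" "v - u < min h d" "bad n x u v" using x unfolding E_def by blast
   have "{u..v} \<subseteq> ball x h" using uv by (auto simp: dist_real_def)
   then have "{u..v} \<subseteq> \<gamma> x" "{u..v} \<subseteq> {a..b}" using h by force+
   then have "(x, u, v) \<in> K" using uv x by (auto simp: K_def)
   moreover have "x \<in> cball (c (x, u, v)) (r (x, u, v))" using uv by (simp add: cb)
   moreover have "r (x, u, v) < d" using uv by (auto simp: r_def)
   ultimately show ?thesis by blast
  qed
  obtain C where C: "countable C" "C \<subseteq> K"
   "pairwise (\<lambda>i j. disjnt (cball (c i) (r i)) (cball (c j) (r j))) C"
   "negligible (E n - (\<Union>i\<in>C. cball (c i) (r i)))" using Vitali_covering_theorem_cballs[of K r "E n" c] r S by blast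
  have bound: "measure lebesgue (\<Union>i\<in>D. cball (c i) (r i)) <= e" if D: "D \<subseteq> C" "finite D" for D
  proof -
   define q where "q i = (fst i, {fst (snd i)..snd (snd i)})" for i :: "real \<times> real \<times> real"
   have injq: "inj_on q D" using D C(2) by (fastforce simp: inj_on_def q_def K_def Icc_eq_Icc)
   have disj: "disjnt (cball (c i) (r i)) (cball (c j) (r j))" if "i \<in> D" "j \<in> D" "i ~= j" for i j
    using C(3) D that by (auto simp: pairwise_def)
   have tp: "q ` D tagged_partial_division_of cbox a b" unfolding tagged_partial_division_of_def
   proof (intro conjI allI impI)
    show "finite (q ` D)" using D by simp
   next
    fix x k assume xk: "(x, k) \<in> q ` D"
    then obtain i where i: "i \<in> D" "x = fst i" "k = {fst (snd i)..snd (snd i)}" by (auto simp: q_def)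
    then have "i \<in> K" using D C by blast
    then show "x \<in> k" "k \<subseteq> cbox a b" using i by (auto simp: K_def)
    show "\<exists>a b. k = cbox a b" using i by (metis box_real(2))
   next
    fix x k x' k' assume xk: "(x, k) \<in> q ` D & (x', k') \<in> q ` D & (x, k) ~= (x', k')"
    then obtain i j where ij: "i \<in> D" "(x, k) = q i" "j \<in> D" "(x', k') = q j" by blast
    then have i: "i \<in> D" "k = {fst (snd i)..snd (snd i)}"
     and j: "j \<in> D" "k' = {fst (snd j)..snd (snd j)}" "j ~= i" using xk by (auto simp: q_def)
    then have "k \<inter> k' = {}" using disj[OF i(1) j(1)] by (simp add: cb disjnt_def)
    then show "interior k \<inter> interior k' = {}" using interior_subset by blast
   qed
   have fine: "\<gamma> fine q ` D"
   proof (rule fineI)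
    fix x k assume "(x, k) \<in> q ` D"
    then obtain i where i: "i \<in> D" "x = fst i" "k = {fst (snd i)..snd (snd i)}" by (auto simp: q_def)
    then have "i \<in> K" using D C by blast
    then show "k \<subseteq> \<gamma> x" unfolding i(2,3) K_def by (simp add: case_prod_beta)
   qed
   have "measure lebesgue (\<Union>i\<in>D. cball (c i) (r i)) = (\<Sum>i\<in>D. measure lebesgue (cball (c i) (r i)))"
    by (rule measure_UNION') (use D disj in "auto simp: pairwise_def simp del: split_paired_All")
   also have "... = (\<Sum>i\<in>D. snd (snd i) - fst (snd i))"
   proof (rule sum.cong[OF refl])
    fix i assume "i \<in> D"
    then have "i \<in> K" using D C by blast
    then have "fst (snd i) < snd (snd i)" unfolding K_def by (simp add: case_prod_beta)
    then show "measure lebesgue (cball (c i) (r i)) = snd (snd i) - fst (snd i)" by (simp add: cb)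
   qed
   also have "... <= (\<Sum>i\<in>D. real (Suc n) * (case q i of (x, k) => norm (measure lborel k *\<^sub>R al x - integral k al)))"
   proof (rule sum_mono)
    fix i assume "i \<in> D"
    then have iK: "i \<in> K" using D C by blast
    obtain x u v where i: "i = (x, u, v)" by (cases i)
    have "u < v" "a <= u" "v <= b" "bad n x u v" using iK unfolding i K_def by simp_all
    then show "snd (snd i) - fst (snd i) <= real (Suc n) * (case q i of (x, k) => norm (measure lborel k *\<^sub>R al x - integral k al))"
     using A[of u v] by (simp add: i q_def bad_def abs_minus_commute field_simps)
   qed
   also have "... = real (Suc n) * sum (\<lambda>(x,k). norm (measure lborel k *\<^sub>R al x - integral k al)) (q ` D)"
    by (simp add: sum.reindex[OF injq] sum_distrib_left)
   also have "... <= real (Suc n) * e'" using \<gamma>(2)[OF tp fine] by (intro mult_left_mono) auto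
   finally show ?thesis by (simp add: e'_def)
  qed
  define U where "U = (\<Union>i\<in>C. cball (c i) (r i))"
  have U: "U \<in> lmeasurable" "measure lebesgue U <= e" unfolding U_def by (rule fmeasurable_UN_bound[OF C(1) _ bound], simp_all)
    (rule measure_UN_bound[OF C(1) _ bound], simp_all)
  have N: "E n - U \<in> lmeasurable" "measure lebesgue (E n - U) = 0" using C(4) unfolding U_def by (auto simp: negligible_iff_measure)
  have "measure lebesgue (U \<union> (E n - U)) <= e" using measure_Un_le[of U lebesgue "E n - U"] U N by (simp add: fmeasurableD)
  then show "\<exists>T. E n \<subseteq> T & T \<in> lmeasurable & measure lebesgue T <= e"
   using fmeasurable.Un[OF U(1) N(1)] by (intro exI[of _ "U \<union> (E n - U)"]) auto
 qed
 have "{x \<in> {a<..<b}. \<not> (A has_real_derivative al x) (at x)} \<subseteq> (\<Union>n. E n)"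
 proof (rule subsetI, rule ccontr)
  fix x assume x: "x \<in> {x \<in> {a<..<b}. \<not> (A has_real_derivative al x) (at x)}" and "x \<notin> (\<Union>n. E n)"
  then have nE: "x \<notin> E n" for n by auto
  have "((\<lambda>y. (A y - A x) / (y - x)) \<longlongrightarrow> al x) (at x)"
  proof (rule tendstoI)
   fix e :: real assume "e > 0"
   then obtain n where n: "inverse (real (Suc n)) < e" using reals_Archimedean by blast
   obtain d where d: "d > 0" "!!u v. u < v ==> x \<in> {u..v} ==> v - u < d ==> \<not> bad n x u v"
    using nE[of n] x unfolding E_def by blast
   have "dist ((A y - A x) / (y - x)) (al x) < e" if "y ~= x" "dist y x < d" for y
   proof -
    have "\<bar>A y - A x - al x * (y - x)\<bar> <= \<bar>y - x\<bar> / real (Suc n)"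
    proof (cases "x < y")
     case True
     then show ?thesis using d(2)[of x y] that by (simp add: bad_def dist_real_def)
    next
     case False
     then have "y < x" using that by simp
     then have "\<bar>A x - A y - al x * (x - y)\<bar> <= (x - y) / real (Suc n)"
      using d(2)[of y x] that by (simp add: bad_def dist_real_def)
     moreover have "\<bar>A x - A y - al x * (x - y)\<bar> = \<bar>A y - A x - al x * (y - x)\<bar>"
      by (simp add: algebra_simps abs_minus_commute)
     ultimately show ?thesis using \<open>y < x\<close> by simp
    qed
    also have "... < \<bar>y - x\<bar> * e" using n that by (simp add: divide_inverse)
    finally have "\<bar>A y - A x - al x * (y - x)\<bar> < \<bar>y - x\<bar> * e" .
    moreover have "A y - A x - al x * (y - x) = (y - x) * ((A y - A x) / (y - x) - al x)" using that by (simp add: field_simps)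
    ultimately have "\<bar>(A y - A x) / (y - x) - al x\<bar> < e" using that by (simp add: abs_mult)
    then show ?thesis by (simp add: dist_real_def)
   qed
   then show "\<forall>\<^sub>F y in at x. dist ((A y - A x) / (y - x)) (al x) < e" using d(1) unfolding eventually_at by blast
  qed
  then have "(A has_real_derivative al x) (at x)" by (simp add: has_field_derivative_iff)
  then show False using x by simp
 qed
 moreover have "negligible (\<Union>n. E n)" using negE by (rule negligible_Union_nat)
 ultimately show ?thesis by (rule negligible_subset[rotated])
qed

lemma indefinite_integral_differentiable_ae:
 fixes A al :: "real => real"
 assumes "!!x y. x <= y ==> A y - A x = integral {x..y} al"
  and "!!x y. al integrable_on {x..y}"
 shows "negligible {x. \<not> (A has_real_derivative al x) (at x)}"
proof -
 have "{x. \<not> (A has_real_derivative al x) (at x)} \<subseteq>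
   (\<Union>n::nat. {x \<in> {- real n<..<real n}. \<not> (A has_real_derivative al x) (at x)})"
 proof
  fix x assume x: "x \<in> {x. \<not> (A has_real_derivative al x) (at x)}"
  obtain n :: nat where "abs x < real n" using reals_Archimedean2 by blast
  then show "x \<in> (\<Union>n::nat. {x \<in> {- real n<..<real n}. \<not> (A has_real_derivative al x) (at x)})"
   using x by (intro UN_I[of n]) auto
 qed
 moreover have "negligible (\<Union>n::nat. {x \<in> {- real n<..<real n}. \<not> (A has_real_derivative al x) (at x)})"
  by (intro negligible_Union_nat indefinite_integral_differentiable_ae_interval) (use assms in auto)
 ultimately show ?thesis by (rule negligible_subset[rotated])
qed

section \<open>Regularity of the nonlinearity and an exchange of integrals\<close>

lemma continuous_nonlin:
 assumes "p > 1"
 shows "continuous_on UNIV (nonlin p a)"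
proof -
 have "continuous_on UNIV (\<lambda>v::real. abs v powr (p - 1))"
  by (rule continuous_on_powr') (use assms in "auto intro!: continuous_intros")
 moreover have "continuous_on UNIV (\<lambda>v::real. ln (2 + v^2) powr a)"
 proof (rule continuous_on_powr)
  show "continuous_on UNIV (\<lambda>v::real. ln (2 + v^2))"
  proof -
   have "2 + v^2 > 0" for v :: real using zero_le_power2[of v] by linarith
   then show ?thesis by (intro continuous_on_ln continuous_intros ballI) (metis less_irrefl)
  qed
  show "\<forall>x::real\<in>UNIV. ln (2 + x^2) ~= 0"
  proof
   fix x :: real
   have "2 + x^2 >= 2" by simp
   then have "ln (2 + x^2) > 0" by (intro ln_gt_zero) linarith
   then show "ln (2 + x^2) ~= 0" by simp
  qed
 qed (auto intro!: continuous_intros)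
 ultimately show ?thesis unfolding nonlin_def by (intro continuous_on_mult continuous_on_id) auto
qed

lemma DERIV_nonlin_prim:
 assumes "p > 1"
 shows "(nonlin_prim p a has_real_derivative nonlin p a v) (at v)"
proof -
 define M where "M = abs v + 1"
 have "((\<lambda>u. LBINT z=ereal 0..ereal u. nonlin p a z) has_vector_derivative nonlin p a v) (at v within {- M..M})"
 proof (rule interval_integral_FTC2)
  show "continuous_on {- M..M} (nonlin p a)" using continuous_nonlin[OF assms] continuous_on_subset by blast
 qed (auto simp: M_def)
 moreover have "at v within {- M..M} = at v" by (rule at_within_interior) (auto simp: M_def abs_if)
 ultimately show ?thesis unfolding nonlin_prim_def has_real_derivative_iff_has_vector_derivative by (simp add: zero_ereal_def)
qed

text \<open>Serves to turn Duhamel's integral over a backward cone into an integral along one of its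
  sides. Extension by 0 from the compact triangle makes Fubini's theorem available.\<close>

lemma integral_triangle_swap:
 fixes k :: "real => real => real"
 assumes cont: "continuous_on {(r, ta). a <= ta & ta <= r & r <= t} (\<lambda>(r, ta). k r ta)"
 shows "integral {a..t} (\<lambda>ta. integral {ta..t} (\<lambda>r. k r ta)) =
     integral {a..t} (\<lambda>r. integral {a..r} (\<lambda>ta. k r ta))" (is ?eq)
  and "(\<lambda>r. integral {a..r} (\<lambda>ta. k r ta)) integrable_on {a..t}"
  and "(\<lambda>ta. integral {ta..t} (\<lambda>r. k r ta)) integrable_on {a..t}"
proof -
 define S where "S = {(r, ta). a <= ta & ta <= r & r <= t}"
 have "closed S"
 proof -
  have "S = {z. a <= snd z} \<inter> {z. snd z <= fst z} \<inter> {z. fst z <= t}" by (auto simp: S_def)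
  moreover have "closed ..." by (intro closed_Int closed_Collect_le continuous_intros)
  ultimately show ?thesis by simp
 qed
 moreover have "S \<subseteq> cbox (a, a) (t, t)" by (auto simp: S_def)
 ultimately have "compact S" using compact_eq_bounded_closed bounded_subset bounded_cbox by blast
 then have int: "integrable lborel2 (\<lambda>(r, ta). indicator S (r, ta) * k r ta)"
  using borel_integrable_compact[OF _ cont[folded S_def]] by (simp add: lborel_prod case_prod_beta')
 have 1: "(LINT r|lborel. indicator S (r, ta) * k r ta) = indicator {a..t} ta * integral {ta..t} (\<lambda>r. k r ta)" for ta
 proof (cases "ta \<in> {a..t}")
  case True
  have "continuous_on {ta..t} (\<lambda>r. k r ta)"
   using True by (intro continuous_on_compose2[OF cont, where f="\<lambda>r. (r, ta)", simplified]) (auto intro!: continuous_intros)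
  then have "integral {ta..t} (\<lambda>r. k r ta) = (LINT r:{ta..t}|lborel. k r ta)"
   by (intro set_borel_integral_eq_integral(2)[symmetric] borel_integrable_atLeastAtMost') auto
  also have "... = (LINT r|lborel. indicator S (r, ta) * k r ta)" unfolding set_lebesgue_integral_def
   by (rule Bochner_Integration.integral_cong) (use True in "auto simp: S_def indicator_def")
  finally show ?thesis using True by simp
 next
  case False
  then have "indicator S (r, ta) = (0::real)" for r by (auto simp: S_def)
  then show ?thesis using False by simp
 qed
 have 2: "(LINT ta|lborel. indicator S (r, ta) * k r ta) = indicator {a..t} r * integral {a..r} (\<lambda>ta. k r ta)" for r
 proof (cases "r \<in> {a..t}")
  case True
  have "continuous_on {a..r} (\<lambda>ta. k r ta)"
   using True by (intro continuous_on_compose2[OF cont, where f="\<lambda>ta. (r, ta)", simplified]) (auto intro!: continuous_intros)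
  then have "integral {a..r} (\<lambda>ta. k r ta) = (LINT ta:{a..r}|lborel. k r ta)"
   by (intro set_borel_integral_eq_integral(2)[symmetric] borel_integrable_atLeastAtMost') auto
  also have "... = (LINT ta|lborel. indicator S (r, ta) * k r ta)" unfolding set_lebesgue_integral_def
   by (rule Bochner_Integration.integral_cong) (use True in "auto simp: S_def indicator_def")
  finally show ?thesis using True by simp
 next
  case False
  then have "indicator S (r, ta) = (0::real)" for ta by (auto simp: S_def)
  then show ?thesis using False by simp
 qed
 have i1: "set_integrable lborel {a..t} (\<lambda>r. integral {a..r} (\<lambda>ta. k r ta))"
  using lborel_pair.integrable_fst'[OF int] 2 by (simp add: set_integrable_def)
 have i2: "set_integrable lborel {a..t} (\<lambda>ta. integral {ta..t} (\<lambda>r. k r ta))"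
  using lborel_pair.integrable_snd[OF int] 1 by (simp add: set_integrable_def)
 show "(\<lambda>r. integral {a..r} (\<lambda>ta. k r ta)) integrable_on {a..t}" using i1 set_borel_integral_eq_integral(1) by blast
 show "(\<lambda>ta. integral {ta..t} (\<lambda>r. k r ta)) integrable_on {a..t}" using i2 set_borel_integral_eq_integral(1) by blast
 have "(LINT ta|lborel. (LINT r|lborel. indicator S (r, ta) * k r ta)) = (LINT r|lborel. (LINT ta|lborel. indicator S (r, ta) * k r ta))"
  by (rule lborel_pair.Fubini_integral[OF int])
 then show ?eq using set_borel_integral_eq_integral(2)[OF i1] set_borel_integral_eq_integral(2)[OF i2]
  by (simp add: 1 2 set_lebesgue_integral_def)
qed

lemma square_integrable_imp_integrable:
 fixes f :: "real => real"
 assumes [measurable]: "f \<in> borel_measurable borel" and sq: "set_integrable lborel {x..y} (\<lambda>z. (f z)^2)"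
 shows "set_integrable lborel {x..y} f"
proof -
 have "set_integrable lborel {x..y} (\<lambda>z. 1 + (f z)^2)" by (intro set_integral_add sq borel_integrable_atLeastAtMost') auto
 then show ?thesis
 proof (rule set_integrable_bound)
  show "set_borel_measurable lborel {x..y} f" unfolding set_borel_measurable_def by measurable
  have "norm (f z) <= norm (1 + (f z)^2)" for z using sum_squares_bound[of 1 "abs (f z)"] by simp
  then show "AE z in lborel. z \<in> {x..y} --> norm (f z) <= norm (1 + (f z)^2)" by simp
 qed
qed

section \<open>The wave equation in the plane\<close>

text \<open>\<open>al j\<close> plays the role of \<open>u1 + j u0'\<close>, with primitive \<open>A j\<close>, so that \<open>U j\<close> below is \<open>u_t + j u_x\<close>.\<close>

locale wave1d =
 fixes p a :: real and T :: "real => real" and u :: "real => real => real"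
  and al A :: "real => real => real"
 assumes p: "p > 1"
  and T_lip: "\<bar>T x - T y\<bar> <= \<bar>x - y\<bar>"
  and u_cont: "continuous_on (infl_dom T) (\<lambda>(x, t). u x t)"
  and al_meas [measurable]: "al j \<in> borel_measurable borel"
  and al_sq: "set_integrable lborel {x..y} (\<lambda>z. (al j z)^2)"
  and A: "x <= y ==> A j y - A j x = integral {x..y} (al j)"
  and rep: "(x, t) \<in> infl_dom T ==> u x t = (A 1 (x + t) - A (- 1) (x - t)
    + integral {0..t} (\<lambda>ta. integral {x - (t - ta)..x + (t - ta)} (\<lambda>z. nonlin p a (u z ta)))) / 2"
begin

definition h where "h x t = nonlin p a (u x t)"

text \<open>The source integrated along the backward characteristic on which \<open>x + j t\<close>
  is constant. Since \<open>Du_t + j Du_x = 2 P j\<close>, it is the contribution of Duhamel's term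
  to \<open>u_t + j u_x\<close>.\<close>

definition P where "P j x t = integral {0..t} (\<lambda>ta. h (x + j * (t - ta)) ta)"

definition U where "U j x t = al j (x + j * t) + P j x t"

definition Du where "Du x t = integral {0..t} (\<lambda>ta. integral {x - (t - ta)..x + (t - ta)} (\<lambda>z. h z ta))"

lemma rep_Du: "(x, t) \<in> infl_dom T ==> u x t = (A 1 (x + t) - A (- 1) (x - t) + Du x t) / 2" by (simp add: rep Du_def h_def)

lemma al_int: "set_integrable lborel {x..y} (al j)" by (rule square_integrable_imp_integrable[OF al_meas al_sq])

lemma cone_subset:
 assumes "(x, t) \<in> infl_dom T" "0 <= ta" "\<bar>z - x\<bar> <= t - ta"
 shows "(z, ta) \<in> infl_dom T" using assms T_lip[of z x] by (auto simp: infl_dom_def)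

lemma h_cont: "continuous_on (infl_dom T) (\<lambda>(x, t). h x t)"
proof -
 have "continuous_on (infl_dom T) (\<lambda>z. nonlin p a ((\<lambda>(x, t). u x t) z))"
  using continuous_on_compose2[OF continuous_nonlin[OF p] u_cont] by simp
 then show ?thesis by (simp add: h_def case_prod_beta)
qed

lemma h_cont_compose:
 assumes "continuous_on S X" "continuous_on S Y" "!!z. z \<in> S ==> (X z, Y z) \<in> infl_dom T"
 shows "continuous_on S (\<lambda>z. h (X z) (Y z))"
 using continuous_on_compose2[OF h_cont continuous_on_Pair[OF assms(1,2)]] assms(3) by auto

text \<open>The range of integration in \<open>P\<close> moves with \<open>t\<close>. Over the fixed
  interval \<open>{0..1}\<close> joint continuity in \<open>(x, t)\<close> becomes continuity of a
  parameter integral.\<close>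

lemma P_rescaled:
 assumes "(x, t) \<in> infl_dom T" "abs j = 1"
 shows "P j x t = t * integral {0..1} (\<lambda>\<theta>. h (x + j * (t - t * \<theta>)) (t * \<theta>))"
proof -
 have t: "t >= 0" using assms by (auto simp: infl_dom_def)
 have cont: "continuous_on {0..t} (\<lambda>ta. h (x + j * (t - ta)) ta)" using cone_subset[OF assms(1)] assms(2)
  by (intro h_cont_compose) (auto intro!: continuous_intros simp: abs_mult)
 have "((\<lambda>\<theta>. t *\<^sub>R h (x + j * (t - t * \<theta>)) (t * \<theta>)) has_integral
   integral {t * 0..t * 1} (\<lambda>ta. h (x + j * (t - ta)) ta)) {0..1}" by (rule has_integral_substitution[where c=0 and d=t])
   (use t cont in "auto intro!: derivative_eq_intros simp: mult_left_le")
 then show ?thesis unfolding P_def by (auto dest!: integral_unique)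
qed

lemma P_cont:
 assumes "abs j = 1"
 shows "continuous_on (infl_dom T) (\<lambda>(x, t). P j x t)"
proof -
 have "continuous_on (infl_dom T \<times> cbox (0::real) 1)
   (\<lambda>((x, t), \<theta>). h (x + j * (t - t * \<theta>)) (t * \<theta>))" unfolding case_prod_beta
 proof (rule h_cont_compose)
  fix z assume z: "z \<in> infl_dom T \<times> cbox (0::real) 1"
  obtain x t \<theta> where zz: "z = ((x, t), \<theta>)" by (metis surj_pair)
  have *: "(x, t) \<in> infl_dom T" "0 <= \<theta>" "\<theta> <= 1" "0 <= t" using z zz by (auto simp: infl_dom_def)
  have "t * \<theta> <= t" using * by (simp add: mult_left_le)
  then have "(x + j * (t - t * \<theta>), t * \<theta>) \<in> infl_dom T"
   by (intro cone_subset[OF *(1)]) (use * assms in "auto simp: abs_mult")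
  then show "(fst (fst z) + j * (snd (fst z) - snd (fst z) * snd z), snd (fst z) * snd z) \<in> infl_dom T" using zz by simp
 qed (intro continuous_intros)+
 then have "continuous_on (infl_dom T) (\<lambda>z. integral (cbox 0 1) (\<lambda>\<theta>. (\<lambda>(x, t). \<lambda>\<theta>. h (x + j * (t - t * \<theta>)) (t * \<theta>)) z \<theta>))"
  by (intro integral_continuous_on_param) (simp add: case_prod_beta)
 then have "continuous_on (infl_dom T) (\<lambda>z. snd z * integral {0..1} (\<lambda>\<theta>. h (fst z + j * (snd z - snd z * \<theta>)) (snd z * \<theta>)))"
  by (intro continuous_intros) (simp add: case_prod_beta)
 then show ?thesis by (rule continuous_on_eq) (auto simp: P_rescaled[OF _ assms])
qed

lemma P_cont_compose:
 assumes "abs j = 1" "continuous_on S X" "continuous_on S Y" "!!z. z \<in> S ==> (X z, Y z) \<in> infl_dom T"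
 shows "continuous_on S (\<lambda>z. P j (X z) (Y z))"
 using continuous_on_compose2[OF P_cont[OF assms(1)] continuous_on_Pair[OF assms(2,3)]] assms(4) by auto

lemma u_cont_compose:
 assumes "continuous_on S X" "continuous_on S Y" "!!z. z \<in> S ==> (X z, Y z) \<in> infl_dom T"
 shows "continuous_on S (\<lambda>z. u (X z) (Y z))"
 using continuous_on_compose2[OF u_cont continuous_on_Pair[OF assms(1,2)]] assms(3) by auto

lemma sigma_cancel: "\<bar>j::real\<bar> = 1 ==> j * (j * x) = x" by (cases "j = 1"; cases "j = -1") auto

lemma char_in_dom:
 assumes "abs j = 1" "(xi - j * b, b) \<in> infl_dom T" "0 <= r" "r <= b"
 shows "(xi - j * r, r) \<in> infl_dom T"
proof (rule cone_subset[OF assms(2,3)])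
 have "\<bar>xi - j * r - (xi - j * b)\<bar> = \<bar>j * (b - r)\<bar>" by (simp add: algebra_simps)
 then show "\<bar>xi - j * r - (xi - j * b)\<bar> <= b - r" using assms by (simp add: abs_mult)
qed

text \<open>On the line \<open>x = xi - j * t\<close> the integrand of \<open>P j\<close> is
  independent of \<open>t\<close>, and only the upper limit moves. This is the equation in the form
  of an ordinary differential equation for \<open>u_t + j u_x\<close>, whose remaining part
  \<open>al j xi\<close> is constant on that line.\<close>

lemma P_char_deriv:
 assumes j: "abs j = 1" and b: "(xi - j * b, b) \<in> infl_dom T" and t: "0 <= t" "t <= b"
 shows "((\<lambda>t. P j (xi - j * t) t) has_real_derivative h (xi - j * t) t) (at t within {0..b})"
proof -
 have "continuous_on {0..b} (\<lambda>ta. h (xi - j * ta) ta)" by (intro h_cont_compose continuous_intros) (use char_in_dom[OF j b] in auto)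
 then have "((\<lambda>t. integral {0..t} (\<lambda>ta. h (xi - j * ta) ta)) has_real_derivative h (xi - j * t) t) (at t within {0..b})"
  by (rule integral_has_real_derivative) (use t in auto)
 moreover have "P j (xi - j * t) t = integral {0..t} (\<lambda>ta. h (xi - j * ta) ta)" for t
  unfolding P_def by (rule integral_cong) (simp add: algebra_simps)
 ultimately show ?thesis by simp
qed

text \<open>A point \<open>(z, ta)\<close> of the backward cone is described by the time
  \<open>r\<close> at which the characteristic of the other family through it meets the line
  \<open>x = xi - j * t\<close>, that is \<open>z = xi - j * (2 * r - ta)\<close>. The factor 2 is
  the Jacobian; exchanging the order of integration collects the points with the same
  \<open>r\<close> into \<open>P (- j)\<close>.\<close>

lemma Du_char:
 assumes j: "abs j = 1" and b: "(xi - j * t, t) \<in> infl_dom T"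
 shows "Du (xi - j * t) t = 2 * integral {0..t} (\<lambda>r. P (- j) (xi - j * r) r)"
proof -
 have t: "t >= 0" using b by (auto simp: infl_dom_def)
 have j': "j = 1 \<or> j = -1" using j by (auto simp: abs_if split: if_splits)
 define k where "k r ta = h (xi - j * (2 * r - ta)) ta" for r ta
 have dom: "(xi - j * (2 * r - ta), ta) \<in> infl_dom T" if "0 <= ta" "ta <= r" "r <= t" for r ta
  by (rule cone_subset[OF b]) (use j' that in auto)
 have inner: "integral {xi - j * t - (t - ta)..xi - j * t + (t - ta)} (\<lambda>z. h z ta) = 2 * integral {ta..t} (\<lambda>r. k r ta)"
  if "0 <= ta" "ta <= t" for ta
 proof -
  have cz: "continuous_on {xi - j * t - (t - ta)..xi - j * t + (t - ta)} (\<lambda>z. h z ta)"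
   by (intro h_cont_compose continuous_intros cone_subset[OF b]) (use that in auto)
  show ?thesis
  proof (cases "j = 1")
   case True
   have "((\<lambda>r. 2 *\<^sub>R (\<lambda>z. h z ta) (xi - (2 * (- r) - ta))) has_integral
     integral {xi - (2 * (- (- t)) - ta)..xi - (2 * (- (- ta)) - ta)} (\<lambda>z. h z ta)) {- t..- ta}"
    by (rule has_integral_substitution[where c="xi - t - (t - ta)" and d="xi - t + (t - ta)"])
     (use that cz True in "auto intro!: derivative_eq_intros")
   then have "((\<lambda>r. 2 * h (xi - (2 * r - ta)) ta) has_integral
     integral {xi - (2 * t - ta)..xi - (2 * ta - ta)} (\<lambda>z. h z ta)) {ta..t}" by (subst has_integral_reflect_real[symmetric]) simp
   then show ?thesis using True by (auto simp: k_def algebra_simps dest!: integral_unique)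
  next
   case False
   then have "j = -1" using j' by simp
   have "((\<lambda>r. 2 *\<^sub>R (\<lambda>z. h z ta) (xi + (2 * r - ta))) has_integral
     integral {xi + (2 * ta - ta)..xi + (2 * t - ta)} (\<lambda>z. h z ta)) {ta..t}"
    by (rule has_integral_substitution[where c="xi + t - (t - ta)" and d="xi + t + (t - ta)"])
     (use that cz \<open>j = -1\<close> in "auto intro!: derivative_eq_intros")
   then show ?thesis using \<open>j = -1\<close> by (auto simp: k_def algebra_simps dest!: integral_unique)
  qed
 qed
 have ck: "continuous_on {(r, ta). 0 <= ta & ta <= r & r <= t} (\<lambda>(r, ta). k r ta)"
  unfolding k_def case_prod_beta by (intro h_cont_compose continuous_intros) (use dom in auto)
 have "Du (xi - j * t) t = integral {0..t} (\<lambda>ta. 2 * integral {ta..t} (\<lambda>r. k r ta))"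
  unfolding Du_def by (rule integral_cong) (use inner in auto)
 also have "... = 2 * integral {0..t} (\<lambda>r. integral {0..r} (\<lambda>ta. k r ta))" using integral_triangle_swap(1)[OF ck] by simp
 also have "integral {0..t} (\<lambda>r. integral {0..r} (\<lambda>ta. k r ta)) = integral {0..t} (\<lambda>r. P (- j) (xi - j * r) r)"
  unfolding P_def k_def by (simp add: algebra_simps)
 finally show ?thesis .
qed

lemma Du_char_deriv:
 assumes j: "abs j = 1" and b: "(xi - j * b, b) \<in> infl_dom T" and t: "0 < t" "t < b"
 shows "((\<lambda>t. Du (xi - j * t) t) has_real_derivative 2 * P (- j) (xi - j * t) t) (at t)"
proof -
 have "continuous_on {0..b} (\<lambda>r. P (- j) (xi - j * r) r)"
  using j by (intro P_cont_compose continuous_intros char_in_dom[OF j b]) auto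
 then have "((\<lambda>t. integral {0..t} (\<lambda>r. P (- j) (xi - j * r) r)) has_real_derivative P (- j) (xi - j * t) t) (at t within {0..b})"
  by (rule integral_has_real_derivative) (use t in auto)
 then have "((\<lambda>t. 2 * integral {0..t} (\<lambda>r. P (- j) (xi - j * r) r)) has_real_derivative 2 * P (- j) (xi - j * t) t) (at t)"
  using t by (auto intro!: DERIV_cmult simp: at_within_Icc_at)
 moreover have "\<forall>\<^sub>F t in nhds t. t \<in> {0<..<b}" using t by (intro eventually_nhds_in_open) auto
 then have "\<forall>\<^sub>F t in nhds t. Du (xi - j * t) t = 2 * integral {0..t} (\<lambda>r. P (- j) (xi - j * r) r)"
  by eventually_elim (use Du_char[OF j] char_in_dom[OF j b] in auto)
 ultimately show ?thesis by (subst DERIV_cong_ev[OF refl _ refl])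
qed

text \<open>In the coordinates \<open>x + t\<close> and \<open>x - t\<close> both partial
  derivatives are known from \<open>Du_char_deriv\<close>. Continuity of \<open>P\<close> makes one
  of them continuous, which gives total differentiability; the curves used later are then covered by
  the chain rule.\<close>

lemma Du_has_derivative:
 assumes xt: "0 < t" "t < T x"
 shows "((\<lambda>(x, t). Du x t) has_derivative
   (\<lambda>(dx, dt). P 1 x t * (dx + dt) - P (- 1) x t * (dx - dt))) (at (x, t))"
proof -
 define f where "f xi et = Du ((xi + et) / 2) ((xi - et) / 2)" for xi et
 define d where "d = min t (T x - t) / 5"
 have d: "d > 0" "d < t" "t + 5 * d <= T x" using xt by (auto simp: d_def)
 define X where "X = {x + t - d<..<x + t + d}"
 define Y where "Y = {x - t - d<..<x - t + d}"
 have dom: "(x', s) \<in> infl_dom T" if "\<bar>x' - x\<bar> <= 3 * d" "0 <= s" "s <= t + d" for x' s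
  using T_lip[of x' x] that d by (auto simp: infl_dom_def)
 have XY: "(x + t, x - t) \<in> X \<times> Y" "open (X \<times> Y)" using d by (auto simp: X_def Y_def open_Times)
 have par: "((\<lambda>et. f xi et) has_real_derivative - P (- 1) ((xi + et) / 2) ((xi - et) / 2)) (at et)"
  if "xi \<in> X" "et \<in> Y" for xi et
 proof -
  have b: "(xi - 1 * (t + d), t + d) \<in> infl_dom T" by (rule dom) (use that d in "auto simp: X_def Y_def abs_if")
  have r: "0 < (xi - et) / 2" "(xi - et) / 2 < t + d" using that d by (auto simp: X_def Y_def)
  have "((\<lambda>t. Du (xi - 1 * t) t) has_real_derivative 2 * P (- 1) (xi - 1 * ((xi - et) / 2)) ((xi - et) / 2)) (at ((xi - et) / 2))"
   by (rule Du_char_deriv[OF _ b r]) simp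
  then have "((\<lambda>et. (\<lambda>t. Du (xi - 1 * t) t) ((xi - et) / 2)) has_real_derivative
    2 * P (- 1) (xi - 1 * ((xi - et) / 2)) ((xi - et) / 2) * (- 1 / 2)) (at et)" by (rule DERIV_chain2) (auto intro!: derivative_eq_intros)
  moreover have "xi - (xi - et) / 2 = (xi + et) / 2" for et by (simp add: field_simps)
  ultimately show ?thesis by (simp add: f_def)
 qed
 have "((\<lambda>xi. f xi (x - t)) has_real_derivative P 1 x t) (at (x + t))"
 proof -
  have b: "((x - t) - (- 1) * (t + d), t + d) \<in> infl_dom T" by (rule dom) (use d in "auto simp: abs_if")
  have "((\<lambda>s. Du ((x - t) - (- 1) * s) s) has_real_derivative 2 * P (- (- 1)) ((x - t) - (- 1) * t) t) (at t)"
   by (rule Du_char_deriv[OF _ b]) (use d xt in auto)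
  then have "((\<lambda>s. Du (x - t + s) s) has_real_derivative 2 * P 1 x t) (at ((x + t - (x - t)) / 2))" by (simp add: field_simps)
  then have "((\<lambda>xi. (\<lambda>s. Du (x - t + s) s) ((xi - (x - t)) / 2)) has_real_derivative 2 * P 1 x t * (1 / 2)) (at (x + t))"
   by (rule DERIV_chain2) (auto intro!: derivative_eq_intros)
  moreover have "x - t + (xi - (x - t)) / 2 = (xi + (x - t)) / 2" for xi by (simp add: field_simps)
  ultimately show ?thesis by (simp add: f_def)
 qed
 then have fx: "((\<lambda>xi. f xi (x - t)) has_derivative (\<lambda>v. P 1 x t * v)) (at (x + t) within X)"
  by (simp add: has_field_derivative_def has_derivative_at_withinI)
 define fy :: "real => real => real \<Rightarrow>\<^sub>L real" where
  "fy xi et = (- P (- 1) ((xi + et) / 2) ((xi - et) / 2)) *\<^sub>R id_blinfun" for xi et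
 have fyapp: "blinfun_apply (fy xi et) = (\<lambda>v. - P (- 1) ((xi + et) / 2) ((xi - et) / 2) * v)" for xi et
  by (simp add: fy_def fun_eq_iff blinfun.scaleR_left blinfun.minus_left)
 have fyd: "((\<lambda>et. f xi et) has_derivative blinfun_apply (fy xi et)) (at et within Y)" if "xi \<in> X" "et \<in> Y" for xi et
  using par[OF that] unfolding fyapp by (simp add: has_field_derivative_def has_derivative_at_withinI)
 have "continuous_on (X \<times> Y) (\<lambda>(xi, et). fy xi et)" unfolding fy_def case_prod_beta
 proof (intro continuous_intros P_cont_compose)
  fix z assume "z \<in> X \<times> Y"
  then obtain xi et where z: "z = (xi, et)" "xi \<in> X" "et \<in> Y" by auto
  show "((fst z + snd z) / 2, (fst z - snd z) / 2) \<in> infl_dom T"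
  proof (rule dom)
   have *: "x + t - d < xi" "xi < x + t + d" "x - t - d < et" "et < x - t + d" using z by (auto simp: X_def Y_def)
   show "\<bar>(fst z + snd z) / 2 - x\<bar> <= 3 * d" unfolding abs_le_iff z(1) fst_conv snd_conv using * d(1) by (simp add: field_simps)
   show "0 <= (fst z - snd z) / 2" "(fst z - snd z) / 2 <= t + d" unfolding z(1) fst_conv snd_conv using * d by (simp_all add: field_simps)
  qed
 qed auto
 then have fyc: "continuous (at (x + t, x - t) within X \<times> Y) (\<lambda>(xi, et). fy xi et)"
  using XY by (auto simp: continuous_on_eq_continuous_within)
 have "((\<lambda>(xi, et). f xi et) has_derivative (\<lambda>(tx, ty). P 1 x t * tx + blinfun_apply (fy (x + t) (x - t)) ty)) (at (x + t, x - t) within X \<times> Y)"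
  by (rule has_derivative_partialsI[OF fx fyd fyc]) (use XY in "auto simp: Y_def")
 then have D: "((\<lambda>(xi, et). f xi et) has_derivative (\<lambda>(tx, ty). P 1 x t * tx - P (- 1) x t * ty)) (at (x + t, x - t))"
  using at_within_open[OF XY] by (simp add: fyapp)
 have "((\<lambda>z. (\<lambda>(xi, et). f xi et) (fst z + snd z, fst z - snd z)) has_derivative
   (\<lambda>z. (\<lambda>(tx, ty). P 1 x t * tx - P (- 1) x t * ty) (fst z + snd z, fst z - snd z))) (at (x, t))"
  by (rule has_derivative_compose[of "\<lambda>z. (fst z + snd z, fst z - snd z)"])
   (use D in "auto intro!: derivative_eq_intros")
 then show ?thesis by (simp add: f_def case_prod_beta')
qed

lemma Du_curve:
 assumes "(X has_real_derivative X') (at s)" "(Y has_real_derivative Y') (at s)" "0 < Y s" "Y s < T (X s)"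
 shows "((\<lambda>s. Du (X s) (Y s)) has_real_derivative
  P 1 (X s) (Y s) * (X' + Y') - P (- 1) (X s) (Y s) * (X' - Y')) (at s)"
proof -
 have "((\<lambda>s. (\<lambda>(x, t). Du x t) (X s, Y s)) has_derivative
   (\<lambda>v. (\<lambda>(dx, dt). P 1 (X s) (Y s) * (dx + dt) - P (- 1) (X s) (Y s) * (dx - dt)) (X' * v, Y' * v))) (at s)"
  by (rule has_derivative_compose[of "\<lambda>s. (X s, Y s)", OF has_derivative_Pair])
    (use assms Du_has_derivative in "auto simp: has_field_derivative_def")
 then have "((\<lambda>s. Du (X s) (Y s)) has_derivative
   (\<lambda>v. P 1 (X s) (Y s) * (X' * v + Y' * v) - P (- 1) (X s) (Y s) * (X' * v - Y' * v))) (at s)" by simp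
 then show ?thesis unfolding has_field_derivative_def by (rule has_derivative_eq_rhs) (simp add: fun_eq_iff algebra_simps)
qed

text \<open>The rough data enter \<open>u\<close> only through \<open>A 1 (x + t)\<close> and
  \<open>A (- 1) (x - t)\<close>, and Duhamel's term is continuously differentiable; so
  \<open>u\<close> is absolutely continuous along every smooth curve on which both characteristic
  coordinates are monotone. This covers rays, characteristics and lines of constant time
  alike.\<close>

lemma u_curve_acd:
 assumes ab: "a0 <= b0"
  and X: "!!s. a0 <= s ==> s <= b0 ==> (X has_real_derivative X' s) (at s)" "continuous_on {a0..b0} X'"
  and Y: "!!s. a0 <= s ==> s <= b0 ==> (Y has_real_derivative Y' s) (at s)" "continuous_on {a0..b0} Y'"
  and dom: "!!s. a0 <= s ==> s <= b0 ==> 0 < Y s & Y s < T (X s)"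
  and mono: "!!s. a0 <= s ==> s <= b0 ==> X' s + Y' s >= 0"
  and mono': "(\<forall>s\<in>{a0..b0}. X' s - Y' s >= 0) \<or> (\<forall>s\<in>{a0..b0}. X' s - Y' s <= 0)"
 shows "acd a0 b0 (\<lambda>s. u (X s) (Y s))
   (\<lambda>s. (U 1 (X s) (Y s) * (X' s + Y' s) - U (- 1) (X s) (Y s) * (X' s - Y' s)) / 2)"
proof -
 have cX: "continuous_on {a0..b0} X" and cY: "continuous_on {a0..b0} Y"
  using X(1) Y(1) by (meson atLeastAtMost_iff DERIV_isCont continuous_at_imp_continuous_on)+
 have 1: "acd a0 b0 (\<lambda>s. A 1 (X s + Y s)) (\<lambda>s. al 1 (X s + Y s) * (X' s + Y' s))"
  by (rule acd_substitution_mono[where al="al 1", OF ab A al_int])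
   (use X Y mono in "auto intro!: derivative_eq_intros continuous_intros")
 have 2: "acd a0 b0 (\<lambda>s. A (- 1) (X s - Y s)) (\<lambda>s. al (- 1) (X s - Y s) * (X' s - Y' s))" using mono'
 proof
  assume m: "\<forall>s\<in>{a0..b0}. X' s - Y' s >= 0"
  show ?thesis by (rule acd_substitution_mono[where al="al (- 1)", OF ab A al_int])
    (use X Y m in "auto intro!: derivative_eq_intros continuous_intros")
 next
  assume m: "\<forall>s\<in>{a0..b0}. X' s - Y' s <= 0"
  show ?thesis by (rule acd_substitution_antimono[where al="al (- 1)", OF ab A al_int])
    (use X Y m in "auto intro!: derivative_eq_intros continuous_intros")
 qed
 have dom': "(X s, Y s) \<in> infl_dom T" if "s \<in> {a0..b0}" for s using dom[of s] that by (auto simp: infl_dom_def)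
 have 3: "acd a0 b0 (\<lambda>s. Du (X s) (Y s)) (\<lambda>s. P 1 (X s) (Y s) * (X' s + Y' s) - P (- 1) (X s) (Y s) * (X' s - Y' s))"
 proof (rule acd_C1)
  show "continuous_on {a0..b0} (\<lambda>s. P 1 (X s) (Y s) * (X' s + Y' s) - P (- 1) (X s) (Y s) * (X' s - Y' s))"
   by (intro continuous_intros P_cont_compose cX cY X(2) Y(2) dom') auto
  fix s assume "a0 <= s" "s <= b0"
  then show "((\<lambda>s. Du (X s) (Y s)) has_real_derivative
    P 1 (X s) (Y s) * (X' s + Y' s) - P (- 1) (X s) (Y s) * (X' s - Y' s)) (at s within {a0..b0})"
   using Du_curve[OF X(1)[of s] Y(1)[of s]] dom[of s] by (simp add: has_field_derivative_at_within)
 qed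
 show ?thesis by (rule acd_cong[OF acd_cmult[OF acd_add[OF acd_add[OF 1 acd_minus[OF 2]] 3], of "1 / 2"]])
   (use rep_Du[OF dom'] in "auto simp: U_def field_simps")
qed

lemma u_has_derivative:
 assumes A1: "(A 1 has_real_derivative al 1 (x + t)) (at (x + t))"
  and A2: "(A (- 1) has_real_derivative al (- 1) (x - t)) (at (x - t))"
  and xt: "0 < t" "t < T x"
 shows "((\<lambda>(x, t). u x t) has_derivative
   (\<lambda>(dx, dt). (U 1 x t * (dx + dt) - U (- 1) x t * (dx - dt)) / 2)) (at (x, t))"
proof -
 have 1: "((\<lambda>z. A 1 (fst z + snd z)) has_derivative (\<lambda>z. al 1 (x + t) * (fst z + snd z))) (at (x, t))"
  by (rule has_derivative_compose[of "\<lambda>z. fst z + snd z"])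
   (use A1 in "auto intro!: derivative_eq_intros simp: has_field_derivative_def")
 have 2: "((\<lambda>z. A (- 1) (fst z - snd z)) has_derivative (\<lambda>z. al (- 1) (x - t) * (fst z - snd z))) (at (x, t))"
  by (rule has_derivative_compose[of "\<lambda>z. fst z - snd z"])
   (use A2 in "auto intro!: derivative_eq_intros simp: has_field_derivative_def")
 have "((\<lambda>z. (A 1 (fst z + snd z) - A (- 1) (fst z - snd z) + (\<lambda>(x, t). Du x t) z) / 2) has_derivative
  (\<lambda>z. (al 1 (x + t) * (fst z + snd z) - al (- 1) (x - t) * (fst z - snd z) +
   (\<lambda>(dx, dt). P 1 x t * (dx + dt) - P (- 1) x t * (dx - dt)) z) / 2)) (at (x, t))"
  by (rule bounded_linear.has_derivative[OF bounded_linear_divide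
     has_derivative_add[OF has_derivative_diff[OF 1 2] Du_has_derivative[OF xt]]])
 then have D: "((\<lambda>z. (A 1 (fst z + snd z) - A (- 1) (fst z - snd z) + Du (fst z) (snd z)) / 2) has_derivative
   (\<lambda>(dx, dt). (U 1 x t * (dx + dt) - U (- 1) x t * (dx - dt)) / 2)) (at (x, t))" by (simp add: case_prod_beta' U_def algebra_simps)
 define S where "S = {z. 0 < snd z & snd z < T (fst z)}"
 have "1-lipschitz_on UNIV T" using T_lip by (intro lipschitz_onI) (auto simp: dist_real_def)
 then have cT: "continuous_on UNIV (\<lambda>z. T (fst z :: real))"
  by (intro continuous_on_compose2[OF lipschitz_on_continuous_on, of 1 UNIV T UNIV fst])
   (auto intro: continuous_intros)
 have "S = {z. 0 < snd z} \<inter> {z. snd z < T (fst z)}" by (auto simp: S_def)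
 then have "open S" using cT by (auto intro!: open_Int open_Collect_less continuous_intros)
 show ?thesis
 proof (rule has_derivative_transform_within_open[OF D \<open>open S\<close>])
  show "(x, t) \<in> S" using xt by (simp add: S_def)
  fix z assume "z \<in> S"
  then have "(fst z, snd z) \<in> infl_dom T" by (auto simp: S_def infl_dom_def)
  then show "(A 1 (fst z + snd z) - A (- 1) (fst z - snd z) + Du (fst z) (snd z)) / 2 = (\<lambda>(x, t). u x t) z"
   using rep_Du by (simp add: case_prod_beta)
 qed
qed

end

section \<open>The scaling factor, and transport along curves in a strip\<close>

lemma phi_pos: "s > 0 ==> phi p a s > 0" by (simp add: phi_def)

definition expo :: "real => real" where "expo p = 2 / (p - 1)"

text \<open>The logarithmic derivative of \<open>phi\<close>. Its \<open>O(1 / s)\<close> part is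
  what the logarithm in the equation contributes to the linear terms.\<close>

definition lam :: "real => real => real => real" where
 "lam p a s = expo p - a * expo p / (2 * s)"

lemma DERIV_phi:
 assumes "s > 0"
 shows "(phi p a has_real_derivative lam p a s * phi p a s) (at s)"
proof -
 have *: "phi p a = (\<lambda>s. exp (expo p * s) * s powr (- (a * expo p / 2)))"
 proof -
  have "a * (2 / d) / 2 = a / d" for d :: real by simp
  then have "a * expo p / 2 = a / (p - 1)" unfolding expo_def .
  then show ?thesis by (simp add: phi_def expo_def fun_eq_iff)
 qed
 have "s powr (- (a * expo p / 2) - 1) = s powr (- (a * expo p / 2)) / s" using assms by (simp add: powr_diff)
 moreover have "((\<lambda>s. exp (expo p * s) * s powr (- (a * expo p / 2))) has_real_derivative
   exp (expo p * s) * expo p * s powr (- (a * expo p / 2)) +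
   exp (expo p * s) * ((- (a * expo p / 2)) * s powr (- (a * expo p / 2) - 1))) (at s)" using assms by (auto intro!: derivative_eq_intros)
 ultimately show ?thesis unfolding * lam_def by (elim DERIV_cong) (use assms in "simp add: field_simps")
qed

text \<open>Passes at each time \<open>s\<close> between the position \<open>y\<close> and the label
  \<open>c\<close> of the line through it; the affine map depends on \<open>s\<close>, so the
  integrability on the plane is recovered from Tonelli's theorem.\<close>

lemma fiber_affine_integrable:
 fixes F :: "real \<times> real => real"
 assumes F: "integrable lborel2 F"
  and [measurable]: "m \<in> borel_measurable borel" "b \<in> borel_measurable borel" and m: "!!s. m s ~= 0"
 shows "integrable lborel2 (\<lambda>(s, c). abs (m s) * F (s, b s + m s * c))" (is "integrable _ ?G")
  and "(LINT c|lborel. abs (m s) * F (s, b s + m s * c)) = (LINT y|lborel. F (s, y))"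
proof -
 have [measurable]: "F \<in> borel_measurable (borel \<Otimes>\<^sub>M borel)" using borel_measurable_integrable[OF F] by simp
 have *: "(LINT y|lborel. f y) = (LINT c|lborel. abs (m s) * f (b s + m s * c))" for f :: "real => real" and s
  using lborel_integral_real_affine[OF m, of f s "b s"] by simp
 show "(LINT c|lborel. abs (m s) * F (s, b s + m s * c)) = (LINT y|lborel. F (s, y))"
  using *[of "\<lambda>y. F (s, y)" s] by simp
 show "integrable lborel2 ?G"
 proof (rule lborel_pair.Fubini_integrable)
  show "?G \<in> borel_measurable lborel2" by measurable
  have "(LINT c|lborel. norm (?G (s, c))) = (LINT y|lborel. norm (F (s, y)))" for s
   using *[of "\<lambda>y. abs (F (s, y))" s] by (simp add: abs_mult)
  then show "integrable lborel (\<lambda>s. \<integral>c. norm (?G (s, c)) \<partial>lborel)"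
   using lborel_pair.integrable_fst'[OF integrable_norm[OF F]] by simp
  show "AE s in lborel. integrable lborel (\<lambda>c. ?G (s, c))" using lborel_pair.AE_integrable_fst'[OF F]
  proof eventually_elim
   case (elim s)
   then have "integrable lborel (\<lambda>c. F (s, b s + m s * c))" using lborel_integrable_real_affine[OF elim m] by auto
   then show ?case by simp
  qed
 qed
qed

lemma lborel_integral_eq_HK:
 fixes f :: "real => real"
 assumes "f absolutely_integrable_on {a..b}" and [measurable]: "(\<lambda>x. indicator {a..b} x * f x) \<in> borel_measurable borel"
 shows "(LINT x|lborel. indicator {a..b} x * f x) = integral {a..b} f"
proof -
 have "(LINT x|lborel. indicator {a..b} x * f x) = (LINT x|lebesgue. indicator {a..b} x * f x)"
  by (rule integral_completion[symmetric]) simp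
 also have "... = integral {a..b} f" using set_lebesgue_integral_eq_integral(2)[OF assms(1)] by (simp add: set_lebesgue_integral_def)
 finally show ?thesis .
qed

text \<open>
 Transport along the lines \<open>j y = 1 - c exp s\<close>, which leave the strip through \<open>j y = - 1\<close>,
 where \<open>Z\<close> vanishes.
\<close>

lemma transport:
 fixes Z G :: "real => real => real"
 assumes s12: "s1 <= s2" and j: "abs j = 1"
  and Z: "!!s. s \<in> {s1, s2} ==> sint (\<lambda>y. Z y s)"
  and G: "set_integrable lborel2 ({s1..s2} \<times> {- 1<..<1}) (\<lambda>(s, y). G y s)"
  and path: "!!c e. 0 < c ==> s1 <= e ==> e <= s2 ==> c * exp e <= 2 ==>
    acd s1 e (\<lambda>s. exp s * Z (chr j c s) s) (\<lambda>s. exp s * G (chr j c s) s)"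
  and bd: "!!s. s1 <= s ==> s <= s2 ==> Z (- j) s = 0"
 shows "(SINT y. Z y s2) - (SINT y. Z y s1)
  = (LINT s:{s1..s2}|lborel. (SINT y. G y s))"
proof -
 define ins where "ins s c = indicat_real {- 1<..<1} (j + (- j * exp s) * c)" for s c
 have ins: "ins s c = (if 0 < c * exp s & c * exp s < 2 then 1 else 0)" for s c
  using j by (auto simp: ins_def indicator_def abs_if mult.commute split: if_splits)
 have arg: "j + (- j * exp s) * c = chr j c s" for s c by (simp add: algebra_simps)
 \<comment> \<open>Here \<open>c\<close> labels the lines and \<open>exp s\<close> is the Jacobian
   from \<open>c\<close> to \<open>y\<close>. The cutoff \<open>ins\<close> records that the line is
   inside the strip; since \<open>j y\<close> decreases along it, no line enters after
   \<open>s1\<close>.\<close>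
 define z0 where "z0 s c = exp s * (ins s c * Z (chr j c s) s)" for s c
 have z0: "(LINT c|lborel. z0 s c) = (SINT y. Z y s)" "integrable lborel (z0 s)" if "s \<in> {s1, s2}" for s
 proof -
  have int: "integrable lborel (\<lambda>y. indicat_real {- 1<..<1} y * Z y s)" using Z[OF that] by (simp add: set_integrable_def)
  have "integrable lborel (\<lambda>c. indicat_real {- 1<..<1} (j + (- j * exp s) * c) * Z (j + (- j * exp s) * c) s)"
   using lborel_integrable_real_affine[OF int, of "- j * exp s" j] j by auto
  then show "integrable lborel (z0 s)" unfolding z0_def ins_def arg by (rule integrable_mult_right)
  show "(LINT c|lborel. z0 s c) = (SINT y. Z y s)"
   using lborel_integral_real_affine[of "- j * exp s" "\<lambda>y. indicat_real {- 1<..<1} y * Z y s" j] j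
   unfolding z0_def ins_def arg by (auto simp: set_lebesgue_integral_def abs_mult)
 qed
 define F where "F = (\<lambda>(s, y). indicat_real ({s1..s2} \<times> {- 1<..<1}) (s, y) * G y s)"
 have F: "integrable lborel2 F" using G by (simp add: set_integrable_def F_def case_prod_beta')
 define g0 where "g0 s c = exp s * (indicat_real {s1..s2} s * ins s c * G (chr j c s) s)" for s c
 have g0F: "g0 s c = exp s * F (s, j + (- j * exp s) * c)" for s c
  unfolding g0_def F_def prod.case ins_def arg by (simp add: indicator_times)
 have sh: "integrable lborel2 (\<lambda>(s, c). exp s * F (s, j + (- j * exp s) * c))"
  "(LINT c|lborel. exp s * F (s, j + (- j * exp s) * c)) = (LINT y|lborel. F (s, y))" for s
  using fiber_affine_integrable[OF F, of "\<lambda>s. - j * exp s" "\<lambda>_. j"] j by (auto simp: abs_mult)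
 have g0: "integrable lborel2 (\<lambda>(s, c). g0 s c)" unfolding g0F by (rule sh(1))
 have g0_meas: "(\<lambda>s. g0 s c) \<in> borel_measurable borel" for c
  using measurable_compose_Pair1[OF _ measurable_pair_swap'[THEN measurable_compose, OF borel_measurable_integrable[OF g0]], of c] by simp
 have line: "(LINT s|lborel. g0 s c) = z0 s2 c - z0 s1 c" for c
 proof -
  consider "c <= 0" | "c > 0" "c * exp s1 >= 2" | "c > 0" "c * exp s1 < 2" by linarith
  then show ?thesis
  proof cases
   case 1
   then have "ins s c = 0" for s by (simp add: ins mult_le_0_iff not_less)
   then show ?thesis by (simp add: g0_def z0_def)
  next
   case 2
   have "ins s c = 0" if "s >= s1" for s
   proof -
    have "c * exp s1 <= c * exp s" using 2 that by (intro mult_left_mono) auto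
    then have "\<not> c * exp s < 2" using 2 by linarith
    then show ?thesis by (simp add: ins)
   qed
   then have "g0 s c = 0" for s by (cases "s >= s1") (auto simp: g0_def)
   moreover have "z0 s1 c = 0" "z0 s2 c = 0" using \<open>!!s. s >= s1 ==> ins s c = 0\<close> s12 by (auto simp: z0_def)
   ultimately show ?thesis by simp
  next
   case 3
   \<comment> \<open>The time at which the line leaves the strip, or \<open>s2\<close> if it is
     still inside then. At an exit \<open>c * exp e = 2\<close>, hence \<open>y = - j\<close>, where
     \<open>Z\<close> vanishes: lines that leave contribute nothing at the upper end.\<close>
   define e where "e = min s2 (ln (2 / c))"
   have "exp s1 < 2 / c" using 3 by (simp add: field_simps)
   have eln': "exp (ln (2 / c)) = 2 / c" using 3 by simp
   then have "s1 < ln (2 / c)" using exp_less_cancel_iff[of s1 "ln (2 / c)"] \<open>exp s1 < 2 / c\<close> by simp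
   then have e: "s1 <= e" "e <= s2" using s12 by (auto simp: e_def)
   have le: "c * exp s < 2 \<longleftrightarrow> s < ln (2 / c)" for s
   proof -
    have "c * exp s < 2 \<longleftrightarrow> exp s < 2 / c" using 3 by (simp add: field_simps)
    also have "... \<longleftrightarrow> s < ln (2 / c)" using exp_less_cancel_iff[of s "ln (2 / c)"] eln' by simp
    finally show ?thesis .
   qed
   have eln: "c * exp (ln (2 / c)) = 2" using 3 by simp
   have e2: "c * exp e <= 2"
   proof -
    have "exp e <= exp (ln (2 / c))" by (simp only: exp_le_cancel_iff e_def)
    then have "c * exp e <= c * exp (ln (2 / c))" using 3 by (intro mult_left_mono) auto
    then show ?thesis using eln by simp
   qed
   let ?f = "\<lambda>s. exp s * G (chr j c s) s"
   have acd: "acd s1 e (\<lambda>s. exp s * Z (chr j c s) s) ?f" by (rule path[OF 3(1) e e2])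
   have AE: "AE s in lborel. s ~= ln (2 / c)" by (rule AE_lborel_singleton)
   have "(LINT s|lborel. g0 s c) = integral {s1..e} (\<lambda>s. ins s c * ?f s)"
   proof -
    have eq: "g0 s c = indicator {s1..e} s * (ins s c * ?f s)" for s using 3 by (auto simp: g0_def ins le indicator_def e_def)
    have "(\<lambda>s. ins s c * ?f s) absolutely_integrable_on {s1..e}"
     by (rule absolutely_integrable_spike[OF acd_abs_integrable[OF acd], of "{ln (2 / c)}"])
       (use 3 in "auto simp: ins le e_def")
    moreover have "(\<lambda>s. indicator {s1..e} s * (ins s c * ?f s)) \<in> borel_measurable borel" using g0_meas[of c] unfolding eq .
    ultimately show ?thesis unfolding eq by (rule lborel_integral_eq_HK)
   qed
   also have "... = integral {s1..e} ?f" by (rule integral_spike[of "{ln (2 / c)}"]) (use 3 in "auto simp: ins le e_def")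
   also have "... = exp e * Z (j * (1 - c * exp e)) e - exp s1 * Z (j * (1 - c * exp s1)) s1" using acd_diff[OF acd, of s1 e] e by simp
   also have "exp s1 * Z (j * (1 - c * exp s1)) s1 = z0 s1 c" using 3 by (simp add: z0_def ins)
   also have "exp e * Z (j * (1 - c * exp e)) e = z0 s2 c"
   proof (cases "s2 < ln (2 / c)")
    case True
    then show ?thesis using 3 le[of s2] by (simp add: z0_def ins e_def)
   next
    case False
    then have "e = ln (2 / c)" by (simp add: e_def)
    then have "Z (j * (1 - c * exp e)) e = 0" using eln bd[of e] e by simp
    moreover have "ins s2 c = 0" using False le[of s2] by (simp add: ins)
    ultimately show ?thesis by (simp add: z0_def)
   qed
   finally show ?thesis .
  qed
 qed
 have "(LINT s:{s1..s2}|lborel. (SINT y. G y s)) = (LINT s|lborel. (LINT y|lborel. F (s, y)))"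
  by (simp add: set_lebesgue_integral_def F_def indicator_times mult.assoc)
 also have "... = (LINT s|lborel. (LINT c|lborel. g0 s c))" unfolding g0F sh(2) ..
 also have "... = (LINT c|lborel. (LINT s|lborel. g0 s c))"
  by (rule lborel_pair.Fubini_integral[OF g0, symmetric])
 also have "... = (LINT c|lborel. z0 s2 c - z0 s1 c)" by (simp add: line)
 also have "... = (SINT y. Z y s2) - (SINT y. Z y s1)" by (simp add: z0)
 finally show ?thesis ..
qed

lemma transport_ray:
 fixes Z G :: "real => real => real"
 assumes s12: "s1 <= s2"
  and Z: "!!s. s \<in> {s1, s2} ==> sint (\<lambda>y. Z y s)"
  and G: "set_integrable lborel2 ({s1..s2} \<times> {- 1<..<1}) (\<lambda>(s, y). G y s)"
  and path: "!!y. - 1 < y ==> y < 1 ==> acd s1 s2 (\<lambda>s. Z y s) (\<lambda>s. G y s)"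
 shows "(SINT y. Z y s2) - (SINT y. Z y s1)
  = (LINT s:{s1..s2}|lborel. (SINT y. G y s))"
proof -
 define F where "F = (\<lambda>s y. indicat_real {s1..s2} s * (indicat_real {- 1<..<1} y * G y s))"
 have F: "integrable lborel2 (\<lambda>(s, y). F s y)"
  using G by (simp add: set_integrable_def F_def case_prod_beta' indicator_times mult.assoc)
 have F_meas: "(\<lambda>s. F s y) \<in> borel_measurable borel" for y
  using measurable_compose_Pair1[OF _ measurable_pair_swap'[THEN measurable_compose, OF borel_measurable_integrable[OF F]], of y] by simp
 have "(LINT s:{s1..s2}|lborel. (SINT y. G y s)) = (LINT s|lborel. (LINT y|lborel. F s y))"
  by (simp add: set_lebesgue_integral_def F_def)
 also have "... = (LINT y|lborel. (LINT s|lborel. F s y))"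
  by (rule lborel_pair.Fubini_integral[OF F, symmetric])
 also have "... = (LINT y|lborel. indicat_real {- 1<..<1} y * Z y s2 - indicat_real {- 1<..<1} y * Z y s1)"
 proof (rule Bochner_Integration.integral_cong[OF refl])
  fix y :: real
  show "(LINT s|lborel. F s y) = indicat_real {- 1<..<1} y * Z y s2 - indicat_real {- 1<..<1} y * Z y s1"
  proof (cases "y \<in> {- 1<..<1}")
   case True
   then have p: "acd s1 s2 (\<lambda>s. Z y s) (\<lambda>s. G y s)" using path by auto
   have eq: "F s y = indicator {s1..s2} s * G y s" for s using True by (simp add: F_def)
   have "(LINT s|lborel. F s y) = integral {s1..s2} (\<lambda>s. G y s)"
    unfolding eq by (rule lborel_integral_eq_HK[OF acd_abs_integrable[OF p]]) (use F_meas[of y] eq in simp)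
   then show ?thesis using acd_diff[OF p, of s1 s2] s12 True by simp
  qed (simp add: F_def)
 qed
 also have "... = (SINT y. Z y s2) - (SINT y. Z y s1)" using Z unfolding set_lebesgue_integral_def set_integrable_def by simp
 finally show ?thesis ..
qed

lemma chr_range:
 assumes "abs j = 1" "0 <= c" "s <= e" "c * exp e <= 2"
 shows "- 1 <= chr j c s" "chr j c s <= 1"
proof -
 have "c * exp s <= c * exp e" "0 <= c * exp s" using assms by (auto intro!: mult_left_mono)
 then show "- 1 <= chr j c s" "chr j c s <= 1" using assms by (auto simp: abs_if split: if_splits)
qed

section \<open>Similarity variables\<close>

text \<open>The part between similarity times \<open>s1\<close> and \<open>s2\<close> of the backward cone with apex \<open>(x0, T0)\<close>; \<open>z\<close> and \<open>wy\<close> are \<open>w_s\<close> and \<open>w_y\<close>.\<close>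

locale cone = wave1d +
 fixes x0 T0 s1 s2 :: real
 assumes s12: "s1 <= s2" and s1: "1 <= s1"
  and dom: "- 1 <= y ==> y <= 1 ==> s1 <= s ==> s <= s2 ==>
   0 < T0 - exp (- s) & T0 - exp (- s) < T (x0 + y * exp (- s))"
begin

definition w where "w y s = u (x0 + y * exp (- s)) (T0 - exp (- s)) / phi p a s"

definition v where "v j y s = exp (- s) * U j (x0 + y * exp (- s)) (T0 - exp (- s)) / phi p a s"

definition g where "g y s = exp (- 2 * s) * nonlin p a (phi p a s * w y s) / phi p a s"

text \<open>The \<open>s\<close>-derivative of \<open>u\<close> along the ray
  \<open>y = const\<close>, divided by \<open>phi\<close>. Hence \<open>w_s = q - lam w\<close>,
  which is \<open>z\<close>.\<close>

definition q where "q y s = ((1 - y) * v 1 y s + (1 + y) * v (- 1) y s) / 2"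

definition wy where "wy y s = (v 1 y s - v (- 1) y s) / 2"

definition z where "z y s = q y s - lam p a s * w y s"

lemma v_z: "v 1 y s = z y s + lam p a s * w y s + (1 + y) * wy y s"
 "v (- 1) y s = z y s + lam p a s * w y s - (1 - y) * wy y s" by (simp_all add: z_def q_def wy_def field_simps)

lemma in_dom: "- 1 <= y ==> y <= 1 ==> s1 <= s ==> s <= s2 ==>
 (x0 + y * exp (- s), T0 - exp (- s)) \<in> infl_dom T" using dom[of y s] by (auto simp: infl_dom_def)

lemma spos: "s1 <= s ==> s > 0" using s1 by simp

lemma phi_nz: "s1 <= s ==> phi p a s ~= 0" using phi_pos[OF spos, of s p a] by simp

lemma phi_w: "s1 <= s ==> phi p a s * w y s = u (x0 + y * exp (- s)) (T0 - exp (- s))"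
 using phi_pos[OF spos] by (simp add: w_def less_imp_neq[symmetric])

lemma g_h: "s1 <= s ==> g y s = exp (- 2 * s) * h (x0 + y * exp (- s)) (T0 - exp (- s)) / phi p a s" by (simp add: g_def phi_w h_def)

lemma phi_cont: "continuous_on {s1..s2} (phi p a)"
 using DERIV_phi[OF spos] by (meson DERIV_isCont atLeastAtMost_iff continuous_at_imp_continuous_on)

lemma lam_cont: "continuous_on {s1..s2} (lam p a)" unfolding lam_def by (intro continuous_intros) (use s1 in auto)

lemma DERIV_inverse_phi:
 "s1 <= s ==> ((\<lambda>s. 1 / phi p a s) has_real_derivative - lam p a s / phi p a s) (at s)" using phi_pos[OF spos, of s p a]
 by (auto intro!: derivative_eq_intros DERIV_phi spos simp: field_simps power2_eq_square)

lemma acd_inverse_phi: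
 assumes "s1 <= c" "d <= s2"
 shows "acd c d (\<lambda>s. 1 / phi p a s) (\<lambda>s. - lam p a s / phi p a s)"
proof (rule acd_C1)
 show "((\<lambda>s. 1 / phi p a s) has_real_derivative - lam p a x / phi p a x) (at x within {c..d})"
  if "c <= x" "x <= d" for x using DERIV_inverse_phi[of x] that assms by (simp add: has_field_derivative_at_within)
 have "\<forall>x\<in>{c..d}. phi p a x ~= 0" using phi_pos[OF spos] assms by (metis atLeastAtMost_iff less_irrefl order_trans)
 moreover have "{c..d} \<subseteq> {s1..s2}" using assms by auto
 ultimately show "continuous_on {c..d} (\<lambda>s. - lam p a s / phi p a s)"
  by (intro continuous_intros continuous_on_subset[OF lam_cont] continuous_on_subset[OF phi_cont]) auto
qed

lemma w_ray_acd:
 assumes y: "- 1 <= y" "y <= 1"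
 shows "acd s1 s2 (\<lambda>s. w y s) (\<lambda>s. z y s)"
proof -
 have 1: "acd s1 s2 (\<lambda>s. u (x0 + y * exp (- s)) (T0 - exp (- s)))
   (\<lambda>s. (U 1 (x0 + y * exp (- s)) (T0 - exp (- s)) * (- y * exp (- s) + exp (- s)) -
    U (- 1) (x0 + y * exp (- s)) (T0 - exp (- s)) * (- y * exp (- s) - exp (- s))) / 2)"
 proof (rule u_curve_acd[OF s12])
  have "- y * exp (- s) + exp (- s) = (1 - y) * exp (- s)" for s by (simp add: algebra_simps)
  then show "0 <= - y * exp (- s) + exp (- s)" for s using y by simp
  have "- y * exp (- s) - exp (- s) = - ((1 + y) * exp (- s))" for s by (simp add: algebra_simps)
  then have "- y * exp (- s) - exp (- s) <= 0" for s using y by simp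
  then show "(\<forall>s\<in>{s1..s2}. 0 <= - y * exp (- s) - exp (- s)) \<or> (\<forall>s\<in>{s1..s2}. - y * exp (- s) - exp (- s) <= 0)"
   by blast
 qed (use dom y in "auto intro!: derivative_eq_intros continuous_intros")
 show ?thesis by (rule acd_cong[OF acd_mult[OF 1 acd_inverse_phi]])
   (auto simp: w_def z_def q_def v_def field_simps phi_nz)
qed

text \<open>The curve \<open>j y = 1 - c * exp s\<close> is the straight line
  \<open>x + j t = const\<close> of the original variables. Along it \<open>u\<close> changes by
  \<open>u_t - j u_x\<close>, so only \<open>v (- j)\<close> appears.\<close>

lemma w_char_acd:
 assumes j: "abs j = 1" and c: "0 <= c" and e: "s1 <= e" "e <= s2" "c * exp e <= 2"
 shows "acd s1 e (\<lambda>s. w (chr j c s) s)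
  (\<lambda>s. v (- j) (chr j c s) s - lam p a s * w (chr j c s) s)"
proof -
 have j': "j = 1 \<or> j = -1" using j by (auto simp: abs_if split: if_splits)
 have X: "x0 + chr j c s * exp (- s) = x0 + j * exp (- s) - j * c" for s by (simp add: algebra_simps flip: exp_add)
 note yb = chr_range[OF j c _ e(3)]
 have 1: "acd s1 e (\<lambda>s. u (x0 + j * exp (- s) - j * c) (T0 - exp (- s)))
   (\<lambda>s. (U 1 (x0 + j * exp (- s) - j * c) (T0 - exp (- s)) * (- j * exp (- s) + exp (- s)) -
    U (- 1) (x0 + j * exp (- s) - j * c) (T0 - exp (- s)) * (- j * exp (- s) - exp (- s))) / 2)"
 proof (rule u_curve_acd[OF e(1)])
  fix s assume "s1 <= s" "s <= e"
  then show "0 < T0 - exp (- s) & T0 - exp (- s) < T (x0 + j * exp (- s) - j * c)"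
   using dom[of "chr j c s" s] yb[of s] e unfolding X by simp
 qed (use j' in "auto intro!: derivative_eq_intros continuous_intros")
 have wX: "w (chr j c s) s = u (x0 + j * exp (- s) - j * c) (T0 - exp (- s)) / phi p a s"
  and vX: "v ta (chr j c s) s = exp (- s) * U ta (x0 + j * exp (- s) - j * c) (T0 - exp (- s)) / phi p a s" for s ta
  unfolding w_def v_def X by (rule refl)+
 show ?thesis unfolding wX vX by (rule acd_cong[OF acd_mult[OF 1 acd_inverse_phi[OF order_refl e(2)]]])
   (use j' in "auto simp: field_simps phi_nz")
qed

text \<open>On the line \<open>x + j t = xi\<close> the rough term \<open>al j xi\<close> is one
  fixed number, and the rest is differentiable by \<open>P_char_deriv\<close>. Therefore the
  equation holds on every characteristic and not only on almost every one, although
  \<open>al j\<close> is merely square integrable.\<close>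

lemma v_char_acd:
 assumes j: "abs j = 1" and c: "0 <= c" and e: "s1 <= e" "e <= s2" "c * exp e <= 2"
 shows "acd s1 e (\<lambda>s. v j (chr j c s) s)
  (\<lambda>s. g (chr j c s) s - (1 + lam p a s) * v j (chr j c s) s)"
proof -
 have j': "j = 1 \<or> j = -1" using j by (auto simp: abs_if split: if_splits)
 define xi where "xi = x0 + j * T0 - j * c"
 have X: "x0 + chr j c s * exp (- s) = xi - j * (T0 - exp (- s))" for s by (simp add: xi_def algebra_simps flip: exp_add)
 note yb = chr_range[OF j c _ e(3)]
 have idom: "(xi - j * (T0 - exp (- s)), T0 - exp (- s)) \<in> infl_dom T" if "s1 <= s" "s <= e" for s
  using in_dom[of "chr j c s" s] yb[of s] that e unfolding X by simp
 have U: "U j (xi - j * t) t = al j xi + P j (xi - j * t) t" for t by (simp add: U_def)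
 let ?U = "\<lambda>s. U j (xi - j * (T0 - exp (- s))) (T0 - exp (- s))"
 let ?h = "\<lambda>s. h (xi - j * (T0 - exp (- s))) (T0 - exp (- s))"
 have 1: "acd s1 e ?U (\<lambda>s. ?h s * exp (- s))"
 proof (rule acd_C1)
  show "continuous_on {s1..e} (\<lambda>s. ?h s * exp (- s))" by (intro continuous_intros h_cont_compose) (use idom in auto)
  fix s assume s: "s1 <= s" "s <= e"
  have t: "0 <= T0 - exp (- r) & T0 - exp (- r) <= T0 - exp (- e)" if "r \<in> {s1..e}" for r
   using idom[of r] that by (auto simp: infl_dom_def)
  have "((\<lambda>t. al j xi + P j (xi - j * t) t) has_real_derivative ?h s) (at (T0 - exp (- s)) within {0..T0 - exp (- e)})"
   using P_char_deriv[OF j idom[OF e(1) order_refl]] t[of s] s by (auto intro!: derivative_eq_intros)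
  then have "((\<lambda>t. al j xi + P j (xi - j * t) t) has_real_derivative ?h s) (at (T0 - exp (- s)) within (\<lambda>s. T0 - exp (- s)) ` {s1..e})"
   by (rule DERIV_subset) (use t in auto)
  moreover have "((\<lambda>s. T0 - exp (- s)) has_real_derivative exp (- s)) (at s within {s1..e})" by (auto intro!: derivative_eq_intros)
  ultimately have "((\<lambda>t. al j xi + P j (xi - j * t) t) \<circ> (\<lambda>s. T0 - exp (- s)) has_real_derivative ?h s * exp (- s)) (at s within {s1..e})"
   by (rule DERIV_image_chain)
  then show "(?U has_real_derivative ?h s * exp (- s)) (at s within {s1..e})" unfolding U comp_def .
 qed
 have 2: "acd s1 e (\<lambda>s. exp (- s)) (\<lambda>s. - exp (- s))" by (rule acd_C1) (auto intro!: derivative_eq_intros continuous_intros)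
 have vX: "v j (chr j c s) s = exp (- s) * ?U s / phi p a s" for s unfolding v_def X by (rule refl)
 have gX: "g (chr j c s) s = exp (- s) * exp (- s) * ?h s / phi p a s" if "s1 <= s" for s unfolding g_h[OF that] X by (simp flip: exp_add)
 show ?thesis unfolding vX
 proof (rule acd_cong[OF acd_mult[OF acd_mult[OF 2 1] acd_inverse_phi[OF order_refl e(2)]]])
  fix s assume s: "s1 <= s" "s <= e"
  show "exp (- s) * ?U s * (1 / phi p a s) = exp (- s) * ?U s / phi p a s" by simp
  show "(- exp (- s) * ?U s + exp (- s) * (?h s * exp (- s))) * (1 / phi p a s) +
    exp (- s) * ?U s * (- lam p a s / phi p a s) =
    g (chr j c s) s - (1 + lam p a s) * (exp (- s) * ?U s / phi p a s)"
   unfolding gX[OF s(1)] using phi_nz[OF s(1)] by (simp add: field_simps)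
 qed
qed

lemma w_fixed_time_acd:
 assumes s: "s1 <= s" "s <= s2"
 shows "acd (- 1) 1 (\<lambda>y. w y s) (\<lambda>y. wy y s)"
proof -
 have 1: "acd (- 1) 1 (\<lambda>y. u (x0 + y * exp (- s)) (T0 - exp (- s)))
   (\<lambda>y. (U 1 (x0 + y * exp (- s)) (T0 - exp (- s)) * (exp (- s) + 0) -
    U (- 1) (x0 + y * exp (- s)) (T0 - exp (- s)) * (exp (- s) - 0)) / 2)"
  by (rule u_curve_acd) (use dom s in "auto intro!: derivative_eq_intros continuous_intros")
 show ?thesis by (rule acd_cong[OF acd_cmult[OF 1, of "1 / phi p a s"]])
   (use s in "auto simp: w_def wy_def v_def field_simps phi_nz")
qed

end

text \<open>For \<open>k < 1\<close> the derivative blows up where \<open>f\<close> vanishes, which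
  may happen at the ends; monotonicity replaces boundedness. Written with a quotient, the derivative
  is 0 at such points by the convention for division by 0, and this does not affect the
  integrals.\<close>

lemma acd_powr_decreasing:
 assumes ab: "a0 <= b0" and k: "k > 0"
  and f: "!!x. a0 <= x ==> x <= b0 ==> (f has_real_derivative f' x) (at x)"
  and pos: "!!x. a0 < x ==> x < b0 ==> f x > 0" "!!x. a0 <= x ==> x <= b0 ==> f x >= 0"
  and dec: "!!x. a0 <= x ==> x <= b0 ==> f' x <= 0"
 shows "acd a0 b0 (\<lambda>x. f x powr k) (\<lambda>x. k * (f x powr k / f x) * f' x)"
proof -
 have "acd a0 b0 (\<lambda>x. - (f x powr k)) (\<lambda>x. - (k * (f x powr k / f x) * f' x))"
 proof (rule acd_mono_interior[OF ab])
  have "continuous_on {a0..b0} f" using f by (meson DERIV_isCont atLeastAtMost_iff continuous_at_imp_continuous_on)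
  then show "continuous_on {a0..b0} (\<lambda>x. - (f x powr k))" using k pos(2) by (intro continuous_on_minus continuous_on_powr') auto
  fix x assume x: "a0 < x" "x < b0"
  then have "((\<lambda>x. f x powr k) has_real_derivative k * f x powr (k - 1) * f' x) (at x)"
   using DERIV_fun_powr[OF f pos(1), of x k] by simp
  moreover have "f x powr (k - 1) = f x powr k / f x" using pos(1)[OF x] by (simp add: powr_diff)
  ultimately show "((\<lambda>x. - (f x powr k)) has_real_derivative - (k * (f x powr k / f x) * f' x)) (at x)" by (intro DERIV_minus) simp
 next
  fix x assume x: "a0 <= x" "x <= b0"
  have "0 <= k * (f x powr k / f x)" using k pos(2)[OF x] by simp
  then have "k * (f x powr k / f x) * f' x <= 0" using dec[OF x] by (rule mult_nonneg_nonpos)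
  then show "0 <= - (k * (f x powr k / f x) * f' x)" by (subst neg_0_le_iff_le)
 qed
 from acd_minus[OF this] show ?thesis by simp
qed

section \<open>The weights \<open>rho\<close> and \<open>rho1\<close>\<close>

lemma expo_pos: "p > 1 ==> expo p > 0" by (simp add: expo_def)

text \<open>The weight of the dissipation. For \<open>expo p < 1\<close> it is unbounded near both
  ends, but its value at \<open>y = 1\<close> and \<open>y = - 1\<close> is 0 by the convention for
  division by 0.\<close>

definition rho1 :: "real => real => real" where "rho1 p y = rho p y / (1 - y^2)"

lemma rho_eq: "rho p y = (1 - y^2) powr expo p" by (simp add: rho_def expo_def)

lemma rho_nonneg: "0 <= rho p y" by (simp add: rho_def)

lemma rho1_nonneg: "y \<in> {- 1..1} ==> 0 <= rho1 p y" by (auto simp: rho1_def rho_def abs_square_le_1 abs_le_iff)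

lemma one_minus_sq_pos: "- 1 < y ==> y < 1 ==> 0 < 1 - y^2" for y :: real using abs_square_less_1[of y] by auto

lemma rho_rho1: "rho p y = rho1 p y * (1 - y^2)" by (auto simp: rho1_def rho_def)

lemma rho_le_1: "y \<in> {- 1..1} ==> p > 1 ==> rho p y <= 1"
 unfolding rho_eq by (rule powr_le1) (auto simp: expo_def abs_square_le_1 abs_le_iff)

lemma rho_meas [measurable]: "rho p \<in> borel_measurable borel" unfolding rho_def[abs_def] by measurable

lemma rho1_meas [measurable]: "rho1 p \<in> borel_measurable borel" unfolding rho1_def[abs_def] by measurable

lemma rho_factor: "- 1 <= y ==> y <= 1 ==> rho p y = (1 + y) powr expo p * (1 - y) powr expo p"
 unfolding rho_eq by (subst powr_mult[symmetric]) (auto simp: power2_eq_square algebra_simps)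

lemma acd_one_minus: "k > 0 ==> acd (- 1) 1 (\<lambda>y. (1 - y) powr k) (\<lambda>y. - (k * ((1 - y) powr k / (1 - y))))"
 by (rule acd_cong[OF acd_powr_decreasing[of "-1" 1 k "\<lambda>y. 1 - y" "\<lambda>_. - 1"]])
  (auto intro!: derivative_eq_intros)

lemma acd_reflect:
 assumes "acd (- b) b f f'"
 shows "acd (- b) b (\<lambda>x. f (- x)) (\<lambda>x. - f' (- x))" unfolding acd_def
proof (intro conjI allI impI)
 have "(\<lambda>x. f' (- x)) absolutely_integrable_on {- b..- (- b)}" using acd_abs_integrable[OF assms]
  by (subst has_absolute_integral_reflect_real[where B="{- b..b}" and b="integral {- b..b} f'", THEN iffD2, THEN conjunct1]) auto
 then show "(\<lambda>x. - f' (- x)) absolutely_integrable_on {- b..b}"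
  using set_integrable_mult_right[of "- 1" lebesgue "{- b..b}" "\<lambda>x. f' (- x)"] by simp
 fix x y assume xy: "- b <= x" "x <= y" "y <= b"
 have "f (- x) - f (- y) = integral {- y..- x} f'" by (rule acd_diff[OF assms]) (use xy in auto)
 also have "... = integral {x..y} (\<lambda>x. f' (- x))"
  using Henstock_Kurzweil_Integration.integral_reflect_real[of "- x" "- y" f'] by simp
 finally show "f (- y) - f (- x) = integral {x..y} (\<lambda>x. - f' (- x))" by simp
qed

lemma acd_one_plus:
 assumes "k > 0"
 shows "acd (- 1) 1 (\<lambda>y. (1 + y) powr k) (\<lambda>y. k * ((1 + y) powr k / (1 + y)))"
 by (rule acd_cong[OF acd_reflect[OF acd_one_minus[OF assms]]]) auto

text \<open>The derivative need not be bounded at the ends, so the product rule is applied to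
  \<open>(1 + y) powr expo p\<close> and \<open>(1 - y) powr expo p\<close>, each of which is
  monotone.\<close>

lemma acd_rho:
 assumes "p > 1"
 shows "acd (- 1) 1 (rho p) (\<lambda>y. - 2 * expo p * y * rho1 p y)"
proof -
 note k = expo_pos[OF assms]
 show ?thesis
 proof (rule acd_cong[OF acd_mult[OF acd_one_plus[OF k] acd_one_minus[OF k]]])
  fix y :: real assume y: "- 1 <= y" "y <= 1"
  show "(1 + y) powr expo p * (1 - y) powr expo p = rho p y" using rho_factor[OF y] by simp
  have e: "y = 1 \<or> y = - 1 \<or> (- 1 < y & y < 1)" using y by auto
  have sq: "1 - y^2 = (1 - y) * (1 + y)" by (simp add: power2_eq_square algebra_simps)
  have *: "k * (X / b) * Y + X * - (k * (Y / a)) = - 2 * k * y * (X * Y / (a * b))"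
   if "a ~= 0" "b ~= 0" "a - b = - 2 * y" for X Y a b k :: real
  proof -
   have "k * (X / b) * Y + X * - (k * (Y / a)) = (a - b) * k * X * Y / (a * b)" using that(1,2) by (simp add: field_simps)
   then show ?thesis unfolding that(3) by simp
  qed
  show "expo p * ((1 + y) powr expo p / (1 + y)) * (1 - y) powr expo p +
     (1 + y) powr expo p * - (expo p * ((1 - y) powr expo p / (1 - y))) = - 2 * expo p * y * rho1 p y"
   using e unfolding rho1_def rho_factor[OF y] sq by (elim disjE) (simp, simp, rule *, auto)
 qed
qed

lemma abs_integrable_imp_lborel:
 fixes f :: "real => real"
 assumes "f absolutely_integrable_on S" "S \<in> sets borel" and [measurable]: "f \<in> borel_measurable borel"
 shows "set_integrable lborel S f"
proof -
 have "(\<lambda>x. indicator S x *\<^sub>R f x) \<in> borel_measurable lborel" using assms(2) by measurable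
 then show ?thesis using assms(1) unfolding set_integrable_def by (subst (asm) integrable_completion)
qed

text \<open>Partial fractions for \<open>2 / (1 - y^2)\<close> separate the two end singularities.
  Each resulting term is, up to a constant, the derivative of a monotone power, hence
  integrable.\<close>

lemma rho1_bound:
 assumes "p > 1" "- 1 < y" "y < 1"
 shows "rho1 p y <= 2 powr expo p * ((1 + y) powr expo p / (1 + y) + (1 - y) powr expo p / (1 - y))"
proof -
 let ?k = "expo p"
 have k: "?k > 0" using expo_pos assms by simp
 have "2 * rho1 p y = (1 - y) powr ?k * ((1 + y) powr ?k / (1 + y)) + (1 + y) powr ?k * ((1 - y) powr ?k / (1 - y))"
 proof -
  have "1 - y^2 = (1 - y) * (1 + y)" by (simp add: power2_eq_square algebra_simps)
  then show ?thesis using rho_factor[of y p] assms by (simp add: rho1_def field_simps)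
 qed
 also have "... <= 2 powr ?k * ((1 + y) powr ?k / (1 + y)) + 2 powr ?k * ((1 - y) powr ?k / (1 - y))"
  using assms k by (intro add_mono mult_right_mono powr_mono2) auto
 finally show ?thesis using rho1_nonneg[of y p] assms by (simp add: distrib_left)
qed

lemma rho1_set_integrable:
 assumes "p > 1"
 shows "sint (rho1 p)"
proof -
 let ?k = "expo p"
 have k: "?k > 0" using expo_pos assms by simp
 have sub: "sint f" if "set_integrable lborel {- 1..1} f" for f :: "real => real" using that by (rule set_integrable_subset) auto
 have 1: "set_integrable lborel {- 1..1} (\<lambda>y. - (?k * ((1 - y) powr ?k / (1 - y))))"
  by (rule abs_integrable_imp_lborel[OF acd_abs_integrable[OF acd_one_minus[OF k]]]) measurable
 have 2: "set_integrable lborel {- 1..1} (\<lambda>y. (?k * ((1 + y) powr ?k / (1 + y))))"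
  by (rule abs_integrable_imp_lborel[OF acd_abs_integrable[OF acd_one_plus[OF k]]]) measurable
 have "sint (\<lambda>y. (2 powr ?k / ?k) * (?k * ((1 + y) powr ?k / (1 + y)) - (- (?k * ((1 - y) powr ?k / (1 - y))))))"
  by (intro set_integrable_mult_right set_integral_diff(1) sub[OF 1] sub[OF 2])
 then show ?thesis
 proof (rule set_integrable_bound)
  show "set_borel_measurable lborel {- 1<..<1} (rho1 p)" unfolding set_borel_measurable_def by measurable
  show "AE y in lborel. y \<in> {- 1<..<1} --> norm (rho1 p y) <=
    norm ((2 powr ?k / ?k) * (?k * ((1 + y) powr ?k / (1 + y)) - (- (?k * ((1 - y) powr ?k / (1 - y))))))"
  proof (intro AE_I2 impI)
   fix y :: real assume y: "y \<in> {- 1<..<1}"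
   have e: "(2 powr ?k / ?k) * (?k * ((1 + y) powr ?k / (1 + y)) - (- (?k * ((1 - y) powr ?k / (1 - y)))))
    = 2 powr ?k * ((1 + y) powr ?k / (1 + y) + (1 - y) powr ?k / (1 - y))" using k by (simp add: distrib_left)
   have "rho1 p y <= 2 powr ?k * ((1 + y) powr ?k / (1 + y) + (1 - y) powr ?k / (1 - y))" using rho1_bound[OF assms] y by auto
   moreover have "0 <= rho1 p y" using rho1_nonneg y by auto
   ultimately show "norm (rho1 p y) <= norm ((2 powr ?k / ?k) * (?k * ((1 + y) powr ?k / (1 + y)) - (- (?k * ((1 - y) powr ?k / (1 - y))))))"
    unfolding e real_norm_def by linarith
  qed
 qed
qed

text \<open>
 The weight is singular at \<open>j y = - 1\<close>, but each characteristic crosses that end transversally: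
 on it the time integral of the weight is at most \<open>2 powr k / k\<close>.
\<close>

lemma char_weight_integrable:
 fixes om :: "real => real"
 assumes k: "k > 0" and j: "abs j = 1" and s12: "s1 <= s2"
  and [measurable]: "om \<in> borel_measurable borel"
  and om: "set_integrable lborel {0..2 * exp (- s1)} om" "!!c. om c >= 0"
 shows "set_integrable lborel2 ({s1..s2} \<times> {- 1<..<1})
   (\<lambda>(s, y). (1 - j * y) * ((1 + j * y) powr k / (1 + j * y)) * om ((1 - j * y) * exp (- s)))"
proof -
 \<comment> \<open>The integrand in the coordinates \<open>(c, s)\<close> with
   \<open>c * exp s = 1 - j * y\<close>. The factor \<open>1 - j * y\<close> makes the weight equal
   to \<open>- 1 / k\<close> times the \<open>s\<close>-derivative of
   \<open>(2 - c * exp s) powr k\<close>, so that its time integral is a difference of two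
   powers.\<close>
 define H where "H = (\<lambda>(c, s). indicat_real {s1..s2} s * (if 0 < c & c * exp s < 2 then 1 else 0) *
   (c * exp s * ((2 - c * exp s) powr k / (2 - c * exp s))) * om c)"
 have [measurable]: "H \<in> borel_measurable (borel \<Otimes>\<^sub>M borel)" unfolding H_def by measurable
 have Hnn: "H (c, s) >= 0" for c s using om(2) by (auto simp: H_def)
 have in1: "integrable lborel (\<lambda>s. H (c, s)) & (LINT s|lborel. H (c, s)) <= 2 powr k / k * (indicator {0..2 * exp (- s1)} c * om c)" for c
 proof -
  consider "c <= 0 \<or> c * exp s1 >= 2" | "c > 0" "c * exp s1 < 2" by linarith
  then show ?thesis
  proof cases
   case 1
   have "H (c, s) = 0" for s
   proof (cases "s1 <= s & c > 0")
    case True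
    then have "c * exp s1 <= c * exp s" by (intro mult_left_mono) auto
    then have "\<not> c * exp s < 2" using 1 True by linarith
    then show ?thesis by (simp add: H_def)
   qed (auto simp: H_def)
   then show ?thesis using k om(2) by simp
  next
   case 2
   have E: "exp (ln (2 / c)) = 2 / c" using 2 by simp
   have le: "c * exp s <= 2 \<longleftrightarrow> s <= ln (2 / c)" for s
   proof -
    have "c * exp s <= 2 \<longleftrightarrow> exp s <= 2 / c" using 2 by (simp add: field_simps)
    then show ?thesis using exp_le_cancel_iff[of s "ln (2 / c)"] E by simp
   qed
   define e where "e = min s2 (ln (2 / c))"
   have e: "s1 <= e" "e <= s2" "c * exp e <= 2" using s12 le[of s1] le[of e] 2 by (auto simp: e_def)
   have acd: "acd s1 e (\<lambda>s. (2 - c * exp s) powr k) (\<lambda>s. k * ((2 - c * exp s) powr k / (2 - c * exp s)) * (- (c * exp s)))"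
   proof (rule acd_powr_decreasing[OF e(1) k])
    fix x
    show "((\<lambda>s. 2 - c * exp s) has_real_derivative - (c * exp x)) (at x)" by (auto intro!: derivative_eq_intros)
    show "- (c * exp x) <= 0" using 2 by simp
    show "x <= e ==> 0 <= 2 - c * exp x" using le[of x] by (simp add: e_def)
    assume "x < e"
    then have "c * exp x < c * exp e" using 2 by simp
    then show "0 < 2 - c * exp x" using e by linarith
   qed
   define f where "f s = k * ((2 - c * exp s) powr k / (2 - c * exp s)) * (- (c * exp s))" for s
   have fi: "set_integrable lborel {s1..e} f"
    by (rule abs_integrable_imp_lborel) (use acd_abs_integrable[OF acd] in "auto simp: f_def[abs_def]")
   have Hf: "H (c, s) = (- (om c) / k) * (indicator {s1..e} s * f s)" for s
    using le[of s] k 2 by (auto simp: H_def f_def e_def indicator_def)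
   have I: "integrable lborel (\<lambda>s. H (c, s))" using fi unfolding Hf set_integrable_def by simp
   have "(LINT s|lborel. H (c, s)) = (- (om c) / k) * (LINT s:{s1..e}|lborel. f s)"
    unfolding Hf set_lebesgue_integral_def by simp
   also have "(LINT s:{s1..e}|lborel. f s) = (2 - c * exp e) powr k - (2 - c * exp s1) powr k"
    using set_borel_integral_eq_integral(2)[OF fi] acd_diff[OF acd[folded f_def], of s1 e] e by simp
   also have "(- (om c) / k) * ... <= 2 powr k / k * om c"
   proof -
    have "(2 - c * exp s1) powr k <= 2 powr k" using 2 k by (intro powr_mono2) auto
    then have "(2 - c * exp s1) powr k - (2 - c * exp e) powr k <= 2 powr k" using powr_ge_zero[of "2 - c * exp e" k] by linarith
    from mult_left_mono[OF this, of "om c / k"] show ?thesis using om(2)[of c] k by (simp add: field_simps)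
   qed
   also have "... = 2 powr k / k * (indicator {0..2 * exp (- s1)} c * om c)" using 2 by (simp add: exp_minus field_simps)
   finally show ?thesis using I by simp
  qed
 qed
 have Hint: "integrable lborel2 H"
 proof (rule lborel_pair.Fubini_integrable)
  show "AE c in lborel. integrable lborel (\<lambda>s. H (c, s))" using in1 by simp
  have "integrable lborel (\<lambda>c. 2 powr k / k * (indicator {0..2 * exp (- s1)} c * om c))"
   using om(1) by (simp add: set_integrable_def)
  then show "integrable lborel (\<lambda>c. \<integral>s. norm (H (c, s)) \<partial>lborel)"
  proof (rule Bochner_Integration.integrable_bound)
   show "AE c in lborel. norm (LINT s|lborel. norm (H (c, s))) <= norm (2 powr k / k * (indicator {0..2 * exp (- s1)} c * om c))"
   proof (intro AE_I2)
    fix c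
    have "0 <= (LINT s|lborel. H (c, s))" by (rule Bochner_Integration.integral_nonneg) (use Hnn in auto)
    then show "norm (LINT s|lborel. norm (H (c, s))) <= norm (2 powr k / k * (indicator {0..2 * exp (- s1)} c * om c))"
     using in1[of c] Hnn abs_ge_self[of "2 powr k / k * (indicat_real {0..2 * exp (- s1)} c * om c)"]
     unfolding real_norm_def abs_of_nonneg[OF Hnn] by linarith
   qed
  qed measurable
 qed measurable
 have "integrable lborel2 (\<lambda>(s, c). H (c, s))" using lborel_pair.integrable_product_swap[OF Hint] by simp
 from fiber_affine_integrable(1)[OF this, of "\<lambda>s. - j * exp (- s)" "\<lambda>s. exp (- s)"] j
 have I: "integrable lborel2 (\<lambda>(s, y). exp (- s) * H (exp (- s) + (- j * exp (- s)) * y, s))" by (auto simp: abs_mult)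
 have "integrable lborel2 (\<lambda>(s, y). (indicator {s1..s2} s * exp s) * (exp (- s) * H (exp (- s) + (- j * exp (- s)) * y, s)))"
 proof (rule Bochner_Integration.integrable_bound[OF integrable_mult_right[OF I, of "exp s2"]])
  show "AE x in lborel2. norm (case x of (s, y) => (indicator {s1..s2} s * exp s) * (exp (- s) * H (exp (- s) + (- j * exp (- s)) * y, s)))
   <= norm (exp s2 * (case x of (s, y) => exp (- s) * H (exp (- s) + (- j * exp (- s)) * y, s)))"
   using Hnn by (intro AE_I2) (auto simp: abs_mult indicator_def intro!: mult_right_mono)
 qed measurable
 moreover have "(indicator {s1..s2} s * exp s) * (exp (- s) * H (exp (- s) + (- j * exp (- s)) * y, s)) =
   indicator ({s1..s2} \<times> {- 1<..<1}) (s, y) *\<^sub>R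
   ((1 - j * y) * ((1 + j * y) powr k / (1 + j * y)) * om ((1 - j * y) * exp (- s)))" for s y
 proof -
  have c: "exp (- s) + (- j * exp (- s)) * y = (1 - j * y) * exp (- s)" by (simp add: algebra_simps)
  have cs: "(1 - j * y) * exp (- s) * exp s = 1 - j * y" by (simp flip: exp_add)
  have ee: "exp s * (exp (- s) * x) = x" for x by (simp flip: exp_add mult.assoc)
  have "(0 < 1 - j * y & 1 - j * y < 2) \<longleftrightarrow> y \<in> {- 1<..<1}" using j by (auto simp: abs_if split: if_splits)
  then show ?thesis unfolding c H_def prod.case cs mult.assoc[of "indicator {s1..s2} s"] ee by (auto simp: indicator_def zero_less_mult_iff)
 qed
 ultimately show ?thesis unfolding set_integrable_def by (simp add: case_prod_beta')
qed

section \<open>Integrability in space-time and on time slices\<close>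

lemma compact_bounded_real:
 fixes f :: "'a::topological_space => real"
 assumes "compact K" "continuous_on K f"
 obtains M where "M > 0" "!!x. x \<in> K ==> abs (f x) <= M"
proof -
 have "bounded (f ` K)" by (rule compact_imp_bounded[OF compact_continuous_image[OF assms(2,1)]])
 then obtain B where B: "!!x. x \<in> f ` K ==> norm x <= B" by (auto simp: bounded_iff)
 show ?thesis
 proof (rule that[of "abs B + 1"])
  fix x assume "x \<in> K"
  then show "abs (f x) <= abs B + 1" using B[of "f x"] by simp
 qed simp
qed

context cone
begin

abbreviation "strip == {- 1..1::real} \<times> {s1..s2}"
abbreviation "obox == {s1..s2} \<times> {- 1<..<1::real}"
abbreviation "strip_cont f == continuous_on strip (\<lambda>(y, s). f y s)"
abbreviation "bint f == set_integrable lborel2 obox f"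
abbreviation bint_value :: "(real \<times> real => real) => real" (binder "BINT " 10)
 where "bint_value f == (LINT x:obox|lborel2. f x)"
abbreviation "oboxM == restrict_space (borel \<Otimes>\<^sub>M borel) obox"

text \<open>The factor removes the singularity of \<open>rho1\<close> at \<open>j y = 1\<close>; the
  one at \<open>j y = - 1\<close> is handled by integrating in time along characteristics. Both
  \<open>q\<close> and \<open>(1 - y^2) wy\<close> are combinations of the two \<open>va j\<close>
  with bounded coefficients, so \<open>va\<close> suffices for the dissipation.\<close>

definition va where "va j y s = (1 - j * y) * v j y s"

lemma q_va: "q y s = (va 1 y s + va (- 1) y s) / 2" by (simp add: q_def va_def)

lemma wy_va: "(1 - y^2) * wy y s = ((1 + y) * va 1 y s - (1 - y) * va (- 1) y s) / 2"
 by (simp add: va_def wy_def field_simps power2_eq_square)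

lemma strip_bounded:
 assumes "strip_cont f"
 obtains C :: real where "C >= 0" "!!y s. - 1 <= y ==> y <= 1 ==> s1 <= s ==> s <= s2 ==> abs (f y s) <= C"
proof -
 obtain C where "C > 0" "!!x. x \<in> strip ==> \<bar>case x of (y, s) => f y s\<bar> <= C"
  by (rule compact_bounded_real[OF compact_Times[OF compact_Icc compact_Icc] assms], rule that)
 note C = this
 show ?thesis
 proof (rule that[of C])
  fix y s :: real assume "- 1 <= y" "y <= 1" "s1 <= s" "s <= s2"
  then show "abs (f y s) <= C" using C(2)[of "(y, s)"] by simp
 qed (use C(1) in simp)
qed

lemma time_bounded:
 assumes "continuous_on {s1..s2} f"
 obtains C :: real where "C >= 0" "!!s. s1 <= s ==> s <= s2 ==> abs (f s) <= C"
proof -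
 obtain C where "C > 0" "!!s. s \<in> {s1..s2} ==> abs (f s) <= C" by (rule compact_bounded_real[OF compact_Icc assms], rule that)
 then show ?thesis by (intro that[of C]) auto
qed

lemma strip_cont_time: "continuous_on {s1..s2} f ==> strip_cont (\<lambda>y s. f s)"
 unfolding case_prod_beta by (rule continuous_on_compose2[of "{s1..s2}" f]) (auto intro: continuous_intros)

lemma X_cont: "continuous_on S (\<lambda>x. x0 + fst x * exp (- snd x))" "continuous_on S (\<lambda>x. T0 - exp (- snd x))"
 by (intro continuous_intros)+

lemma w_cont: "strip_cont w" unfolding w_def case_prod_beta
 by (intro continuous_on_divide u_cont_compose X_cont strip_cont_time[OF phi_cont, unfolded case_prod_beta])
  (use in_dom phi_nz in auto)

lemma g_cont: "strip_cont g"
proof -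
 have "continuous_on strip (\<lambda>x. exp (- 2 * snd x) * h (x0 + fst x * exp (- snd x)) (T0 - exp (- snd x)) / phi p a (snd x))"
  by (intro continuous_on_divide continuous_on_mult h_cont_compose X_cont
    strip_cont_time[OF phi_cont, unfolded case_prod_beta] continuous_intros)
   (use in_dom phi_nz in auto)
 then show ?thesis by (rule continuous_on_eq) (auto simp: g_h)
qed

definition G where "G y s = exp (- 2 * s) * nonlin_prim p a (phi p a s * w y s) / (phi p a s)^2"

lemma nonlin_prim_cont: "continuous_on UNIV (nonlin_prim p a)"
 using DERIV_nonlin_prim[OF p] by (meson DERIV_isCont continuous_at_imp_continuous_on)

lemma G_cont: "strip_cont G"
proof -
 have "continuous_on strip (\<lambda>x. nonlin_prim p a (u (x0 + fst x * exp (- snd x)) (T0 - exp (- snd x))))"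
  by (rule continuous_on_compose2[OF nonlin_prim_cont u_cont_compose[OF X_cont]]) (use in_dom in auto)
 then have "continuous_on strip (\<lambda>x. exp (- 2 * snd x) * nonlin_prim p a (u (x0 + fst x * exp (- snd x)) (T0 - exp (- snd x))) / (phi p a (snd x))^2)"
  by (intro continuous_on_divide continuous_on_mult continuous_on_power
    strip_cont_time[OF phi_cont, unfolded case_prod_beta] continuous_intros)
   (use phi_nz in auto)
 then show ?thesis by (rule continuous_on_eq) (auto simp: G_def phi_w)
qed

text \<open>The point at which the characteristic with label \<open>c\<close> meets the line
  \<open>t = 0\<close>, where the data are given.\<close>

definition foot where "foot j c = x0 + j * T0 - j * c"

lemma v_split:
 assumes "abs j = 1"
 shows "v j y s = exp (- s) / phi p a s * al j (foot j ((1 - j * y) * exp (- s)))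
  + exp (- s) / phi p a s * P j (x0 + y * exp (- s)) (T0 - exp (- s))"
proof -
 have eq: "x0 + y * exp (- s) + j * (T0 - exp (- s)) = foot j ((1 - j * y) * exp (- s))"
  using sigma_cancel[OF assms, of "y * exp (- s)"] by (simp add: foot_def algebra_simps)
 show ?thesis unfolding v_def U_def eq by (simp add: add_divide_distrib distrib_left)
qed

lemma exp_phi_cont: "continuous_on {s1..s2} (\<lambda>s. exp (- s) / phi p a s)" using phi_nz by (intro continuous_intros phi_cont) auto

lemma P_strip_cont:
 assumes "abs j = 1"
 shows "strip_cont (\<lambda>y s. exp (- s) / phi p a s * P j (x0 + y * exp (- s)) (T0 - exp (- s)))" unfolding case_prod_beta
 by (intro continuous_on_mult P_cont_compose[OF assms] X_cont strip_cont_time[OF exp_phi_cont, unfolded case_prod_beta])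
  (use in_dom in auto)

lemma v_sq_bound:
 assumes j: "abs j = 1"
 obtains C where "C >= 0" "!!y s. - 1 <= y ==> y <= 1 ==> s1 <= s ==> s <= s2 ==>
   (v j y s)^2 <= C * (1 + (al j (foot j ((1 - j * y) * exp (- s))))^2)"
proof -
 obtain C1 where C1: "C1 >= 0" "!!s. s1 <= s ==> s <= s2 ==> \<bar>exp (- s) / phi p a s\<bar> <= C1"
  by (rule time_bounded[OF exp_phi_cont], rule that)
 obtain C2 where C2: "C2 >= 0" "!!y s. - 1 <= y ==> y <= 1 ==> s1 <= s ==> s <= s2 ==>
   \<bar>exp (- s) / phi p a s * P j (x0 + y * exp (- s)) (T0 - exp (- s))\<bar> <= C2"
  by (rule strip_bounded[OF P_strip_cont[OF j]], rule that)
 show ?thesis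
 proof (rule that[of "2 * (C1^2 + C2^2)"])
  fix y s :: real assume ys: "- 1 <= y" "y <= 1" "s1 <= s" "s <= s2"
  define X where "X = exp (- s) / phi p a s"
  define Y where "Y = X * P j (x0 + y * exp (- s)) (T0 - exp (- s))"
  define Z where "Z = al j (foot j ((1 - j * y) * exp (- s)))"
  have "abs X <= C1" "abs Y <= C2" using C1(2)[OF ys(3,4)] C2(2)[OF ys] by (auto simp: X_def Y_def)
  then have "X^2 <= C1^2" "Y^2 <= C2^2" using power_mono[of "abs X" C1 2] power_mono[of "abs Y" C2 2] by simp_all
  have "(v j y s)^2 = (X * Z + Y)^2" by (simp add: v_split[OF j] X_def Y_def Z_def)
  also have "... <= 2 * (X^2 * Z^2 + Y^2)" using sum_squares_bound[of "X * Z" Y] by (simp add: power2_sum power_mult_distrib)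
  also have "... <= 2 * (C1^2 * Z^2 + C2^2 * 1)"
   using mult_right_mono[OF \<open>X\<^sup>2 <= C1^2\<close>, of "Z^2"] \<open>Y\<^sup>2 <= C2^2\<close> by simp
  also have "... <= 2 * (C1^2 + C2^2) * (1 + Z^2)" by (simp add: algebra_simps)
  finally show "(v j y s)^2 <= 2 * (C1^2 + C2^2) * (1 + (al j (foot j ((1 - j * y) * exp (- s))))^2)" by (simp add: Z_def)
 qed simp
qed

lemma box_sets [measurable]: "obox \<in> sets (borel \<Otimes>\<^sub>M borel)" by measurable

lemma boxM_cont:
 assumes "strip_cont f"
 shows "(\<lambda>(s, y). f y s) \<in> borel_measurable oboxM"
proof -
 have "continuous_on obox (\<lambda>x. (\<lambda>(y, s). f y s) (snd x, fst x))"
  by (rule continuous_on_compose2[OF assms]) (auto intro!: continuous_intros)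
 then have "(\<lambda>x. (\<lambda>(y, s). f y s) (snd x, fst x)) \<in> borel_measurable (restrict_space borel obox)"
  by (rule borel_measurable_continuous_on_restrict)
 then show ?thesis by (simp add: borel_prod case_prod_beta')
qed

lemma boxM_plane:
 assumes "f \<in> borel_measurable (borel \<Otimes>\<^sub>M borel)"
 shows "f \<in> borel_measurable oboxM" using assms by (rule measurable_restrict_space1)

lemma v_boxM:
 assumes "abs j = 1"
 shows "(\<lambda>(s, y). v j y s) \<in> borel_measurable oboxM"
proof -
 have [measurable]: "phi p a \<in> borel_measurable borel" unfolding phi_def[abs_def] by measurable
 have [measurable]: "foot j \<in> borel_measurable borel" unfolding foot_def[abs_def] by measurable
 have "(\<lambda>(s, y). exp (- s) / phi p a s * al j (foot j ((1 - j * y) * exp (- s)))) \<in> borel_measurable oboxM"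
  by (rule boxM_plane) measurable
 then have "(\<lambda>x. (\<lambda>(s, y). exp (- s) / phi p a s * al j (foot j ((1 - j * y) * exp (- s)))) x
   + (\<lambda>(s, y). exp (- s) / phi p a s * P j (x0 + y * exp (- s)) (T0 - exp (- s))) x) \<in> borel_measurable oboxM"
  by (rule borel_measurable_add[OF _ boxM_cont[OF P_strip_cont[OF assms]]])
 then show ?thesis by (simp add: v_split[OF assms] case_prod_beta')
qed

lemma box_integrable_bound:
 fixes f b :: "real \<times> real => real"
 assumes b0: "bint b" and f: "f \<in> borel_measurable oboxM"
  and le: "!!s y. s1 <= s ==> s <= s2 ==> - 1 < y ==> y < 1 ==> abs (f (s, y)) <= b (s, y)"
 shows "bint f"
proof (rule set_integrable_bound[OF b0])
 have "(\<lambda>x. indicator obox x *\<^sub>R f x) \<in> borel_measurable (borel \<Otimes>\<^sub>M borel)"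
  using f by (subst (asm) borel_measurable_restrict_space_iff) (auto simp: mult.commute)
 then show "set_borel_measurable lborel2 obox f" by (simp add: set_borel_measurable_def)
 have "norm (f x) <= norm (b x)" if "x \<in> obox" for x using le[of "fst x" "snd x"] that by (cases x) force
 then show "AE x in lborel2. x \<in> obox --> norm (f x) <= norm (b x)" by simp
qed

lemma slice_integrable_bound:
 fixes f :: "real \<times> real => real" and b :: "real => real"
 assumes b0: "sint b" and f: "f \<in> borel_measurable oboxM" and s: "s1 <= s" "s <= s2"
  and le: "!!y. - 1 < y ==> y < 1 ==> abs (f (s, y)) <= b y"
 shows "sint (\<lambda>y. f (s, y))"
proof (rule set_integrable_bound[OF b0])
 have [measurable]: "(\<lambda>x. indicator obox x * f x) \<in> borel_measurable (borel \<Otimes>\<^sub>M borel)"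
  using f by (subst (asm) borel_measurable_restrict_space_iff) (auto simp: mult.commute)
 have "(\<lambda>y. indicator obox (s, y) * f (s, y)) \<in> borel_measurable borel" by measurable
 moreover have "indicator obox (s, y) * f (s, y) = indicator {- 1<..<1} y *\<^sub>R f (s, y)" for y using s by (simp add: indicator_def)
 ultimately show "set_borel_measurable lborel {- 1<..<1} (\<lambda>y. f (s, y))" by (simp add: set_borel_measurable_def)
 show "AE y in lborel. y \<in> {- 1<..<1} --> norm (f (s, y)) <= norm (b y)" using le by (intro AE_I2) force
qed

lemma kpos: "expo p > 0" using expo_pos[OF p] .

lemma rho1_box_integrable: "bint (\<lambda>(s, y). rho1 p y)"
proof -
 let ?I = "\<lambda>y. indicat_real {- 1<..<1} y * rho1 p y"
 have I: "integrable lborel ?I" using rho1_set_integrable[OF p] by (simp add: set_integrable_def)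
 have J: "integrable lborel (indicat_real {s1..s2})" by (intro integrable_real_indicator) (auto simp: emeasure_lborel_Icc_eq)
 have "integrable lborel2 (\<lambda>(s, y). indicat_real {s1..s2} s * ?I y)"
 proof (rule lborel_pair.Fubini_integrable)
  have "(LINT y|lborel. norm (case (s, y) of (s, y) => indicat_real {s1..s2} s * ?I y)) = indicat_real {s1..s2} s * (LINT y|lborel. norm (?I y))" for s
   by (simp add: abs_mult)
  then show "integrable lborel (\<lambda>s. \<integral>y. norm (case (s, y) of (s, y) => indicat_real {s1..s2} s * ?I y) \<partial>lborel)"
   using J by simp
  show "AE s in lborel. integrable lborel (\<lambda>y. case (s, y) of (s, y) => indicat_real {s1..s2} s * ?I y)" using I by simp
 qed measurable
 then show ?thesis by (simp add: set_integrable_def case_prod_beta' indicator_times mult.assoc)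
qed

text \<open>Up to a continuous term, \<open>v j\<close> depends on \<open>(y, s)\<close> only
  through the label \<open>(1 - j * y) * exp (- s)\<close>, so its square is dominated by an
  integrable function \<open>om\<close> of the label. Since \<open>rho1 * (1 - j * y)^2\<close> is
  at most a constant times the weight of \<open>char_weight_integrable\<close>, this is
  enough.\<close>

lemma va_box_integrable:
 assumes j: "abs j = 1"
 shows "bint (\<lambda>(s, y). rho1 p y * (va j y s)^2)"
proof -
 let ?k = "expo p"
 define om where "om c = 1 + (al j (foot j c))^2" for c
 have [measurable]: "foot j \<in> borel_measurable borel" unfolding foot_def[abs_def] by measurable
 have omm: "om \<in> borel_measurable borel" unfolding om_def[abs_def] by measurable
 have "set_integrable lborel {0..2 * exp (- s1)} om" unfolding om_def
 proof (intro set_integral_add(1))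
  show "set_integrable lborel {0..2 * exp (- s1)} (\<lambda>c. 1 :: real)" by (intro borel_integrable_atLeastAtMost') auto
  define b where "b = 2 * exp (- s1)"
  have b: "b >= 0" by (simp add: b_def)
  let ?J = "{x0 + j * T0 - b..x0 + j * T0 + b}"
  have "integrable lborel (\<lambda>x. indicat_real ?J x * (al j x)^2)" using al_sq by (simp add: set_integrable_def)
  then have "integrable lborel (\<lambda>c. indicat_real ?J ((x0 + j * T0) + (- j) * c) * (al j ((x0 + j * T0) + (- j) * c))^2)"
   using j by (subst lborel_integrable_real_affine_iff) auto
  then have "integrable lborel (\<lambda>c. indicat_real {- b..b} c * (al j (foot j c))^2)"
   by (rule back_subst[where P="integrable lborel"])
    (use j in "auto simp: fun_eq_iff foot_def indicator_def abs_if split: if_splits")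
  then have "set_integrable lborel {- b..b} (\<lambda>c. (al j (foot j c))^2)" by (simp add: set_integrable_def)
  then show "set_integrable lborel {0..2 * exp (- s1)} (\<lambda>c. (al j (foot j c))^2)"
   by (rule set_integrable_subset) (use b in "auto simp: b_def")
 qed
 then have W: "bint
   (\<lambda>(s, y). (1 - j * y) * ((1 + j * y) powr ?k / (1 + j * y)) * om ((1 - j * y) * exp (- s)))"
  by (rule char_weight_integrable[OF kpos j s12 omm]) (simp add: om_def)
 obtain C where C: "C >= 0" "!!y s. - 1 <= y ==> y <= 1 ==> s1 <= s ==> s <= s2 ==>
   (v j y s)^2 <= C * om ((1 - j * y) * exp (- s))" using v_sq_bound[OF j] unfolding om_def by blast
 have "bint (\<lambda>x. (2 powr ?k * C) *
  (case x of (s, y) => (1 - j * y) * ((1 + j * y) powr ?k / (1 + j * y)) * om ((1 - j * y) * exp (- s))))"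
  by (rule set_integrable_mult_right) (use W in simp)
 then show ?thesis
 proof (rule box_integrable_bound)
  have "(\<lambda>x. (\<lambda>(s, y). rho1 p y * (1 - j * y)^2) x * ((\<lambda>(s, y). v j y s) x)^2) \<in> borel_measurable oboxM"
   by (intro borel_measurable_times borel_measurable_power v_boxM[OF j] boxM_plane) measurable
  then show "(\<lambda>(s, y). rho1 p y * (va j y s)^2) \<in> borel_measurable oboxM"
   by (simp add: case_prod_beta' va_def power_mult_distrib mult.assoc)
  fix s y :: real assume *: "s1 <= s" "s <= s2" "- 1 < y" "y < 1"
  define Y where "Y = j * y"
  have Y: "- 1 < Y" "Y < 1" using * j by (auto simp: Y_def abs_if split: if_splits)
  have "y^2 = Y^2" using j by (auto simp: Y_def power_mult_distrib power2_eq_square abs_if split: if_splits)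
  then have r1: "rho1 p y = (1 + Y) powr ?k * (1 - Y) powr ?k / ((1 - Y) * (1 + Y))"
   using rho_factor[of Y p] Y unfolding rho1_def rho_eq by (simp add: power2_eq_square algebra_simps)
  have "rho1 p y * (1 - Y)^2 = (1 - Y) powr ?k * ((1 - Y) * ((1 + Y) powr ?k / (1 + Y)))"
   unfolding r1 using Y by (simp add: power2_eq_square)
  also have "... <= 2 powr ?k * ((1 - Y) * ((1 + Y) powr ?k / (1 + Y)))" using Y kpos by (intro mult_right_mono powr_mono2) auto
  finally have le: "rho1 p y * (1 - Y)^2 <= 2 powr ?k * ((1 - Y) * ((1 + Y) powr ?k / (1 + Y)))" .
  have "(v j y s)^2 <= C * om ((1 - Y) * exp (- s))" using C(2)[of y s] * by (simp add: Y_def)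
  then have "rho1 p y * (1 - Y)^2 * (v j y s)^2 <= 2 powr ?k * ((1 - Y) * ((1 + Y) powr ?k / (1 + Y))) * (C * om ((1 - Y) * exp (- s)))"
   by (rule mult_mono[OF le]) (use Y in auto)
  moreover have "0 <= rho1 p y" using rho1_nonneg[of y p] * by auto
  ultimately show "\<bar>case (s, y) of (s, y) => rho1 p y * (va j y s)^2\<bar> <=
    2 powr ?k * C * (case (s, y) of (s, y) => (1 - j * y) * ((1 + j * y) powr ?k / (1 + j * y)) * om ((1 - j * y) * exp (- s)))"
   by (simp add: va_def power_mult_distrib Y_def mult_ac)
 qed
qed

lemma v_slice_integrable:
 assumes j: "abs j = 1" and s: "s1 <= s" "s <= s2"
 shows "sint (\<lambda>y. (v j y s)^2)"
proof -
 obtain C where C: "C >= 0" "!!y s. - 1 <= y ==> y <= 1 ==> s1 <= s ==> s <= s2 ==>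
   (v j y s)^2 <= C * (1 + (al j (foot j ((1 - j * y) * exp (- s))))^2)" using v_sq_bound[OF j] by blast
 define c where "c = x0 + j * T0 - j * exp (- s)"
 let ?J = "{c - exp (- s)..c + exp (- s)}"
 have arg: "foot j ((1 - j * y) * exp (- s)) = c + exp (- s) * y" for y
  using sigma_cancel[OF j, of "y * exp (- s)"] by (simp add: foot_def c_def algebra_simps)
 have "integrable lborel (\<lambda>x. indicat_real ?J x * (al j x)^2)" using al_sq by (simp add: set_integrable_def)
 then have "integrable lborel (\<lambda>y. indicat_real ?J (c + exp (- s) * y) * (al j (c + exp (- s) * y))^2)"
  by (subst lborel_integrable_real_affine_iff) auto
 then have "integrable lborel (\<lambda>y. indicat_real {- 1..1} y * (al j (c + exp (- s) * y))^2)"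
 proof (rule back_subst[where P="integrable lborel"], intro ext)
  fix y
  have "(c + exp (- s) * y \<in> ?J) = (y \<in> {- 1..1})"
  proof -
   have "(c + exp (- s) * y \<in> ?J) = (exp (- s) * (- 1) <= exp (- s) * y & exp (- s) * y <= exp (- s) * 1)" by auto
   also have "... = (y \<in> {- 1..1})" unfolding mult_le_cancel_left_pos[OF exp_gt_zero] by simp
   finally show ?thesis .
  qed
  then show "indicat_real ?J (c + exp (- s) * y) * (al j (c + exp (- s) * y))^2 = indicat_real {- 1..1} y * (al j (c + exp (- s) * y))^2"
   by (simp add: indicator_def)
 qed
 then have "set_integrable lborel {- 1..1} (\<lambda>y. (al j (c + exp (- s) * y))^2)" by (simp add: set_integrable_def)
 then have "sint (\<lambda>y. (al j (c + exp (- s) * y))^2)" by (rule set_integrable_subset) auto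
 moreover have "sint (\<lambda>y::real. 1::real)" by (rule set_integrable_subset[OF borel_integrable_atLeastAtMost'[of "- 1" 1]]) auto
 ultimately have "sint (\<lambda>y. C * (1 + (al j (c + exp (- s) * y))^2))" by (intro set_integrable_mult_right set_integral_add(1)) auto
 then have "sint (\<lambda>y. (\<lambda>x. ((\<lambda>(s, y). v j y s) x)^2) (s, y))"
  by (rule slice_integrable_bound[OF _ borel_measurable_power[OF v_boxM[OF j]] s])
   (use C(2)[OF _ _ s] in "simp add: arg")
 then show ?thesis by simp
qed

end

lemma Zc_arith:
 fixes E r m W k v w R d e f k' f' :: real
 shows "E * (r * m * W) * (1 / 4 * (k * (v * v)) + 1 / 2 * (f * (w * v))) +
  E * (m * (r * R)) * (1 / 4 * (k' * (v * v) + k * (d * v + v * d)) + 1 / 2 * (f' * (w * v) + f * (e * v + w * d))) =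
  E * (r * m * (W * (k / 4 * v^2 + f / 2 * (w * v)) +
   R * (k' / 4 * v^2 + k / 2 * v * d + f' / 2 * (w * v) + f / 2 * (e * v + w * d))))" by (simp add: field_simps power2_eq_square)

lemma quad_arith:
 fixes A B :: real
 assumes "abs c1 <= C" "abs c2 <= C" "abs c3 <= C" "abs c4 <= C" "abs c5 <= C" "abs c6 <= C"
 shows "\<bar>c1 * A^2 + c2 * (A * B) + c3 * B^2 + c4 * A + c5 * B + c6\<bar> <= 3 * C * (1 + A^2 + B^2)"
proof -
 have C: "C >= 0" using assms(1) by linarith
 have 1: "\<bar>c1 * A^2\<bar> <= C * A^2" "\<bar>c3 * B^2\<bar> <= C * B^2" using assms by (auto simp: abs_mult intro!: mult_right_mono)
 have "2 * \<bar>A * B\<bar> <= A^2 + B^2" using sum_squares_bound[of "abs A" "abs B"] by (simp add: abs_mult)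
 then have "\<bar>c2 * (A * B)\<bar> <= C * (A^2 + B^2)" using assms(2) C unfolding abs_mult[of c2] by (intro mult_mono) auto
 moreover have "2 * abs A <= 1 + A^2" "2 * abs B <= 1 + B^2" using sum_squares_bound[of 1 "abs A"] sum_squares_bound[of 1 "abs B"] by auto
 then have "\<bar>c4 * A\<bar> <= C * (1 + A^2)" "\<bar>c5 * B\<bar> <= C * (1 + B^2)"
  using assms(4,5) C unfolding abs_mult by (intro mult_mono; auto)+
 moreover have "0 <= C * A^2" "0 <= C * B^2" using C by auto
 ultimately show ?thesis using 1 assms(6) unfolding distrib_left distrib_right
  by (simp only: abs_le_iff mult_1_right) (auto simp: algebra_simps)
qed

context cone
begin

text \<open>Normal form of all space-time integrands that occur: quadratic in the two
  \<open>va j\<close>, with coefficients continuous on the closed strip and weight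
  \<open>rho1\<close>. Integrability then has to be proved once.\<close>

definition quad where
 "quad c1 c2 c3 c4 c5 c6 y s = rho1 p y * (c1 y s * (va 1 y s)^2 + c2 y s * (va 1 y s * va (- 1) y s)
   + c3 y s * (va (- 1) y s)^2 + c4 y s * va 1 y s + c5 y s * va (- 1) y s + c6 y s)"

lemma strip_bounded6:
 assumes "strip_cont c1" "strip_cont c2"
  "strip_cont c3" "strip_cont c4"
  "strip_cont c5" "strip_cont c6"
 obtains C :: real where "C >= 0" "!!y s. - 1 <= y ==> y <= 1 ==> s1 <= s ==> s <= s2 ==>
  abs (c1 y s) <= C & abs (c2 y s) <= C & abs (c3 y s) <= C & abs (c4 y s) <= C & abs (c5 y s) <= C & abs (c6 y s) <= C"
proof -
 have cc: "strip_cont (\<lambda>y s. abs (c1 y s) + abs (c2 y s) + abs (c3 y s) + abs (c4 y s) + abs (c5 y s) + abs (c6 y s))"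
  using assms unfolding case_prod_beta by (intro continuous_intros)
 obtain C where "C >= 0" and C: "!!y s. - 1 <= y ==> y <= 1 ==> s1 <= s ==> s <= s2 ==>
   \<bar>\<bar>c1 y s\<bar> + \<bar>c2 y s\<bar> + \<bar>c3 y s\<bar> + \<bar>c4 y s\<bar> + \<bar>c5 y s\<bar> + \<bar>c6 y s\<bar>\<bar> <= C"
  by (rule strip_bounded[OF cc], rule that)
 show ?thesis
 proof (rule that[OF \<open>C >= 0\<close>])
  fix y s :: real assume "- 1 <= y" "y <= 1" "s1 <= s" "s <= s2"
  from C[OF this] show "abs (c1 y s) <= C & abs (c2 y s) <= C & abs (c3 y s) <= C & abs (c4 y s) <= C & abs (c5 y s) <= C & abs (c6 y s) <= C"
   by linarith
 qed
qed

lemma va_boxM: "abs j = 1 ==> (\<lambda>(s, y). va j y s) \<in> borel_measurable oboxM"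
proof -
 assume j: "abs j = 1"
 have "(\<lambda>x. (\<lambda>(s, y). 1 - j * y) x * (\<lambda>(s, y). v j y s) x) \<in> borel_measurable oboxM"
  by (intro borel_measurable_times v_boxM[OF j] boxM_plane) measurable
 then show ?thesis by (simp add: va_def case_prod_beta')
qed

lemma quad_boxM:
 assumes "strip_cont c1" "strip_cont c2"
  "strip_cont c3" "strip_cont c4"
  "strip_cont c5" "strip_cont c6"
 shows "(\<lambda>(s, y). quad c1 c2 c3 c4 c5 c6 y s) \<in> borel_measurable oboxM"
proof -
 have r: "(\<lambda>(s, y). rho1 p y) \<in> borel_measurable oboxM" by (rule boxM_plane) measurable
 note m = r[unfolded case_prod_beta'] assms[THEN boxM_cont, unfolded case_prod_beta'] va_boxM[of 1, unfolded case_prod_beta'] va_boxM[of "- 1", unfolded case_prod_beta']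
 show ?thesis unfolding quad_def case_prod_beta' by (intro borel_measurable_times borel_measurable_add borel_measurable_power m) auto
qed

lemma quad_box_integrable:
 assumes "strip_cont c1" "strip_cont c2"
  "strip_cont c3" "strip_cont c4"
  "strip_cont c5" "strip_cont c6"
 shows "bint (\<lambda>(s, y). quad c1 c2 c3 c4 c5 c6 y s)"
proof -
 obtain C where C: "C >= 0" "!!y s. - 1 <= y ==> y <= 1 ==> s1 <= s ==> s <= s2 ==>
  abs (c1 y s) <= C & abs (c2 y s) <= C & abs (c3 y s) <= C & abs (c4 y s) <= C & abs (c5 y s) <= C & abs (c6 y s) <= C"
  by (rule strip_bounded6[OF assms], rule that)
 have "bint (\<lambda>x. 3 * C * ((\<lambda>(s, y). rho1 p y) x +
   (\<lambda>(s, y). rho1 p y * (va 1 y s)^2) x + (\<lambda>(s, y). rho1 p y * (va (- 1) y s)^2) x))"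
  by (intro set_integrable_mult_right set_integral_add(1) rho1_box_integrable va_box_integrable) auto
 then show ?thesis
 proof (rule box_integrable_bound)
  show "(\<lambda>(s, y). quad c1 c2 c3 c4 c5 c6 y s) \<in> borel_measurable oboxM" by (rule quad_boxM[OF assms])
  fix s y :: real assume *: "s1 <= s" "s <= s2" "- 1 < y" "y < 1"
  have r: "0 <= rho1 p y" using rho1_nonneg[of y p] * by auto
  have "abs (quad c1 c2 c3 c4 c5 c6 y s) <= rho1 p y * (3 * C * (1 + (va 1 y s)^2 + (va (- 1) y s)^2))"
   unfolding quad_def abs_mult abs_of_nonneg[OF r] by (intro mult_left_mono[OF _ r] quad_arith) (use C(2)[of y s] * in auto)
  then show "\<bar>case (s, y) of (s, y) => quad c1 c2 c3 c4 c5 c6 y s\<bar> <= 3 * C * ((case (s, y) of (s, y) => rho1 p y) +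
    (case (s, y) of (s, y) => rho1 p y * (va 1 y s)^2) + (case (s, y) of (s, y) => rho1 p y * (va (- 1) y s)^2))"
   by (simp add: algebra_simps)
 qed
qed

text \<open>At a fixed time the \<open>va\<close>-terms must carry the weight \<open>rho\<close> instead of \<open>rho1\<close>.\<close>

definition quad0 where
 "quad0 c1 c2 c3 c4 c5 c6 d y s = rho p y * (c1 y s * (v 1 y s)^2 + c2 y s * (v 1 y s * v (- 1) y s)
   + c3 y s * (v (- 1) y s)^2 + c4 y s * v 1 y s + c5 y s * v (- 1) y s + c6 y s) + rho1 p y * d y s"

lemma quad0_slice_integrable:
 assumes "strip_cont c1" "strip_cont c2"
  "strip_cont c3" "strip_cont c4"
  "strip_cont c5" "strip_cont c6"
  "strip_cont d" and s: "s1 <= s" "s <= s2"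
 shows "sint (\<lambda>y. quad0 c1 c2 c3 c4 c5 c6 d y s)"
proof -
 obtain C where C: "C >= 0" "!!y s. - 1 <= y ==> y <= 1 ==> s1 <= s ==> s <= s2 ==>
  abs (c1 y s) <= C & abs (c2 y s) <= C & abs (c3 y s) <= C & abs (c4 y s) <= C & abs (c5 y s) <= C & abs (c6 y s) <= C"
  by (rule strip_bounded6[OF assms(1-6)], rule that)
 obtain D where D: "D >= 0" "!!y s. - 1 <= y ==> y <= 1 ==> s1 <= s ==> s <= s2 ==> abs (d y s) <= D"
  by (rule strip_bounded[OF assms(7)], rule that)
 have one: "sint (\<lambda>y::real. 1::real)" by (rule set_integrable_subset[OF borel_integrable_atLeastAtMost'[of "- 1" 1]]) auto
 have "sint (\<lambda>y. 3 * C * (1 + (v 1 y s)^2 + (v (- 1) y s)^2) + D * rho1 p y)"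
  by (intro set_integrable_mult_right set_integral_add(1) rho1_set_integrable[OF p] v_slice_integrable s one) auto
 moreover have "(\<lambda>(s, y). quad0 c1 c2 c3 c4 c5 c6 d y s) \<in> borel_measurable oboxM"
 proof -
  have r: "(\<lambda>x. rho p (snd x)) \<in> borel_measurable oboxM" "(\<lambda>x. rho1 p (snd x)) \<in> borel_measurable oboxM"
   by (rule boxM_plane; (rule measurable_compose[OF measurable_snd]); simp add: rho_meas rho1_meas)+
  note m = r assms(1-7)[THEN boxM_cont, unfolded case_prod_beta'] v_boxM[of 1, unfolded case_prod_beta'] v_boxM[of "- 1", unfolded case_prod_beta']
  show ?thesis unfolding quad0_def case_prod_beta'
   by (intro borel_measurable_times borel_measurable_add borel_measurable_power; (rule m)?; simp)
 qed
 ultimately have "sint (\<lambda>y. (\<lambda>(s, y). quad0 c1 c2 c3 c4 c5 c6 d y s) (s, y))"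
 proof (rule slice_integrable_bound[OF _ _ s])
  fix y :: real assume y: "- 1 < y" "y < 1"
  have r: "0 <= rho1 p y" using rho1_nonneg[of y p] y by auto
  have r1: "0 <= rho p y" "rho p y <= 1" using rho_nonneg[of p y] rho_le_1[of y p] p y by auto
  let ?Q = "c1 y s * (v 1 y s)^2 + c2 y s * (v 1 y s * v (- 1) y s)
   + c3 y s * (v (- 1) y s)^2 + c4 y s * v 1 y s + c5 y s * v (- 1) y s + c6 y s"
  have "\<bar>rho p y * ?Q\<bar> <= 1 * (3 * C * (1 + (v 1 y s)^2 + (v (- 1) y s)^2))"
   unfolding abs_mult abs_of_nonneg[OF r1(1)] by (intro mult_mono quad_arith) (use C(2)[of y s] y s r1 in auto)
  moreover have "\<bar>rho1 p y * d y s\<bar> <= D * rho1 p y" unfolding abs_mult abs_of_nonneg[OF r] mult.commute[of _ "rho1 p y"]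
   using D(2)[of y s] y s by (intro mult_left_mono[OF _ r]) auto
  ultimately show "\<bar>case (s, y) of (s, y) => quad0 c1 c2 c3 c4 c5 c6 d y s\<bar> <= 3 * C * (1 + (v 1 y s)^2 + (v (- 1) y s)^2) + D * rho1 p y"
   unfolding quad0_def prod.case by linarith
 qed
 then show ?thesis by simp
qed

text \<open>The derivative in \<open>y\<close> of \<open>y * w^2 * rho\<close>, with
  \<open>y^2\<close> in the weight derivative written as \<open>1 - (1 - y^2)\<close>. Its term
  \<open>- 2 * expo p * w^2 * rho1\<close> lacks the factor \<open>1 - y^2\<close>, and that is its
  use: added with a positive coefficient it controls \<open>w^2\<close> near the ends.\<close>

definition ibp where "ibp y s = rho1 p y * ((1 - y^2) * (2 * y * w y s * wy y s + (1 + 2 * expo p) * (w y s)^2) - 2 * expo p * (w y s)^2)"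

lemma strip_cont_const: "strip_cont (\<lambda>y s. c)" by (simp add: case_prod_beta)

lemma strip_cont_fst: "strip_cont (\<lambda>y s. y)" by (simp add: case_prod_beta continuous_on_fst)

lemma strip_cont_mult: "strip_cont f ==> strip_cont (\<lambda>y s. gg y s :: real)
  ==> strip_cont (\<lambda>y s. f y s * gg y s)" by (auto simp: case_prod_beta intro: continuous_on_mult)

lemma strip_cont_add: "strip_cont f ==> strip_cont (\<lambda>y s. gg y s :: real)
  ==> strip_cont (\<lambda>y s. f y s + gg y s)" by (auto simp: case_prod_beta intro: continuous_on_add)

lemma strip_cont_diff: "strip_cont f ==> strip_cont (\<lambda>y s. gg y s :: real)
  ==> strip_cont (\<lambda>y s. f y s - gg y s)" by (auto simp: case_prod_beta intro: continuous_on_diff)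

lemma strip_cont_minus: "strip_cont (\<lambda>y s. f y s :: real)
  ==> strip_cont (\<lambda>y s. - f y s)" by (auto simp: case_prod_beta intro: continuous_on_minus)

lemma strip_cont_power: "strip_cont (\<lambda>y s. f y s :: real)
  ==> strip_cont (\<lambda>y s. (f y s) ^ n)" by (auto simp: case_prod_beta intro: continuous_on_power)

lemmas strip_intros = strip_cont_mult strip_cont_add strip_cont_diff strip_cont_minus strip_cont_power
 w_cont g_cont G_cont strip_cont_fst strip_cont_const

lemma ibp_slice:
 assumes s: "s1 <= s" "s <= s2"
 shows "sint (\<lambda>y. ibp y s)" "(SINT y. ibp y s) = 0"
proof -
 let ?k = "expo p"
 have eq: "ibp y s = quad0 (\<lambda>_ _. 0) (\<lambda>_ _. 0) (\<lambda>_ _. 0) (\<lambda>y s. y * w y s) (\<lambda>y s. - (y * w y s)) (\<lambda>y s. (1 + 2 * ?k) * (w y s)^2) (\<lambda>y s. - (2 * ?k * (w y s)^2)) y s" for y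
  unfolding ibp_def quad0_def rho_rho1 wy_def by (simp add: field_simps)
 show int: "sint (\<lambda>y. ibp y s)" unfolding eq by (rule quad0_slice_integrable) (intro strip_intros s)+
 have y: "acd (- 1) 1 (\<lambda>y. y) (\<lambda>_. 1)" by (rule acd_C1) (auto intro!: derivative_eq_intros)
 note ww = acd_mult[OF w_fixed_time_acd[OF s] w_fixed_time_acd[OF s]]
 have acd: "acd (- 1) 1 (\<lambda>y. y * (w y s * w y s) * rho p y) (\<lambda>y. ibp y s)"
 proof (rule acd_cong[OF acd_mult[OF acd_mult[OF y ww] acd_rho[OF p]] refl])
  fix y :: real assume "- 1 <= y" "y <= 1"
  show "(1 * (w y s * w y s) + y * (wy y s * w y s + w y s * wy y s)) * rho p y +
     y * (w y s * w y s) * (- 2 * ?k * y * rho1 p y) = ibp y s" unfolding ibp_def rho_rho1 by (simp add: power2_eq_square algebra_simps)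
 qed
 have "(SINT y. ibp y s) = integral {- 1<..<1} (\<lambda>y. ibp y s)" by (rule set_borel_integral_eq_integral(2)[OF int])
 also have "... = integral {- 1..1} (\<lambda>y. ibp y s)" by (simp add: integral_open_interval_real)
 also have "... = 0" using acd_diff[OF acd, of "- 1" 1] by (simp add: rho_def)
 finally show "(SINT y. ibp y s) = 0" .
qed

end

section \<open>The functional identity\<close>

text \<open>
 \<open>dens\<close> is \<open>Zc 1 + Zc (-1) + Zr\<close>: \<open>Zc j\<close> is transported along the characteristics, \<open>Zr\<close> along the rays \<open>y = const\<close>. The
 term \<open>ibp\<close>, a total \<open>y\<close>-derivative, may be added with any coefficient.
\<close>

locale cone_mult = cone +
 fixes ka ka' mu mu' :: "real => real"
 assumes ka: "!!s. s1 <= s ==> s <= s2 ==> (ka has_real_derivative ka' s) (at s)"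
  and ka'_cont: "continuous_on {s1..s2} ka'"
  and mu: "!!s. s1 <= s ==> s <= s2 ==> (mu has_real_derivative mu' s) (at s)"
  and mu'_cont: "continuous_on {s1..s2} mu'"
begin

lemma ka_cont: "continuous_on {s1..s2} ka" using ka by (meson DERIV_isCont atLeastAtMost_iff continuous_at_imp_continuous_on)

lemma mu_cont: "continuous_on {s1..s2} mu" using mu by (meson DERIV_isCont atLeastAtMost_iff continuous_at_imp_continuous_on)

definition lam' where "lam' s = a * expo p / (2 * s^2)"

lemma DERIV_lam: "s1 <= s ==> (lam p a has_real_derivative lam' s) (at s)" unfolding lam_def[abs_def] lam'_def using spos[of s]
 by (auto intro!: derivative_eq_intros simp: field_simps power2_eq_square)

lemma lam'_cont: "continuous_on {s1..s2} lam'" unfolding lam'_def by (intro continuous_intros) (use s1 in auto)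

definition k0 :: real where "k0 = expo p / 2 + (expo p)^2 / 2"
definition om where "om s = mu s - ka s * lam p a s"
definition om' where "om' s = mu' s - ka' s * lam p a s - ka s * lam' s"
definition chi where "chi s = ka s * ((lam p a s)^2 / 2 + k0) - mu s * lam p a s"
definition chi' where "chi' s = ka' s * ((lam p a s)^2 / 2 + k0) + ka s * lam p a s * lam' s - mu' s * lam p a s - mu s * lam' s"

lemma om: "s1 <= s ==> s <= s2 ==> (om has_real_derivative om' s) (at s)" unfolding om_def[abs_def] om'_def
 by (auto intro!: derivative_eq_intros ka mu DERIV_lam)

lemma chi: "s1 <= s ==> s <= s2 ==> (chi has_real_derivative chi' s) (at s)" unfolding chi_def[abs_def] chi'_def
 by (auto intro!: derivative_eq_intros ka mu DERIV_lam simp: algebra_simps)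

lemma om_cont: "continuous_on {s1..s2} om" and om'_cont: "continuous_on {s1..s2} om'" unfolding om_def om'_def
 by (intro continuous_intros ka_cont ka'_cont mu_cont mu'_cont lam_cont lam'_cont)+

lemma chi_cont: "continuous_on {s1..s2} chi" unfolding chi_def by (intro continuous_intros ka_cont mu_cont lam_cont) simp

lemma chi'_cont: "continuous_on {s1..s2} chi'"
 unfolding chi'_def by (intro continuous_intros ka_cont ka'_cont mu_cont mu'_cont lam_cont lam'_cont) simp

lemma acd_time:
 assumes "!!s. s1 <= s ==> s <= s2 ==> (f has_real_derivative f' s) (at s)" "continuous_on {s1..s2} f'"
  and "s1 <= c" "d <= s2"
 shows "acd c d f f'" by (rule acd_C1) (use assms in "auto intro: has_field_derivative_at_within continuous_on_subset")

text \<open>The splitting rests on \<open>q^2 + (1 - y^2) wy^2 = ((1 - y) (v 1)^2 + (1 + y) (v (-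
  1))^2) / 2\<close>, which has no mixed term: each summand is transported along its own family.
  Substituting \<open>z = q - lam w\<close> in the density produces the coefficient
  \<open>om\<close> for \<open>w q\<close> and \<open>chi\<close> for \<open>w^2\<close>.\<close>

definition Zc where "Zc j y s = (1 - j * y) * rho p y * (ka s / 4 * (v j y s)^2 + om s / 2 * (w y s * v j y s))"

definition DZc where "DZc j y s = rho1 p y * (1 - j * y) *
  ((2 * (1 - y^2) + 2 * expo p * (j * y) * (1 - j * y)) * (ka s / 4 * (v j y s)^2 + om s / 2 * (w y s * v j y s)) +
   (1 - y^2) * (ka' s / 4 * (v j y s)^2 + ka s / 2 * v j y s * (g y s - (1 + lam p a s) * v j y s)
    + om' s / 2 * (w y s * v j y s)
    + om s / 2 * ((v (- j) y s - lam p a s * w y s) * v j y s + w y s * (g y s - (1 + lam p a s) * v j y s))))"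

definition Zr where "Zr y s = rho p y * (chi s * (w y s)^2 - ka s * G y s)"

definition DZr where "DZr y s = rho p y * (chi' s * (w y s)^2 + 2 * chi s * (w y s * z y s) - ka' s * G y s
   - ka s * (g y s * q y s - 2 * (1 + lam p a s) * G y s))"

text \<open>With \<open>r = c * exp s\<close> the weight is
  \<open>r powr (1 + k) * (2 - r) powr k\<close>. The first factor is smooth for
  \<open>c > 0\<close>; the second decreases, so it stays absolutely continuous up to the exit
  \<open>r = 2\<close> even for \<open>k < 1\<close>.\<close>

lemma rho_char_acd:
 assumes j: "abs j = 1" and c: "0 < c" and e: "s1 <= e" "e <= s2" "c * exp e <= 2"
 shows "acd s1 e (\<lambda>s. exp s * ((1 - j * (chr j c s)) * rho p (chr j c s)))
  (\<lambda>s. exp s * (rho1 p (chr j c s) * (1 - j * (chr j c s)) *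
   (2 * (1 - (chr j c s)^2) + 2 * expo p * (j * (chr j c s)) * (1 - j * (chr j c s)))))"
proof -
 let ?k = "expo p"
 have E: "acd s1 e exp exp" by (rule acd_C1) (auto intro!: derivative_eq_intros continuous_intros)
 have 1: "acd s1 e (\<lambda>s. (c * exp s) powr (1 + ?k)) (\<lambda>s. (1 + ?k) * (c * exp s) powr (1 + ?k))"
 proof (rule acd_C1)
  fix x
  have "((\<lambda>s. (c * exp s) powr (1 + ?k)) has_real_derivative (1 + ?k) * (c * exp x) powr (1 + ?k - 1) * (c * exp x)) (at x)"
   using DERIV_fun_powr[of "\<lambda>s. c * exp s" "c * exp x" x "1 + ?k"] c by (auto intro!: derivative_eq_intros)
  moreover have "(c * exp x) powr (1 + ?k) = (c * exp x) powr ?k * (c * exp x)" using c by (simp add: powr_add)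
  ultimately show "((\<lambda>s. (c * exp s) powr (1 + ?k)) has_real_derivative (1 + ?k) * (c * exp x) powr (1 + ?k)) (at x within {s1..e})"
   by (simp add: has_field_derivative_at_within mult.assoc)
  show "continuous_on {s1..e} (\<lambda>s. (1 + ?k) * (c * exp s) powr (1 + ?k))" using c by (intro continuous_intros) auto
 qed
 have 2: "acd s1 e (\<lambda>s. (2 - c * exp s) powr ?k) (\<lambda>s. ?k * ((2 - c * exp s) powr ?k / (2 - c * exp s)) * (- (c * exp s)))"
 proof (rule acd_powr_decreasing[OF e(1) kpos])
  fix x
  show "((\<lambda>s. 2 - c * exp s) has_real_derivative - (c * exp x)) (at x)" by (auto intro!: derivative_eq_intros)
  show "- (c * exp x) <= 0" using c by simp
  show "0 <= 2 - c * exp x" if "x <= e"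
  proof -
   have "c * exp x <= c * exp e" using that c by (intro mult_left_mono) auto
   then show ?thesis using e by linarith
  qed
  assume "x < e"
  then have "c * exp x < c * exp e" using c by simp
  then show "0 < 2 - c * exp x" using e by linarith
 qed
 show ?thesis unfolding sigma_cancel[OF j]
 proof (rule acd_cong[OF acd_mult[OF E acd_mult[OF 1 2]]])
  fix s assume s: "s1 <= s" "s <= e"
  define r where "r = c * exp s"
  have r: "r > 0" "r <= 2"
  proof -
   show "r > 0" using c by (simp add: r_def)
   have "c * exp s <= c * exp e" using s c by (intro mult_left_mono) auto
   then show "r <= 2" using e by (simp add: r_def)
  qed
  have sq: "(j * (1 - r))^2 = (1 - r)^2" using sigma_cancel[OF j, of 1] by (simp add: power_mult_distrib power2_eq_square)
  have R: "1 - (j * (1 - r))^2 = r * (2 - r)" unfolding sq by (simp add: power2_eq_square algebra_simps)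
  have rho: "rho p (j * (1 - r)) = r powr ?k * (2 - r) powr ?k" unfolding rho_eq R using r by (simp add: powr_mult)
  have pw: "r powr (1 + ?k) = r * r powr ?k" using r by (simp add: powr_add)
  show "exp s * ((c * exp s) powr (1 + ?k) * (2 - c * exp s) powr ?k) =
     exp s * ((1 - (1 - c * exp s)) * rho p (chr j c s))" unfolding r_def[symmetric] rho pw by simp
  have "exp s * (r * r powr ?k * (2 - r) powr ?k) +
    exp s * ((1 + ?k) * (r * r powr ?k) * (2 - r) powr ?k + r * r powr ?k * (?k * ((2 - r) powr ?k / (2 - r)) * - r)) =
    exp s * (r powr ?k * (2 - r) powr ?k / (r * (2 - r)) * (1 - (1 - r)) * (2 * (r * (2 - r)) + 2 * ?k * (1 - r) * (1 - (1 - r))))"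
  proof (cases "r = 2")
   case False
   then have "2 - r ~= 0" "r ~= 0" using r by auto
   then show ?thesis by (simp add: divide_simps) (simp add: algebra_simps)
  qed simp
  then show "exp s * ((c * exp s) powr (1 + ?k) * (2 - c * exp s) powr ?k) +
     exp s * ((1 + ?k) * (c * exp s) powr (1 + ?k) * (2 - c * exp s) powr ?k +
     (c * exp s) powr (1 + ?k) * (?k * ((2 - c * exp s) powr ?k / (2 - c * exp s)) * - (c * exp s))) =
     exp s * (rho1 p (chr j c s) * (1 - (1 - c * exp s)) *
      (2 * (1 - (chr j c s)^2) + 2 * ?k * (1 - c * exp s) * (1 - (1 - c * exp s))))" unfolding r_def[symmetric] rho1_def rho R pw .
 qed
qed

lemma Zc_char_acd:
 assumes j: "abs j = 1" and c: "0 < c" and e: "s1 <= e" "e <= s2" "c * exp e <= 2"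
 shows "acd s1 e (\<lambda>s. exp s * Zc j (chr j c s) s) (\<lambda>s. exp s * DZc j (chr j c s) s)"
proof -
 note v = v_char_acd[OF j less_imp_le[OF c] e]
 note w = w_char_acd[OF j less_imp_le[OF c] e]
 note ka = acd_time[OF ka ka'_cont order_refl e(2)]
 note om = acd_time[OF om om'_cont order_refl e(2)]
 note all = acd_mult[OF rho_char_acd[OF j c e] acd_add[OF
   acd_cmult[OF acd_mult[OF ka acd_mult[OF v v]], of "1 / 4"]
   acd_cmult[OF acd_mult[OF om acd_mult[OF w v]], of "1 / 2"]]]
 show ?thesis
 proof (rule acd_cong[OF all])
  fix s
  define y where "y = chr j c s"
  show "exp s * ((1 - j * (chr j c s)) * rho p (chr j c s)) *
     (1 / 4 * (ka s * (v j (chr j c s) s * v j (chr j c s) s)) +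
     1 / 2 * (om s * (w (chr j c s) s * v j (chr j c s) s))) =
     exp s * Zc j (chr j c s) s" unfolding Zc_def y_def[symmetric] by (simp add: power2_eq_square algebra_simps)
  show "exp s * (rho1 p (chr j c s) * (1 - j * (chr j c s)) *
     (2 * (1 - (chr j c s)^2) +
      2 * expo p * (j * (chr j c s)) * (1 - j * (chr j c s)))) *
     (1 / 4 * (ka s * (v j (chr j c s) s * v j (chr j c s) s)) +
     1 / 2 * (om s * (w (chr j c s) s * v j (chr j c s) s))) +
     exp s * ((1 - j * (chr j c s)) * rho p (chr j c s)) *
     (1 / 4 * (ka' s * (v j (chr j c s) s * v j (chr j c s) s) +
      ka s * ((g (chr j c s) s - (1 + lam p a s) * v j (chr j c s) s) * v j (chr j c s) s +
       v j (chr j c s) s * (g (chr j c s) s - (1 + lam p a s) * v j (chr j c s) s))) +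
     1 / 2 * (om' s * (w (chr j c s) s * v j (chr j c s) s) +
      om s * ((v (- j) (chr j c s) s - lam p a s * w (chr j c s) s) * v j (chr j c s) s +
       w (chr j c s) s * (g (chr j c s) s - (1 + lam p a s) * v j (chr j c s) s)))) =
     exp s * DZc j (chr j c s) s" unfolding DZc_def y_def[symmetric] rho_rho1 by (rule Zc_arith)
 qed
qed

end

text \<open>Everything is linear in \<open>K\<close>, \<open>K'\<close>, \<open>m\<close>,
  \<open>m'\<close>, so sorting by these leaves four separate identities. The letters stand for
  \<open>ka\<close>, \<open>mu\<close> and their derivatives; \<open>la\<close>, \<open>l1\<close>
  for \<open>lam\<close>, \<open>lam'\<close>; \<open>n\<close> for \<open>k0\<close>;
  \<open>R\<close> for \<open>1 - y^2\<close>; \<open>v1\<close>, \<open>v2\<close> for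
  \<open>v 1\<close>, \<open>v (- 1)\<close>; \<open>W1\<close>, \<open>W2\<close> for the factors
  coming from the weight; \<open>I\<close> for \<open>ibp\<close> without \<open>rho1\<close>. In
  the identities that follow \<open>c\<close> is \<open>wy\<close>.\<close>

lemma density_arith_split:
 fixes y k l1 K K' m m' z w G g R la n v1 v2 W1 W2 I :: real
 shows "(1 - y) * (W1 * (K / 4 * v1^2 + (m - K * la) / 2 * (w * v1)) +
   R * (K' / 4 * v1^2 + K / 2 * v1 * (g - (1 + la) * v1) + (m' - K' * la - K * l1) / 2 * (w * v1)
    + (m - K * la) / 2 * ((v2 - la * w) * v1 + w * (g - (1 + la) * v1)))) +
  (1 + y) * (W2 * (K / 4 * v2^2 + (m - K * la) / 2 * (w * v2)) +
   R * (K' / 4 * v2^2 + K / 2 * v2 * (g - (1 + la) * v2) + (m' - K' * la - K * l1) / 2 * (w * v2)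
    + (m - K * la) / 2 * ((v1 - la * w) * v2 + w * (g - (1 + la) * v2)))) +
  R * ((K' * (la^2 / 2 + n) + K * la * l1 - m' * la - m * l1) * w^2 + 2 * (K * (la^2 / 2 + n) - m * la) * (w * z) - K' * G - K * (g * (z + la * w) - 2 * (1 + la) * G)) +
  (K * la^2 - m * (la + k)) * I =
  K' * (R * ((1 - y) * (v1^2 / 4 - la * w * v1 / 2) + (1 + y) * (v2^2 / 4 - la * w * v2 / 2) + (la^2 / 2 + n) * w^2 - G)) +
  m' * (R * ((1 - y) * w * v1 / 2 + (1 + y) * w * v2 / 2 - la * w^2)) +
  K * ((1 - y) * (W1 * (v1^2 / 4 - la * w * v1 / 2) + R * (v1 * (g - (1 + la) * v1) / 2 - l1 * w * v1 / 2 - la / 2 * ((v2 - la * w) * v1 + w * (g - (1 + la) * v1)))) +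
   (1 + y) * (W2 * (v2^2 / 4 - la * w * v2 / 2) + R * (v2 * (g - (1 + la) * v2) / 2 - l1 * w * v2 / 2 - la / 2 * ((v1 - la * w) * v2 + w * (g - (1 + la) * v2)))) +
   R * (la * l1 * w^2 + 2 * (la^2 / 2 + n) * (w * z) - (g * (z + la * w) - 2 * (1 + la) * G)) + la^2 * I) +
  m * ((1 - y) * (W1 * (w * v1) / 2 + R / 2 * ((v2 - la * w) * v1 + w * (g - (1 + la) * v1))) +
   (1 + y) * (W2 * (w * v2) / 2 + R / 2 * ((v1 - la * w) * v2 + w * (g - (1 + la) * v2))) +
   R * (- l1 * w^2 - 2 * la * (w * z)) - (la + k) * I)" by (simp add: field_simps power2_eq_square)

lemma density_arith_K':
 fixes y z w c G la n :: real
 defines "R == 1 - y^2"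
 defines "v1 == z + la * w + (1 + y) * c" and "v2 == z + la * w - (1 - y) * c"
 shows "(1 - y) * (v1^2 / 4 - la * w * v1 / 2) + (1 + y) * (v2^2 / 4 - la * w * v2 / 2) + (la^2 / 2 + n) * w^2 - G
  = z^2 / 2 + R * c^2 / 2 + n * w^2 - G" unfolding assms by (simp add: field_simps power2_eq_square)

lemma density_arith_m':
 fixes y z w c la :: real
 defines "v1 == z + la * w + (1 + y) * c" and "v2 == z + la * w - (1 - y) * c"
 shows "(1 - y) * w * v1 / 2 + (1 + y) * w * v2 / 2 - la * w^2 = w * z" unfolding assms by (simp add: field_simps power2_eq_square)

text \<open>The source enters the two families as \<open>v j * g\<close>. With their weights these
  terms add up to \<open>g * q\<close>, which cancels the corresponding term in the derivative of
  \<open>G\<close>; what remains of the nonlinearity is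
  \<open>2 * (1 + la) * G - la * (w * g)\<close>.\<close>

lemma density_arith_K_reduce:
 fixes y k L l1 z w G g R la v1 v2 W1 W2 J n :: real
 assumes q: "(1 - y) * v1 / 2 + (1 + y) * v2 / 2 = z + la * w"
 shows "(1 - y) * (W1 * (v1^2 / 4 - la * w * v1 / 2) + R * (v1 * (g - (1 + la) * v1) / 2 - l1 * w * v1 / 2 - la / 2 * ((v2 - la * w) * v1 + w * (g - (1 + la) * v1)))) +
   (1 + y) * (W2 * (v2^2 / 4 - la * w * v2 / 2) + R * (v2 * (g - (1 + la) * v2) / 2 - l1 * w * v2 / 2 - la / 2 * ((v1 - la * w) * v2 + w * (g - (1 + la) * v2)))) +
   R * (la * l1 * w^2 + 2 * (la^2 / 2 + n) * (w * z) - (g * (z + la * w) - 2 * (1 + la) * G)) + J =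
  (1 - y) * (W1 * (v1^2 / 4 - la * w * v1 / 2) + R * (- ((1 + la) * v1^2) / 2 - la / 2 * ((v2 - la * w) * v1 - w * (1 + la) * v1))) +
   (1 + y) * (W2 * (v2^2 / 4 - la * w * v2 / 2) + R * (- ((1 + la) * v2^2) / 2 - la / 2 * ((v1 - la * w) * v2 - w * (1 + la) * v2))) +
   R * (2 * (la^2 / 2 + n) * (w * z)) + J + R * (2 * (1 + la) * G - la * (w * g) - l1 * (w * z))"
proof -
 have z: "z = (1 - y) * v1 / 2 + (1 + y) * v2 / 2 - la * w" using q by simp
 show ?thesis unfolding z by (simp add: field_simps power2_eq_square)
qed

lemma density_arith_K_quad:
 fixes y k la z w c :: real
 defines "v1 == z + la * w + (1 + y) * c" and "v2 == z + la * w - (1 - y) * c"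
 shows "(1 - y) * ((2 * (1 - y^2) + 2 * k * y * (1 - y)) * (v1^2 / 4 - la * w * v1 / 2) + (1 - y^2) * (- ((1 + la) * v1^2) / 2 - la / 2 * ((v2 - la * w) * v1 - w * (1 + la) * v1))) +
   (1 + y) * ((2 * (1 - y^2) - 2 * k * y * (1 + y)) * (v2^2 / 4 - la * w * v2 / 2) + (1 - y^2) * (- ((1 + la) * v2^2) / 2 - la / 2 * ((v1 - la * w) * v2 - w * (1 + la) * v2))) +
   (1 - y^2) * (2 * (la^2 / 2 + (k / 2 + k^2 / 2)) * (w * z)) +
   la^2 * ((1 - y^2) * (2 * y * w * c + (1 + 2 * k) * w^2) - 2 * k * w^2)
  = - 2 * k * z^2 + (1 - y^2) * (2 * (k - la) * z^2 + 2 * (k - la) * (y * c * z)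
    + ((k - la) + 2 * (k - la) * k - (k - la)^2) * (w * z))" unfolding assms by (simp add: field_simps power2_eq_square)

text \<open>With \<open>k = expo p\<close> and \<open>L = a k / s\<close>, the case
  \<open>L = 0\<close>, \<open>l1 = 0\<close> is the classical one: the value of \<open>n\<close>
  makes all quadratic terms cancel except the dissipation \<open>- 2 * k * z^2\<close>. For a pure
  power the nonlinear rest vanishes too, because \<open>k * (p + 1) = 2 + 2 * k\<close>. Thus only
  terms of order \<open>L\<close> and the deviation of the nonlinearity from a power
  survive.\<close>

lemma density_arith_K:
 fixes y k L l1 z w c G g :: real
 defines "R == 1 - y^2" and "la == k - L / 2" and "n == k / 2 + k^2 / 2"
 defines "v1 == z + la * w + (1 + y) * c" and "v2 == z + la * w - (1 - y) * c"
 shows "(1 - y) * ((2 * R + 2 * k * y * (1 - y)) * (v1^2 / 4 - la * w * v1 / 2) + R * (v1 * (g - (1 + la) * v1) / 2 - l1 * w * v1 / 2 - la / 2 * ((v2 - la * w) * v1 + w * (g - (1 + la) * v1)))) +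
   (1 + y) * ((2 * R - 2 * k * y * (1 + y)) * (v2^2 / 4 - la * w * v2 / 2) + R * (v2 * (g - (1 + la) * v2) / 2 - l1 * w * v2 / 2 - la / 2 * ((v1 - la * w) * v2 + w * (g - (1 + la) * v2)))) +
   R * (la * l1 * w^2 + 2 * (la^2 / 2 + n) * (w * z) - (g * (z + la * w) - 2 * (1 + la) * G)) +
   la^2 * (R * (2 * y * w * c + (1 + 2 * k) * w^2) - 2 * k * w^2)
  = - 2 * k * z^2 + R * (L * z^2 + L * (y * c * z) + 2 * (1 + la) * G - la * (w * g)
    + (L / 2 + L * k - L^2 / 4 - l1) * (w * z))"
proof -
 have q: "(1 - y) * v1 / 2 + (1 + y) * v2 / 2 = z + la * w" by (simp add: v1_def v2_def field_simps)
 have e: "k - la = L / 2" by (simp add: la_def)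
 show ?thesis unfolding density_arith_K_reduce[OF q]
  unfolding v1_def v2_def R_def n_def density_arith_K_quad e by (simp add: field_simps power2_eq_square)
qed

text \<open>The virial identity, obtained from \<open>w\<close> times the equation. Two terms on the
  right lack the factor \<open>R\<close>: \<open>- 4 * k * (w * z)\<close>, which the dissipation
  has to pay for, and \<open>L * k * w^2\<close>.\<close>

lemma density_arith_m:
 fixes y k L l1 z w c g :: real
 defines "R == 1 - y^2" and "la == k - L / 2" and "n == k / 2 + k^2 / 2"
 defines "v1 == z + la * w + (1 + y) * c" and "v2 == z + la * w - (1 - y) * c"
 shows "(1 - y) * ((2 * R + 2 * k * y * (1 - y)) * (w * v1) / 2 + R / 2 * ((v2 - la * w) * v1 + w * (g - (1 + la) * v1))) +
   (1 + y) * ((2 * R - 2 * k * y * (1 + y)) * (w * v2) / 2 + R / 2 * ((v1 - la * w) * v2 + w * (g - (1 + la) * v2))) +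
   R * (- l1 * w^2 - 2 * la * (w * z)) - (la + k) * (R * (2 * y * w * c + (1 + 2 * k) * w^2) - 2 * k * w^2)
  = R * (z^2 - R * c^2 - 2 * n * w^2 + w * g + 2 * (y * c * z) + (1 + L + 2 * k) * (w * z) - (L^2 / 4 + l1) * w^2)
    - 4 * k * (w * z) + L * k * w^2" unfolding assms by (simp add: field_simps power2_eq_square)

lemma density_arith:
 fixes y k L l1 K K' m m' z w c G g :: real
 defines "R == 1 - y^2" and "la == k - L / 2" and "n == k / 2 + k^2 / 2"
 defines "v1 == z + la * w + (1 + y) * c" and "v2 == z + la * w - (1 - y) * c"
 shows "(1 - y) * ((2 * R + 2 * k * y * (1 - y)) * (K / 4 * v1^2 + (m - K * la) / 2 * (w * v1)) +
   R * (K' / 4 * v1^2 + K / 2 * v1 * (g - (1 + la) * v1) + (m' - K' * la - K * l1) / 2 * (w * v1)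
    + (m - K * la) / 2 * ((v2 - la * w) * v1 + w * (g - (1 + la) * v1)))) +
  (1 + y) * ((2 * R - 2 * k * y * (1 + y)) * (K / 4 * v2^2 + (m - K * la) / 2 * (w * v2)) +
   R * (K' / 4 * v2^2 + K / 2 * v2 * (g - (1 + la) * v2) + (m' - K' * la - K * l1) / 2 * (w * v2)
    + (m - K * la) / 2 * ((v1 - la * w) * v2 + w * (g - (1 + la) * v2)))) +
  R * ((K' * (la^2 / 2 + n) + K * la * l1 - m' * la - m * l1) * w^2 + 2 * (K * (la^2 / 2 + n) - m * la) * (w * z) - K' * G - K * (g * (z + la * w) - 2 * (1 + la) * G)) +
  (K * la^2 - m * (la + k)) * (R * (2 * y * w * c + (1 + 2 * k) * w^2) - 2 * k * w^2)
 = R * (K' * (z^2 / 2 + R * c^2 / 2 + n * w^2 - G) + m' * (w * z)) +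
  K * (- 2 * k * z^2 + R * (L * z^2 + L * (y * c * z) + 2 * (1 + la) * G - la * (w * g)
    + (L / 2 + L * k - L^2 / 4 - l1) * (w * z))) +
  m * (R * (z^2 - R * c^2 - 2 * n * w^2 + w * g + 2 * (y * c * z) + (1 + L + 2 * k) * (w * z) - (L^2 / 4 + l1) * w^2)
    - 4 * k * (w * z) + L * k * w^2)" unfolding density_arith_split
 unfolding assms density_arith_K' density_arith_m' density_arith_K density_arith_m by (simp add: algebra_simps)

context cone_mult
begin

definition dens where "dens y s = rho p y * (ka s * ((z y s)^2 / 2 + (1 - y^2) * (wy y s)^2 / 2 + k0 * (w y s)^2 - G y s)
   + mu s * (w y s * z y s))"

definition rate where "rate y s = rho1 p y * ((1 - y^2) * (ka' s * ((z y s)^2 / 2 + (1 - y^2) * (wy y s)^2 / 2 + k0 * (w y s)^2 - G y s)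
    + mu' s * (w y s * z y s)) +
  ka s * (- 2 * expo p * (z y s)^2 + (1 - y^2) * (a * expo p / s * (z y s)^2 + a * expo p / s * (y * wy y s * z y s)
    + 2 * (1 + lam p a s) * G y s - lam p a s * (w y s * g y s)
    + (a * expo p / s / 2 + a * expo p / s * expo p - (a * expo p / s)^2 / 4 - lam' s) * (w y s * z y s))) +
  mu s * ((1 - y^2) * ((z y s)^2 - (1 - y^2) * (wy y s)^2 - 2 * k0 * (w y s)^2 + w y s * g y s + 2 * (y * wy y s * z y s)
    + (1 + a * expo p / s + 2 * expo p) * (w y s * z y s) - ((a * expo p / s)^2 / 4 + lam' s) * (w y s)^2)
    - 4 * expo p * (w y s * z y s) + a * expo p / s * expo p * (w y s)^2))"

lemma dens_eq: "Zc 1 y s + Zc (- 1) y s + Zr y s = dens y s" unfolding Zc_def Zr_def dens_def v_z om_def chi_def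
 by (simp add: field_simps power2_eq_square)

text \<open>The multiple of \<open>ibp\<close> is the one that removes the products
  \<open>y * w * wy\<close>, which have no sign and no small coefficient.\<close>

lemma rate_eq:
 "DZc 1 y s + DZc (- 1) y s + DZr y s + (ka s * (lam p a s)^2 - mu s * (lam p a s + expo p)) * ibp y s = rate y s"
proof -
 have la: "lam p a s = expo p - a * expo p / s / 2" by (simp add: lam_def)
 have q: "q y s = z y s + lam p a s * w y s" by (simp add: z_def)
 have "DZc 1 y s + DZc (- 1) y s + DZr y s + (ka s * (lam p a s)^2 - mu s * (lam p a s + expo p)) * ibp y s =
  rho1 p y * ((1 - y) * ((2 * (1 - y^2) + 2 * expo p * y * (1 - y)) * (ka s / 4 * (v 1 y s)^2 + (mu s - ka s * lam p a s) / 2 * (w y s * v 1 y s)) +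
   (1 - y^2) * (ka' s / 4 * (v 1 y s)^2 + ka s / 2 * v 1 y s * (g y s - (1 + lam p a s) * v 1 y s) + (mu' s - ka' s * lam p a s - ka s * lam' s) / 2 * (w y s * v 1 y s)
    + (mu s - ka s * lam p a s) / 2 * ((v (- 1) y s - lam p a s * w y s) * v 1 y s + w y s * (g y s - (1 + lam p a s) * v 1 y s)))) +
  (1 + y) * ((2 * (1 - y^2) - 2 * expo p * y * (1 + y)) * (ka s / 4 * (v (- 1) y s)^2 + (mu s - ka s * lam p a s) / 2 * (w y s * v (- 1) y s)) +
   (1 - y^2) * (ka' s / 4 * (v (- 1) y s)^2 + ka s / 2 * v (- 1) y s * (g y s - (1 + lam p a s) * v (- 1) y s) + (mu' s - ka' s * lam p a s - ka s * lam' s) / 2 * (w y s * v (- 1) y s)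
    + (mu s - ka s * lam p a s) / 2 * ((v 1 y s - lam p a s * w y s) * v (- 1) y s + w y s * (g y s - (1 + lam p a s) * v (- 1) y s)))) +
  (1 - y^2) * ((ka' s * ((lam p a s)^2 / 2 + k0) + ka s * lam p a s * lam' s - mu' s * lam p a s - mu s * lam' s) * (w y s)^2 + 2 * (ka s * ((lam p a s)^2 / 2 + k0) - mu s * lam p a s) * (w y s * z y s) - ka' s * G y s - ka s * (g y s * (z y s + lam p a s * w y s) - 2 * (1 + lam p a s) * G y s)) +
  (ka s * (lam p a s)^2 - mu s * (lam p a s + expo p)) * ((1 - y^2) * (2 * y * w y s * wy y s + (1 + 2 * expo p) * (w y s)^2) - 2 * expo p * (w y s)^2))"
  unfolding DZc_def DZr_def ibp_def rho_rho1 om_def om'_def chi_def chi'_def q by (simp add: algebra_simps)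
 also have "... = rate y s" unfolding rate_def by (rule arg_cong[where f="\<lambda>x. rho1 p y * x"])
   (simp only: v_z la k0_def density_arith)
 finally show ?thesis .
qed

end

lemma DZc_quad_arith:
 fixes r m b k e K v f w K' g la f' u :: real
 shows "r * m * ((2 * (m * b) + 2 * k * e * m) * (K / 4 * v^2 + f / 2 * (w * v)) +
   m * b * (K' / 4 * v^2 + K / 2 * v * (g - (1 + la) * v) + f' / 2 * (w * v)
    + f / 2 * ((u - la * w) * v + w * (g - (1 + la) * v)))) =
  r * (((2 * b + 2 * k * e) * (K * (1 / 4)) + b * (K' * (1 / 4) - K * (1 + la) * (1 / 2))) * (m * v)^2 +
   m * (f * (1 / 2)) * (m * v * (b * u)) +
   ((2 * (m * b) + 2 * k * e * m) * (f * w * (1 / 2)) + m * b * (K * g * (1 / 2) + f' * w * (1 / 2) - f * w * (1 + 2 * la) * (1 / 2))) * (m * v) +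
   m * (m * b) * (f * (w * g) * (1 / 2)))" by (simp add: field_simps power2_eq_square)

context cone
begin

lemma obox_Fubini:
 fixes f :: "real => real => real"
 assumes "bint (\<lambda>(s, y). f y s)"
 shows "(LINT s:{s1..s2}|lborel. (SINT y. f y s)) = (BINT x. f (snd x) (fst x))"
proof -
 have "integrable lborel2 (\<lambda>(s, y). indicat_real {s1..s2} s * (indicat_real {- 1<..<1} y * f y s))"
  using assms by (simp add: set_integrable_def case_prod_beta' indicator_times mult.assoc)
 from lborel_pair.integral_fst[OF this]
 show ?thesis by (simp add: set_lebesgue_integral_def case_prod_beta' indicator_times mult.assoc)
qed

end

context cone_mult
begin

lemma strip_time:
 "strip_cont (\<lambda>y s. ka s)" "strip_cont (\<lambda>y s. ka' s)"
 "strip_cont (\<lambda>y s. om s)" "strip_cont (\<lambda>y s. om' s)"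
 "strip_cont (\<lambda>y s. chi s)" "strip_cont (\<lambda>y s. chi' s)"
 "strip_cont (\<lambda>y s. lam p a s)" "strip_cont (\<lambda>y s. lam' s)"
 by (rule strip_cont_time, rule ka_cont ka'_cont om_cont om'_cont chi_cont chi'_cont lam_cont lam'_cont)+

text \<open>Both \<open>1 - y^2\<close> and the derivative of the weight contain a second factor
  \<open>1 - y\<close>, so \<open>(v 1)^2\<close> completes to \<open>(va 1)^2\<close>. In the mixed
  term \<open>1 - y^2\<close> supplies the factor \<open>1 + y\<close> that turns
  \<open>v (- 1)\<close> into \<open>va (- 1)\<close>.\<close>

lemma DZc_plus_quad: "DZc 1 y s = quad
  (\<lambda>y s. (2 * (1 + y) + 2 * expo p * y) * (ka s * (1 / 4)) + (1 + y) * (ka' s * (1 / 4) - ka s * (1 + lam p a s) * (1 / 2)))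
  (\<lambda>y s. (1 - y) * (om s * (1 / 2))) (\<lambda>_ _. 0)
  (\<lambda>y s. (2 * (1 - y^2) + 2 * expo p * y * (1 - y)) * (om s * w y s * (1 / 2)) + (1 - y^2) * (ka s * g y s * (1 / 2) + om' s * w y s * (1 / 2)
    - om s * w y s * (1 + 2 * lam p a s) * (1 / 2)))
  (\<lambda>_ _. 0) (\<lambda>y s. (1 - y) * (1 - y^2) * (om s * (w y s * g y s) * (1 / 2))) y s"
proof -
 have R: "1 - y^2 = (1 - y) * (1 + y)" by (simp add: power2_eq_square algebra_simps)
 show ?thesis unfolding DZc_def quad_def va_def R
  using DZc_quad_arith[of "rho1 p y" "1 - y" "1 + y" "expo p" y "ka s" "v 1 y s" "om s" "w y s" "ka' s" "g y s" "lam p a s" "om' s" "v (- 1) y s"]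
  by simp
qed

lemma DZc_minus_quad: "DZc (- 1) y s = quad (\<lambda>_ _. 0)
  (\<lambda>y s. (1 + y) * (om s * (1 / 2)))
  (\<lambda>y s. (2 * (1 - y) + 2 * expo p * (- y)) * (ka s * (1 / 4)) + (1 - y) * (ka' s * (1 / 4) - ka s * (1 + lam p a s) * (1 / 2)))
  (\<lambda>_ _. 0)
  (\<lambda>y s. (2 * ((1 + y) * (1 - y)) + 2 * expo p * (- y) * (1 + y)) * (om s * w y s * (1 / 2)) + (1 + y) * (1 - y) * (ka s * g y s * (1 / 2) + om' s * w y s * (1 / 2)
    - om s * w y s * (1 + 2 * lam p a s) * (1 / 2)))
  (\<lambda>y s. (1 + y) * ((1 + y) * (1 - y)) * (om s * (w y s * g y s) * (1 / 2))) y s"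
proof -
 have R: "1 - y^2 = (1 + y) * (1 - y)" by (simp add: power2_eq_square algebra_simps)
 have m: "1 - (- 1) * y = 1 + y" "1 - 1 * y = 1 - y" "(- 1) * y = - y" "- (- 1) = (1::real)" "1 + - 1 * y = 1 - y" by simp_all
 have c: "va 1 y s * va (- 1) y s = (1 + y) * v (- 1) y s * ((1 - y) * v 1 y s)" unfolding va_def by simp
 show ?thesis unfolding DZc_def quad_def c unfolding va_def R m
  using DZc_quad_arith[of "rho1 p y" "1 + y" "1 - y" "expo p" "- y" "ka s" "v (- 1) y s" "om s" "w y s" "ka' s" "g y s" "lam p a s" "om' s" "v 1 y s"]
  by (simp add: add_ac)
qed

lemma DZr_quad: "DZr y s = quad (\<lambda>_ _. 0) (\<lambda>_ _. 0) (\<lambda>_ _. 0)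
  (\<lambda>y s. (1 - y^2) * (chi s * w y s - ka s * g y s * (1 / 2))) (\<lambda>y s. (1 - y^2) * (chi s * w y s - ka s * g y s * (1 / 2)))
  (\<lambda>y s. (1 - y^2) * (chi' s * (w y s)^2 - 2 * chi s * lam p a s * (w y s)^2 - ka' s * G y s + ka s * 2 * (1 + lam p a s) * G y s)) y s"
 unfolding DZr_def quad_def rho_rho1 z_def q_va by (simp add: field_simps power2_eq_square)

lemma ibp_quad: "f s * ibp y s = quad (\<lambda>_ _. 0) (\<lambda>_ _. 0) (\<lambda>_ _. 0)
  (\<lambda>y s. f s * y * w y s * (1 + y)) (\<lambda>y s. - (f s * y * w y s * (1 - y)))
  (\<lambda>y s. f s * ((1 - y^2) * ((1 + 2 * expo p) * (w y s)^2) - 2 * expo p * (w y s)^2)) y s"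
proof -
 have eq: "(1 - y^2) * (2 * y * w y s * wy y s) = y * w y s * ((1 + y) * va 1 y s - (1 - y) * va (- 1) y s)"
 proof -
  have "(1 - y^2) * (2 * y * w y s * wy y s) = 2 * y * w y s * ((1 - y^2) * wy y s)" by simp
  then show ?thesis unfolding wy_va by (simp add: algebra_simps)
 qed
 show ?thesis unfolding ibp_def quad_def distrib_left[of "1 - y^2"] eq by (simp add: algebra_simps)
qed

lemma DZc_integrable:
 assumes "abs j = 1"
 shows "bint (\<lambda>(s, y). DZc j y s)"
proof -
 have "j = 1 \<or> j = - 1" using assms by (auto simp: abs_if split: if_splits)
 then show ?thesis
 proof
  assume "j = 1"
  then show ?thesis unfolding \<open>j = 1\<close> DZc_plus_quad by (intro quad_box_integrable) (intro strip_intros strip_time)+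
 next
  assume "j = - 1"
  then show ?thesis unfolding \<open>j = - 1\<close> DZc_minus_quad by (intro quad_box_integrable) (intro strip_intros strip_time)+
 qed
qed

lemma DZr_integrable: "bint (\<lambda>(s, y). DZr y s)" unfolding DZr_quad by (intro quad_box_integrable) (intro strip_intros strip_time)+

lemma ibp_integrable:
 assumes "continuous_on {s1..s2} f"
 shows "bint (\<lambda>(s, y). f s * ibp y s)"
 unfolding ibp_quad by (intro quad_box_integrable) (intro strip_intros strip_time strip_cont_time[OF assms])+

lemma Zc_slice_integrable:
 assumes "abs j = 1" "s1 <= s" "s <= s2"
 shows "sint (\<lambda>y. Zc j y s)"
proof -
 have 1: "Zc 1 y s = quad0 (\<lambda>y s. (1 - y) * (ka s * (1 / 4))) (\<lambda>_ _. 0) (\<lambda>_ _. 0)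
   (\<lambda>y s. (1 - y) * (om s * w y s * (1 / 2))) (\<lambda>_ _. 0) (\<lambda>_ _. 0) (\<lambda>_ _. 0) y s" for y
  unfolding Zc_def quad0_def by (simp add: field_simps)
 have 2: "Zc (- 1) y s = quad0 (\<lambda>_ _. 0) (\<lambda>_ _. 0) (\<lambda>y s. (1 + y) * (ka s * (1 / 4)))
   (\<lambda>_ _. 0) (\<lambda>y s. (1 + y) * (om s * w y s * (1 / 2))) (\<lambda>_ _. 0) (\<lambda>_ _. 0) y s" for y
  unfolding Zc_def quad0_def by (simp add: field_simps)
 have "j = 1 \<or> j = - 1" using assms by (auto simp: abs_if split: if_splits)
 then show ?thesis
 proof
  assume "j = 1"
  then show ?thesis unfolding \<open>j = 1\<close> 1 by (intro quad0_slice_integrable) (intro strip_intros strip_time assms)+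
 next
  assume "j = - 1"
  then show ?thesis unfolding \<open>j = - 1\<close> 2 by (intro quad0_slice_integrable) (intro strip_intros strip_time assms)+
 qed
qed

lemma Zr_slice_integrable:
 assumes "s1 <= s" "s <= s2"
 shows "sint (\<lambda>y. Zr y s)"
proof -
 have "Zr y s = quad0 (\<lambda>_ _. 0) (\<lambda>_ _. 0) (\<lambda>_ _. 0) (\<lambda>_ _. 0) (\<lambda>_ _. 0)
   (\<lambda>y s. chi s * (w y s)^2 - ka s * G y s) (\<lambda>_ _. 0) y s" for y unfolding Zr_def quad0_def by simp
 then show ?thesis by (simp only:) (intro quad0_slice_integrable; (intro strip_intros strip_time assms)?)
qed

lemma acd_phi: "acd s1 s2 (phi p a) (\<lambda>s. lam p a s * phi p a s)"
 by (rule acd_time[OF DERIV_phi]) (use spos in "auto intro!: continuous_intros lam_cont phi_cont")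

lemma G_ray_acd:
 assumes y: "- 1 <= y" "y <= 1"
 shows "acd s1 s2 (\<lambda>s. G y s) (\<lambda>s. g y s * q y s - 2 * (1 + lam p a s) * G y s)"
proof -
 have F: "acd s1 s2 (\<lambda>s. nonlin_prim p a (phi p a s * w y s))
   (\<lambda>s. nonlin p a (phi p a s * w y s) * (lam p a s * phi p a s * w y s + phi p a s * z y s))"
  by (rule acd_comp[OF acd_mult[OF acd_phi w_ray_acd[OF y]] DERIV_nonlin_prim[OF p] continuous_nonlin[OF p]])
 have E: "acd s1 s2 (\<lambda>s. exp (- 2 * s)) (\<lambda>s. - 2 * exp (- 2 * s))"
  by (rule acd_C1) (auto intro!: derivative_eq_intros continuous_intros)
 note i = acd_inverse_phi[OF order_refl order_refl]
 show ?thesis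
 proof (rule acd_cong[OF acd_mult[OF acd_mult[OF E F] acd_mult[OF i i]]])
  fix s assume s: "s1 <= s" "s <= s2"
  show "exp (- 2 * s) * nonlin_prim p a (phi p a s * w y s) * (1 / phi p a s * (1 / phi p a s)) = G y s"
   by (simp add: G_def power2_eq_square)
  have q: "q y s = z y s + lam p a s * w y s" by (simp add: z_def)
  show "(- 2 * exp (- 2 * s) * nonlin_prim p a (phi p a s * w y s) + exp (- 2 * s) *
     (nonlin p a (phi p a s * w y s) * (lam p a s * phi p a s * w y s + phi p a s * z y s))) *
     (1 / phi p a s * (1 / phi p a s)) + exp (- 2 * s) * nonlin_prim p a (phi p a s * w y s) *
     (- lam p a s / phi p a s * (1 / phi p a s) + 1 / phi p a s * (- lam p a s / phi p a s)) =
     g y s * q y s - 2 * (1 + lam p a s) * G y s" unfolding G_def g_def q using phi_nz[OF s(1)] by (simp add: field_simps power2_eq_square)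
 qed
qed

lemma Zr_ray_acd:
 assumes y: "- 1 < y" "y < 1"
 shows "acd s1 s2 (\<lambda>s. Zr y s) (\<lambda>s. DZr y s)"
proof -
 have w: "acd s1 s2 (\<lambda>s. w y s) (\<lambda>s. z y s)" by (rule w_ray_acd) (use y in auto)
 have G: "acd s1 s2 (\<lambda>s. G y s) (\<lambda>s. g y s * q y s - 2 * (1 + lam p a s) * G y s)" by (rule G_ray_acd) (use y in auto)
 note c = acd_time[OF chi chi'_cont order_refl order_refl]
 note k = acd_time[OF ka ka'_cont order_refl order_refl]
 show ?thesis by (rule acd_cong[OF acd_cmult[OF acd_add[OF acd_mult[OF c acd_mult[OF w w]] acd_minus[OF acd_mult[OF k G]]], of "rho p y"]])
   (auto simp: Zr_def DZr_def power2_eq_square algebra_simps)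
qed

lemma rate_integrable: "bint (\<lambda>(s, y). rate y s)"
proof -
 have "bint (\<lambda>x. (\<lambda>(s, y). DZc 1 y s) x + (\<lambda>(s, y). DZc (- 1) y s) x
   + (\<lambda>(s, y). DZr y s) x + (\<lambda>(s, y). (ka s * (lam p a s)^2 - mu s * (lam p a s + expo p)) * ibp y s) x)"
  by (intro set_integral_add(1) DZc_integrable DZr_integrable ibp_integrable continuous_intros ka_cont mu_cont lam_cont) auto
 then show ?thesis by (simp add: case_prod_beta' rate_eq)
qed

lemma dens_slice_integrable:
 assumes "s1 <= s" "s <= s2"
 shows "sint (\<lambda>y. dens y s)" unfolding dens_eq[symmetric]
 by (intro set_integral_add(1) Zc_slice_integrable Zr_slice_integrable assms) auto

theorem functional_identity:
 assumes j: "continuous_on {s1..s2} j"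
 shows "(SINT y. dens y s2) - (SINT y. dens y s1) =
  (BINT x. rate (snd x) (fst x) + j (fst x) * ibp (snd x) (fst x))"
proof -
 let ?j = "\<lambda>s. ka s * (lam p a s)^2 - mu s * (lam p a s + expo p)"
 have s12': "s \<in> {s1, s2} ==> s1 <= s & s <= s2" for s using s12 by auto
 have Z: "(SINT y. Zc j y s2) - (SINT y. Zc j y s1)
  = (BINT x. DZc j (snd x) (fst x))" if j: "abs j = 1" for j unfolding obox_Fubini[OF DZc_integrable[OF j], symmetric]
 proof (rule transport[OF s12 j _ DZc_integrable[OF j] Zc_char_acd[OF j]])
  show "sint (\<lambda>y. Zc j y s)" if "s \<in> {s1, s2}" for s using Zc_slice_integrable[OF j] s12'[OF that] by blast
  have "(- j)^2 = 1" using sigma_cancel[OF j, of 1] by (simp add: power2_eq_square)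
  then show "Zc j (- j) s = 0" for s by (simp add: Zc_def rho_def)
 qed
 have r: "(SINT y. Zr y s2) - (SINT y. Zr y s1)
  = (BINT x. DZr (snd x) (fst x))" unfolding obox_Fubini[OF DZr_integrable, symmetric]
  by (rule transport_ray[OF s12 _ DZr_integrable Zr_ray_acd]) (use Zr_slice_integrable s12' in blast)+
 have i: "(BINT x. f (fst x) * ibp (snd x) (fst x)) = 0" if f: "continuous_on {s1..s2} f" for f
 proof -
  have "(LINT s:{s1..s2}|lborel. (SINT y. f s * ibp y s)) = (LINT s:{s1..s2}|lborel. 0)"
   unfolding set_lebesgue_integral_def[of lborel "{s1..s2}"]
   by (rule Bochner_Integration.integral_cong) (auto simp: indicator_def ibp_slice)
  then show ?thesis using obox_Fubini[OF ibp_integrable[OF f]] by (simp add: set_lebesgue_integral_def)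
 qed
 have jc: "continuous_on {s1..s2} ?j" by (intro continuous_intros ka_cont mu_cont lam_cont)
 have add: "(SINT y. dens y s) = (SINT y. Zc 1 y s) + (SINT y. Zc (- 1) y s)
   + (SINT y. Zr y s)" if "s \<in> {s1, s2}" for s unfolding dens_eq[symmetric] using s12'[OF that]
  by (subst set_integral_add(2); (subst set_integral_add(2))?)
   (auto intro!: set_integral_add(1) Zc_slice_integrable Zr_slice_integrable)
 have I: "bint (\<lambda>x. DZc j (snd x) (fst x))" if "abs j = 1" for j using DZc_integrable[OF that] by (simp add: case_prod_beta')
 have Ir: "bint (\<lambda>x. DZr (snd x) (fst x))" using DZr_integrable by (simp add: case_prod_beta')
 have Ii: "bint (\<lambda>x. f (fst x) * ibp (snd x) (fst x))" if "continuous_on {s1..s2} f" for f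
  using ibp_integrable[OF that] by (simp add: case_prod_beta')
 have "(BINT x. rate (snd x) (fst x) + j (fst x) * ibp (snd x) (fst x)) =
  (BINT x. DZc 1 (snd x) (fst x)) + (BINT x. DZc (- 1) (snd x) (fst x))
  + (BINT x. DZr (snd x) (fst x)) + (BINT x. ?j (fst x) * ibp (snd x) (fst x))
  + (BINT x. j (fst x) * ibp (snd x) (fst x))" unfolding rate_eq[symmetric]
  by (simp only: set_integral_add(1,2) I[of 1] I[of "- 1"] Ir Ii[OF jc] Ii[OF j] abs_minus_cancel abs_one)
 also have "... = (SINT y. dens y s2) - (SINT y. dens y s1)" using Z[of 1] Z[of "- 1"] r i[OF jc] i[OF j] add[of s1] add[of s2] by simp
 finally show ?thesis ..
qed

end

section \<open>Estimates of the nonlinearity\<close>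

definition Lg :: "real => real" where "Lg x = ln (2 + x^2)"

definition Qn :: "real => real => real => real" where
 "Qn p a x = x * nonlin p a x"

lemma Lg_ge: "Lg x >= ln 2" unfolding Lg_def by (subst ln_le_cancel_iff) (auto simp: add_pos_nonneg)

lemma ln2_pos: "ln (2::real) > 0" by simp

lemma Lg_pos: "Lg x > 0" using Lg_ge[of x] ln2_pos by linarith

lemma Lg_powr: "Lg x powr (b - 1) = Lg x powr b / Lg x" using Lg_pos[of x] by (simp add: powr_diff)

lemma Qn_eq: "Qn p a x = abs x powr (p + 1) * Lg x powr a"
proof (cases "x = 0")
 case False
 have "abs x powr (p + 1) = abs x powr (p - 1) * abs x powr 2" using powr_add[of "abs x" "p - 1" 2] by (simp add: add.commute)
 also have "abs x powr 2 = x * x" using False by (simp add: power2_eq_square)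
 finally have "x * (abs x powr (p - 1) * x) = abs x powr (p + 1)" by simp
 then show ?thesis by (simp add: Qn_def nonlin_def Lg_def mult.assoc[symmetric])
qed (simp add: Qn_def)

lemma Qn_nonneg: "Qn p a x >= 0" by (simp add: Qn_eq)

lemma Qn_minus: "Qn p a (- x) = Qn p a x" by (simp add: Qn_eq Lg_def)

lemma nonlin_minus: "nonlin p a (- x) = - nonlin p a x" by (simp add: nonlin_def)

lemma nonlin_prim_minus:
 assumes "p > 1"
 shows "nonlin_prim p a (- x) = nonlin_prim p a x"
proof -
 have "((\<lambda>x. nonlin_prim p a (- x) - nonlin_prim p a x) has_real_derivative 0) (at x)" for x
 proof -
  have "((\<lambda>x. nonlin_prim p a (- x)) has_real_derivative nonlin p a (- x) * (- 1)) (at x)"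
   by (rule DERIV_chain2[OF DERIV_nonlin_prim[OF assms]]) (auto intro!: derivative_eq_intros)
  then have "((\<lambda>x. nonlin_prim p a (- x) - nonlin_prim p a x) has_real_derivative nonlin p a (- x) * (- 1) - nonlin p a x) (at x)"
   by (rule DERIV_diff[OF _ DERIV_nonlin_prim[OF assms]])
  then show ?thesis by (simp add: nonlin_minus)
 qed
 then obtain c where "!!x. nonlin_prim p a (- x) - nonlin_prim p a x = c"
  using DERIV_const_ratio_const DERIV_isconst_all[of "\<lambda>x. nonlin_prim p a (- x) - nonlin_prim p a x"] by metis
 from this[of 0] this[of x] show ?thesis by simp
qed

lemma DERIV_Lg: "(Lg has_real_derivative 2 * x / (2 + x^2)) (at x)"
proof -
 have "2 + x^2 > 0" using zero_le_power2[of x] by linarith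
 then show ?thesis unfolding Lg_def[abs_def] by (auto intro!: derivative_eq_intros simp: field_simps)
qed

lemma DERIV_power_log:
 assumes "x > 0"
 shows "((\<lambda>x. x powr (p + 1) * Lg x powr b) has_real_derivative
  x powr p * ((p + 1) * Lg x powr b + 2 * b * (x^2 / (2 + x^2)) * Lg x powr (b - 1))) (at x)"
proof -
 have "((\<lambda>x. x powr (p + 1) * Lg x powr b) has_real_derivative
   x powr (p + 1) * (b * Lg x powr (b - 1) * (2 * x / (2 + x^2))) + (p + 1) * x powr (p + 1 - 1) * 1 * Lg x powr b) (at x)"
  using DERIV_fun_powr[OF DERIV_ident assms, of "p + 1"] DERIV_fun_powr[OF DERIV_Lg Lg_pos, of b x]
  by (rule DERIV_mult'[THEN DERIV_cong]) simp
 moreover have "x powr (p + 1) = x powr p * x" using assms by (simp add: powr_add)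
 ultimately show ?thesis by (elim DERIV_cong) (simp add: algebra_simps power2_eq_square)
qed

text \<open>The remainder after two terms of the expansion of \<open>nonlin_prim\<close> at
  infinity, as given by integration by parts: each step gains a factor
  \<open>1 / Lg\<close>.\<close>

definition Vn :: "real => real => real => real" where
 "Vn p a x = nonlin_prim p a x - Qn p a x / (p + 1) + 2 * a / (p + 1)^2 * (Qn p a x / Lg x)"

lemma Vn_minus: "p > 1 ==> Vn p a (- x) = Vn p a x" by (simp add: Vn_def nonlin_prim_minus Qn_minus) (simp add: Lg_def)

lemma Qn_div: "Qn p a x / Lg x ^ n = abs x powr (p + 1) * Lg x powr (a - real n)"
 using Lg_pos[of x] by (simp add: Qn_eq powr_diff powr_realpow)

lemma DERIV_Vn:
 assumes p: "p > 1" and x: "x > 0"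
 shows "(Vn p a has_real_derivative
  x powr p * (4 * a / (p + 1) / (2 + x^2) * Lg x powr (a - 1) + 4 * a * (a - 1) / (p + 1)^2 * (x^2 / (2 + x^2)) * Lg x powr (a - 2))) (at x)"
proof -
 have ev: "\<forall>\<^sub>F y in nhds x. Vn p a y = nonlin_prim p a y - (y powr (p + 1) * Lg y powr a) / (p + 1)
   + 2 * a / (p + 1)^2 * (y powr (p + 1) * Lg y powr (a - 1))" using eventually_nhds_in_open[of "{0<..}" x] x
  by (auto elim!: eventually_mono simp: Vn_def Qn_eq Lg_powr)
 have f: "nonlin p a x = x powr p * Lg x powr a" using x by (simp add: nonlin_def Lg_def powr_diff)
 have "x^2 / (2 + x^2) = 1 - 2 / (2 + x^2)"
 proof -
  have "2 + x^2 ~= 0" using zero_le_power2[of x] by linarith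
  then show ?thesis by (simp add: field_simps)
 qed
 note r = this
 have "((\<lambda>y. nonlin_prim p a y - (y powr (p + 1) * Lg y powr a) / (p + 1)
   + 2 * a / (p + 1)^2 * (y powr (p + 1) * Lg y powr (a - 1))) has_real_derivative
   nonlin p a x - x powr p * ((p + 1) * Lg x powr a + 2 * a * (x^2 / (2 + x^2)) * Lg x powr (a - 1)) / (p + 1)
   + 2 * a / (p + 1)^2 * (x powr p * ((p + 1) * Lg x powr (a - 1) + 2 * (a - 1) * (x^2 / (2 + x^2)) * Lg x powr (a - 1 - 1)))) (at x)"
  by (intro DERIV_add DERIV_diff DERIV_cmult DERIV_cdivide DERIV_nonlin_prim[OF p] DERIV_power_log x)
 moreover have "nonlin p a x - x powr p * ((p + 1) * Lg x powr a + 2 * a * (x^2 / (2 + x^2)) * Lg x powr (a - 1)) / (p + 1)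
   + 2 * a / (p + 1)^2 * (x powr p * ((p + 1) * Lg x powr (a - 1) + 2 * (a - 1) * (x^2 / (2 + x^2)) * Lg x powr (a - 1 - 1)))
  = x powr p * (4 * a / (p + 1) / (2 + x^2) * Lg x powr (a - 1) + 4 * a * (a - 1) / (p + 1)^2 * (x^2 / (2 + x^2)) * Lg x powr (a - 2))"
 proof -
  define P where "P = p + 1"
  define t where "t = 2 / (2 + x^2)"
  have P: "P ~= 0" using p by (simp add: P_def)
  have t2: "4 * a / P / (2 + x^2) = 2 * a * t / P" by (simp add: t_def)
  show ?thesis unfolding f r P_def[symmetric] t_def[symmetric] t2 using P by (simp add: field_simps power2_eq_square)
 qed
 ultimately show ?thesis by (subst DERIV_cong_ev[OF refl ev refl]) simp
qed

text \<open>For large \<open>x\<close> the derivative of \<open>Vn\<close> is at most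
  \<open>C1\<close> times that of \<open>H x = x powr (p + 1) * Lg x powr (a - 2)\<close>, so
  \<open>C1 * H + Vn\<close> and \<open>C1 * H - Vn\<close> both increase. Compactness covers
  bounded \<open>x\<close> and symmetry the negative ones.\<close>

lemma Vn_bound:
 assumes p: "p > 1"
 shows "\<exists>C\<ge>0. \<forall>x. abs (Vn p a x) <= C * (1 + Qn p a x / (Lg x)^2)"
proof -
 define H where "H x = x powr (p + 1) * Lg x powr (a - 2)" for x
 define H' where "H' x = x powr p * ((p + 1) * Lg x powr (a - 2) + 2 * (a - 2) * (x^2 / (2 + x^2)) * Lg x powr (a - 2 - 1))" for x
 define V' where "V' x = x powr p * (4 * a / (p + 1) / (2 + x^2) * Lg x powr (a - 1) + 4 * a * (a - 1) / (p + 1)^2 * (x^2 / (2 + x^2)) * Lg x powr (a - 2))" for x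
 \<comment> \<open>Beyond \<open>X0\<close> one has
   \<open>Lg x >= 2 * \<bar>a - 2\<bar> + 1\<close>, since \<open>ln x <= Lg x\<close>. Then the
   logarithmic factor of \<open>H\<close> costs at most half of the growth of the power, and
   \<open>H'\<close> is bounded below.\<close>
 define X0 where "X0 = exp (2 * \<bar>a - 2\<bar> + 1)"
 define C1 where "C1 = 4 * abs a / (p + 1) + 4 * \<bar>a * (a - 1)\<bar> / (p + 1)^2"
 have C1: "C1 >= 0" using p by (simp add: C1_def)
 have X0: "X0 > 0" by (simp add: X0_def)
 have der: "abs (V' x) <= C1 * H' x" if "x >= X0" for x
 proof -
  have x: "x > 0" using that X0 by linarith
  define l where "l = Lg x powr (a - 2)"
  have l: "l > 0" using Lg_pos[of x] by (simp add: l_def)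
  have sq: "2 + x^2 > 0" "x^2 >= 0" using zero_le_power2[of x] by linarith+
  have lm: "Lg x powr (a - 1) = Lg x * l" "Lg x powr (a - 2 - 1) = l / Lg x"
   using Lg_pos[of x] powr_add[of "Lg x" 1 "a - 2"] unfolding l_def Lg_powr[of x "a - 2"] by simp_all
  have "Lg x <= 2 + x^2" unfolding Lg_def using ln_le_minus_one[OF sq(1)] by linarith
  then have Lr: "Lg x / (2 + x^2) <= 1" by (subst pos_divide_le_eq[OF sq(1)]) simp
  have r1: "0 <= x^2 / (2 + x^2)" "x^2 / (2 + x^2) <= 1" unfolding pos_divide_le_eq[OF sq(1)] using sq by simp_all
  have "ln X0 <= ln x" using that X0 by simp
  moreover have "ln x <= Lg x"
  proof -
   have "x <= 2 + x^2" using x sum_squares_bound[of 1 x] by (simp add: power2_eq_square)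
   then show ?thesis unfolding Lg_def using x by simp
  qed
  ultimately have big: "Lg x >= 2 * \<bar>a - 2\<bar> + 1" by (simp add: X0_def)
  have "\<bar>4 * a / (p + 1) / (2 + x^2) * Lg x powr (a - 1) + 4 * a * (a - 1) / (p + 1)^2 * (x^2 / (2 + x^2)) * Lg x powr (a - 2)\<bar> <= C1 * l"
  proof -
   have "\<bar>4 * a / (p + 1) / (2 + x^2) * Lg x powr (a - 1)\<bar> = 4 * abs a / (p + 1) * l * (Lg x / (2 + x^2))"
    unfolding lm using p l sq Lg_pos[of x] by (simp add: abs_mult)
   also have "... <= 4 * abs a / (p + 1) * l * 1" by (rule mult_left_mono[OF Lr]) (use p l in auto)
   finally have 1: "\<bar>4 * a / (p + 1) / (2 + x^2) * Lg x powr (a - 1)\<bar> <= 4 * abs a / (p + 1) * l" by simp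
   have "\<bar>4 * a * (a - 1) / (p + 1)^2 * (x^2 / (2 + x^2)) * l\<bar> = 4 * \<bar>a * (a - 1)\<bar> / (p + 1)^2 * l * (x^2 / (2 + x^2))"
    using l sq by (simp add: abs_mult)
   also have "... <= 4 * \<bar>a * (a - 1)\<bar> / (p + 1)^2 * l * 1" by (rule mult_left_mono[OF r1(2)]) (use l in auto)
   finally have 2: "\<bar>4 * a * (a - 1) / (p + 1)^2 * (x^2 / (2 + x^2)) * Lg x powr (a - 2)\<bar> <= 4 * \<bar>a * (a - 1)\<bar> / (p + 1)^2 * l"
    by (simp add: l_def)
   show ?thesis using 1 2 unfolding C1_def distrib_right by linarith
  qed
  then have 1: "abs (V' x) <= x powr p * (C1 * l)" unfolding V'_def abs_mult[of "x powr p"] by (simp add: mult_left_mono)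
  have "\<bar>2 * (a - 2) * (x^2 / (2 + x^2)) * (l / Lg x)\<bar> <= l"
  proof -
   have "\<bar>2 * d * (x^2 / (2 + x^2)) * (l / Lg x)\<bar> = (2 * abs d / Lg x) * (x^2 / (2 + x^2)) * l" for d
    using l sq Lg_pos[of x] by (simp add: abs_mult mult_ac)
   then have "\<bar>2 * (a - 2) * (x^2 / (2 + x^2)) * (l / Lg x)\<bar> = (2 * \<bar>a - 2\<bar> / Lg x) * (x^2 / (2 + x^2)) * l" .
   also have "... <= 1 * 1 * l" by (intro mult_right_mono mult_mono r1) (use big l Lg_pos[of x] in auto)
   finally show ?thesis by simp
  qed
  then have "l <= (p + 1) * l + 2 * (a - 2) * (x^2 / (2 + x^2)) * (l / Lg x)"
  proof -
   have "2 * l <= (p + 1) * l" using p l by (intro mult_right_mono) auto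
   with \<open>\<bar>2 * (a - 2) * (x^2 / (2 + x^2)) * (l / Lg x)\<bar> <= l\<close> show ?thesis by linarith
  qed
  then have "x powr p * l <= H' x" unfolding H'_def lm l_def[symmetric] by (intro mult_left_mono) auto
  from mult_left_mono[OF this C1] 1 show ?thesis by (simp add: mult_ac)
 qed
 have mono: "abs (Vn p a x) <= abs (Vn p a X0) + C1 * H x" if "x >= X0" for x
 proof -
  have dV: "(Vn p a has_real_derivative V' y) (at y)" if "y >= X0" for y using DERIV_Vn[OF p, of y a] that X0 by (simp add: V'_def)
  have dH: "(H has_real_derivative H' y) (at y)" if "y >= X0" for y
   unfolding H_def[abs_def] H'_def by (rule DERIV_power_log) (use that X0 in linarith)
  have "C1 * H X0 - Vn p a X0 <= C1 * H x - Vn p a x"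
  proof (rule DERIV_nonneg_imp_nondecreasing[OF that])
   fix y assume y: "X0 <= y" "y <= x"
   show "\<exists>d. ((\<lambda>y. C1 * H y - Vn p a y) has_real_derivative d) (at y) & 0 <= d"
    using der[OF y(1)] by (intro exI[of _ "C1 * H' y - V' y"] conjI DERIV_diff DERIV_cmult dV dH y) linarith
  qed
  moreover have "C1 * H X0 + Vn p a X0 <= C1 * H x + Vn p a x"
  proof (rule DERIV_nonneg_imp_nondecreasing[OF that])
   fix y assume y: "X0 <= y" "y <= x"
   show "\<exists>d. ((\<lambda>y. C1 * H y + Vn p a y) has_real_derivative d) (at y) & 0 <= d"
    using der[OF y(1)] by (intro exI[of _ "C1 * H' y + V' y"] conjI DERIV_add DERIV_cmult dV dH y) linarith
  qed
  moreover have "0 <= C1 * H X0" using C1 by (simp add: H_def)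
  ultimately show ?thesis by linarith
 qed
 have contV: "continuous_on UNIV (Vn p a)"
 proof -
  have "continuous_on UNIV (nonlin_prim p a)" using DERIV_nonlin_prim[OF p] by (meson DERIV_isCont continuous_at_imp_continuous_on)
  moreover have "continuous_on UNIV Lg" using DERIV_Lg by (meson DERIV_isCont continuous_at_imp_continuous_on)
  ultimately show ?thesis unfolding Vn_def[abs_def] Qn_def by (intro continuous_intros continuous_nonlin[OF p] ballI)
    (use Lg_pos p in "simp_all add: less_imp_neq[OF Lg_pos, symmetric]")
 qed
 have "compact (Vn p a ` {0..X0})" by (intro compact_continuous_image continuous_on_subset[OF contV]) auto
 then obtain C2 where C2: "!!x. x \<in> Vn p a ` {0..X0} ==> abs x <= C2" using compact_imp_bounded bounded_real by metis
 have C2_0: "abs (Vn p a X0) <= C2" using C2[of "Vn p a X0"] X0 by auto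
 then have C2nn: "C2 >= 0" by linarith
 have pos: "abs (Vn p a x) <= (C1 + C2) * (1 + Qn p a x / (Lg x)^2)" if "x >= 0" for x
 proof -
  have Hq: "Qn p a x / (Lg x)^2 = H x" using Qn_div[of p a x 2] that by (simp add: H_def)
  have Hnn: "H x >= 0" by (simp add: H_def)
  have "abs (Vn p a x) <= C2 + C1 * H x"
  proof (cases "x >= X0")
   case True
   then show ?thesis using mono[OF True] C2_0 by linarith
  next
   case False
   then have "abs (Vn p a x) <= C2" using C2[of "Vn p a x"] that by auto
   then show ?thesis using C1 Hnn by (simp add: add_increasing2)
  qed
  also have "... <= (C1 + C2) * (1 + H x)" using C1 C2nn Hnn by (simp add: algebra_simps)
  finally show ?thesis unfolding Hq .
 qed
 show ?thesis
 proof (intro exI[of _ "C1 + C2"] conjI allI)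
  show "0 <= C1 + C2" using C1 C2nn by simp
  fix x
  show "abs (Vn p a x) <= (C1 + C2) * (1 + Qn p a x / (Lg x)^2)"
  proof (cases "x >= 0")
   case False
   then show ?thesis using pos[of "- x"] Vn_minus[OF p] Qn_minus by (simp add: Lg_def)
  qed (rule pos)
 qed
qed

text \<open>The coefficient of \<open>F (phi w)\<close> in \<open>E1\<close>. With it,
  \<open>G\<close> and \<open>w * g\<close> are \<open>E2\<close> times functions of
  \<open>phi w\<close> alone.\<close>

definition E2 :: "real => real => real => real" where
 "E2 p a s = exp (- 2 * s) / (phi p a s)^2"

lemma E2_nonneg: "E2 p a s >= 0" by (simp add: E2_def)

lemma expo_mult: "p > 1 ==> expo p * (p - 1) = 2"
proof -
 assume "p > 1"
 then have "p - 1 > 0" by simp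
 moreover have "d > 0 ==> 2 / d * d = 2" for d :: real by simp
 ultimately show ?thesis unfolding expo_def by blast
qed

lemma expo_mult': "p > 1 ==> expo p * (p + 1) = 2 + 2 * expo p" using expo_mult[of p] by (simp add: algebra_simps)

lemma phi_expo: "phi p a s = exp (expo p * s) * s powr (- (a * expo p / 2))"
proof -
 have "a * (2 / d) / 2 = a / d" for d :: real by simp
 then have "a * expo p / 2 = a / (p - 1)" unfolding expo_def .
 then show ?thesis by (simp add: phi_def expo_def)
qed

lemma phi_powr:
 assumes "s > 0"
 shows "phi p a s powr r = exp (r * expo p * s) * s powr (- (r * a * expo p / 2))"
 unfolding phi_expo using assms by (simp add: powr_mult powr_powr exp_powr_real mult_ac)

lemma E2_eq:
 assumes "s > 0"
 shows "E2 p a s = exp (- 2 * (1 + expo p) * s) * s powr (a * expo p)"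
proof -
 have "(phi p a s)^2 = phi p a s powr 2" using phi_pos[OF assms, of p a] by (simp add: powr_numeral)
 also have "... = exp (2 * expo p * s) * s powr (- (a * expo p))" unfolding phi_powr[OF assms] by simp
 finally show ?thesis by (simp add: E2_def powr_minus field_simps exp_add[symmetric] exp_minus[symmetric])
qed

text \<open>This is what the logarithm in \<open>psi\<close> is made for: for \<open>w\<close> of
  order 1 the factor \<open>Lg (phi w) powr a\<close> is of order \<open>s powr a\<close>, and
  \<open>E2 * phi powr (p + 1)\<close> compensates exactly this.\<close>

lemma E2_phi:
 assumes "s > 0" "p > 1"
 shows "E2 p a s * phi p a s powr (p + 1) = s powr (- a)"
proof -
 have 1: "(p + 1) * expo p = 2 * (1 + expo p)" using expo_mult'[OF assms(2)] by (simp add: algebra_simps)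
 have "a * expo p + - ((p + 1) * a * expo p / 2) = - (a * (expo p * (p - 1)) / 2)" by (simp add: field_simps)
 then have 2: "a * expo p + - ((p + 1) * a * expo p / 2) = - a" unfolding expo_mult[OF assms(2)] by simp
 have "E2 p a s * phi p a s powr (p + 1) =
   (exp (- 2 * (1 + expo p) * s) * exp (2 * (1 + expo p) * s)) * (s powr (a * expo p) * s powr (- ((p + 1) * a * expo p / 2)))"
  unfolding E2_eq[OF assms(1)] phi_powr[OF assms(1)] 1 by simp
 also have "exp (- 2 * (1 + expo p) * s) * exp (2 * (1 + expo p) * s) = 1"
 proof -
  have "- 2 * (1 + expo p) * s = - (2 * (1 + expo p) * s)" by (simp add: algebra_simps)
  then show ?thesis using exp_minus_inverse[of "2 * (1 + expo p) * s"] by (simp only: mult.commute)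
 qed
 also have "s powr (a * expo p) * s powr (- ((p + 1) * a * expo p / 2)) = s powr (- a)" unfolding powr_add[symmetric] 2 ..
 finally show ?thesis by simp
qed

text \<open>If \<open>phi w\<close> is at most the fourth root of \<open>exp (expo p * s)\<close>,
  then \<open>Qn\<close> grows at most like \<open>exp ((1 + expo p) * s / 2)\<close> up to powers
  of \<open>s\<close>, far less than the decay \<open>exp (- 2 * (1 + expo p) * s)\<close> of
  \<open>E2\<close>. In the complementary region \<open>Lg\<close> is at least a multiple of
  \<open>s\<close>.\<close>

lemma small_region_bound:
 assumes p: "p > 1"
 shows "\<exists>S\<ge>1. \<forall>s\<ge>S. \<forall>x. abs x <= exp (expo p * s / 4) --> E2 p a s * (1 + Qn p a x) <= exp (- s)"
proof -
 define k b c where "k = expo p" and "b = abs a" and "c = ln (2::real) powr a"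
 have k: "k > 0" using expo_pos[OF p] by (simp add: k_def)
 have b: "b >= 0" and c: "c >= 0" by (auto simp: b_def c_def)
 define d where "d = a * k"
 define d' b' where "d' = abs d + 1" and "b' = b + 1"
 have d'b': "d' > 0" "b' > 0" using b by (auto simp: d'_def b'_def)
 have "eventually (\<lambda>s. s powr d' <= exp (s / 8)) at_top" using d'b' by real_asymp
 moreover have "eventually (\<lambda>s. (2 + k * s) powr b' <= exp (s / 8)) at_top" using d'b' k by real_asymp
 moreover have "eventually (\<lambda>s. c <= exp (s / 8)) at_top" by real_asymp
 moreover have "eventually (\<lambda>s::real. exp (- s / 2) + 2 * exp (- s / 4) <= 1) at_top" by real_asymp
 moreover have "eventually (\<lambda>s::real. s >= 1) at_top" by (rule eventually_ge_at_top)
 ultimately have "eventually (\<lambda>s. exp (- 2 * (1 + k) * s) * s powr d * (1 + exp ((1 + k) * s / 2) * ((2 + k * s) powr b + c)) <= exp (- s)) at_top"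
 proof eventually_elim
  case (elim s)
  have "s powr d <= s powr d'" using elim by (intro powr_mono) (auto simp: d'_def)
  then have 1: "s powr d <= exp (s / 8)" using elim by linarith
  have "(2 + k * s) powr b <= (2 + k * s) powr b'" using k elim by (intro powr_mono) (auto simp: b'_def add_increasing2)
  then have 2: "(2 + k * s) powr b + c <= 2 * exp (s / 8)" using elim by linarith
  define X where "X = exp ((1 + k) * s / 2)"
  have X: "X > 0" by (simp add: X_def)
  have X4: "exp (- 2 * (1 + k) * s) = inverse X ^ 4"
  proof -
   have "- 2 * (1 + k) * s = - (real 4 * ((1 + k) * s / 2))" by (simp add: algebra_simps)
   then show ?thesis unfolding X_def using exp_of_nat_mult[of 4 "(1 + k) * s / 2"] by (simp only: exp_minus power_inverse)
  qed
  have Xs: "inverse X <= exp (- s / 2)" using k elim unfolding X_def exp_minus[symmetric] exp_le_cancel_iff by (simp add: field_simps)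
  have Xs4: "inverse X ^ 4 <= exp (- s / 2) ^ 4" and Xs3: "inverse X ^ 3 <= exp (- s / 2) ^ 3" using X by (intro power_mono Xs; simp)+
  have "inverse X ^ 4 * s powr d * (1 + X * ((2 + k * s) powr b + c)) <=
    inverse X ^ 4 * exp (s / 8) * (1 + X * (2 * exp (s / 8)))"
   using X k c 1 2 by (intro mult_mono add_mono mult_left_mono add_nonneg_nonneg mult_nonneg_nonneg) auto
  also have "... = inverse X ^ 4 * exp (s / 8) + inverse X ^ 3 * (2 * exp (s / 8) * exp (s / 8))"
   using X by (simp add: field_simps power_numeral_reduce)
  also have "... <= exp (- s / 2) ^ 4 * exp (s / 8) + exp (- s / 2) ^ 3 * (2 * exp (s / 8) * exp (s / 8))"
   by (intro add_mono mult_right_mono Xs4 Xs3) auto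
  also have "... = exp (- s + (- 7 * s / 8)) + 2 * exp (- s + (- s / 4))" by (simp flip: exp_of_nat_mult exp_add)
  also have "... <= exp (- s) * (exp (- s / 2) + 2 * exp (- s / 4))" unfolding exp_add using elim by (simp add: algebra_simps)
  also have "... <= exp (- s)" using elim by simp
  finally show ?case unfolding X4 using X_def by simp
 qed
 then obtain S where S: "!!s. s >= S ==> exp (- 2 * (1 + k) * s) * s powr d * (1 + exp ((1 + k) * s / 2) * ((2 + k * s) powr b + c)) <= exp (- s)"
  by (auto simp: eventually_at_top_linorder)
 show ?thesis
 proof (intro exI[of _ "max 1 S"] conjI allI impI)
  fix s x assume s: "max 1 S <= s" and x: "abs x <= exp (expo p * s / 4)"
  have s0: "s > 0" using s by simp
  have "abs x powr (p + 1) <= exp (expo p * s / 4) powr (p + 1)" using x p by (intro powr_mono2) auto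
  also have "... = exp ((1 + k) * s / 2)" using expo_mult'[OF p] by (simp add: exp_powr_real k_def algebra_simps)
  finally have 1: "abs x powr (p + 1) <= exp ((1 + k) * s / 2)" .
  have L: "Lg x <= 2 + k * s"
  proof -
   have "x^2 <= (exp (expo p * s / 4))^2" using power_mono[OF x, of 2] by simp
   also have "... = exp (k * s / 2)" by (simp add: k_def power2_eq_square flip: exp_add)
   moreover have "1 <= exp (k * s / 2)" using k s0 by simp
   ultimately have "2 + x^2 <= 3 * exp (k * s / 2)" by linarith
   then have "Lg x <= ln (3 * exp (k * s / 2))" unfolding Lg_def by (subst ln_le_cancel_iff) (auto simp: add_pos_nonneg)
   also have "... = ln 3 + k * s / 2" by (simp add: ln_mult)
   also have "... <= 2 + k * s" using ln_le_minus_one[of 3] mult_pos_pos[OF k s0] by simp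
   finally show ?thesis .
  qed
  have 2: "Lg x powr a <= (2 + k * s) powr b + c"
  proof (cases "a >= 0")
   case True
   then have "Lg x powr a <= (2 + k * s) powr b" using L Lg_pos[of x] by (simp add: b_def powr_mono2)
   then show ?thesis using c by simp
  next
   case False
   then have "Lg x powr a <= c" unfolding c_def using Lg_ge[of x] by (intro powr_mono2') auto
   then show ?thesis by (simp add: add_increasing)
  qed
  have "Qn p a x <= exp ((1 + k) * s / 2) * ((2 + k * s) powr b + c)" unfolding Qn_eq by (intro mult_mono 1 2) auto
  then have "E2 p a s * (1 + Qn p a x) <= E2 p a s * (1 + exp ((1 + k) * s / 2) * ((2 + k * s) powr b + c))"
   by (intro mult_left_mono E2_nonneg) auto
  also have "... <= exp (- s)" using S[of s] s unfolding E2_eq[OF s0] d_def k_def[symmetric] by simp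
  finally show "E2 p a s * (1 + Qn p a x) <= exp (- s)" .
 qed simp
qed

lemma large_region_log:
 assumes "p > 1" "s >= 1" "exp (expo p * s / 4) <= abs x"
 shows "expo p * s / 2 <= Lg x"
proof -
 have "exp (expo p * s / 2) = (exp (expo p * s / 4))^2" by (simp add: power2_eq_square flip: exp_add)
 also have "... <= x^2" using power_mono[OF assms(3), of 2] by simp
 finally have "exp (expo p * s / 2) <= 2 + x^2" by simp
 then have "ln (exp (expo p * s / 2)) <= Lg x" unfolding Lg_def by (subst ln_le_cancel_iff) (auto simp: add_pos_nonneg)
 then show ?thesis by simp
qed

text \<open>The contribution of the nonlinearity to the derivative of the functional, per unit of \<open>ka rho\<close>.\<close>

definition Nl :: "real => real => real => real => real => real" where
 "Nl p a s \<nu> x = 2 * (1 + lam p a s) * (E2 p a s * nonlin_prim p a x) - lam p a s * (E2 p a s * Qn p a x)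
   + (p + 3) / 2 * \<nu> * (E2 p a s * nonlin_prim p a x) - \<nu> * (E2 p a s * Qn p a x)"

text \<open>Inserting the expansion of the primitive cancels the leading terms, because
  \<open>expo p * (p + 1) = 2 + 2 * expo p\<close>. The main survivor is the mismatch between
  \<open>1 / s\<close> and \<open>2 * expo p / Lg x\<close>, zero exactly when
  \<open>Lg x = 2 * expo p * s\<close>. The gain
  \<open>- (p - 1) / (2 * (p + 1)) * \<nu> * Qn\<close> is \<open>(p + 3) / 2\<close> divided by
  \<open>p + 1\<close>, minus 1.\<close>

lemma Nl_eq:
 fixes p a s \<nu> x :: real
 assumes p: "p > 1" and s: "s > 0"
 defines "d == Vn p a x - 2 * a / (p + 1)^2 * (Qn p a x / Lg x)"
 shows "Nl p a s \<nu> x = E2 p a s * (a / (p + 1) * Qn p a x * (1 / s - 2 * expo p / Lg x) + expo p * (p + 1) * Vn p a x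
   - a * expo p / s * d + \<nu> * ((p + 3) / 2 * d - (p - 1) / (2 * (p + 1)) * Qn p a x))"
proof -
 define P where "P = p + 1"
 define k where "k = expo p"
 have P: "P > 2" "p = P - 1" using p by (auto simp: P_def)
 have kP: "k * P = 2 + 2 * k" using expo_mult'[OF p] by (simp add: P_def k_def)
 define F where "F = nonlin_prim p a x"
 define Q where "Q = Qn p a x"
 define M where "M = Q / Lg x"
 define V where "V = Vn p a x"
 have F: "F = Q / P + d" by (simp add: F_def d_def Vn_def P_def Q_def)
 have d: "d = V - 2 * a / P^2 * M" by (simp add: d_def V_def P_def M_def Q_def)
 have "2 * (1 + lam p a s) * F - lam p a s * Q = a / P * Q * (1 / s) - 2 * k * a / P * M + k * P * V - a * k / s * d"
 proof -
  have r: "(X + Y * (1 / s)) * F = X * d + X * Q / P + Y * (1 / s) * d + Y * (1 / s) * Q / P" for X Y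
   unfolding F by (simp add: algebra_simps add_divide_distrib)
  have "2 * (1 + lam p a s) * F - lam p a s * Q =
    ((2 + 2 * k) + - (a * k) * (1 / s)) * F - k * Q + a * k * (1 / s) * Q / 2"
   unfolding lam_def k_def[symmetric] by (simp add: algebra_simps)
  also have "... = (2 + 2 * k) * d - a * k / s * d + ((2 + 2 * k) * Q / P - k * Q) + (- a * k / s * Q / P + a * k / s * Q / 2)"
   unfolding r by (simp add: algebra_simps)
  also have "(2 + 2 * k) * Q / P = k * Q" using P by (simp flip: kP)
  finally have 1: "2 * (1 + lam p a s) * F - lam p a s * Q = (2 + 2 * k) * d - a * k / s * d + (- a * k / s * Q / P + a * k / s * Q / 2)" by simp
  have 2: "- a * k / s * Q / P + a * k / s * Q / 2 = a / s * Q * (k * (P - 2)) / (2 * P)" using P s by (simp add: field_simps)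
  have 3: "k * (P - 2) = 2" using kP by (simp add: algebra_simps)
  have 4: "(2 + 2 * k) * d = k * P * V - 2 * k * a / P * M" unfolding kP[symmetric] d using P by (simp add: field_simps power2_eq_square)
  show ?thesis unfolding 1 2 3 4 by (simp add: field_simps)
 qed
 moreover have "(p + 3) / 2 * F - Q = (p + 3) / 2 * d - (p - 1) / (2 * P) * Q" unfolding F P(2) using P by (simp add: field_simps)
 then have "(p + 3) / 2 * \<nu> * F - \<nu> * Q = \<nu> * ((p + 3) / 2 * d - (p - 1) / (2 * P) * Q)"
  by (metis (no_types, opaque_lifting) mult.assoc mult.commute right_diff_distrib)
 ultimately have "2 * (1 + lam p a s) * F - lam p a s * Q + ((p + 3) / 2 * \<nu> * F - \<nu> * Q) =
   a / P * Q * (1 / s) - 2 * k * a / P * M + k * P * V - a * k / s * d + \<nu> * ((p + 3) / 2 * d - (p - 1) / (2 * P) * Q)" by simp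
 moreover have "a / P * Q * (1 / s - 2 * k / Lg x) = a / P * Q * (1 / s) - 2 * k * a / P * M" by (simp add: M_def right_diff_distrib)
 moreover have "Nl p a s \<nu> x = E2 p a s * (2 * (1 + lam p a s) * F - lam p a s * Q + ((p + 3) / 2 * \<nu> * F - \<nu> * Q))"
  by (simp add: Nl_def F_def Q_def algebra_simps)
 ultimately show ?thesis by (simp add: P_def k_def Q_def V_def)
qed

text \<open>Below the threshold every term but the gain is \<open>O(exp (- s))\<close> by
  \<open>small_region_bound\<close>. Above it \<open>1 / Lg x <= 2 / (expo p * s)\<close> turns the
  remainder \<open>Vn\<close> into \<open>Qn / s^2\<close> and the errors proportional to \<nu> into
  \<open>\<nu> * Qn / s\<close>. The mismatch is kept unestimated, as its treatment depends on what
  is known about \<open>w\<close>.\<close>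

lemma Nl_bound:
 assumes p: "p > 1"
 shows "\<exists>C\<ge>0. \<exists>S\<ge>1. \<forall>s\<ge>S. \<forall>x \<nu>. 0 <= \<nu> --> \<nu> <= 1 -->
  (abs x < exp (expo p * s / 4) --> Nl p a s \<nu> x <= C * exp (- s) - (p - 1) / (2 * (p + 1)) * \<nu> * (E2 p a s * Qn p a x)) &
  (exp (expo p * s / 4) <= abs x --> Nl p a s \<nu> x <= C * exp (- s) +
    E2 p a s * Qn p a x * (a / (p + 1) * (1 / s - 2 * expo p / Lg x) + C / s^2 + C * \<nu> / s - (p - 1) / (2 * (p + 1)) * \<nu>))"
proof -
 obtain Cv where Cv: "Cv >= 0" "!!x. abs (Vn p a x) <= Cv * (1 + Qn p a x / (Lg x)^2)" using Vn_bound[OF p] by blast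
 obtain S where S: "S >= 1" "!!s x. s >= S ==> abs x <= exp (expo p * s / 4) ==> E2 p a s * (1 + Qn p a x) <= exp (- s)"
  using small_region_bound[OF p] by blast
 define k where "k = expo p"
 have k: "k > 0" using expo_pos[OF p] by (simp add: k_def)
 define l where "l = ln (2::real)"
 have l: "0 < l" by (simp add: l_def)
 define Cd where "Cd = 2 * abs a / (p + 1)^2 + Cv + Cv / l"
 have Cd: "Cd >= 0" "Cd >= Cv" using Cv l p by (auto simp: Cd_def)
 have d: "\<bar>Vn p a x - 2 * a / (p + 1)^2 * (Qn p a x / Lg x)\<bar> <= Cd * (1 + Qn p a x / Lg x)" for x
 proof -
  define M where "M = Qn p a x / Lg x"
  have M: "M >= 0" using Qn_nonneg Lg_pos[of x] by (simp add: M_def)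
  have "Qn p a x / (Lg x)^2 = M / Lg x" by (simp add: M_def power2_eq_square)
  also have "... <= M / l" using Lg_ge[of x] l M by (intro divide_left_mono) (auto simp: l_def Lg_pos)
  finally have "Cv * (1 + Qn p a x / (Lg x)^2) <= Cv * (1 + M / l)" by (intro mult_left_mono Cv) auto
  then have "abs (Vn p a x) <= Cv + Cv / l * M" using Cv(2)[of x] by (simp add: algebra_simps)
  moreover have "\<bar>2 * a / (p + 1)^2 * M\<bar> <= 2 * abs a / (p + 1)^2 * M" using M by (simp add: abs_mult)
  ultimately have "abs (Vn p a x) + \<bar>2 * a / (p + 1)^2 * M\<bar> <= (Cv + Cv / l * M) + 2 * abs a / (p + 1)^2 * M" by (rule add_mono)
  then have "\<bar>Vn p a x - 2 * a / (p + 1)^2 * M\<bar> <= (Cv + Cv / l * M) + 2 * abs a / (p + 1)^2 * M"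
   by (rule order_trans[OF abs_triangle_ineq4])
  then have "\<bar>Vn p a x - 2 * a / (p + 1)^2 * M\<bar> <= Cv + (2 * abs a / (p + 1)^2 + Cv / l) * M" by (simp add: distrib_right)
  also have "... <= Cd + Cd * M" by (intro add_mono mult_right_mono M Cd(2)) (use Cv in "auto simp: Cd_def")
  finally show ?thesis by (simp add: M_def algebra_simps)
 qed
 define A0 A1 A2 A3 where "A0 = abs a / (p + 1) * (1 + 2 * k / l)" and "A1 = k * (p + 1) * Cv" and "A2 = abs a * k * Cd" and "A3 = (p + 3) / 2 * Cd"
 have pk: "0 <= A0" "0 <= A1" "0 <= A2" "0 <= A3" using k p l Cv Cd by (auto simp: A0_def A1_def A2_def A3_def)
 define C1 where "C1 = A1 * (4 / k^2) + A2 * (2 / k)"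
 define C2 where "C2 = A3 * (2 / k)"
 define C where "C = A0 + A1 * (1 + 1 / l^2) + (A2 + A3) * (1 + 1 / l) + (C1 + C2)"
 have C12: "0 <= C1" "0 <= C2" using pk k by (simp_all add: C1_def C2_def)
 have C0: "A0 + A1 * (1 + 1 / l^2) + (A2 + A3) * (1 + 1 / l) <= C" "A1 + A2 + A3 <= C" "C1 <= C" "C2 <= C" "0 <= C"
 proof -
  define X Y where "X = A1 * (1 + 1 / l^2)" and "Y = (A2 + A3) * (1 + 1 / l)"
  have "A1 <= X" "A2 + A3 <= Y" using pk l by (simp_all add: X_def Y_def distrib_left)
  then show "A0 + A1 * (1 + 1 / l^2) + (A2 + A3) * (1 + 1 / l) <= C" "A1 + A2 + A3 <= C" "C1 <= C" "C2 <= C" "0 <= C"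
   unfolding C_def X_def[symmetric] Y_def[symmetric] using pk C12 by linarith+
 qed
 show ?thesis
 proof (rule exI[of _ C], rule conjI[OF C0(5)], rule exI[of _ S], rule conjI[OF S(1)], intro allI impI conjI)
  fix s x \<nu> :: real assume s: "S <= s" and nu: "0 <= \<nu>" "\<nu> <= 1"
  have s1: "s >= 1" "s > 0" using s S(1) by auto
  define Q where "Q = Qn p a x"
  define D where "D = Vn p a x - 2 * a / (p + 1)^2 * (Q / Lg x)"
  define c3 where "c3 = (p - 1) / (2 * (p + 1))"
  define X where "X = a / (p + 1) * (1 / s - 2 * k / Lg x)"
  have Q: "Q >= 0" using Qn_nonneg by (simp add: Q_def)
  have L: "Lg x >= l" "Lg x > 0" using Lg_ge[of x] Lg_pos by (auto simp: l_def)
  have Eq: "Nl p a s \<nu> x = E2 p a s * (Q * X + k * (p + 1) * Vn p a x - a * k / s * D + \<nu> * ((p + 3) / 2 * D - c3 * Q))"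
   using Nl_eq[OF p s1(2), of a \<nu> x] by (simp add: Q_def D_def c3_def X_def k_def mult_ac)
  have D: "abs D <= Cd * (1 + Q / Lg x)" using d[of x] by (simp add: D_def Q_def)
  have V: "abs (Vn p a x) <= Cv * (1 + Q / (Lg x)^2)" using Cv(2)[of x] by (simp add: Q_def)
  have t1: "k * (p + 1) * Vn p a x <= A1 * (1 + Q / (Lg x)^2)"
  proof -
   have "Vn p a x <= Cv * (1 + Q / (Lg x)^2)" using V by linarith
   then have "k * (p + 1) * Vn p a x <= k * (p + 1) * (Cv * (1 + Q / (Lg x)^2))" by (intro mult_left_mono) (use k p in auto)
   then show ?thesis by (simp add: A1_def mult.assoc)
  qed
  have t2: "- (a * k / s * D) <= abs a * k / s * (Cd * (1 + Q / Lg x))"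
  proof -
   have "\<bar>a * k / s * D\<bar> = abs a * k / s * abs D" using k s1 by (simp add: abs_mult)
   also have "... <= abs a * k / s * (Cd * (1 + Q / Lg x))" using k s1 by (intro mult_left_mono D) auto
   finally show ?thesis by linarith
  qed
  have t3: "\<nu> * ((p + 3) / 2 * D - c3 * Q) <= \<nu> * ((p + 3) / 2) * (Cd * (1 + Q / Lg x)) - c3 * \<nu> * Q"
  proof -
   have "\<nu> * ((p + 3) / 2) * D <= \<nu> * ((p + 3) / 2) * (Cd * (1 + Q / Lg x))" using D nu p by (intro mult_left_mono) auto
   then show ?thesis by (simp add: algebra_simps)
  qed
  note t = t1 t2 t3
  {
   assume x: "abs x < exp (expo p * s / 4)"
   have il: "1 / Lg x <= 1 / l" using L l by (intro divide_left_mono) auto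
   have il2: "1 / (Lg x)^2 <= 1 / l^2" using L l by (intro divide_left_mono power_mono) auto
   have q1: "1 + Q / (Lg x)^2 <= (1 + 1 / l^2) * (1 + Q)"
   proof -
    have "Q / (Lg x)^2 <= (1 / l^2) * Q" using mult_right_mono[OF il2 Q] by simp
    moreover have "(1 + 1 / l^2) * (1 + Q) = 1 + Q + 1 / l^2 + 1 / l^2 * Q" by (simp add: algebra_simps add_divide_distrib)
    moreover have "0 <= 1 / l^2" using l by simp
    ultimately show ?thesis using Q by linarith
   qed
   have q2: "1 + Q / Lg x <= (1 + 1 / l) * (1 + Q)"
   proof -
    have "Q / Lg x <= (1 / l) * Q" using mult_right_mono[OF il Q] by simp
    moreover have "(1 + 1 / l) * (1 + Q) = 1 + Q + 1 / l + 1 / l * Q" by (simp add: algebra_simps add_divide_distrib)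
    moreover have "0 <= 1 / l" using l by simp
    ultimately show ?thesis using Q by linarith
   qed
   have "\<bar>1 / s - 2 * k / Lg x\<bar> <= 1 + 2 * k / l"
   proof -
    have "1 / s <= 1" "0 <= 1 / s" using s1 by auto
    moreover have "2 * k / Lg x <= 2 * k / l" "0 <= 2 * k / Lg x" using mult_left_mono[OF il, of "2 * k"] k L by auto
    ultimately show ?thesis by linarith
   qed
   then have "abs X <= A0" unfolding X_def A0_def abs_mult using p by (intro mult_mono) auto
   then have "X * Q <= A0 * Q" by (intro mult_right_mono Q) linarith
   also have "... <= A0 * (1 + Q)" using pk by (intro mult_left_mono) auto
   finally have u1: "Q * X <= A0 * (1 + Q)" by (simp add: mult.commute)
   have u2: "A1 * (1 + Q / (Lg x)^2) <= A1 * ((1 + 1 / l^2) * (1 + Q))" by (rule mult_left_mono[OF q1 pk(2)])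
   have u3: "abs a * k / s * (Cd * (1 + Q / Lg x)) <= A2 * ((1 + 1 / l) * (1 + Q))"
   proof -
    have "abs a * k / s * (Cd * (1 + Q / Lg x)) = (1 / s) * (A2 * (1 + Q / Lg x))" by (simp add: A2_def)
    also have "... <= 1 * (A2 * ((1 + 1 / l) * (1 + Q)))" by (intro mult_mono mult_left_mono[OF q2 pk(3)]) (use s1 Q L pk in auto)
    finally show ?thesis by simp
   qed
   have u4: "\<nu> * ((p + 3) / 2) * (Cd * (1 + Q / Lg x)) <= A3 * ((1 + 1 / l) * (1 + Q))"
   proof -
    have "\<nu> * ((p + 3) / 2) * (Cd * (1 + Q / Lg x)) = \<nu> * (A3 * (1 + Q / Lg x))" by (simp add: A3_def)
    also have "... <= 1 * (A3 * ((1 + 1 / l) * (1 + Q)))" by (intro mult_mono mult_left_mono[OF q2 pk(4)]) (use nu Q L pk in auto)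
    finally show ?thesis by simp
   qed
   define c0 where "c0 = A0 + A1 * (1 + 1 / l^2) + (A2 + A3) * (1 + 1 / l)"
   have c0: "0 <= c0" "c0 <= C" using pk l C0 by (auto simp: c0_def)
   have "Q * X + k * (p + 1) * Vn p a x - a * k / s * D + \<nu> * ((p + 3) / 2 * D - c3 * Q) <= c0 * (1 + Q) - c3 * \<nu> * Q"
   proof -
    have "c0 * (1 + Q) = A0 * (1 + Q) + A1 * ((1 + 1 / l^2) * (1 + Q))
     + A2 * ((1 + 1 / l) * (1 + Q)) + A3 * ((1 + 1 / l) * (1 + Q))" unfolding c0_def by (simp only: distrib_right mult.assoc)
    moreover note u1 order_trans[OF t1 u2] order_trans[OF t2 u3] order_trans[OF t3 diff_right_mono[OF u4]]
    ultimately show ?thesis by linarith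
   qed
   then have "Nl p a s \<nu> x <= E2 p a s * (c0 * (1 + Q) - c3 * \<nu> * Q)" unfolding Eq by (rule mult_left_mono[OF _ E2_nonneg])
   also have "... = c0 * (E2 p a s * (1 + Q)) - c3 * \<nu> * (E2 p a s * Q)" by (simp add: algebra_simps)
   also have "c0 * (E2 p a s * (1 + Q)) <= C * exp (- s)"
    using S(2)[OF s less_imp_le[OF x]] c0 Q E2_nonneg[of p a s] by (intro mult_mono) (auto simp: Q_def)
   finally show "Nl p a s \<nu> x <= C * exp (- s) - (p - 1) / (2 * (p + 1)) * \<nu> * (E2 p a s * Qn p a x)" by (simp add: c3_def Q_def)
  next
   assume x: "exp (expo p * s / 4) <= abs x"
   have Lk: "k * s / 2 <= Lg x" using large_region_log[OF p s1(1) x] by (simp add: k_def)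
   have ks: "0 < k * s / 2" using k s1 by simp
   have il: "1 / Lg x <= 2 / (k * s)" using divide_left_mono[OF Lk, of 1] ks L by simp
   have il2: "1 / (Lg x)^2 <= 4 / (k^2 * s^2)" using power_mono[OF il, of 2] L by (simp add: power_divide power_mult_distrib)
   have u2: "A1 * (1 + Q / (Lg x)^2) <= A1 + A1 * (4 / k^2) * (Q / s^2)"
   proof -
    have "Q / (Lg x)^2 <= 4 / k^2 * (Q / s^2)" using mult_right_mono[OF il2 Q] by (simp add: mult_ac)
    from mult_left_mono[OF this pk(2)] show ?thesis by (simp only: distrib_left mult_1_right mult.assoc add_left_mono)
   qed
   have QL: "Q / Lg x <= 2 / k * (Q / s)" using mult_right_mono[OF il Q] by (simp add: mult_ac)
   have u3: "abs a * k / s * (Cd * (1 + Q / Lg x)) <= A2 + A2 * (2 / k) * (Q / s^2)"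
   proof -
    have "abs a * k / s * (Cd * (1 + Q / Lg x)) = (1 / s) * A2 + A2 / s * (Q / Lg x)" by (simp add: A2_def algebra_simps)
    also have "... <= 1 * A2 + A2 / s * (2 / k * (Q / s))" by (intro add_mono mult_right_mono mult_left_mono QL) (use s1 pk in auto)
    finally show ?thesis using k by (simp add: power2_eq_square mult_ac)
   qed
   have u4: "\<nu> * ((p + 3) / 2) * (Cd * (1 + Q / Lg x)) <= A3 + A3 * (2 / k) * (\<nu> * Q / s)"
   proof -
    have "\<nu> * H * (Cd * (1 + R)) = \<nu> * (H * Cd) + H * Cd * \<nu> * R" for H R by (simp add: algebra_simps)
    then have "\<nu> * ((p + 3) / 2) * (Cd * (1 + Q / Lg x)) = \<nu> * (A3) + A3 * \<nu> * (Q / Lg x)" unfolding A3_def .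
    also have "... <= 1 * (A3) + A3 * \<nu> * (2 / k * (Q / s))" by (intro add_mono mult_right_mono mult_left_mono QL) (use nu pk in auto)
    finally show ?thesis by (simp add: mult_ac)
   qed
   define c0 where "c0 = A1 + A2 + A3"
   have c0: "0 <= c0" "c0 <= C" using pk C0 by (auto simp: c0_def)
   have "Q * X + k * (p + 1) * Vn p a x - a * k / s * D + \<nu> * ((p + 3) / 2 * D - c3 * Q)
     <= c0 + Q * X + C1 * (Q / s^2) + C2 * (\<nu> * Q / s) - c3 * \<nu> * Q"
   proof -
    have "c0 + C1 * (Q / s^2) + C2 * (\<nu> * Q / s) = (A1 + A1 * (4 / k^2) * (Q / s^2))
     + (A2 + A2 * (2 / k) * (Q / s^2)) + (A3 + A3 * (2 / k) * (\<nu> * Q / s))" unfolding c0_def C1_def C2_def by (simp only: distrib_right)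
    moreover note order_trans[OF t1 u2] order_trans[OF t2 u3] order_trans[OF t3 diff_right_mono[OF u4]]
    ultimately show ?thesis by linarith
   qed
   also have "... <= c0 + Q * X + C * (Q / s^2) + C * (\<nu> * Q / s) - c3 * \<nu> * Q"
    by (intro add_mono diff_mono mult_right_mono C0(3,4) order_refl) (use Q nu s1 in auto)
   also have "... = c0 + Q * (X + C / s^2 + C * \<nu> / s - c3 * \<nu>)" by (simp add: algebra_simps)
   finally have "Nl p a s \<nu> x <= E2 p a s * (c0 + Q * (X + C / s^2 + C * \<nu> / s - c3 * \<nu>))"
    unfolding Eq by (rule mult_left_mono[OF _ E2_nonneg])
   also have "... = c0 * (E2 p a s * 1) + E2 p a s * Q * (X + C / s^2 + C * \<nu> / s - c3 * \<nu>)" by (simp add: algebra_simps)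
   also have "c0 * (E2 p a s * 1) <= C * exp (- s)"
   proof -
    have "E2 p a s * 1 <= E2 p a s * (1 + Qn p a 0)" using E2_nonneg[of p a s] by (simp add: Qn_def)
    also have "... <= exp (- s)" by (rule S(2)[OF s]) simp
    finally show ?thesis using c0 E2_nonneg[of p a s] by (intro mult_mono) auto
   qed
   finally show "Nl p a s \<nu> x <= C * exp (- s) +
     E2 p a s * Qn p a x * (a / (p + 1) * (1 / s - 2 * expo p / Lg x) + C / s^2 + C * \<nu> / s - (p - 1) / (2 * (p + 1)) * \<nu>)"
    by (simp add: c3_def Q_def X_def k_def)
  }
 qed
qed

section \<open>The quadratic part of the rate, and the size of \<open>Nl\<close> for both choices of
  \<open>nu\<close>\<close>

lemma young:
 fixes A B c :: real
 assumes "c > 0"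
 shows "A * B <= c / 4 * A^2 + B^2 / c"
proof -
 have "c / 4 * A^2 + B^2 / c - A * B = (c * A / 2 - B)^2 / c" using assms by (simp add: field_simps power2_eq_square)
 then show ?thesis using assms by (smt (verit) divide_nonneg_pos zero_le_power2)
qed

text \<open>With \<open>b = 1 / k + 2\<close> the energy outweighs the virial term by
  \<open>nu / (2 * k)\<close> in \<open>(R * c)^2\<close> and by \<open>nu * k0 / k\<close> in
  \<open>R * w^2\<close>. Together with \<open>- 2 * k * z^2\<close> these are the gains against
  which all other terms are to be estimated.\<close>

lemma rate_expand:
 fixes k L l1 nu nu' R y z c w b k0 NG G W eta :: real
 assumes k: "k > 0" and b: "b = 1 / k + 2"
 defines "M == b * nu^2 - nu' + (L / 2 + L * k - L^2 / 4 - l1) - nu * (1 + L + 2 * k)"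
 shows "R * (- b * nu * (z^2 / 2 + R * c^2 / 2 + k0 * w^2 - G) + (b * nu^2 - nu') * (w * z)) +
   (- 2 * k * z^2 + R * (L * z^2 + L * (y * c * z) + NG + (L / 2 + L * k - L^2 / 4 - l1) * (w * z))) +
   - nu * (R * (z^2 - R * c^2 - 2 * k0 * w^2 + W + 2 * (y * c * z) + (1 + L + 2 * k) * (w * z) - (L^2 / 4 + l1) * w^2)
    - 4 * k * (w * z) + L * k * w^2) +
   eta * (R * (2 * y * w * c + (1 + 2 * k) * w^2) - 2 * k * w^2)
  = R * (NG + b * nu * G - nu * W) - 2 * k * z^2 + L * (R * z^2) - R * (b * nu / 2 + nu) * z^2
   - nu / (2 * k) * (R * c)^2 + (nu * (L^2 / 4 + l1) + eta * (1 + 2 * k)) * (R * w^2) - nu * k0 / k * (R * w^2)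
   - nu * L * k * w^2 - 2 * k * eta * w^2 + z * (R * M * w) + z * (4 * k * nu * w)
   + z * (R * (L - 2 * nu) * (y * c)) + (R * c) * (2 * eta * (y * w))"
proof -
 have 1: "nu / (2 * k) = nu * (b / 2 - 1)" and 2: "nu * k0 / k = nu * k0 * (b - 2)" using k by (simp_all add: b field_simps)
 show ?thesis unfolding 1 2 M_def by (simp add: algebra_simps power2_eq_square)
qed

lemma rate_lin:
 fixes N :: real
 assumes "0 <= q0" "t1 <= k / 4 * Z + v16" "t2 <= k / 4 * Z + y8" "t3 <= y8 + v3" "t4 <= k / 4 * Z + m1"
  "t5 <= k / 8 * Z" "- u6 <= v2" "x7 <= vh" "z8 <= k / 8 * Z" "z9 <= y4" "0 <= v1"
  "y8 + y8 + y4 = y2" "vh + vh = vf" "v3 = 32 * v1 + v2" "e2 = 64 * v1 + 2 * v2" "v16 = 16 * v1" "x7 = m1 + x8"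
 shows "N - 2 * k * Z + t5 - q0 - y2 + x8 - vf - u6 - e2 + t4 + t1 + t2 + t3 <= N - k * Z - (z8 + z9) - vh" using assms by linarith

text \<open>Young's inequality with the following budget. Of \<open>2 * k * z^2\<close> one half is
  spent: \<open>k / 4\<close> on each product of \<open>z\<close> with \<open>nu * w\<close>,
  \<open>y * c\<close> and \<open>M * w\<close>, and \<open>k / 8\<close> each on
  \<open>L * R * z^2\<close> and on the part of the new dissipation in \<open>z\<close>. Of
  \<open>nu / (2 * k) * (R * c)^2\<close> a quarter goes to each of the two products containing
  \<open>c\<close> and half to the new dissipation. Half of \<open>nu * k0 / k * R * w^2\<close> is
  left over, and \<open>w^2\<close> without \<open>R\<close> is paid by \<open>eta\<close>.\<close>

lemma rate_quad_ineq:
 fixes k L l1 La nu nu' nu1 R y z c w b k0 NG G W c0 de :: real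
 assumes k: "k > 0" and b: "b = 1 / k + 2" and k0: "k0 > 0" and R: "0 <= R" "R <= 1" and y: "abs y <= 1"
  and nu: "nu > 0" and L: "abs L <= La" and l1: "abs l1 <= La" and nu1: "abs nu' <= nu1"
  and c0: "0 < c0" "c0 <= 1 / (4 * k)" "c0 <= k0 / (4 * k)"
  and s1: "La <= k / 8" "c0 * nu <= k / 8" "(La + 2 * nu)^2 <= nu / 8" "8 * (32 * nu + La) <= 1"
  and s2: "(b * nu^2 + nu1 + (La / 2 + La * k + La^2 / 4 + La) + nu * (1 + La + 2 * k))^2 / k
    + nu * (La^2 / 4 + La) + (32 * nu^2 + nu * La) * (1 + 2 * k) <= nu * k0 / (2 * k)"
 shows "R * (- b * nu * (z^2 / 2 + R * c^2 / 2 + k0 * w^2 - G) + (b * nu^2 - nu') * (w * z)) +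
   (- 2 * k * z^2 + R * (L * z^2 + L * (y * c * z) + NG + (L / 2 + L * k - L^2 / 4 - l1) * (w * z))) +
   - nu * (R * (z^2 - R * c^2 - 2 * k0 * w^2 + W + 2 * (y * c * z) + (1 + L + 2 * k) * (w * z) - (L^2 / 4 + l1) * w^2)
    - 4 * k * (w * z) + L * k * w^2) +
   (32 * nu^2 + nu * La) * (R * (2 * y * w * c + (1 + 2 * k) * w^2) - 2 * k * w^2)
  <= R * (NG + b * nu * G - nu * W) - k * z^2 - c0 * nu * (R * (z^2 + R * c^2)) - nu * k0 / (2 * k) * (R * w^2)"
proof -
 define M where "M = b * nu^2 - nu' + (L / 2 + L * k - L^2 / 4 - l1) - nu * (1 + L + 2 * k)"
 define M1 where "M1 = b * nu^2 + nu1 + (La / 2 + La * k + La^2 / 4 + La) + nu * (1 + La + 2 * k)"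
 \<comment> \<open>The \<open>ibp\<close> term yields \<open>2 * k * eta * w^2\<close>, that is
   \<open>64 * nu^2 * k + 2 * nu * La * k\<close> times \<open>w^2\<close>. It has to cover
   \<open>16 * nu^2 * k\<close> from the product \<open>z * w\<close>, \<open>nu * La * k\<close>
   from the term linear in \<open>L\<close>, and \<open>32 * nu^2 * k + nu * La * k\<close> from the
   product \<open>w * c\<close> that \<open>ibp\<close> itself introduces.\<close>
 define eta where "eta = 32 * nu^2 + nu * La"
 have La: "La >= 0" using L by linarith
 have bp: "b > 0" using k by (simp add: b add_pos_pos)
 have L2: "L^2 <= La^2" using L by (simp add: abs_le_square_iff[symmetric])
 have M: "abs M <= M1"
 proof -
  have "\<bar>L * k\<bar> <= La * k" using L k by (simp add: abs_mult)
  moreover have "\<bar>nu * (1 + L + 2 * k)\<bar> <= nu * (1 + La + 2 * k)" using L k nu unfolding abs_mult by (intro mult_mono) auto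
  moreover have "0 <= b * nu^2" "0 <= L^2" using bp by auto
  ultimately show ?thesis using L2 L l1 nu1 unfolding M_def M1_def by linarith
 qed
 then have M2: "M^2 <= M1^2" using power2_abs[of M] by (metis abs_ge_zero power_mono)
 define Z Y V where "Z = z^2" and "Y = (R * c)^2" and "V = w^2"
 have nn: "Z >= 0" "Y >= 0" "V >= 0" by (auto simp: Z_def Y_def V_def)
 have RZ: "R * Z <= Z" "0 <= R * Z" using R nn by (auto simp: mult_left_le_one_le)
 have y2: "y^2 <= 1" using y by (simp add: abs_square_le_1)
 have f1: "z * (4 * k * nu * w) <= k / 4 * Z + 16 * k * nu^2 * V"
 proof -
  have "(4 * k * nu * w)^2 / k = 16 * k * nu^2 * V" using k by (simp add: V_def power2_eq_square)
  then show ?thesis using young[OF k, of z "4 * k * nu * w"] by (simp add: Z_def)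
 qed
 have f2: "z * (R * (L - 2 * nu) * (y * c)) <= k / 4 * Z + nu / (8 * k) * Y"
 proof -
  have "\<bar>L - 2 * nu\<bar> <= \<bar>La + 2 * nu\<bar>" using L nu by linarith
  then have "(L - 2 * nu)^2 <= (La + 2 * nu)^2" by (simp add: abs_le_square_iff)
  then have "(L - 2 * nu)^2 <= nu / 8" using s1(3) by linarith
  then have "(L - 2 * nu)^2 * y^2 <= nu / 8 * 1" using y2 nu by (intro mult_mono) auto
  then have "(L - 2 * nu)^2 * y^2 * (Y / k) <= nu / 8 * 1 * (Y / k)" using nn k by (intro mult_right_mono) auto
  moreover have "(R * (L - 2 * nu) * (y * c))^2 / k = (L - 2 * nu)^2 * y^2 * (Y / k)" by (simp add: Y_def power_mult_distrib)
  ultimately show ?thesis using young[OF k, of z "R * (L - 2 * nu) * (y * c)"] k by (simp add: Z_def)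
 qed
 have f3: "(R * c) * (2 * eta * (y * w)) <= nu / (8 * k) * Y + (k * nu * (32 * nu + La)) * V"
 proof -
  have c: "nu / (2 * k) > 0" using nu k by simp
  have "(2 * eta * (y * w))^2 / (nu / (2 * k)) = (8 * (32 * nu + La)) * (k * nu * (32 * nu + La)) * (y^2 * V)"
   using nu k by (simp add: eta_def V_def field_simps power2_eq_square)
  also have "... <= 1 * (k * nu * (32 * nu + La)) * (1 * V)" using s1(4) k nu La y2 nn by (intro mult_mono mult_nonneg_nonneg) auto
  finally show ?thesis using young[OF c, of "R * c" "2 * eta * (y * w)"] by (simp add: Y_def)
 qed
 have f4: "z * (R * M * w) <= k / 4 * Z + M1^2 / k * (R * V)"
 proof -
  have "(R * M * w)^2 / k = (M^2 / k) * (R * (R * V))" by (simp add: V_def power2_eq_square)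
  also have "... <= (M1^2 / k) * (1 * (R * V))"
   using M2 k R nn by (intro mult_mono divide_right_mono mult_right_mono mult_nonneg_nonneg) auto
  finally show ?thesis using young[OF k, of z "R * M * w"] by (simp add: Z_def)
 qed
 have f5: "L * (R * Z) <= k / 8 * Z"
 proof -
  have "L * (R * Z) <= k / 8 * (R * Z)" using L s1(1) RZ by (intro mult_right_mono) auto
  also have "... <= k / 8 * Z" using RZ k by (intro mult_left_mono) auto
  finally show ?thesis .
 qed
 have f6: "- (nu * L * k * V) <= nu * La * k * V"
 proof -
  have "nu * - L <= nu * La" using L nu by (intro mult_left_mono) auto
  then have "nu * - L * k <= nu * La * k" using k by (intro mult_right_mono) auto
  then have "nu * - L * k * V <= nu * La * k * V" by (rule mult_right_mono[OF _ nn(3)])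
  then show ?thesis by simp
 qed
 have f7: "(M1^2 / k + (nu * (L^2 / 4 + l1) + eta * (1 + 2 * k))) * (R * V) <= nu * k0 / (2 * k) * (R * V)"
 proof (rule mult_right_mono)
  have "nu * (L^2 / 4 + l1) <= nu * (La^2 / 4 + La)" using nu L2 l1 by (intro mult_left_mono) auto
  then show "M1^2 / k + (nu * (L^2 / 4 + l1) + eta * (1 + 2 * k)) <= nu * k0 / (2 * k)"
   using s2 unfolding M1_def[symmetric] eta_def[symmetric] by linarith
 qed (use R nn in auto)
 have f8: "c0 * nu * (R * Z) <= k / 8 * Z" using s1(2) RZ c0 nu k by (intro mult_mono) auto
 have f9: "c0 * nu * Y <= nu / (4 * k) * Y"
 proof (rule mult_right_mono[OF _ nn(2)])
  show "c0 * nu <= nu / (4 * k)" using mult_right_mono[OF c0(2), of nu] nu by simp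
 qed
 have f0: "0 <= R * (b * nu / 2 + nu) * Z" using R bp nu nn by auto
 have f10: "0 <= nu^2 * k * V" using nu k nn by auto
 have i1: "nu / (8 * k) * Y + nu / (8 * k) * Y + nu / (4 * k) * Y = nu / (2 * k) * Y" using k by (simp add: field_simps)
 have i2: "nu * k0 / (2 * k) * (R * V) + nu * k0 / (2 * k) * (R * V) = nu * k0 / k * (R * V)" using k by (simp add: field_simps)
 have i3: "k * nu * (32 * nu + La) * V = 32 * (nu^2 * k * V) + nu * La * k * V" by (simp add: algebra_simps power2_eq_square)
 have i4: "2 * k * eta * V = 64 * (nu^2 * k * V) + 2 * (nu * La * k * V)" by (simp add: eta_def algebra_simps power2_eq_square)
 have i5: "16 * k * nu^2 * V = 16 * (nu^2 * k * V)" by simp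
 have i6: "c0 * nu * (R * (Z + R * c^2)) = c0 * nu * (R * Z) + c0 * nu * Y" by (simp add: Z_def Y_def power2_eq_square algebra_simps)
 have i7: "(M1^2 / k + (nu * (L^2 / 4 + l1) + eta * (1 + 2 * k))) * (R * V) =
   M1^2 / k * (R * V) + (nu * (L^2 / 4 + l1) + eta * (1 + 2 * k)) * (R * V)" by (rule distrib_right)
 have i8: "- nu * L * k * V = - (nu * L * k * V)" by simp
 show ?thesis
  unfolding eta_def[symmetric] unfolding rate_expand[OF k b] unfolding M_def[symmetric] Z_def[symmetric] Y_def[symmetric] V_def[symmetric] i6
  by (rule rate_lin[OF f0 f1 f2 f3 f4 f5 f6 f7 f8 f9 f10 i1 i2 i3 i4 i5 i7])
qed

text \<open>Above the threshold \<open>2 * expo p / Lg x <= 4 / s\<close>, so the mismatch is at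
  most \<open>5 / s\<close> whatever \<open>x\<close> is. For \<open>bt\<close> large it uses up a
  quarter of the gain \<open>c3 * bt / s\<close>; the errors of higher order use up another quarter
  once \<open>s\<close> is large.\<close>

lemma Nl_crude:
 assumes p: "p > 1"
 shows "\<exists>bt\<ge>1. \<exists>C\<ge>0. \<exists>S\<ge>1. \<forall>s\<ge>S. \<forall>x.
  Nl p a s (bt / s) x <= C * exp (- s) - (p - 1) / (4 * (p + 1)) * (bt / s) * (E2 p a s * Qn p a x)"
proof -
 define c3 where "c3 = (p - 1) / (2 * (p + 1))"
 have c3: "c3 > 0" "(p - 1) / (4 * (p + 1)) = c3 / 2" using p by (auto simp: c3_def)
 obtain C S where C: "C >= 0" and S: "S >= 1" and B: "!!s x \<nu>. s >= S ==> 0 <= \<nu> ==> \<nu> <= 1 ==>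
  (abs x < exp (expo p * s / 4) --> Nl p a s \<nu> x <= C * exp (- s) - c3 * \<nu> * (E2 p a s * Qn p a x)) &
  (exp (expo p * s / 4) <= abs x --> Nl p a s \<nu> x <= C * exp (- s) +
    E2 p a s * Qn p a x * (a / (p + 1) * (1 / s - 2 * expo p / Lg x) + C / s^2 + C * \<nu> / s - c3 * \<nu>))"
  using Nl_bound[OF p, of a] unfolding c3_def by metis
 define K where "K = abs a / (p + 1) * 5"
 define bt where "bt = max 1 (4 * K / c3)"
 have bt: "bt >= 1" "K <= c3 / 4 * bt" using c3 by (auto simp: bt_def field_simps max_def split: if_splits)
 define S' where "S' = max S (max bt (4 * C * (1 + bt) / (c3 * bt)))"
 show ?thesis
 proof (rule exI[of _ bt], rule conjI[OF bt(1)], rule exI[of _ C], rule conjI[OF C], rule exI[of _ S'], rule conjI, goal_cases)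
  case 1 show ?case using S by (simp add: S'_def)
 next
  case 2
  show ?case
  proof (intro allI impI)
   fix s x :: real assume s: "S' <= s"
   have s1: "S <= s" "bt <= s" "1 <= s" "4 * C * (1 + bt) / (c3 * bt) <= s" "0 < s" using s S by (auto simp: S'_def)
   have nu: "0 <= bt / s" "bt / s <= 1" using s1 bt by auto
   define EQ where "EQ = E2 p a s * Qn p a x"
   have EQ: "EQ >= 0" by (simp add: EQ_def E2_nonneg Qn_nonneg)
   have half: "c3 / 2 * (bt / s) * EQ <= c3 * (bt / s) * EQ" using c3 nu EQ by (intro mult_right_mono) auto
   show "Nl p a s (bt / s) x <= C * exp (- s) - (p - 1) / (4 * (p + 1)) * (bt / s) * (E2 p a s * Qn p a x)"
   proof (cases "abs x < exp (expo p * s / 4)")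
    case True
    then show ?thesis using B[OF s1(1) nu, of x] half unfolding c3(2) EQ_def[symmetric] by linarith
   next
    case False
    then have x: "exp (expo p * s / 4) <= abs x" by simp
    define k where "k = expo p"
    have k: "k > 0" using expo_pos[OF p] by (simp add: k_def)
    have Lk: "k * s / 2 <= Lg x" using large_region_log[OF p s1(3) x] by (simp add: k_def)
    have ks: "0 < k * s / 2" using k s1 by simp
    have "2 * k / Lg x <= 2 * k / (k * s / 2)" using divide_left_mono[OF Lk, of "2 * k"] ks k Lg_pos[of x] by simp
    also have "... = 4 / s" using k by simp
    finally have "\<bar>1 / s - 2 * k / Lg x\<bar> <= 5 / s"
     using s1 k Lg_pos[of x] divide_nonneg_pos[of "2 * k" "Lg x"] divide_nonneg_pos[of 1 s] by (simp add: abs_le_iff field_simps)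
    then have "\<bar>a / (p + 1) * (1 / s - 2 * k / Lg x)\<bar> <= abs a / (p + 1) * (5 / s)"
     unfolding abs_mult using p by (intro mult_mono) auto
    moreover have "abs a / (p + 1) * (5 / s) = K / s" by (simp add: K_def)
    ultimately have 1: "a / (p + 1) * (1 / s - 2 * k / Lg x) <= K / s" by linarith
    have 2: "K / s <= c3 / 4 * (bt / s)" using divide_right_mono[OF bt(2), of s] s1 by simp
    have 3: "C / s^2 + C * (bt / s) / s <= c3 / 4 * (bt / s)"
    proof -
     have "4 * C * (1 + bt) <= s * (c3 * bt)" using s1(4) c3 bt by (simp add: pos_divide_le_eq)
     then have "(C * (1 + bt)) / s^2 <= (s * (c3 * bt) / 4) / s^2" by (intro divide_right_mono) auto
     then show ?thesis using s1 by (simp add: power2_eq_square add_divide_distrib distrib_left)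
    qed
    have "a / (p + 1) * (1 / s - 2 * k / Lg x) + C / s^2 + C * (bt / s) / s - c3 * (bt / s) <= - (c3 / 2 * (bt / s))"
     using 1 2 3 by linarith
    then have "EQ * (a / (p + 1) * (1 / s - 2 * k / Lg x) + C / s^2 + C * (bt / s) / s - c3 * (bt / s)) <= EQ * - (c3 / 2 * (bt / s))"
     by (rule mult_left_mono[OF _ EQ])
    moreover have "EQ * - (c3 / 2 * (bt / s)) = - (c3 / 2 * (bt / s) * EQ)" by simp
    ultimately show ?thesis using B[OF s1(1) nu, of x] x unfolding c3(2) EQ_def[symmetric] k_def[symmetric] by linarith
   qed
  qed
 qed
qed

text \<open>Only one sign of the mismatch hurts. For \<open>a >= 0\<close> an upper bound on
  \<open>Lg\<close> is needed, which the polynomial bound on \<open>w\<close> supplies. For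
  \<open>a < 0\<close> a lower bound is needed, which fails for very small \<open>w\<close>; but
  there \<open>E2 * Qn\<close> is at most a constant times \<open>w^2 / s\<close>, and the mismatch
  \<open>O(1 / s)\<close> times this is below \<open>de * s powr (- 3 / 2) * w^2\<close>. Otherwise
  the mismatch is \<open>O(ln s / s^2)\<close> and the gain absorbs it.\<close>

lemma Nl_refined:
 assumes p: "p > 1" and q: "q >= 0" and de: "de > 0"
 shows "\<exists>C\<ge>0. \<exists>S\<ge>1. \<forall>s\<ge>S. \<forall>w. abs w <= s powr q -->
  Nl p a s (s powr (- 3 / 2)) (phi p a s * w) <= C * exp (- s) + de * s powr (- 3 / 2) * w^2
   - (p - 1) / (4 * (p + 1)) * s powr (- 3 / 2) * (E2 p a s * Qn p a (phi p a s * w))"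
proof -
 define c3 where "c3 = (p - 1) / (2 * (p + 1))"
 have c3: "c3 > 0" "(p - 1) / (4 * (p + 1)) = c3 / 2" using p by (auto simp: c3_def)
 obtain C S where C: "C >= 0" and S: "S >= 1" and B: "!!s x \<nu>. s >= S ==> 0 <= \<nu> ==> \<nu> <= 1 ==>
  (abs x < exp (expo p * s / 4) --> Nl p a s \<nu> x <= C * exp (- s) - c3 * \<nu> * (E2 p a s * Qn p a x)) &
  (exp (expo p * s / 4) <= abs x --> Nl p a s \<nu> x <= C * exp (- s) +
    E2 p a s * Qn p a x * (a / (p + 1) * (1 / s - 2 * expo p / Lg x) + C / s^2 + C * \<nu> / s - c3 * \<nu>))"
  using Nl_bound[OF p, of a] unfolding c3_def by metis
 define k where "k = expo p"
 have k: "k > 0" using expo_pos[OF p] by (simp add: k_def)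
 define A where "A = abs a / (p + 1)"
 have A: "A >= 0" using p by (simp add: A_def)
 define m where "m = abs a * k + k + 2 * q + 1"
 have m: "m > 0" using k q by (simp add: m_def add_nonneg_pos)
 define A1 where "A1 = A * 5 + 2 * C + 1"
 have A1: "A1 > 0" using A C by (simp add: A1_def)
 define A2 where "A2 = (k / 2) powr a"
 have A2: "A2 > 0" using k by (simp add: A2_def)
 have "eventually (\<lambda>s. A1 * (2 * (2 + m * ln s) / (k * s^2)) <= c3 / 4 * s powr (- 3 / 2)) at_top" using A1 m k c3 by real_asymp
 moreover have "eventually (\<lambda>s. A1 / s^2 + A1 * s powr (- 3 / 2) / s <= c3 / 4 * s powr (- 3 / 2)) at_top" using A1 c3 by real_asymp
 moreover have "eventually (\<lambda>s. A1 / s * (A2 / s) <= de * s powr (- 3 / 2)) at_top" using A1 A2 de by real_asymp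
 ultimately have "eventually (\<lambda>s. A1 * (2 * (2 + m * ln s) / (k * s^2)) <= c3 / 4 * s powr (- 3 / 2) &
   A1 / s^2 + A1 * s powr (- 3 / 2) / s <= c3 / 4 * s powr (- 3 / 2) &
   A1 / s * (A2 / s) <= de * s powr (- 3 / 2)) at_top" by eventually_elim simp
 then obtain S2 where S2: "!!s. S2 <= s ==> A1 * (2 * (2 + m * ln s) / (k * s^2)) <= c3 / 4 * s powr (- 3 / 2) &
   A1 / s^2 + A1 * s powr (- 3 / 2) / s <= c3 / 4 * s powr (- 3 / 2) &
   A1 / s * (A2 / s) <= de * s powr (- 3 / 2)" by (auto simp: eventually_at_top_linorder)
 show ?thesis
 proof (rule exI[of _ C], rule conjI[OF C], rule exI[of _ "max S S2"], rule conjI, goal_cases)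
  case 1 show ?case using S by simp
 next
  case 2
  show ?case
  proof (intro allI impI)
   fix s w :: real assume "max S S2 <= s" and w: "abs w <= s powr q"
   then have s: "S <= s" "S2 <= s" "1 <= s" "0 < s" using S by auto
   define nu where "nu = s powr (- 3 / 2)"
   have nu: "0 <= nu" "nu <= 1" using s powr_mono[of "- 3 / 2" 0 s] by (auto simp: nu_def)
   note S2' = S2[OF s(2), folded nu_def]
   define x where "x = phi p a s * w"
   have ph: "phi p a s > 0" by (rule phi_pos[OF s(4)])
   define EQ where "EQ = E2 p a s * Qn p a x"
   have EQ: "EQ >= 0" by (simp add: EQ_def E2_nonneg Qn_nonneg)
   have half: "c3 / 2 * nu * EQ <= c3 * nu * EQ" using c3 nu EQ by (intro mult_right_mono) auto
   have dw: "0 <= de * nu * w^2" using de nu by simp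
   have "Nl p a s nu x <= C * exp (- s) + de * nu * w^2 - c3 / 2 * nu * EQ"
   proof (cases "abs x < exp (expo p * s / 4)")
    case True
    then show ?thesis using B[OF s(1) nu, of x] half dw unfolding EQ_def[symmetric] by linarith
   next
    case False
    then have x: "exp (expo p * s / 4) <= abs x" by simp
    have Lk: "k * s / 2 <= Lg x" using large_region_log[OF p s(3) x] by (simp add: k_def)
    have ks: "0 < k * s / 2" using k s by simp
    have N: "Nl p a s nu x <= C * exp (- s) + EQ * (a / (p + 1) * (1 / s - 2 * k / Lg x) + C / s^2 + C * nu / s - c3 * nu)"
     using B[OF s(1) nu, of x] x by (simp add: EQ_def k_def)
    have CA: "C / s^2 + C * nu / s <= A1 / s^2 + A1 * nu / s"
     using s nu A C by (intro add_mono divide_right_mono mult_right_mono) (auto simp: A1_def)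
    have ln0: "0 <= ln s" using s by simp
    define D where "D = 2 * (2 + m * ln s) / (k * s^2)"
    have D: "D >= 0" using m ln0 k by (simp add: D_def)
    have ph2: "(phi p a s)^2 = exp (2 * k * s) * s powr (- (a * k))" using phi_powr[OF s(4), of p a 2] ph by (simp add: powr_numeral k_def)
    have conc: ?thesis if "a / (p + 1) * (1 / s - 2 * k / Lg x) <= A * D"
    proof -
     have "A * D <= A1 * D" using D C A by (intro mult_right_mono) (auto simp: A1_def)
     then have "a / (p + 1) * (1 / s - 2 * k / Lg x) + C / s^2 + C * nu / s - c3 * nu <= - (c3 / 2 * nu)"
      using that CA S2' unfolding D_def[symmetric] by linarith
     then have "EQ * (a / (p + 1) * (1 / s - 2 * k / Lg x) + C / s^2 + C * nu / s - c3 * nu) <= EQ * - (c3 / 2 * nu)"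
      by (rule mult_left_mono[OF _ EQ])
     moreover have "EQ * - (c3 / 2 * nu) = - (c3 / 2 * nu * EQ)" by simp
     ultimately show ?thesis using N dw by linarith
    qed
    have frac: "1 / s - 2 * k / Lg x = (Lg x - 2 * k * s) / (s * Lg x)" using s Lg_pos[of x] by (simp add: field_simps)
    have fr: "Z / (s * Lg x) <= D" if Z: "Z <= 2 + m * ln s" "0 <= Z" for Z
    proof -
     have "Z / (s * Lg x) <= (2 + m * ln s) / (s * (k * s / 2))" using Z Lk ks s by (intro frac_le mult_left_mono) auto
     also have "... = D" by (simp add: D_def power2_eq_square mult_ac)
     finally show ?thesis .
    qed
    show ?thesis
    proof (cases "a >= 0")
     case True
     have le: "Lg x - 2 * k * s <= 2 + m * ln s"
     proof -
      have "w^2 <= (s powr q)^2" using power_mono[OF w, of 2] by simp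
      also have "... = s powr (2 * q)" using s by (simp add: power2_eq_square flip: powr_add)
      finally have "x^2 <= (phi p a s)^2 * s powr (2 * q)" unfolding x_def power_mult_distrib by (intro mult_left_mono) auto
      also have "... = exp (2 * k * s) * s powr (2 * q - a * k)" unfolding ph2 by (simp add: powr_diff powr_minus field_simps)
      also have "... <= exp (2 * k * s) * s powr m" using s q k True by (intro mult_left_mono powr_mono) (auto simp: m_def)
      finally have "x^2 <= exp (2 * k * s) * s powr m" .
      moreover have "1 * 1 <= exp (2 * k * s) * s powr m" using k s m by (intro mult_mono) (auto simp: ge_one_powr_ge_zero)
      ultimately have "2 + x^2 <= 3 * (exp (2 * k * s) * s powr m)" by linarith
      then have "Lg x <= ln (3 * (exp (2 * k * s) * s powr m))"
       unfolding Lg_def using s by (subst ln_le_cancel_iff) (auto simp: add_pos_nonneg)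
      also have "... = ln 3 + 2 * k * s + m * ln s" using s by (simp add: ln_mult ln_powr)
      finally show ?thesis using ln_le_minus_one[of 3] by simp
     qed
     have "a / (p + 1) * (1 / s - 2 * k / Lg x) <= A * D"
     proof -
      have "1 / s - 2 * k / Lg x <= D"
      proof (cases "0 <= Lg x - 2 * k * s")
       case True then show ?thesis unfolding frac by (rule fr[OF le])
      next
       case False
       then have "(Lg x - 2 * k * s) / (s * Lg x) <= 0" using s Lg_pos[of x] by (intro divide_nonpos_nonneg) auto
       then show ?thesis unfolding frac using D by linarith
      qed
      then have "A * (1 / s - 2 * k / Lg x) <= A * D" by (rule mult_left_mono[OF _ A])
      moreover have "a / (p + 1) = A" using True by (simp add: A_def)
      ultimately show ?thesis by simp
     qed
     then show ?thesis by (rule conc)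
    next
     case False
     have Aa: "a / (p + 1) * E = A * (- E)" for E using False by (simp add: A_def)
     show ?thesis
     \<comment> \<open>The exponent is chosen so that below the threshold
       \<open>abs w powr (p - 1) <= 1 / s\<close>, by \<open>k * (p - 1) = 2\<close>; above it
       \<open>Lg\<close> is still within \<open>O(ln s)\<close> of \<open>2 * k * s\<close> from
       below.\<close>
     proof (cases "s powr (- k / 2) <= abs w")
      case True
      have le: "2 * k * s - Lg x <= 2 + m * ln s"
      proof -
       have "(s powr (- k / 2))^2 <= w^2" using power_mono[OF True, of 2] by simp
       moreover have "(s powr (- k / 2))^2 = s powr (- k)" using s by (simp add: power2_eq_square flip: powr_add)
       ultimately have "(phi p a s)^2 * s powr (- k) <= x^2" unfolding x_def power_mult_distrib by (intro mult_left_mono) auto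
       moreover have "exp (2 * k * s) * s powr (- m) <= exp (2 * k * s) * s powr (- (a * k) - k)"
        using s q mult_nonpos_nonneg[of a k] k False by (intro mult_left_mono powr_mono) (auto simp: m_def)
       moreover have "(phi p a s)^2 * s powr (- k) = exp (2 * k * s) * s powr (- (a * k) - k)"
        unfolding ph2 using powr_add[of s "- (a * k)" "- k"] by simp
       ultimately have "exp (2 * k * s) * s powr (- m) <= 2 + x^2" by linarith
       then have "ln (exp (2 * k * s) * s powr (- m)) <= Lg x"
        unfolding Lg_def using s by (subst ln_le_cancel_iff) (auto simp: add_pos_nonneg)
       moreover have "ln (exp (2 * k * s) * s powr (- m)) = 2 * k * s - m * ln s" using s by (simp add: ln_mult ln_powr)
       ultimately show ?thesis by linarith
      qed
      have "- (1 / s - 2 * k / Lg x) <= D"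
      proof (cases "0 <= 2 * k * s - Lg x")
       case True from fr[OF le this] show ?thesis unfolding frac by (simp add: minus_divide_left)
      next
       case False
       then have "0 <= (Lg x - 2 * k * s) / (s * Lg x)" using s Lg_pos[of x] by (intro divide_nonneg_nonneg) auto
       then show ?thesis unfolding frac using D by linarith
      qed
      then have "a / (p + 1) * (1 / s - 2 * k / Lg x) <= A * D" unfolding Aa using A by (rule mult_left_mono)
      then show ?thesis by (rule conc)
     next
      case wlt: False
      have EQw: "EQ <= A2 / s * w^2"
      proof -
       have w0: "w ~= 0" using x x_def ph by auto
       have "abs w powr (p - 1) <= (s powr (- k / 2)) powr (p - 1)" using wlt p by (intro powr_mono2) auto
       also have "... = s powr (- 1)" using expo_mult[OF p] by (simp add: powr_powr k_def)
       also have "... = 1 / s" using s by (simp add: powr_minus_divide)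
       finally have w1: "abs w powr (p - 1) <= 1 / s" .
       have wp: "abs w powr (p + 1) = abs w powr (p - 1) * w^2"
       proof -
        have "abs w powr ((p - 1) + 2) = abs w powr (p - 1) * abs w powr 2" by (rule powr_add)
        moreover have "abs w powr 2 = w^2" using w0 by simp
        ultimately show ?thesis by (simp add: add.commute)
       qed
       have La: "Lg x powr a <= A2 * s powr a"
       proof -
        have "Lg x powr a <= (k * s / 2) powr a" using Lk ks False by (intro powr_mono2') auto
        also have "... = A2 * s powr a" using powr_mult[of "k / 2" s a] k s by (simp add: A2_def)
        finally show ?thesis .
       qed
       have "EQ = E2 p a s * (phi p a s powr (p + 1) * abs w powr (p + 1) * Lg x powr a)"
        unfolding EQ_def Qn_eq x_def abs_mult using ph by (simp add: powr_mult)
       also have "... = s powr (- a) * abs w powr (p + 1) * Lg x powr a" using E2_phi[OF s(4) p, of a] by (simp add: mult.assoc[symmetric])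
       also have "... <= s powr (- a) * (1 / s * w^2) * (A2 * s powr a)"
        unfolding wp by (intro mult_mono mult_left_mono mult_right_mono w1 La) (use s in auto)
       also have "... = A2 / s * w^2" using s by (simp add: powr_minus field_simps)
       finally show ?thesis .
      qed
      have c1: "a / (p + 1) * (1 / s - 2 * k / Lg x) + C / s^2 + C * nu / s <= A1 / s"
      proof -
       have "2 * k / Lg x <= 2 * k / (k * s / 2)" using divide_left_mono[OF Lk, of "2 * k"] ks k Lg_pos[of x] by simp
       also have "... = 4 / s" using k by simp
       finally have "2 * k / Lg x <= 4 / s" .
       moreover have "5 / s = 4 / s + 1 / s" "0 <= 1 / s" using s by (simp_all flip: add_divide_distrib)
       ultimately have "- (1 / s - 2 * k / Lg x) <= 5 / s" by linarith
       then have "a / (p + 1) * (1 / s - 2 * k / Lg x) <= A * (5 / s)" unfolding Aa using A by (rule mult_left_mono)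
       moreover have "C / s^2 <= C / s" using s C by (intro divide_left_mono) (auto simp: power2_eq_square)
       moreover have "C * nu / s <= C * 1 / s" using s C nu by (intro divide_right_mono mult_left_mono) auto
       moreover have "A1 / s = A * (5 / s) + C / s + C * 1 / s + 1 / s" by (simp add: A1_def add_divide_distrib)
       moreover have "0 < 1 / s" using s by simp
       ultimately show ?thesis by linarith
      qed
      have "EQ * (a / (p + 1) * (1 / s - 2 * k / Lg x) + C / s^2 + C * nu / s) <= EQ * (A1 / s)" by (rule mult_left_mono[OF c1 EQ])
      also have "... <= A2 / s * w^2 * (A1 / s)" using A1 s by (intro mult_right_mono EQw) auto
      also have "... = A1 / s * (A2 / s) * w^2" by simp
      also have "... <= de * nu * w^2" using S2' by (intro mult_right_mono) auto
      finally have "EQ * (a / (p + 1) * (1 / s - 2 * k / Lg x) + C / s^2 + C * nu / s) <= de * nu * w^2" .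
      moreover have "EQ * (a / (p + 1) * (1 / s - 2 * k / Lg x) + C / s^2 + C * nu / s - c3 * nu)
        = EQ * (a / (p + 1) * (1 / s - 2 * k / Lg x) + C / s^2 + C * nu / s) - c3 * nu * EQ" by (simp add: algebra_simps)
      ultimately show ?thesis using N half by linarith
     qed
    qed
   qed
   then show "Nl p a s (s powr (- 3 / 2)) (phi p a s * w) <= C * exp (- s) + de * s powr (- 3 / 2) * w^2
    - (p - 1) / (4 * (p + 1)) * s powr (- 3 / 2) * (E2 p a s * Qn p a (phi p a s * w))" unfolding c3(2) nu_def EQ_def x_def .
  qed
 qed
qed

section \<open>Decay of the functional\<close>

definition k0c :: "real => real" where "k0c p = expo p / 2 + (expo p)^2 / 2"

text \<open>The three bounds are what the parts of the dissipation in \<open>wy\<close>, in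
  \<open>w\<close> and in \<open>w * g\<close> can afford, in this order.\<close>

definition cdis :: "real => real" where
 "cdis p = min (1 / (4 * expo p)) (min (k0c p / (4 * expo p)) ((p - 1) / (4 * (p + 1))))"

text \<open>A common bound for \<open>a * expo p / s\<close> and for the derivative of
  \<open>lam\<close>; the summand 1 keeps it positive when \<open>a = 0\<close>.\<close>

definition Lb :: "real => real => real => real" where "Lb p a s = (abs a + 1) * expo p / s"

text \<open>The smallness conditions of \<open>rate_quad_ineq\<close>, with \<open>nu1\<close>
  bounding the derivative of \<open>nu\<close>. The third and the last compare squares of
  coefficients \<open>O(1 / s)\<close> with \<open>nu\<close>, and so require \<open>nu\<close> to
  dominate \<open>s powr (- 2)\<close>.\<close>

definition small_rate :: "real => real => real => real => real => bool" where
 "small_rate p a nu nu1 s \<longleftrightarrow> nu > 0 & Lb p a s <= expo p / 8 & cdis p * nu <= expo p / 8 &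
   (Lb p a s + 2 * nu)\<^sup>2 <= nu / 8 & 8 * (32 * nu + Lb p a s) <= 1 &
   ((1 / expo p + 2) * nu^2 + nu1 + (Lb p a s / 2 + Lb p a s * expo p + (Lb p a s)^2 / 4 + Lb p a s)
    + nu * (1 + Lb p a s + 2 * expo p))\<^sup>2 / expo p
    + nu * ((Lb p a s)^2 / 4 + Lb p a s) + (32 * nu^2 + nu * Lb p a s) * (1 + 2 * expo p) <= nu * k0c p / (2 * expo p)"

lemma k0c_pos: "p > 1 ==> k0c p > 0" using expo_pos[of p] by (simp add: k0c_def add_pos_pos)

lemma cdis_pos: "p > 1 ==> cdis p > 0" using expo_pos[of p] k0c_pos[of p] by (simp add: cdis_def)

lemma cdis_le: "cdis p <= 1 / (4 * expo p)" "cdis p <= k0c p / (4 * expo p)" "cdis p <= (p - 1) / (4 * (p + 1))" by (simp_all add: cdis_def)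

lemma small_rate_crude:
 assumes p: "p > 1" and be: "bt > 0"
 shows "eventually (\<lambda>s. small_rate p a (bt / s) (bt / s^2) s) at_top"
proof -
 define k A c n where "k = expo p" and "A = abs a + 1" and "c = cdis p" and "n = k0c p"
 have pos: "k > 0" "A > 0" "c > 0" "n > 0" using expo_pos[OF p] cdis_pos[OF p] k0c_pos[OF p] by (auto simp: k_def A_def c_def n_def)
 have e1: "eventually (\<lambda>s. bt / s > 0) at_top" using be by real_asymp
 have e2: "eventually (\<lambda>s. A * k / s <= k / 8) at_top" using pos by real_asymp
 have e3: "eventually (\<lambda>s. c * (bt / s) <= k / 8) at_top" using pos be by real_asymp
 define E where "E = A * k"
 define e where "e = E + 2 * bt"
 \<comment> \<open>Collecting powers of \<open>1 / s\<close> reduces the condition to a comparison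
   of asymptotic orders whose only parameters are positive constants.\<close>
 define b c1 c2 P Q X Y Z where "b = 1 / k + 2" and "c1 = 3 / 2 + k" and "c2 = 1 + 2 * k" and "P = E * c1 + bt * c2"
  and "Q = b * bt^2 + bt + E^2 / 4 + bt * E" and "X = bt * E^2 / 4" and "Y = bt * E + (32 * bt^2 + bt * E) * c2"
  and "Z = bt * n / (2 * k)"
 have pos': "E > 0" using pos by (simp add: E_def)
 have pos'': "e > 0" "b > 0" "c1 > 0" "c2 > 0" using pos pos' be by (auto simp: e_def b_def c1_def c2_def add_pos_pos)
 have pos3: "P > 0" "Q > 0" "X > 0" "Y > 0" "Z > 0" using pos pos' pos'' be by (auto simp: P_def Q_def X_def Y_def Z_def add_pos_pos)
 have "eventually (\<lambda>s. (e / s)^2 <= bt / 8 / s) at_top" using pos'' be by real_asymp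
 then have e4: "eventually (\<lambda>s. (A * k / s + 2 * (bt / s))^2 <= bt / s / 8) at_top"
  by eventually_elim (simp add: e_def E_def add_divide_distrib)
 have e5: "eventually (\<lambda>s. 8 * (32 * (bt / s) + A * k / s) <= 1) at_top" using pos be by real_asymp
 have "eventually (\<lambda>s. (P / s + Q / s^2)^2 / k + X / s ^ 3 + Y / s^2 <= Z / s) at_top" using pos pos3 by real_asymp
 then have e6: "eventually (\<lambda>s. ((1 / k + 2) * (bt / s)^2 + bt / s^2 + (A * k / s / 2 + A * k / s * k + (A * k / s)^2 / 4 + A * k / s)
    + bt / s * (1 + A * k / s + 2 * k))^2 / k
    + bt / s * ((A * k / s)^2 / 4 + A * k / s) + (32 * (bt / s)^2 + bt / s * (A * k / s)) * (1 + 2 * k) <= bt / s * n / (2 * k)) at_top"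
  using eventually_gt_at_top[of 0]
 proof eventually_elim
  case (elim s)
  have 1: "(1 / k + 2) * (bt / s)^2 + bt / s^2 + (A * k / s / 2 + A * k / s * k + (A * k / s)^2 / 4 + A * k / s)
    + bt / s * (1 + A * k / s + 2 * k) = P / s + Q / s^2"
   unfolding E_def[symmetric] b_def[symmetric] P_def Q_def c1_def c2_def using elim(2) by (simp add: field_simps power2_eq_square)
  have 2: "bt / s * ((A * k / s)^2 / 4 + A * k / s) + (32 * (bt / s)^2 + bt / s * (A * k / s)) * (1 + 2 * k) = X / s ^ 3 + Y / s^2"
   unfolding E_def[symmetric] X_def Y_def c2_def using elim(2) by (simp add: field_simps power2_eq_square power3_eq_cube)
  have 3: "bt / s * n / (2 * k) = Z / s" by (simp add: Z_def)
  show ?case unfolding 1 3 using elim(1) 2 by linarith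
 qed
 show ?thesis using e1 e2 e3 e4 e5 e6 by eventually_elim (simp only: small_rate_def Lb_def k_def A_def c_def n_def simp_thms)
qed

text \<open>The terms to be beaten are of order \<open>s powr (- 2)\<close>, so a rate decaying like
  \<open>s powr (- 3 / 2)\<close> still dominates them.\<close>

lemma small_rate_refined:
 assumes p: "p > 1"
 shows "eventually (\<lambda>s. small_rate p a (s powr (- 3 / 2)) (3 / 2 * s powr (- 5 / 2)) s) at_top"
proof -
 define k A c n where "k = expo p" and "A = abs a + 1" and "c = cdis p" and "n = k0c p"
 have pos: "k > 0" "A > 0" "c > 0" "n > 0" using expo_pos[OF p] cdis_pos[OF p] k0c_pos[OF p] by (auto simp: k_def A_def c_def n_def)
 have e1: "eventually (\<lambda>s::real. s powr (- 3 / 2) > 0) at_top" by real_asymp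
 have e2: "eventually (\<lambda>s. A * k / s <= k / 8) at_top" using pos by real_asymp
 have e3: "eventually (\<lambda>s. c * s powr (- 3 / 2) <= k / 8) at_top" using pos by real_asymp
 define E where "E = A * k"
 define b c2 P Z where "b = 1 / k + 2" and "c2 = 1 + 2 * k" and "P = E * (3 / 2 + k)" and "Z = n / (2 * k)"
 have pos': "E > 0" using pos by (simp add: E_def)
 have pos'': "b > 0" "c2 > 0" "P > 0" "Z > 0" using pos pos' by (auto simp: b_def c2_def P_def Z_def add_pos_pos)
 have "eventually (\<lambda>s. (E / s + 2 * s powr (- 3 / 2))^2 <= s powr (- 3 / 2) / 8) at_top" using pos' by real_asymp
 then have e4: "eventually (\<lambda>s. (A * k / s + 2 * s powr (- 3 / 2))^2 <= s powr (- 3 / 2) / 8) at_top" by (simp add: E_def)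
 have e5: "eventually (\<lambda>s. 8 * (32 * s powr (- 3 / 2) + A * k / s) <= 1) at_top" using pos by real_asymp
 have "eventually (\<lambda>s. (b * (s powr (- 3 / 2))^2 + 3 / 2 * s powr (- 5 / 2) + P / s + E^2 / 4 / s^2
    + s powr (- 3 / 2) * (c2 + E / s))^2 / k
    + s powr (- 3 / 2) * (E^2 / 4 / s^2 + E / s) + (32 * (s powr (- 3 / 2))^2 + s powr (- 3 / 2) * (E / s)) * c2 <= s powr (- 3 / 2) * Z) at_top"
  using pos pos' pos'' by real_asymp
 then have e6: "eventually (\<lambda>s. ((1 / k + 2) * (s powr (- 3 / 2))^2 + 3 / 2 * s powr (- 5 / 2) + (A * k / s / 2 + A * k / s * k + (A * k / s)^2 / 4 + A * k / s)
    + s powr (- 3 / 2) * (1 + A * k / s + 2 * k))^2 / k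
    + s powr (- 3 / 2) * ((A * k / s)^2 / 4 + A * k / s) + (32 * (s powr (- 3 / 2))^2 + s powr (- 3 / 2) * (A * k / s)) * (1 + 2 * k) <= s powr (- 3 / 2) * n / (2 * k)) at_top"
 proof eventually_elim
  case (elim s)
  have 1: "(1 / k + 2) * (s powr (- 3 / 2))^2 + 3 / 2 * s powr (- 5 / 2) + (A * k / s / 2 + A * k / s * k + (A * k / s)^2 / 4 + A * k / s)
    + s powr (- 3 / 2) * (1 + A * k / s + 2 * k) = b * (s powr (- 3 / 2))^2 + 3 / 2 * s powr (- 5 / 2) + P / s + E^2 / 4 / s^2
    + s powr (- 3 / 2) * (c2 + E / s)" unfolding E_def[symmetric] b_def P_def c2_def
   by (simp add: algebra_simps power_divide add_divide_distrib)
  have 2: "(E / s)^2 / 4 = E^2 / 4 / s^2" by (simp add: power_divide)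
  show ?case unfolding 1 using elim unfolding E_def[symmetric] 2 c2_def Z_def by simp
 qed
 show ?thesis using e1 e2 e3 e4 e5 e6 by eventually_elim (simp only: small_rate_def Lb_def k_def A_def c_def n_def simp_thms)
qed

context cone
begin

text \<open>The term with \<open>expo p\<close> is the dissipation in the final estimate; the one
  with \<open>nu\<close> is the full energy density including the nonlinear part, gained from the
  correction term.\<close>

definition diss where "diss nu y s = rho1 p y * (expo p * (z y s)^2 + nu * cdis p * ((1 - y^2) * ((z y s)^2 + (1 - y^2) * (wy y s)^2
   + (w y s)^2 + w y s * g y s)))"

lemma wg_E2: "s1 <= s ==> w y s * g y s = E2 p a s * Qn p a (phi p a s * w y s)"
 using phi_nz[of s] by (simp add: g_def E2_def Qn_def power2_eq_square field_simps)

lemma G_E2: "G y s = E2 p a s * nonlin_prim p a (phi p a s * w y s)" by (simp add: G_def E2_def)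

lemma wg_nonneg: "s1 <= s ==> 0 <= w y s * g y s" by (simp add: wg_E2 E2_nonneg Qn_nonneg)

lemma diss_nonneg:
 assumes "s1 <= s" "- 1 < y" "y < 1" "nu >= 0"
 shows "rho1 p y * (expo p * (z y s)^2) <= diss nu y s" "0 <= diss nu y s"
  "nu * cdis p * (rho p y * ((z y s)^2 + (1 - y^2) * (wy y s)^2 + (w y s)^2 + w y s * g y s)) <= diss nu y s"
proof -
 have R: "0 < 1 - y^2" using one_minus_sq_pos[of y] assms by simp
 have r: "0 <= rho1 p y" using rho1_nonneg[of y p] assms by auto
 have c: "0 <= nu * cdis p" using cdis_pos[OF p] assms by simp
 have k: "0 < expo p" by (rule expo_pos[OF p])
 define X where "X = (z y s)^2 + (1 - y^2) * (wy y s)^2 + (w y s)^2 + w y s * g y s"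
 have X: "0 <= X" using R wg_nonneg[OF assms(1)] by (simp add: X_def)
 have eq: "diss nu y s = rho1 p y * (expo p * (z y s)^2) + nu * cdis p * (rho p y * X)"
  unfolding diss_def X_def rho_rho1 by (simp add: algebra_simps)
 have 1: "0 <= rho1 p y * (expo p * (z y s)^2)" using r k by simp
 have 2: "0 <= nu * cdis p * (rho p y * X)" using c X rho_nonneg by simp
 show "rho1 p y * (expo p * (z y s)^2) <= diss nu y s" "0 <= diss nu y s"
  "nu * cdis p * (rho p y * ((z y s)^2 + (1 - y^2) * (wy y s)^2 + (w y s)^2 + w y s * g y s)) <= diss nu y s"
  using 1 2 unfolding eq X_def[symmetric] by auto
qed

lemma diss_quad_arith:
 fixes r k v1 v2 la w c y W m f :: real
 assumes "(1 - y^2) * d = ((1 + y) * v1 - (1 - y) * v2) / 2"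
 shows "f * (r * (k * ((v1 + v2) / 2 - la * w)^2 + m * ((1 - y^2) * (((v1 + v2) / 2 - la * w)^2 + (1 - y^2) * d^2 + w^2 + W))))
  = r * ((f * (k + m * (1 - y^2)) * (1 / 4) + f * m * ((1 + y)^2) * (1 / 4)) * v1^2
    + (f * (k + m * (1 - y^2)) * (1 / 2) - f * m * ((1 + y) * (1 - y)) * (1 / 2)) * (v1 * v2)
    + (f * (k + m * (1 - y^2)) * (1 / 4) + f * m * ((1 - y)^2) * (1 / 4)) * v2^2
    + (- (f * (k + m * (1 - y^2)) * la * w)) * v1 + (- (f * (k + m * (1 - y^2)) * la * w)) * v2
    + (f * (k + m * (1 - y^2)) * (la^2 * w^2) + f * m * (1 - y^2) * (w^2 + W)))"
proof -
 have 1: "f * (r * (k * q^2 + m * (R * (q^2 + R * d^2 + w^2 + W)))) =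
   r * (f * (k + m * R) * q^2 + f * m * (R * d)^2 + f * m * R * (w^2 + W))" for q R by (simp add: algebra_simps power2_eq_square)
 show ?thesis unfolding 1 assms by (rule arg_cong[where f = "\<lambda>x. r * x"]) (simp add: field_simps power2_eq_square)
qed

lemma diss_integrable:
 assumes f: "continuous_on {s1..s2} f" and nu: "continuous_on {s1..s2} nu"
 shows "bint (\<lambda>(s, y). f s * diss (nu s) y s)"
proof -
 note f' = strip_cont_time[OF f] strip_cont_time[OF nu] strip_cont_time[OF lam_cont]
 have eq: "f s * diss (nu s) y s = quad
   (\<lambda>y s. f s * (expo p + nu s * cdis p * (1 - y^2)) * (1 / 4) + f s * (nu s * cdis p) * ((1 + y)^2) * (1 / 4))
   (\<lambda>y s. f s * (expo p + nu s * cdis p * (1 - y^2)) * (1 / 2) - f s * (nu s * cdis p) * ((1 + y) * (1 - y)) * (1 / 2))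
   (\<lambda>y s. f s * (expo p + nu s * cdis p * (1 - y^2)) * (1 / 4) + f s * (nu s * cdis p) * ((1 - y)^2) * (1 / 4))
   (\<lambda>y s. - (f s * (expo p + nu s * cdis p * (1 - y^2)) * lam p a s * w y s))
   (\<lambda>y s. - (f s * (expo p + nu s * cdis p * (1 - y^2)) * lam p a s * w y s))
   (\<lambda>y s. f s * (expo p + nu s * cdis p * (1 - y^2)) * ((lam p a s)^2 * (w y s)^2)
    + f s * (nu s * cdis p) * (1 - y^2) * ((w y s)^2 + w y s * g y s)) y s" for y s
  unfolding diss_def quad_def z_def q_va by (rule diss_quad_arith[OF wy_va])
 show ?thesis unfolding eq by (intro quad_box_integrable) (intro strip_intros f')+
qed

end

context cone_mult
begin

text \<open>The condition on \<open>mu'\<close> is the derivative of \<open>- nu * ka\<close> when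
  \<open>ka' = - (1 / expo p + 2) * nu * ka\<close>. After the quadratic estimate
  \<open>nu * k0c p / (2 * expo p)\<close> times \<open>w^2\<close> is left: one half is what
  hypothesis \<open>N\<close> may consume, the other becomes the \<open>w\<close>-part of
  \<open>diss\<close>.\<close>

lemma rate_le:
 assumes s: "s1 <= s" "s <= s2" and y: "- 1 < y" "y < 1"
  and kap: "ka s > 0" and ka': "ka' s = - (1 / expo p + 2) * nu * ka s" and mu: "mu s = - nu * ka s"
  and mu': "mu' s = ((1 / expo p + 2) * nu^2 - nu') * ka s" and nu': "abs nu' <= nu1"
  and small: "small_rate p a nu nu1 s"
  and N: "Nl p a s nu (phi p a s * w y s) <= D + k0c p / (4 * expo p) * nu * (w y s)^2
   - (p - 1) / (4 * (p + 1)) * nu * (E2 p a s * Qn p a (phi p a s * w y s))"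
 shows "rate y s + ka s * (32 * nu^2 + nu * Lb p a s) * ibp y s <= - (ka s * diss nu y s) + ka s * (rho p y * D)"
proof -
 define k b R L where "k = expo p" and "b = 1 / k + 2" and "R = 1 - y^2" and "L = a * k / s"
 define W Z where "W = w y s" and "Z = z y s"
 define NG where "NG = 2 * (1 + lam p a s) * G y s - lam p a s * (W * g y s)"
 have k: "k > 0" by (simp add: k_def expo_pos[OF p])
 have R: "0 < R" "R <= 1" using one_minus_sq_pos[of y] y by (auto simp: R_def)
 have r: "0 <= rho1 p y" using rho1_nonneg[of y p] y by auto
 have n: "k0 = k0c p" by (simp add: k0_def k0c_def)
 have sp: "s >= 1" using s s1 by simp
 have nu: "nu > 0" using small by (simp add: small_rate_def)
 have La: "abs L <= Lb p a s"
 proof -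
  have "abs L = abs a * k / s" using k sp by (simp add: L_def abs_mult)
  also have "... <= Lb p a s" unfolding Lb_def k_def[symmetric] using k sp by (intro divide_right_mono mult_right_mono) auto
  finally show ?thesis .
 qed
 have l1: "abs (lam' s) <= Lb p a s"
 proof -
  have "abs (lam' s) = abs L * (1 / (2 * s))" using sp by (simp add: lam'_def L_def k_def abs_mult power2_eq_square)
  also have "... <= abs L * 1" using sp by (intro mult_left_mono) auto
  finally show ?thesis using La by simp
 qed
 have q: "R * (- b * nu * (Z^2 / 2 + R * (wy y s)^2 / 2 + k0c p * W^2 - G y s) + (b * nu^2 - nu') * (W * Z)) +
   (- 2 * k * Z^2 + R * (L * Z^2 + L * (y * wy y s * Z) + NG + (L / 2 + L * k - L^2 / 4 - lam' s) * (W * Z))) +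
   - nu * (R * (Z^2 - R * (wy y s)^2 - 2 * k0c p * W^2 + W * g y s + 2 * (y * wy y s * Z) + (1 + L + 2 * k) * (W * Z) - (L^2 / 4 + lam' s) * W^2)
    - 4 * k * (W * Z) + L * k * W^2) +
   (32 * nu^2 + nu * Lb p a s) * (R * (2 * y * W * wy y s + (1 + 2 * k) * W^2) - 2 * k * W^2)
  <= R * (NG + b * nu * G y s - nu * (W * g y s)) - k * Z^2 - cdis p * nu * (R * (Z^2 + R * (wy y s)^2)) - nu * k0c p / (2 * k) * (R * W^2)"
 proof (rule rate_quad_ineq[OF k b_def k0c_pos[OF p] _ R(2) _ nu La l1 nu' cdis_pos[OF p]])
  show "cdis p <= 1 / (4 * k)" "cdis p <= k0c p / (4 * k)" using cdis_le unfolding k_def by auto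
 qed (use R y small in "simp_all add: small_rate_def k_def b_def")
 have NN: "NG + b * nu * G y s - nu * (W * g y s) = Nl p a s nu (phi p a s * w y s)"
 proof -
  have b: "b = (p + 3) / 2"
  proof -
   have "1 / k = (p - 1) / 2" using p by (simp add: k_def expo_def)
   then show ?thesis by (simp add: b_def field_simps)
  qed
  show ?thesis unfolding NG_def Nl_def b G_E2 W_def wg_E2[OF s(1)] by simp
 qed
 have Wg: "E2 p a s * Qn p a (phi p a s * w y s) = W * g y s" using wg_E2[OF s(1)] by (simp add: W_def)
 have Wg0: "0 <= W * g y s" using wg_nonneg[OF s(1)] by (simp add: W_def)
 have N': "R * (NG + b * nu * G y s - nu * (W * g y s)) <= R * D + k0c p / (4 * k) * nu * (R * W^2) - cdis p * nu * (R * (W * g y s))"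
 proof -
  have "(p - 1) / (4 * (p + 1)) * nu * (W * g y s) >= cdis p * nu * (W * g y s)" using cdis_le(3) nu Wg0 by (intro mult_right_mono) auto
  then have "NG + b * nu * G y s - nu * (W * g y s) <= D + k0c p / (4 * k) * nu * W^2 - cdis p * nu * (W * g y s)"
   using N[unfolded Wg] unfolding NN W_def[symmetric] k_def[symmetric] by linarith
  then have "R * (NG + b * nu * G y s - nu * (W * g y s)) <= R * (D + k0c p / (4 * k) * nu * W^2 - cdis p * nu * (W * g y s))"
   using R by (intro mult_left_mono) auto
  also have "... = R * D + k0c p / (4 * k) * nu * (R * W^2) - cdis p * nu * (R * (W * g y s))" by (simp add: algebra_simps)
  finally show ?thesis .
 qed
 have half: "nu * k0c p / (2 * k) * (R * W^2) = k0c p / (4 * k) * nu * (R * W^2) + k0c p / (4 * k) * nu * (R * W^2)"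
  using k by (simp add: field_simps)
 have cw: "cdis p * nu * (R * W^2) <= k0c p / (4 * k) * nu * (R * W^2)"
  using cdis_le(2) nu R unfolding k_def by (intro mult_right_mono) auto
 have fin: "R * (NG + b * nu * G y s - nu * (W * g y s)) - k * Z^2 - cdis p * nu * (R * (Z^2 + R * (wy y s)^2)) - nu * k0c p / (2 * k) * (R * W^2)
   <= R * D - (k * Z^2 + nu * cdis p * (R * (Z^2 + R * (wy y s)^2 + W^2 + W * g y s)))"
 proof -
  have "nu * cdis p * (R * (Z^2 + R * (wy y s)^2 + W^2 + W * g y s)) =
   cdis p * nu * (R * (Z^2 + R * (wy y s)^2)) + cdis p * nu * (R * W^2) + cdis p * nu * (R * (W * g y s))" by (simp add: algebra_simps)
  then show ?thesis using N' half cw by linarith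
 qed
 have "rate y s + ka s * (32 * nu^2 + nu * Lb p a s) * ibp y s = rho1 p y * (ka s *
  (R * (- b * nu * (Z^2 / 2 + R * (wy y s)^2 / 2 + k0c p * W^2 - G y s) + (b * nu^2 - nu') * (W * Z)) +
   (- 2 * k * Z^2 + R * (L * Z^2 + L * (y * wy y s * Z) + NG + (L / 2 + L * k - L^2 / 4 - lam' s) * (W * Z))) +
   - nu * (R * (Z^2 - R * (wy y s)^2 - 2 * k0c p * W^2 + W * g y s + 2 * (y * wy y s * Z) + (1 + L + 2 * k) * (W * Z) - (L^2 / 4 + lam' s) * W^2)
    - 4 * k * (W * Z) + L * k * W^2) +
   (32 * nu^2 + nu * Lb p a s) * (R * (2 * y * W * wy y s + (1 + 2 * k) * W^2) - 2 * k * W^2)))"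
  unfolding rate_def ibp_def ka' mu mu' NG_def R_def[symmetric] W_def[symmetric] Z_def[symmetric] k_def[symmetric] L_def[symmetric] n b_def[symmetric]
  by (simp add: algebra_simps)
 also have "... <= rho1 p y * (ka s * (R * D - (k * Z^2 + nu * cdis p * (R * (Z^2 + R * (wy y s)^2 + W^2 + W * g y s)))))"
  using order_trans[OF q fin] kap r by (intro mult_left_mono) auto
 also have "... = - (ka s * diss nu y s) + ka s * (rho p y * D)"
  unfolding diss_def rho_rho1 R_def W_def Z_def k_def by (simp add: algebra_simps)
 finally show ?thesis .
qed

lemma decay:
 fixes nu dn bn D :: "real => real"
 assumes "!!s. s1 <= s ==> s <= s2 ==> ka s > 0"
  and "!!s. s1 <= s ==> s <= s2 ==> ka' s = - (1 / expo p + 2) * nu s * ka s"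
  and "!!s. s1 <= s ==> s <= s2 ==> mu s = - nu s * ka s"
  and "!!s. s1 <= s ==> s <= s2 ==> mu' s = ((1 / expo p + 2) * (nu s)^2 - dn s) * ka s"
  and "!!s. s1 <= s ==> s <= s2 ==> abs (dn s) <= bn s"
  and "!!s. s1 <= s ==> s <= s2 ==> small_rate p a (nu s) (bn s) s"
  and "!!s y. s1 <= s ==> s <= s2 ==> - 1 < y ==> y < 1 ==>
   Nl p a s (nu s) (phi p a s * w y s) <= D s + k0c p / (4 * expo p) * nu s * (w y s)^2
   - (p - 1) / (4 * (p + 1)) * nu s * (E2 p a s * Qn p a (phi p a s * w y s))"
  and nu: "continuous_on {s1..s2} nu" and D: "continuous_on {s1..s2} D"
 shows "(SINT y. dens y s2) - (SINT y. dens y s1) <=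
  (BINT x. ka (fst x) * (rho p (snd x) * D (fst x)))
   - (BINT x. ka (fst x) * diss (nu (fst x)) (snd x) (fst x))"
proof -
 let ?j = "\<lambda>s. ka s * (32 * (nu s)^2 + nu s * Lb p a s)"
 have Lc: "continuous_on {s1..s2} (Lb p a)" unfolding Lb_def using s1 by (intro continuous_intros) auto
 have j: "continuous_on {s1..s2} ?j" by (intro continuous_intros ka_cont nu Lc)
 have I1: "bint (\<lambda>x. rate (snd x) (fst x) + ?j (fst x) * ibp (snd x) (fst x))"
  using rate_integrable ibp_integrable[OF j] by (intro set_integral_add(1)) (simp_all add: case_prod_beta')
 have I2: "bint (\<lambda>x. ka (fst x) * diss (nu (fst x)) (snd x) (fst x))"
  using diss_integrable[OF ka_cont nu] by (simp add: case_prod_beta')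
 have I3: "bint (\<lambda>x. ka (fst x) * (rho p (snd x) * D (fst x)))"
 proof -
  have "bint (\<lambda>(s, y). quad (\<lambda>_ _. 0) (\<lambda>_ _. 0) (\<lambda>_ _. 0) (\<lambda>_ _. 0) (\<lambda>_ _. 0) (\<lambda>y s. ka s * (1 - y^2) * D s) y s)"
   by (intro quad_box_integrable) (intro strip_intros strip_time strip_cont_time[OF D])+
  then show ?thesis by (simp add: quad_def rho_rho1 case_prod_beta' mult_ac)
 qed
 have "(BINT x. rate (snd x) (fst x) + ?j (fst x) * ibp (snd x) (fst x)) <=
  (BINT x. ka (fst x) * (rho p (snd x) * D (fst x)) - ka (fst x) * diss (nu (fst x)) (snd x) (fst x))"
 proof (rule set_integral_mono[OF I1 set_integral_diff(1)[OF I3 I2]])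
  fix x :: "real \<times> real" assume "x \<in> obox"
  then have *: "s1 <= fst x" "fst x <= s2" "- 1 < snd x" "snd x < 1" by auto
  show "rate (snd x) (fst x) + ?j (fst x) * ibp (snd x) (fst x) <= ka (fst x) * (rho p (snd x) * D (fst x)) - ka (fst x) * diss (nu (fst x)) (snd x) (fst x)"
   using rate_le[OF * assms(1)[OF *(1,2)] assms(2)[OF *(1,2)] assms(3)[OF *(1,2)] assms(4)[OF *(1,2)] assms(5)[OF *(1,2)] assms(6)[OF *(1,2)] assms(7)[OF *]] by linarith
 qed
 then show ?thesis unfolding functional_identity[OF j] set_integral_diff(2)[OF I3 I2] .
qed

end

text \<open>Bundles constants that depend on \<open>p\<close> and \<open>a\<close> only, so that
  they can be fixed before any cone is chosen. The condition
  \<open>(bt / s)\<^sup>2 <= 2 * k0c p\<close> is the one that bounds the functional from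
  below.\<close>

definition crude_ok :: "real => real => real => real => real => bool" where
 "crude_ok p a bt C S \<longleftrightarrow> bt >= 1 & C >= 0 & S >= 1 & (\<forall>s\<ge>S. small_rate p a (bt / s) (bt / s^2) s & (bt / s)\<^sup>2 <= 2 * k0c p &
   (\<forall>x. Nl p a s (bt / s) x <= C * exp (- s) - (p - 1) / (4 * (p + 1)) * (bt / s) * (E2 p a s * Qn p a x)))"

lemma crude_ok_exists:
 assumes p: "p > 1"
 obtains bt C S where "crude_ok p a bt C S"
proof -
 obtain bt C S where *: "bt >= 1" "C >= 0" "!!s x. S <= s ==>
  Nl p a s (bt / s) x <= C * exp (- s) - (p - 1) / (4 * (p + 1)) * (bt / s) * (E2 p a s * Qn p a x)" using Nl_crude[OF p, of a] by metis
 define n where "n = k0c p"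
 have n: "n > 0" using k0c_pos[OF p] by (simp add: n_def)
 have b: "bt > 0" using * by simp
 have "eventually (\<lambda>s. (bt / s)^2 <= 2 * n) at_top" using n b by real_asymp
 with small_rate_crude[OF p b, of a] have "eventually (\<lambda>s. small_rate p a (bt / s) (bt / s^2) s & (bt / s)\<^sup>2 <= 2 * n) at_top"
  by eventually_elim simp
 then obtain S' where "!!s. S' <= s ==> small_rate p a (bt / s) (bt / s^2) s & (bt / s)\<^sup>2 <= 2 * n"
  by (auto simp: eventually_at_top_linorder)
 then have "crude_ok p a bt C (max 1 (max S S'))" using * unfolding crude_ok_def n_def by auto
 then show ?thesis by (rule that)
qed

definition refined_ok :: "real => real => real => real => real => bool" where
 "refined_ok p a q C S \<longleftrightarrow> C >= 0 & S >= 1 & (\<forall>s\<ge>S. small_rate p a (s powr (- 3 / 2)) (3 / 2 * s powr (- 5 / 2)) s &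
   (\<forall>w. abs w <= s powr q --> Nl p a s (s powr (- 3 / 2)) (phi p a s * w) <= C * exp (- s) + k0c p / (4 * expo p) * s powr (- 3 / 2) * w^2
   - (p - 1) / (4 * (p + 1)) * s powr (- 3 / 2) * (E2 p a s * Qn p a (phi p a s * w))))"

lemma refined_ok_exists:
 assumes p: "p > 1" and q: "q >= 0"
 obtains C S where "refined_ok p a q C S"
proof -
 have de: "k0c p / (4 * expo p) > 0" using k0c_pos[OF p] expo_pos[OF p] by simp
 obtain C S where *: "C >= 0" "!!s w. S <= s ==> abs w <= s powr q ==> Nl p a s (s powr (- 3 / 2)) (phi p a s * w) <= C * exp (- s) + k0c p / (4 * expo p) * s powr (- 3 / 2) * w^2
   - (p - 1) / (4 * (p + 1)) * s powr (- 3 / 2) * (E2 p a s * Qn p a (phi p a s * w))" using Nl_refined[OF p q de, of a] by metis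
 obtain S' where "!!s. S' <= s ==> small_rate p a (s powr (- 3 / 2)) (3 / 2 * s powr (- 5 / 2)) s"
  using small_rate_refined[OF p, of a] by (auto simp: eventually_at_top_linorder)
 then have "refined_ok p a q C (max 1 (max S S'))" using * unfolding refined_ok_def by auto
 then show ?thesis by (rule that)
qed

section \<open>Decay of the functional for the two rates\<close>

context cone
begin

definition En where "En y s = (z y s)^2 / 2 + (1 - y^2) * (wy y s)^2 / 2 + k0c p * (w y s)^2 - G y s"

text \<open>The functional \<open>L0\<close> with a free coefficient \<open>nu\<close> in place of
  \<open>1 / (s * sqrt s)\<close> and with \<open>z\<close>, \<open>wy\<close> in place of the
  classical derivatives.\<close>

definition Lf where "Lf nu s = (SINT y. rho p y * (En y s - nu * (w y s * z y s)))"

lemma Lf_integrable: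
 assumes s: "s1 <= s" "s <= s2"
 shows "sint (\<lambda>y. rho p y * (En y s - nu * (w y s * z y s)))"
proof -
 interpret m: cone_mult p a T u al A x0 T0 s1 s2 "\<lambda>_. 1" "\<lambda>_. 0" "\<lambda>_. - nu" "\<lambda>_. 0" by unfold_locales auto
 show ?thesis using m.dens_slice_integrable[OF s] by (simp add: m.dens_def En_def m.k0_def k0c_def)
qed

text \<open>Completing the square in \<open>z - nu * w\<close> absorbs the correction into
  \<open>z^2 / 2 + k0c p * w^2\<close>, so only \<open>- G\<close> can be negative. The factor 2 is
  the length of the interval.\<close>

lemma Lf_lower:
 assumes s: "s1 <= s" "s <= s2" and nu: "nu^2 <= 2 * k0c p" and G: "!!y. - 1 < y ==> y < 1 ==> G y s <= M" and M: "0 <= M"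
 shows "- 2 * M <= Lf nu s"
proof -
 have one: "sint (\<lambda>y::real. - M)" by (rule set_integrable_subset[OF borel_integrable_atLeastAtMost'[of "- 1" 1]]) auto
 have "(LINT y:{- 1<..<1::real}|lborel. - M) <= (SINT y. rho p y * (En y s - nu * (w y s * z y s)))"
 proof (rule set_integral_mono[OF one])
  show "sint (\<lambda>y. rho p y * (En y s - nu * (w y s * z y s)))" by (rule Lf_integrable[OF s])
 next
  fix y :: real assume "y \<in> {- 1<..<1}"
  then have y: "- 1 < y" "y < 1" by auto
  have R: "0 < 1 - y^2" using one_minus_sq_pos[of y] y by auto
  have r: "0 <= rho p y" "rho p y <= 1" using rho_nonneg[of p y] rho_le_1[of y p] p y by auto
  have "0 <= (z y s - nu * w y s)^2 / 2" by simp
  then have "nu * (w y s * z y s) <= (z y s)^2 / 2 + nu^2 / 2 * (w y s)^2" by (simp add: power2_diff power_mult_distrib algebra_simps)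
  also have "... <= (z y s)^2 / 2 + k0c p * (w y s)^2" using nu by (intro add_left_mono mult_right_mono) auto
  finally have "nu * (w y s * z y s) <= (z y s)^2 / 2 + k0c p * (w y s)^2" .
  moreover have "0 <= (1 - y^2) * (wy y s)^2 / 2" using R by simp
  ultimately have "- M <= En y s - nu * (w y s * z y s)" using G[OF y] unfolding En_def by linarith
  then have "rho p y * (- M) <= rho p y * (En y s - nu * (w y s * z y s))" using r by (intro mult_left_mono) auto
  moreover have "rho p y * M <= 1 * M" using r M by (intro mult_right_mono) auto
  ultimately show "- M <= rho p y * (En y s - nu * (w y s * z y s))" by simp
 qed
 then show ?thesis unfolding Lf_def by (simp add: set_lebesgue_integral_def)
qed

lemma source_bound:
 assumes ka: "continuous_on {s1..s2} ka" "!!s. s1 <= s ==> s <= s2 ==> 0 <= ka s & ka s <= K" and C: "C >= 0" and K: "K >= 0"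
 shows "(BINT x. ka (fst x) * (rho p (snd x) * (C * exp (- fst x)))) <= 2 * K * C * exp (- s1)"
proof -
 have I: "bint (\<lambda>x. f (fst x))" if f: "continuous_on {s1..s2} f" for f :: "real => real"
 proof -
  obtain B where B: "B >= 0" "!!s. s1 <= s ==> s <= s2 ==> abs (f s) <= B" using time_bounded[OF f] by blast
  have e: "emeasure lborel2 obox < \<infinity>"
   by (subst lborel.emeasure_pair_measure_Times) (auto simp: ennreal_mult_less_top emeasure_lborel_Icc_eq emeasure_lborel_Ioo)
  have m: "(\<lambda>x. indicator obox x *\<^sub>R f (fst x)) \<in> borel_measurable lborel2"
   using boxM_cont[OF strip_cont_time[OF f]] by (simp add: borel_measurable_restrict_space_iff case_prod_beta')
  have "integrable lborel2 (\<lambda>x. B * indicator obox x :: real)" by (intro integrable_mult_right integrable_real_indicator e) auto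
  then show ?thesis unfolding set_integrable_def
   by (rule Bochner_Integration.integrable_bound[OF _ m]) (auto intro!: AE_I2 order_trans[OF B(2) abs_ge_self] split: split_indicator)
 qed
 have m1: "continuous_on {s1..s2} (\<lambda>s. K * C * exp (- s))" by (intro continuous_intros)
 have I1: "bint (\<lambda>x. ka (fst x) * (rho p (snd x) * (C * exp (- fst x))))"
 proof -
  have "bint (\<lambda>(s, y). quad (\<lambda>_ _. 0) (\<lambda>_ _. 0) (\<lambda>_ _. 0) (\<lambda>_ _. 0) (\<lambda>_ _. 0) (\<lambda>y s. ka s * (1 - y^2) * (C * exp (- s))) y s)"
   by (intro quad_box_integrable) (intro strip_intros strip_cont_time[OF ka(1)] strip_cont_time continuous_intros)+
  then show ?thesis by (simp add: quad_def rho_rho1 case_prod_beta' mult_ac)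
 qed
 have "(BINT x. ka (fst x) * (rho p (snd x) * (C * exp (- fst x)))) <= (BINT x. K * C * exp (- fst x))"
 proof (rule set_integral_mono[OF I1 I[OF m1]])
  fix x :: "real \<times> real" assume "x \<in> obox"
  then have *: "s1 <= fst x" "fst x <= s2" "- 1 < snd x" "snd x < 1" by auto
  have "rho p (snd x) * (C * exp (- fst x)) <= 1 * (C * exp (- fst x))" using rho_le_1[of "snd x" p] * p C by (intro mult_right_mono) auto
  then have "ka (fst x) * (rho p (snd x) * (C * exp (- fst x))) <= K * (1 * (C * exp (- fst x)))"
   by (rule mult_mono[rotated]) (use ka(2)[OF *(1,2)] C K rho_nonneg in auto)
  then show "ka (fst x) * (rho p (snd x) * (C * exp (- fst x))) <= K * C * exp (- fst x)" by simp
 qed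
 also have "... = (LINT s:{s1..s2}|lborel. (LINT y:{- 1<..<1::real}|lborel. K * C * exp (- s)))"
  using I[OF m1] by (subst obox_Fubini[symmetric]) (simp_all add: case_prod_beta')
 also have "... = (LINT s:{s1..s2}|lborel. 2 * K * C * exp (- s))" by (simp add: set_lebesgue_integral_def mult_ac)
 also have "... = 2 * K * C * exp (- s1) - 2 * K * C * exp (- s2)"
 proof -
  have "(LINT s|lborel. indicator {s1..s2} s *\<^sub>R (2 * K * C * exp (- s))) = (- (2 * K * C * exp (- s2))) - (- (2 * K * C * exp (- s1)))"
   by (rule integral_FTC_atLeastAtMost[OF s12])
    (auto intro!: derivative_eq_intros continuous_intros simp: has_real_derivative_iff_has_vector_derivative[symmetric])
  then show ?thesis unfolding set_lebesgue_integral_def by linarith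
 qed
 also have "... <= 2 * K * C * exp (- s1)" using K C by simp
 finally show ?thesis .
qed

text \<open>The weight \<open>s powr e\<close> is the solution of
  \<open>ka' = - (1 / expo p + 2) * (bt / s) * ka\<close>. Its decay is the source of the polynomial
  loss in the space-time bound.\<close>

lemma crude_decay:
 fixes bt C S :: real
 assumes ok: "crude_ok p a bt C S" and S: "S <= s1"
 defines "e == - ((1 / expo p + 2) * bt)"
 shows "s2 powr e * Lf (bt / s2) s2 <= s1 powr e * Lf (bt / s1) s1 + 2 * C * exp (- s1)
   - (BINT x. fst x powr e * diss (bt / fst x) (snd x) (fst x))"
proof -
 define b where "b = 1 / expo p + 2"
 have e: "e = - (b * bt)" by (simp add: e_def b_def)
 have ok': "bt >= 1" "C >= 0" using ok by (auto simp: crude_ok_def)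
 have "b > 0" using expo_pos[OF p] by (simp add: b_def add_pos_pos)
 then have e0: "e <= 0" using ok' by (simp add: e)
 have pw: "s powr (e - 1) = s powr e / s" "s powr (e - 2) = s powr e / s^2" if "s > 0" for s
  using that powr_diff[of s e 1] powr_diff[of s e 2] by simp_all
 interpret m: cone_mult p a T u al A x0 T0 s1 s2 "\<lambda>s. s powr e" "\<lambda>s. e * s powr (e - 1)" "\<lambda>s. - bt * s powr (e - 1)" "\<lambda>s. - bt * (e - 1) * s powr (e - 2)"
 proof unfold_locales
  fix s assume "s1 <= s" "s <= s2"
  then have s: "s > 0" by (rule_tac spos)
  show "((\<lambda>s. s powr e) has_real_derivative e * s powr (e - 1)) (at s)" using s by (auto intro!: derivative_eq_intros)
  have "((\<lambda>s. s powr (e - 1)) has_real_derivative (e - 1) * s powr (e - 1 - 1)) (at s)"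
   using s by (auto intro!: derivative_eq_intros)
  then show "((\<lambda>s. - bt * s powr (e - 1)) has_real_derivative - bt * (e - 1) * s powr (e - 2)) (at s)"
   using s by (auto intro!: derivative_eq_intros)
 qed (use s1 in "auto intro!: continuous_intros")
 have ka1: "s powr e <= 1" if "s1 <= s" for s using powr_mono[OF e0, of s] that s1 by simp
 have main: "(SINT y. m.dens y s2) - (SINT y. m.dens y s1) <=
  (BINT x. fst x powr e * (rho p (snd x) * (C * exp (- fst x))))
   - (BINT x. fst x powr e * diss (bt / fst x) (snd x) (fst x))"
 proof (rule m.decay[where dn = "\<lambda>s. - bt / s^2" and bn = "\<lambda>s. bt / s^2" and nu = "\<lambda>s. bt / s" and D = "\<lambda>s. C * exp (- s)"])
  fix s assume s: "s1 <= s" "s <= s2"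
  then have sp: "s > 0" by (rule_tac spos)
  show "s powr e > 0" using sp by simp
  show "e * s powr (e - 1) = - (1 / expo p + 2) * (bt / s) * s powr e" unfolding pw[OF sp] b_def[symmetric] unfolding e by simp
  show "- bt * s powr (e - 1) = - (bt / s) * s powr e" unfolding pw[OF sp] by simp
  show "- bt * (e - 1) * s powr (e - 2) = ((1 / expo p + 2) * (bt / s)^2 - - bt / s^2) * s powr e"
   unfolding pw[OF sp] b_def[symmetric] using sp unfolding e by (simp add: field_simps power2_eq_square)
  show "\<bar>- bt / s^2\<bar> <= bt / s^2" using ok' by simp
  have S': "S <= s" using S s by simp
  show "small_rate p a (bt / s) (bt / s^2) s" using ok S' by (simp add: crude_ok_def)
  fix y :: real
  have "Nl p a s (bt / s) (phi p a s * w y s) <= C * exp (- s) - (p - 1) / (4 * (p + 1)) * (bt / s) * (E2 p a s * Qn p a (phi p a s * w y s))"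
   using ok S' unfolding crude_ok_def by blast
  moreover have "0 <= k0c p / (4 * expo p) * (bt / s) * (w y s)^2" using k0c_pos[OF p] expo_pos[OF p] ok' sp by simp
  ultimately show "Nl p a s (bt / s) (phi p a s * w y s) <= C * exp (- s) + k0c p / (4 * expo p) * (bt / s) * (w y s)^2
   - (p - 1) / (4 * (p + 1)) * (bt / s) * (E2 p a s * Qn p a (phi p a s * w y s))" by linarith
 next
  show "continuous_on {s1..s2} (\<lambda>s. bt / s)" using s1 by (intro continuous_intros) auto
  show "continuous_on {s1..s2} (\<lambda>s. C * exp (- s))" by (intro continuous_intros)
 qed
 have dens: "(SINT y. m.dens y s) = s powr e * Lf (bt / s) s" if "s \<in> {s1, s2}" for s
 proof -
  have sp: "s > 0" using that s1 s12 by auto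
  have "m.dens y s = s powr e * (rho p y * (En y s - bt / s * (w y s * z y s)))" for y
   unfolding m.dens_def En_def pw[OF sp] m.k0_def k0c_def[symmetric] by (simp add: algebra_simps)
  then show ?thesis by (simp add: Lf_def)
 qed
 have "(BINT x. fst x powr e * (rho p (snd x) * (C * exp (- fst x)))) <= 2 * 1 * C * exp (- s1)"
  by (rule source_bound[OF m.ka_cont]) (use ka1 ok' in auto)
 moreover note main dens[of s1] dens[of s2]
 ultimately show ?thesis by simp
qed

text \<open>For \<open>nu = s powr (- 3 / 2)\<close> the equation for \<open>ka\<close> is solved by
  \<open>exp ((p + 3) / sqrt s)\<close>, since \<open>1 / expo p + 2 = (p + 3) / 2\<close>. This
  weight lies between 1 and \<open>exp (p + 3)\<close>: the lower bound allows the dissipation to be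
  kept with factor 1, the upper one controls the source.\<close>

lemma refined_decay:
 fixes q' C S :: real
 assumes ok: "refined_ok p a q' C S" and S: "S <= s1"
  and W: "!!s y. s1 <= s ==> s <= s2 ==> - 1 < y ==> y < 1 ==> abs (w y s) <= s powr q'"
 shows "exp ((p + 3) / sqrt s2) * Lf (s2 powr (- 3 / 2)) s2 <= exp ((p + 3) / sqrt s1) * Lf (s1 powr (- 3 / 2)) s1
   + 2 * exp (p + 3) * C * exp (- s1)
   - (BINT x. rho1 p (snd x) * (expo p * (z (snd x) (fst x))^2))"
proof -
 define b where "b = 1 / expo p + 2"
 have b: "p + 3 = 2 * b"
 proof -
  have "1 / expo p = (p - 1) / 2" using p by (simp add: expo_def)
  then show ?thesis by (simp add: b_def field_simps)
 qed
 define K where "K s = exp (2 * b * s powr (- 1 / 2))" for s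
 have C: "C >= 0" using ok by (auto simp: refined_ok_def)
 have sq: "s powr (- 1 / 2) = 1 / sqrt s" if "s > 0" for s using that by (simp add: powr_minus_divide powr_half_sqrt)
 have Keq: "K s = exp ((p + 3) / sqrt s)" if "s > 0" for s using sq[OF that] by (simp add: K_def b)
 have DK: "(K has_real_derivative - b * s powr (- 3 / 2) * K s) (at s)" if "s > 0" for s
 proof -
  have "((\<lambda>s. s powr (- 1 / 2)) has_real_derivative (- 1 / 2) * s powr (- 1 / 2 - 1)) (at s)"
   using that by (rule has_real_derivative_powr)
  then have "((\<lambda>s. s powr (- 1 / 2)) has_real_derivative (- 1 / 2) * s powr (- 3 / 2)) (at s)" by simp
  then show ?thesis unfolding K_def[abs_def] using that by (auto intro!: derivative_eq_intros)
 qed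
 have Dn: "((\<lambda>s. s powr (- 3 / 2)) has_real_derivative (- 3 / 2) * s powr (- 5 / 2)) (at s)" if "s > 0" for s
 proof -
  have "((\<lambda>s. s powr (- 3 / 2)) has_real_derivative (- 3 / 2) * s powr (- 3 / 2 - 1)) (at s)"
   using that by (rule has_real_derivative_powr)
  then show ?thesis by simp
 qed
 have Kc: "continuous_on {s1..s2} K" unfolding K_def using s1 by (intro continuous_intros) auto
 interpret m: cone_mult p a T u al A x0 T0 s1 s2 K "\<lambda>s. - b * s powr (- 3 / 2) * K s" "\<lambda>s. - (s powr (- 3 / 2)) * K s"
  "\<lambda>s. (b * (s powr (- 3 / 2))^2 - - 3 / 2 * s powr (- 5 / 2)) * K s"
 proof unfold_locales
  fix s assume "s1 <= s" "s <= s2"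
  then have s: "s > 0" by (rule_tac spos)
  show "(K has_real_derivative - b * s powr (- 3 / 2) * K s) (at s)" by (rule DK[OF s])
  show "((\<lambda>s. - (s powr (- 3 / 2)) * K s) has_real_derivative (b * (s powr (- 3 / 2))^2 - - 3 / 2 * s powr (- 5 / 2)) * K s) (at s)"
   by (rule DERIV_cong[OF DERIV_mult[OF DERIV_minus[OF Dn[OF s]] DK[OF s]]]) (simp add: algebra_simps power2_eq_square)
 qed (use s1 in "auto intro!: continuous_intros Kc")
 have K1: "1 <= K s" "K s <= exp (p + 3)" if "s1 <= s" for s
 proof -
  have sp: "s > 0" "s >= 1" using that s1 by auto
  have "(p + 3) / sqrt s <= (p + 3) / 1" using p sp by (intro divide_left_mono) auto
  then show "1 <= K s" "K s <= exp (p + 3)" unfolding Keq[OF sp(1)] using p sp by auto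
 qed
 have nuc: "continuous_on {s1..s2} (\<lambda>s. s powr (- 3 / 2))" using s1 by (intro continuous_intros) auto
 have main: "(SINT y. m.dens y s2) - (SINT y. m.dens y s1) <=
  (BINT x. K (fst x) * (rho p (snd x) * (C * exp (- fst x))))
   - (BINT x. K (fst x) * diss (fst x powr (- 3 / 2)) (snd x) (fst x))"
 proof (rule m.decay[where dn = "\<lambda>s. - 3 / 2 * s powr (- 5 / 2)" and bn = "\<lambda>s. 3 / 2 * s powr (- 5 / 2)" and nu = "\<lambda>s. s powr (- 3 / 2)" and D = "\<lambda>s. C * exp (- s)", OF _ _ _ _ _ _ _ nuc])
  fix s assume s: "s1 <= s" "s <= s2"
  then have sp: "s > 0" by (rule_tac spos)
  show "K s > 0" by (simp add: K_def)
  show "- b * s powr (- 3 / 2) * K s = - (1 / expo p + 2) * s powr (- 3 / 2) * K s" by (simp add: b_def)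
  show "- (s powr (- 3 / 2)) * K s = - (s powr (- 3 / 2)) * K s" by simp
  show "(b * (s powr (- 3 / 2))^2 - - 3 / 2 * s powr (- 5 / 2)) * K s = ((1 / expo p + 2) * (s powr (- 3 / 2))^2 - - 3 / 2 * s powr (- 5 / 2)) * K s"
   by (simp add: b_def)
  show "\<bar>- 3 / 2 * s powr (- 5 / 2)\<bar> <= 3 / 2 * s powr (- 5 / 2)" by (simp add: abs_mult)
  have S': "S <= s" using S s by simp
  show "small_rate p a (s powr (- 3 / 2)) (3 / 2 * s powr (- 5 / 2)) s" using ok S' by (simp only: refined_ok_def)
  fix y :: real assume y: "- 1 < y" "y < 1"
  show "Nl p a s (s powr (- 3 / 2)) (phi p a s * w y s) <= C * exp (- s) + k0c p / (4 * expo p) * s powr (- 3 / 2) * (w y s)^2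
   - (p - 1) / (4 * (p + 1)) * s powr (- 3 / 2) * (E2 p a s * Qn p a (phi p a s * w y s))"
   using ok S' W[OF s y] unfolding refined_ok_def by blast
 qed (intro continuous_intros)
 have dens: "(SINT y. m.dens y s) = exp ((p + 3) / sqrt s) * Lf (s powr (- 3 / 2)) s" if "s \<in> {s1, s2}" for s
 proof -
  have sp: "s > 0" using that s1 s12 by auto
  have "m.dens y s = K s * (rho p y * (En y s - s powr (- 3 / 2) * (w y s * z y s)))" for y
   unfolding m.dens_def En_def m.k0_def k0c_def[symmetric] by (simp add: algebra_simps)
  then show ?thesis by (simp add: Lf_def Keq[OF sp])
 qed
 have "(BINT x. K (fst x) * (rho p (snd x) * (C * exp (- fst x)))) <= 2 * exp (p + 3) * C * exp (- s1)"
  by (rule source_bound[OF Kc]) (use K1 C in "auto simp: K_def")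
 moreover have "(BINT x. rho1 p (snd x) * (expo p * (z (snd x) (fst x))^2))
   <= (BINT x. K (fst x) * diss (fst x powr (- 3 / 2)) (snd x) (fst x))"
 proof (rule set_integral_mono)
  show "bint (\<lambda>x. K (fst x) * diss (fst x powr (- 3 / 2)) (snd x) (fst x))"
   using diss_integrable[OF Kc nuc] by (simp add: case_prod_beta')
  have "bint (\<lambda>(s, y). 1 * diss 0 y s)" by (rule diss_integrable) (intro continuous_intros)+
  then show "bint (\<lambda>x. rho1 p (snd x) * (expo p * (z (snd x) (fst x))^2))" by (simp add: diss_def case_prod_beta')
  fix x :: "real \<times> real" assume "x \<in> obox"
  then have *: "s1 <= fst x" "fst x <= s2" "- 1 < snd x" "snd x < 1" by auto
  have "rho1 p (snd x) * (expo p * (z (snd x) (fst x))^2) <= diss (fst x powr (- 3 / 2)) (snd x) (fst x)"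
   by (rule diss_nonneg(1)[OF *(1,3,4)]) simp
  also have "... <= K (fst x) * diss (fst x powr (- 3 / 2)) (snd x) (fst x)"
   using K1(1)[OF *(1)] diss_nonneg(2)[OF *(1,3,4), of "fst x powr (- 3 / 2)"] by (simp add: mult_le_cancel_right1)
  finally show "rho1 p (snd x) * (expo p * (z (snd x) (fst x))^2) <= K (fst x) * diss (fst x powr (- 3 / 2)) (snd x) (fst x)" .
 qed
 moreover have "(SINT y. m.dens y s1) = exp ((p + 3) / sqrt s1) * Lf (s1 powr (- 3 / 2)) s1"
  "(SINT y. m.dens y s2) = exp ((p + 3) / sqrt s2) * Lf (s2 powr (- 3 / 2)) s2" by (rule dens; simp)+
 ultimately show ?thesis using main by linarith
qed

end

section \<open>A polynomial bound on \<open>w\<close> near a non characteristic point\<close>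

lemma E2_tendsto_0:
 assumes p: "p > 1"
 shows "(E2 p a \<longlongrightarrow> 0) at_top"
proof -
 define k d where "k = expo p" and "d = \<bar>a * k\<bar> + 1"
 have k: "k > 0" "d > 0" using expo_pos[OF p] by (auto simp: k_def d_def)
 show ?thesis
 proof (rule tendsto_sandwich)
  show "eventually (\<lambda>s. 0 <= E2 p a s) at_top" by (simp add: E2_nonneg)
  show "eventually (\<lambda>s. E2 p a s <= exp (- 2 * (1 + k) * s) * s powr d) at_top" using eventually_ge_at_top[of 1]
  proof eventually_elim
   case (elim s)
   then show ?case unfolding E2_eq[OF less_le_trans[OF zero_less_one elim]] k_def[symmetric]
    by (intro mult_left_mono powr_mono) (auto simp: d_def)
  qed
  show "((\<lambda>s. exp (- 2 * (1 + k) * s) * s powr d) \<longlongrightarrow> 0) at_top" using k by real_asymp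
 qed simp
qed

lemma set_integral_mono_domain:
 fixes f :: "'a => real"
 assumes "set_integrable M B f" "A \<in> sets M" "A \<subseteq> B" "!!x. x \<in> B ==> 0 <= f x"
 shows "(LINT x:A|M. f x) <= (LINT x:B|M. f x)" unfolding set_lebesgue_integral_def
proof (rule integral_mono)
 show "integrable M (\<lambda>x. indicat_real A x *\<^sub>R f x)"
  using set_integrable_subset[OF assms(1-3)] by (simp add: set_integrable_def)
 show "integrable M (\<lambda>x. indicat_real B x *\<^sub>R f x)" using assms(1) by (simp add: set_integrable_def)
qed (use assms(3,4) in "auto split: split_indicator")

context wave1d
begin

text \<open>As \<open>T\<close> is 1-Lipschitz, the backward cone of any point strictly below the
  graph stays strictly below the graph.\<close>

lemma cone_below:
 assumes "T1 < T x" "exp (- s1) < T1" "1 <= s1" "s1 <= s2"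
 shows "cone p a T u al A x T1 s1 s2"
proof unfold_locales
 fix y s :: real assume ys: "- 1 <= y" "y <= 1" "s1 <= s" "s <= s2"
 have "exp (- s) <= exp (- s1)" using ys by simp
 moreover have "T x - T (x + y * exp (- s)) <= exp (- s)"
 proof -
  have "\<bar>T x - T (x + y * exp (- s))\<bar> <= abs y * exp (- s)" using T_lip[of x "x + y * exp (- s)"] by (simp add: abs_mult)
  also have "... <= 1 * exp (- s)" using ys by (intro mult_right_mono) auto
  finally show ?thesis by simp
 qed
 ultimately show "0 < T1 - exp (- s) & T1 - exp (- s) < T (x + y * exp (- s))" using assms by linarith
qed (use assms in auto)

text \<open>Letting the upper time tend to infinity, the functional is bounded from below because \<open>u\<close> is bounded near an apex inside the domain.\<close>

lemma spacetime_bound: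
 assumes ok: "crude_ok p a bt C S" and S: "S <= s1" and T1: "T1 < T x" "exp (- s1) < T1" and s: "s1 <= s2"
 defines "e == - ((1 / expo p + 2) * bt)"
 shows "(LINT z:({s1..s2} \<times> {- 1<..<1})|lborel2. fst z powr e * cone.diss p a u al x T1 (bt / fst z) (snd z) (fst z))
   <= s1 powr e * cone.Lf p a u al x T1 (bt / s1) s1 + 2 * C * exp (- s1) + 1"
proof -
 have ok': "bt >= 1" "C >= 0" "S >= 1" using ok by (auto simp: crude_ok_def)
 have e0: "e <= 0"
 proof -
  have "1 / expo p + 2 > 0" using expo_pos[OF p] by (simp add: add_pos_pos)
  then show ?thesis using ok' by (simp add: e_def)
 qed
 have s1: "1 <= s1" using S ok' by simp
 have dom: "(x + y * r, T1 - r) \<in> infl_dom T" if "- 1 <= y" "y <= 1" "0 <= r" "r <= exp (- s1)" for y r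
 proof -
  have "abs y * abs r <= 1 * r" using that by (intro mult_mono) auto
  then have 1: "\<bar>x + y * r - x\<bar> <= T1 - (T1 - r)" by (simp add: abs_mult)
  have "0 <= T1" using T1(2) exp_gt_zero[of "- s1"] by linarith
  then have 2: "(x, T1) \<in> infl_dom T" using T1 by (simp add: infl_dom_def)
  have "0 <= T1 - r" using T1 that by linarith
  then show ?thesis by (rule cone_subset[OF 2 _ 1])
 qed
 have cn: "continuous_on UNIV (nonlin_prim p a)" using DERIV_nonlin_prim[OF p] by (meson DERIV_isCont continuous_at_imp_continuous_on)
 have "continuous_on ({- 1..1} \<times> {0..exp (- s1)}) (\<lambda>z. u (x + fst z * snd z) (T1 - snd z))"
  by (intro u_cont_compose continuous_intros dom) auto
 then have cu: "continuous_on ({- 1..1} \<times> {0..exp (- s1)}) (\<lambda>z. nonlin_prim p a (u (x + fst z * snd z) (T1 - snd z)))"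
  by (rule continuous_on_compose2[OF cn]) auto
 obtain M where M0: "M > 0" "!!z. z \<in> {- 1..1} \<times> {0..exp (- s1)} ==> \<bar>nonlin_prim p a (u (x + fst z * snd z) (T1 - snd z))\<bar> <= M"
  using compact_bounded_real[OF compact_Times[OF compact_Icc compact_Icc] cu] by blast
 have M: "M > 0" "!!y r. - 1 <= y ==> y <= 1 ==> 0 <= r ==> r <= exp (- s1) ==> nonlin_prim p a (u (x + y * r) (T1 - r)) <= M"
 proof -
  fix y r :: real assume *: "- 1 <= y" "y <= 1" "0 <= r" "r <= exp (- s1)"
  then show "nonlin_prim p a (u (x + y * r) (T1 - r)) <= M" using M0(2)[of "(y, r)"] by simp
 qed (rule M0(1))
 \<comment> \<open>\<open>M\<close> bounds the primitive of the nonlinearity up to the apex, so at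
   late times \<open>G\<close> is at most \<open>1 / 2\<close> and the functional at least
   \<open>- 1\<close>. This accounts for the last summand of the bound.\<close>
 have "eventually (\<lambda>s. E2 p a s < 1 / (2 * M)) at_top" using E2_tendsto_0[OF p] M(1) by (intro order_tendstoD) auto
 then obtain s0 where "!!s. s0 <= s ==> E2 p a s < 1 / (2 * M)" by (auto simp: eventually_at_top_linorder)
 then obtain s3 where s3: "E2 p a s3 < 1 / (2 * M)" "s2 <= s3" by (meson max.cobounded1 max.cobounded2)
 interpret c: cone p a T u al A x T1 s1 s3 by (rule cone_below) (use T1 s1 s s3 in auto)
 have G: "c.G y s3 <= 1 / 2" if "- 1 < y" "y < 1" for y
 proof -
  have "c.G y s3 = E2 p a s3 * nonlin_prim p a (u (x + y * exp (- s3)) (T1 - exp (- s3)))"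
   unfolding c.G_E2 using c.phi_w[of s3 y] s s3 by simp
  also have "... <= E2 p a s3 * M" using s s3 that by (intro mult_left_mono E2_nonneg M(2)) auto
  also have "... <= 1 / (2 * M) * M" using s3 M(1) by (intro mult_right_mono) auto
  finally show ?thesis using M(1) by simp
 qed
 have "(bt / s3)^2 <= 2 * k0c p" using ok S s s3 by (auto simp: crude_ok_def)
 then have "- 2 * (1 / 2) <= c.Lf (bt / s3) s3" using s s3 by (intro c.Lf_lower G) auto
 then have "s3 powr e * (- 1) <= s3 powr e * c.Lf (bt / s3) s3" by (intro mult_left_mono) auto
 moreover have "s3 powr e <= 1" using powr_mono[OF e0, of s3] s s3 s1 by simp
 ultimately have low: "- 1 <= s3 powr e * c.Lf (bt / s3) s3" by linarith
 have cont: "continuous_on {s1..s3} (\<lambda>s. s powr e)" "continuous_on {s1..s3} (\<lambda>s. bt / s)"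
  using s1 by (intro continuous_intros; auto)+
 have "(LINT z:({s1..s2} \<times> {- 1<..<1})|lborel2. fst z powr e * c.diss (bt / fst z) (snd z) (fst z)) <=
  (LINT z:({s1..s3} \<times> {- 1<..<1})|lborel2. fst z powr e * c.diss (bt / fst z) (snd z) (fst z))"
 proof (rule set_integral_mono_domain)
  show "set_integrable lborel2 ({s1..s3} \<times> {- 1<..<1}) (\<lambda>z. fst z powr e * c.diss (bt / fst z) (snd z) (fst z))"
   using c.diss_integrable[OF cont] by (simp add: case_prod_beta')
  fix z :: "real \<times> real" assume z: "z \<in> {s1..s3} \<times> {- 1<..<1}"
  then show "0 <= fst z powr e * c.diss (bt / fst z) (snd z) (fst z)" using ok' s1 by (intro mult_nonneg_nonneg c.diss_nonneg(2)) auto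
 qed (use s3 in auto)
 also have "... <= s1 powr e * c.Lf (bt / s1) s1 + 2 * C * exp (- s1) - s3 powr e * c.Lf (bt / s3) s3"
  using c.crude_decay[OF ok S] unfolding e_def[symmetric] by linarith
 finally show ?thesis using low by linarith
qed

end

lemma affine_window:
 fixes f :: "real => real"
 assumes f: "integrable lborel f" and nn: "!!x. 0 <= f x" and c: "c > 0"
 shows "set_integrable lborel {r..t} (\<lambda>s. f ((t + r - 2 * s) * c))"
  "(LINT s:{r..t}|lborel. f ((t + r - 2 * s) * c)) <= (LINT y|lborel. f y) / (2 * c)"
proof -
 have eq: "(t + r - 2 * s) * c = (t + r) * c + (- 2 * c) * s" for s by (simp add: algebra_simps)
 have I: "integrable lborel (\<lambda>s. f ((t + r - 2 * s) * c))" unfolding eq using c by (intro lborel_integrable_real_affine[OF f]) simp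
 show "set_integrable lborel {r..t} (\<lambda>s. f ((t + r - 2 * s) * c))"
  by (rule set_integrable_subset[OF _ _ subset_UNIV]) (use I in "auto simp: set_integrable_def")
 then have "(LINT s:{r..t}|lborel. f ((t + r - 2 * s) * c)) <= (LINT s|lborel. f ((t + r - 2 * s) * c))"
  unfolding set_lebesgue_integral_def using I nn by (intro integral_mono) (auto simp: set_integrable_def split: split_indicator)
 also have "... = (LINT y|lborel. f y) / (2 * c)" using lborel_integral_real_affine[of "- 2 * c" f "(t + r) * c"] c unfolding eq by simp
 finally show "(LINT s:{r..t}|lborel. f ((t + r - 2 * s) * c)) <= (LINT y|lborel. f y) / (2 * c)" .
qed

context cone
begin

lemma v_abs_integrable:
 assumes j: "abs j = 1" and s: "s1 <= s" "s <= s2"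
 shows "sint (\<lambda>y. abs (v j y s))"
proof -
 have one: "sint (\<lambda>y::real. 1::real)" by (rule set_integrable_subset[OF borel_integrable_atLeastAtMost'[of "- 1" 1]]) auto
 have "sint (\<lambda>y. (\<lambda>(s, y). abs (v j y s)) (s, y))"
 proof (rule slice_integrable_bound[OF set_integral_add(1)[OF one v_slice_integrable[OF j s]] _ s])
  show "(\<lambda>(s, y). abs (v j y s)) \<in> borel_measurable oboxM"
   using borel_measurable_abs[OF v_boxM[OF j]] by (simp add: case_prod_beta')
  fix y
  show "\<bar>case (s, y) of (s, y) => \<bar>v j y s\<bar>\<bar> <= 1 + (v j y s)^2" using sum_squares_bound[of 1 "abs (v j y s)"] by simp
 qed
 then show ?thesis by simp
qed

lemma gint_cont: "continuous_on {s1..s2} (\<lambda>s. integral {- (1 / 2)..1 / 2} (\<lambda>y. abs (g y s)))"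
proof -
 have "continuous_on ({s1..s2} \<times> cbox (- (1 / 2)) (1 / 2)) (\<lambda>(s, y). abs (g y s))" unfolding case_prod_beta
  by (rule continuous_on_rabs, rule continuous_on_compose2[OF g_cont[unfolded case_prod_beta], of _ "\<lambda>x. (snd x, fst x)", simplified])
   (auto intro!: continuous_intros)
 then show ?thesis using integral_continuous_on_param[of "{s1..s2}" "- (1 / 2)" "1 / 2" "\<lambda>s y. abs (g y s)"] by simp
qed

text \<open>d'Alembert's formula inside the cone, along the characteristic through its tip.\<close>

lemma tip_bound:
 assumes d: "exp (- s1) <= 2 * exp (- s2)"
 shows "\<bar>u x0 (T0 - exp (- s2))\<bar> <= phi p a s1 * \<bar>w (1 - exp (s1 - s2)) s1\<bar>
   + phi p a s1 / 2 * (LINT y:{- (1 / 2)..1 / 2}|lborel. abs (v (- 1) y s1))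
   + 1 / 2 * integral {s1..s2} (\<lambda>s. phi p a s * integral {- (1 / 2)..1 / 2} (\<lambda>y. abs (g y s)))"
proof -
 define t b where "t = T0 - exp (- s2)" and "b = T0 - exp (- s1)"
 have tb: "b <= t" "t - b <= exp (- s1) / 2" "t - b = exp (- s1) - exp (- s2)" using s12 d by (auto simp: t_def b_def)
 have b0: "0 < b" using dom[of 0 s1] s12 by (simp add: b_def)
 have tip: "(x0, t) \<in> infl_dom T" using in_dom[of 0 s2] s12 by (simp add: t_def)
 have tri: "(z, r) \<in> infl_dom T" if "\<bar>z - x0\<bar> <= t - r" "0 <= r" for z r by (rule cone_subset[OF tip that(2,1)])
 note line = u_curve_acd[OF tb(1), of "\<lambda>s. x0 + t - s" "\<lambda>_. - 1" "\<lambda>s. s" "\<lambda>_. 1"]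
 have acd: "acd b t (\<lambda>s. u (x0 + t - s) s) (\<lambda>s. U (- 1) (x0 + t - s) s)"
 proof -
  have "acd b t (\<lambda>s. u (x0 + t - s) s) (\<lambda>s. (U 1 (x0 + t - s) s * (- 1 + 1) - U (- 1) (x0 + t - s) s * (- 1 - 1)) / 2)"
  proof (rule line)
   fix s assume s: "b <= s" "s <= t"
   then show "0 < s & s < T (x0 + t - s)" using b0 tri[of "x0 + t - s" s] by (auto simp: infl_dom_def)
  qed (auto intro!: derivative_eq_intros)
  then show ?thesis by simp
 qed
 \<comment> \<open>Tracing \<open>U (- 1)\<close> from time \<open>s\<close> back to time
   \<open>b\<close> along \<open>x - t = const\<close> leaves its value \<open>F\<close> at time
   \<open>b\<close> and the source collected in between, whose modulus is \<open>k\<close>.\<close>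
 define F where "F s = U (- 1) (x0 + (t + b - 2 * s)) b" for s
 define k where "k s r = \<bar>h (x0 + (t + r - 2 * s)) r\<bar>" for s r
 have split: "\<bar>U (- 1) (x0 + t - s) s - F s\<bar> <= integral {b..s} (k s)" if s: "b <= s" "s <= t" for s
 proof -
  have cont: "continuous_on {0..s} (\<lambda>r. h (x0 + (t + r - 2 * s)) r)" by (intro h_cont_compose continuous_intros tri) (use s in auto)
  then have cont': "continuous_on {b..s} (\<lambda>r. h (x0 + (t + r - 2 * s)) r)" by (rule continuous_on_subset) (use b0 in auto)
  have "P (- 1) (x0 + t - s) s = integral {0..s} (\<lambda>r. h (x0 + (t + r - 2 * s)) r)"
   unfolding P_def by (rule integral_cong) (simp add: algebra_simps)
  also have "... = integral {0..b} (\<lambda>r. h (x0 + (t + r - 2 * s)) r) + integral {b..s} (\<lambda>r. h (x0 + (t + r - 2 * s)) r)"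
   using b0 s integrable_continuous_real[OF cont] by (subst Henstock_Kurzweil_Integration.integral_combine) auto
  also have "integral {0..b} (\<lambda>r. h (x0 + (t + r - 2 * s)) r) = P (- 1) (x0 + (t + b - 2 * s)) b"
   unfolding P_def by (rule integral_cong) (simp add: algebra_simps)
  finally have "U (- 1) (x0 + t - s) s - F s = integral {b..s} (\<lambda>r. h (x0 + (t + r - 2 * s)) r)"
   unfolding F_def U_def by (simp add: algebra_simps)
  then show ?thesis unfolding k_def
   using integral_norm_bound_integral[of "\<lambda>r. h (x0 + (t + r - 2 * s)) r" "{b..s}" "\<lambda>r. \<bar>h (x0 + (t + r - 2 * s)) r\<bar>"]
   by (simp add: integrable_continuous_real cont' continuous_on_rabs)
 qed
 have kc: "continuous_on {(s, r). b <= r & r <= s & s <= t} (\<lambda>(s, r). k s r)" unfolding k_def case_prod_beta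
  by (intro continuous_on_rabs h_cont_compose continuous_intros tri) (use b0 in auto)
 note swap = integral_triangle_swap[OF kc]
 define V where "V y = indicator {- (1 / 2)..1 / 2} y * abs (v (- 1) y s1)" for y
 have V: "integrable lborel V" "!!y. 0 <= V y"
 proof -
  have "set_integrable lborel {- (1 / 2)..1 / 2} (\<lambda>y. abs (v (- 1) y s1))"
   by (rule set_integrable_subset[OF v_abs_integrable]) (use s12 in auto)
  then show "integrable lborel V" by (simp add: V_def[abs_def] set_integrable_def)
 qed (simp add: V_def)
 have ph: "phi p a s > 0" if "s1 <= s" for s using phi_pos[OF spos[OF that]] .
 \<comment> \<open>By the assumption on \<open>s1\<close> and \<open>s2\<close> the small cone stays
   within \<open>abs y <= 1 / 2\<close> at each similarity time, away from the ends, where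
   \<open>rho\<close> degenerates and the energy gives no uniform control.\<close>
 have in_win: "\<bar>(t + r - 2 * s) * exp j\<bar> <= 1 / 2" if "s1 <= j" "j <= s2" "r = T0 - exp (- j)" "r <= s" "s <= t" for r s j
 proof -
  have "\<bar>t + r - 2 * s\<bar> <= t - r" using that by auto
  also have "... = exp (- j) - exp (- s2)" using that by (simp add: t_def)
  also have "... <= exp (- j) / 2"
  proof -
   have "exp (- j) <= exp (- s1)" using that by simp
   then show ?thesis using d by linarith
  qed
  finally have "\<bar>t + r - 2 * s\<bar> * exp j <= exp (- j) / 2 * exp j" by (intro mult_right_mono) auto
  then show ?thesis by (simp add: abs_mult exp_minus)
 qed
 have FV: "abs (F s) = phi p a s1 * exp s1 * V ((t + b - 2 * s) * exp s1)" if s: "b <= s" "s <= t" for s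
 proof -
  have y: "\<bar>(t + b - 2 * s) * exp s1\<bar> <= 1 / 2" by (rule in_win) (use s s12 in "auto simp: b_def")
  have "phi p a s1 * exp s1 * v (- 1) ((t + b - 2 * s) * exp s1) s1 = F s"
  proof -
   have e: "(t + b - 2 * s) * exp s1 * exp (- s1) = t + b - 2 * s" by (simp add: exp_minus)
   show ?thesis unfolding v_def F_def b_def[symmetric] e using ph[of s1] by (simp add: exp_minus)
  qed
  then have "abs (F s) = phi p a s1 * exp s1 * \<bar>v (- 1) ((t + b - 2 * s) * exp s1) s1\<bar>"
   using ph[of s1] by (metis abs_mult abs_of_pos exp_gt_zero order_refl)
  then show ?thesis using y by (auto simp: V_def indicator_def abs_le_iff)
 qed
 note win = affine_window[OF V, of "exp s1" b t, OF exp_gt_zero]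
 have FI: "(\<lambda>s. abs (F s)) integrable_on {b..t}"
  and FB: "integral {b..t} (\<lambda>s. abs (F s)) <= phi p a s1 / 2 * (LINT y:{- (1 / 2)..1 / 2}|lborel. abs (v (- 1) y s1))"
 proof -
  have c1: "set_integrable lborel {b..t} (\<lambda>s. phi p a s1 * exp s1 * V ((t + b - 2 * s) * exp s1))"
   by (rule set_integrable_mult_right) (use win(1) in simp)
  note c2 = set_borel_integral_eq_integral[OF c1]
  show "(\<lambda>s. abs (F s)) integrable_on {b..t}" by (rule integrable_eq[OF c2(1)]) (use FV in auto)
  have "integral {b..t} (\<lambda>s. abs (F s)) = integral {b..t} (\<lambda>s. phi p a s1 * exp s1 * V ((t + b - 2 * s) * exp s1))"
   by (rule integral_cong) (use FV in auto)
  also have "... = phi p a s1 * exp s1 * (LINT s:{b..t}|lborel. V ((t + b - 2 * s) * exp s1))" unfolding c2(2)[symmetric] by simp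
  also have "... <= phi p a s1 * exp s1 * ((LINT y|lborel. V y) / (2 * exp s1))" using ph[of s1] by (intro mult_left_mono win(2)) auto
  also have "... = phi p a s1 / 2 * (LINT y:{- (1 / 2)..1 / 2}|lborel. abs (v (- 1) y s1))" by (simp add: V_def set_lebesgue_integral_def)
  finally show "integral {b..t} (\<lambda>s. abs (F s)) <= phi p a s1 / 2 * (LINT y:{- (1 / 2)..1 / 2}|lborel. abs (v (- 1) y s1))" .
 qed
 define Ga where "Ga s = integral {- (1 / 2)..1 / 2} (\<lambda>y. abs (g y s))" for s
 \<comment> \<open>The similarity time that belongs to the physical time \<open>r\<close>.\<close>
 define ta where "ta r = - ln (T0 - r)" for r
 have ta: "s1 <= ta r" "ta r <= s2" "r = T0 - exp (- ta r)" "0 < T0 - r" if r: "b <= r" "r <= t" for r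
 proof -
  have r2: "exp (- s2) <= T0 - r" and r1: "T0 - r <= exp (- s1)" using r by (auto simp: t_def b_def)
  then show pos: "0 < T0 - r" by (smt (verit) exp_gt_zero)
  have "ln (T0 - r) <= ln (exp (- s1))" "ln (exp (- s2)) <= ln (T0 - r)" using r1 r2 pos by (subst ln_le_cancel_iff; simp)+
  then show "s1 <= ta r" "ta r <= s2" by (auto simp: ta_def)
  show "r = T0 - exp (- ta r)" using pos by (simp add: ta_def)
 qed
 define H where "H r = phi p a (ta r) * exp (ta r) / 2 * Ga (ta r)" for r
 have inner: "integral {r..t} (\<lambda>s. k s r) <= H r" if r: "b <= r" "r <= t" for r
 proof -
  define j where "j = ta r"
  note sg = ta[OF r, folded j_def]
  define f where "f y = indicator {- (1 / 2)..1 / 2} y * (phi p a j * exp (2 * j) * abs (g y j))" for y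
  have gc: "continuous_on {- (1 / 2)..1 / 2} (\<lambda>y. abs (g y j))"
   by (rule continuous_on_rabs, rule continuous_on_compose2[OF g_cont[unfolded case_prod_beta], of _ "\<lambda>y. (y, j)", simplified])
    (use sg in "auto intro!: continuous_intros")
  have fI: "set_integrable lborel {- (1 / 2)..1 / 2} (\<lambda>y. phi p a j * exp (2 * j) * abs (g y j))"
   by (intro borel_integrable_atLeastAtMost' continuous_intros gc)
  have f: "integrable lborel f" "!!y. 0 <= f y" using fI ph[OF sg(1)] by (auto simp: f_def[abs_def] set_integrable_def)
  have fk: "k s r = f ((t + r - 2 * s) * exp j)" if s: "r <= s" "s <= t" for s
  proof -
   have y: "\<bar>(t + r - 2 * s) * exp j\<bar> <= 1 / 2" by (rule in_win[OF sg(1-3) s])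
   have e: "(t + r - 2 * s) * exp j * exp (- j) = t + r - 2 * s" by (simp add: exp_minus)
   have "g ((t + r - 2 * s) * exp j) j = exp (- 2 * j) * h (x0 + (t + r - 2 * s)) r / phi p a j"
    unfolding g_h[OF sg(1)] e sg(3)[symmetric] ..
   then have "phi p a j * exp (2 * j) * g ((t + r - 2 * s) * exp j) j = h (x0 + (t + r - 2 * s)) r"
    using ph[OF sg(1)] by (simp add: exp_minus field_simps)
   then have "k s r = phi p a j * exp (2 * j) * \<bar>g ((t + r - 2 * s) * exp j) j\<bar>"
    unfolding k_def using ph[OF sg(1)] by (metis abs_mult abs_of_pos exp_gt_zero)
   then show ?thesis using y by (auto simp: f_def indicator_def abs_le_iff)
  qed
  note win' = affine_window[OF f, of "exp j" r t, OF exp_gt_zero]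
  note c2 = set_borel_integral_eq_integral[OF win'(1)]
  have "integral {r..t} (\<lambda>s. k s r) = integral {r..t} (\<lambda>s. f ((t + r - 2 * s) * exp j))"
   by (rule integral_cong) (use fk in auto)
  also have "... <= (LINT y|lborel. f y) / (2 * exp j)" using win'(2) unfolding c2(2) .
  also have "(LINT y|lborel. f y) = phi p a j * exp (2 * j) * Ga j"
  proof -
   have "(LINT y|lborel. f y) = integral {- (1 / 2)..1 / 2} (\<lambda>y. phi p a j * exp (2 * j) * abs (g y j))"
    using set_borel_integral_eq_integral(2)[OF fI] unfolding f_def[abs_def] set_lebesgue_integral_def real_scaleR_def .
   then show ?thesis by (simp add: Ga_def)
  qed
  also have "phi p a j * exp (2 * j) * Ga j / (2 * exp j) = H r"
  proof -
   have "exp (2 * j) = exp j * exp j" by (simp flip: exp_add)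
   then show ?thesis by (simp add: H_def j_def)
  qed
  finally show ?thesis .
 qed
 have phc: "continuous_on {b..t} (\<lambda>r. phi p a (ta r))" and Gc: "continuous_on {b..t} (\<lambda>r. Ga (ta r))"
  and tac: "continuous_on {b..t} ta"
 proof -
  have "T0 - r ~= 0" if "r \<in> {b..t}" for r using ta(4)[of r] that by auto
  then show "continuous_on {b..t} ta" unfolding ta_def by (intro continuous_intros) auto
  then show "continuous_on {b..t} (\<lambda>r. phi p a (ta r))" "continuous_on {b..t} (\<lambda>r. Ga (ta r))"
   by (rule continuous_on_compose2[OF phi_cont] continuous_on_compose2[OF gint_cont[folded Ga_def]]; use ta in auto)+
 qed
 have Hc: "continuous_on {b..t} H" unfolding H_def by (intro continuous_intros phc Gc tac) auto
 have HB: "integral {b..t} H = 1 / 2 * integral {s1..s2} (\<lambda>s. phi p a s * Ga s)"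
 proof -
  have "((\<lambda>s. exp (- s) *\<^sub>R H (T0 - exp (- s))) has_integral integral {T0 - exp (- s1)..T0 - exp (- s2)} H) {s1..s2}"
   by (rule has_integral_substitution[where c = b and d = t])
    (use s12 Hc in "auto intro!: derivative_eq_intros simp: t_def b_def")
  then have "integral {s1..s2} (\<lambda>s. exp (- s) *\<^sub>R H (T0 - exp (- s))) = integral {b..t} H"
   by (simp add: integral_unique t_def b_def)
  moreover have "integral {s1..s2} (\<lambda>s. exp (- s) *\<^sub>R H (T0 - exp (- s))) = integral {s1..s2} (\<lambda>s. 1 / 2 * (phi p a s * Ga s))"
  proof (rule integral_cong)
   fix s
   have "ta (T0 - exp (- s)) = s" by (simp add: ta_def)
   moreover have "exp (- s) * exp s = 1" by (simp flip: exp_add)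
   ultimately show "exp (- s) *\<^sub>R H (T0 - exp (- s)) = 1 / 2 * (phi p a s * Ga s)" by (simp add: H_def)
  qed
  ultimately show ?thesis by simp
 qed
 have kI: "integral {b..t} (\<lambda>s. integral {b..s} (k s)) <= integral {b..t} H"
 proof -
  have "integral {b..t} (\<lambda>s. integral {b..s} (k s)) = integral {b..t} (\<lambda>r. integral {r..t} (\<lambda>s. k s r))"
   using swap(1) by simp
  also have "... <= integral {b..t} H" by (rule integral_le[OF swap(3) integrable_continuous_real[OF Hc]]) (use inner in auto)
  finally show ?thesis .
 qed
 have UI: "(\<lambda>s. U (- 1) (x0 + t - s) s) integrable_on {b..t}" by (rule acd_integrable[OF acd]) auto
 have "norm (integral {b..t} (\<lambda>s. U (- 1) (x0 + t - s) s)) <= integral {b..t} (\<lambda>s. abs (F s) + integral {b..s} (k s))"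
 proof (rule integral_norm_bound_integral[OF UI integrable_add[OF FI swap(2)]])
  fix s assume "s \<in> {b..t}"
  then show "norm (U (- 1) (x0 + t - s) s) <= abs (F s) + integral {b..s} (k s)" using split[of s] by simp
 qed
 then have bound: "\<bar>integral {b..t} (\<lambda>s. U (- 1) (x0 + t - s) s)\<bar> <= integral {b..t} (\<lambda>s. abs (F s) + integral {b..s} (k s))"
  by simp
 have "integral {b..t} (\<lambda>s. abs (F s) + integral {b..s} (k s)) = integral {b..t} (\<lambda>s. abs (F s)) + integral {b..t} (\<lambda>s. integral {b..s} (k s))"
  by (rule integral_add[OF FI swap(2)])
 moreover have "u x0 t - u (x0 + (t - b)) b = integral {b..t} (\<lambda>s. U (- 1) (x0 + t - s) s)"
  using acd_diff[OF acd, of b t] tb by (simp add: algebra_simps)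
 moreover have "\<bar>u (x0 + (t - b)) b\<bar> = phi p a s1 * \<bar>w (1 - exp (s1 - s2)) s1\<bar>"
 proof -
  have "(1 - exp (s1 - s2)) * exp (- s1) = t - b" by (simp add: tb(3) left_diff_distrib flip: exp_add)
  then have "phi p a s1 * w (1 - exp (s1 - s2)) s1 = u (x0 + (t - b)) b" using phi_w[of s1 "1 - exp (s1 - s2)"] by (simp add: b_def)
  then show ?thesis using ph[of s1] by (metis abs_mult abs_of_pos order_refl)
 qed
 ultimately show ?thesis using bound FB kI HB unfolding t_def[symmetric] Ga_def by linarith
qed

end

text \<open>In similarity variables this reads \<open>abs g <= w * g + Cg * s powr abs a\<close>.
  For \<open>abs w >= 1\<close> the first term suffices. For \<open>abs w < 1\<close> the size of
  \<open>g\<close> is at most \<open>s powr (- a) * Lg powr a\<close> by \<open>E2_phi\<close>, and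
  \<open>Lg\<close> lies between \<open>ln 2\<close> and a multiple of \<open>s\<close>, the upper
  bound being needed for \<open>a >= 0\<close> and the lower one for \<open>a < 0\<close>.\<close>

lemma source_growth:
 assumes p: "p > 1"
 obtains Cg where "Cg >= 0" "!!s w. s >= 1 ==>
  \<bar>E2 p a s * phi p a s * nonlin p a (phi p a s * w)\<bar> <= E2 p a s * Qn p a (phi p a s * w) + Cg * s powr abs a"
proof -
 define k where "k = expo p"
 have k: "k > 0" using expo_pos[OF p] by (simp add: k_def)
 define c where "c = 2 + 2 * k + abs a * k"
 have c: "c > 0" using k by (simp add: c_def add_pos_nonneg)
 show ?thesis
 proof (rule that[of "c powr a + ln 2 powr a"])
  show "0 <= c powr a + ln 2 powr a" by simp
  fix s w :: real assume s: "s >= 1"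
  have ph: "phi p a s > 0" using s by (intro phi_pos) simp
  define x where "x = phi p a s * w"
  have nl: "abs (nonlin p a x) = abs x powr (p - 1) * abs x * Lg x powr a" unfolding nonlin_def Lg_def by (simp add: abs_mult)
  have Qx: "Qn p a x = abs x * abs (nonlin p a x)" using Qn_nonneg[of p a x] by (simp add: Qn_def flip: abs_mult)
  have E: "\<bar>E2 p a s * phi p a s * nonlin p a x\<bar> = E2 p a s * phi p a s * abs (nonlin p a x)"
   using E2_nonneg[of p a s] ph by (simp add: abs_mult)
  show "\<bar>E2 p a s * phi p a s * nonlin p a (phi p a s * w)\<bar> <= E2 p a s * Qn p a (phi p a s * w) + (c powr a + ln 2 powr a) * s powr abs a"
   unfolding x_def[symmetric]
  proof (cases "abs w >= 1")
   case True
   then have "phi p a s * 1 <= abs x" unfolding x_def abs_mult using ph by (intro mult_mono) auto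
   then have "E2 p a s * phi p a s * abs (nonlin p a x) <= E2 p a s * abs x * abs (nonlin p a x)"
    using E2_nonneg[of p a s] by (intro mult_right_mono mult_left_mono) auto
   also have "... = E2 p a s * Qn p a x" by (simp add: Qx)
   finally show "\<bar>E2 p a s * phi p a s * nonlin p a x\<bar> <= E2 p a s * Qn p a x + (c powr a + ln 2 powr a) * s powr abs a"
    unfolding E by (simp add: add_increasing2)
  next
   case False
   then have xp: "abs x <= phi p a s" using ph by (simp add: x_def abs_mult mult_left_le)
   have "abs x powr (p - 1) * abs x * Lg x powr a <= phi p a s powr (p - 1) * phi p a s * Lg x powr a"
    using xp p ph by (intro mult_right_mono mult_mono powr_mono2) auto
   then have "E2 p a s * phi p a s * abs (nonlin p a x) <= E2 p a s * phi p a s * (phi p a s powr (p - 1) * phi p a s * Lg x powr a)"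
    unfolding nl using E2_nonneg[of p a s] ph by (intro mult_left_mono) auto
   also have "phi p a s powr (p + 1) = phi p a s powr (p - 1) * phi p a s * phi p a s"
   proof -
    have "phi p a s powr ((p - 1) + 2) = phi p a s powr (p - 1) * phi p a s powr 2" by (rule powr_add)
    then show ?thesis using ph by (simp add: powr_numeral power2_eq_square add.commute)
   qed
   then have "E2 p a s * phi p a s * (phi p a s powr (p - 1) * phi p a s * Lg x powr a) = E2 p a s * phi p a s powr (p + 1) * Lg x powr a"
    by simp
   also have "... = s powr (- a) * Lg x powr a" using s p by (subst E2_phi) auto
   also have "... <= (c powr a + ln 2 powr a) * s powr abs a"
   proof (cases "a >= 0")
    case True
    have "x^2 <= (phi p a s)^2" using power_mono[OF xp, of 2] by simp
    also have "... = exp (2 * k * s) * s powr (- (a * k))" using phi_powr[of s p a 2] s ph by (simp add: powr_numeral k_def)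
    also have "... <= exp (2 * k * s) * s powr 0" using s True k by (intro mult_left_mono powr_mono) auto
    also have "... <= exp (2 * k * s)" using s by simp
    finally have "2 + x^2 <= 3 * exp (2 * k * s)" using one_le_exp_iff[of "2 * k * s"] k s by (smt (verit) mult_nonneg_nonneg)
    then have "Lg x <= ln (3 * exp (2 * k * s))" unfolding Lg_def by (subst ln_le_cancel_iff) (auto simp: add_pos_nonneg)
    also have "... = ln 3 + 2 * k * s" by (simp add: ln_mult)
    also have "... <= 2 * s + 2 * k * s" using ln_le_minus_one[of 3] s by simp
    also have "... <= c * s"
    proof -
     have "0 <= abs a * k * s" using k s by simp
     then show ?thesis by (simp add: c_def algebra_simps)
    qed
    finally have "Lg x powr a <= (c * s) powr a" using True Lg_pos[of x] by (intro powr_mono2) auto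
    then have "s powr (- a) * Lg x powr a <= s powr (- a) * (c powr a * s powr a)"
     using c s by (intro mult_left_mono) (auto simp: powr_mult)
    also have "... = c powr a" using s by (simp add: powr_minus field_simps)
    also have "... <= (c powr a + ln 2 powr a) * 1" by simp
    also have "... <= (c powr a + ln 2 powr a) * s powr abs a" using s by (intro mult_left_mono) (auto simp: ge_one_powr_ge_zero)
    finally show ?thesis .
   next
    case False
    have "Lg x powr a <= ln 2 powr a" using False Lg_ge[of x] by (intro powr_mono2') auto
    then have "s powr (- a) * Lg x powr a <= s powr abs a * (c powr a + ln 2 powr a)"
     using False by (intro mult_mono) (auto intro: add_increasing)
    then show ?thesis by (simp add: mult.commute)
   qed
   finally show "\<bar>E2 p a s * phi p a s * nonlin p a x\<bar> <= E2 p a s * Qn p a x + (c powr a + ln 2 powr a) * s powr abs a"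
    unfolding E using E2_nonneg[of p a s] Qn_nonneg[of p a x] by (simp add: add_increasing)
  qed
 qed
qed

text \<open>The exponential factors differ by at most \<open>exp (expo p * m)\<close>. The powers of
  \<open>s\<close> are bounded crudely, with \<open>abs a\<close> in the exponent so that both signs
  of \<open>a\<close> are covered.\<close>

lemma phi_compare:
 assumes p: "p > 1" and r: "1 <= r" "r <= s + m" and s: "1 <= s" and m: "0 <= m"
 shows "phi p a r <= exp (expo p * m) * phi p a s * (s + m) powr (abs a * expo p)"
proof -
 define k where "k = expo p"
 have k: "k > 0" using expo_pos[OF p] by (simp add: k_def)
 have ak: "\<bar>a * k / 2\<bar> = abs a * k / 2" using k by (simp add: abs_mult)
 have "r powr (- (a * k / 2)) <= r powr (abs a * k / 2)" using r ak by (intro powr_mono) linarith+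
 also have "... <= (s + m) powr (abs a * k / 2)" using r k by (intro powr_mono2) auto
 finally have 1: "r powr (- (a * k / 2)) <= (s + m) powr (abs a * k / 2)" .
 have "s powr (a * k / 2) <= s powr (abs a * k / 2)" using s ak by (intro powr_mono) linarith+
 also have "... <= (s + m) powr (abs a * k / 2)" using s m k by (intro powr_mono2) auto
 finally have 2: "s powr (a * k / 2) <= (s + m) powr (abs a * k / 2)" .
 have e: "exp (k * s) = phi p a s * s powr (a * k / 2)" unfolding phi_expo k_def[symmetric] using s by (simp add: powr_minus field_simps)
 have "phi p a r = exp (k * r) * r powr (- (a * k / 2))" unfolding phi_expo k_def[symmetric] ..
 also have "... <= (exp (k * m) * exp (k * s)) * (s + m) powr (abs a * k / 2)"
 proof (rule mult_mono[OF _ 1])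
  have "k * r <= k * m + k * s" using mult_left_mono[OF r(2), of k] k by (simp add: algebra_simps)
  then show "exp (k * r) <= exp (k * m) * exp (k * s)" by (simp flip: exp_add)
 qed auto
 also have "... <= (exp (k * m) * (phi p a s * (s + m) powr (abs a * k / 2))) * (s + m) powr (abs a * k / 2)"
  unfolding e using phi_pos[of s p a] s by (intro mult_right_mono mult_left_mono 2) auto
 also have "... = exp (k * m) * phi p a s * ((s + m) powr (abs a * k / 2) * (s + m) powr (abs a * k / 2))" by simp
 also have "(s + m) powr (abs a * k / 2) * (s + m) powr (abs a * k / 2) = (s + m) powr (abs a * k)"
  by (simp add: mult.commute flip: powr_add)
 finally show ?thesis by (simp add: k_def)
qed

context cone
begin

definition Dd where "Dd y s = rho p y * ((z y s)^2 + (1 - y^2) * (wy y s)^2 + (w y s)^2 + w y s * g y s)"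

lemma Dd_nonneg:
 assumes "s1 <= s" "- 1 < y" "y < 1"
 shows "0 <= Dd y s"
proof -
 have "0 <= (1 - y^2) * (wy y s)^2" using one_minus_sq_pos[of y] assms by simp
 then have "0 <= (z y s)^2 + (1 - y^2) * (wy y s)^2 + (w y s)^2 + w y s * g y s"
  using wg_nonneg[OF assms(1), of y] by (simp add: add_nonneg_nonneg)
 then show ?thesis unfolding Dd_def using rho_nonneg by (rule mult_nonneg_nonneg[rotated])
qed

lemma Dd_box_integrable: "bint (\<lambda>x. Dd (snd x) (fst x))"
proof -
 have I: "bint (\<lambda>x. 1 / cdis p * diss n (snd x) (fst x))" for n
  using diss_integrable[of "\<lambda>_. 1 / cdis p" "\<lambda>_. n"] by (simp add: case_prod_beta')
 have "Dd y s = 1 / cdis p * diss 1 y s - 1 / cdis p * diss 0 y s" for y s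
  unfolding Dd_def diss_def rho_rho1 using cdis_pos[OF p] by (simp add: field_simps)
 then show ?thesis using set_integral_diff(1)[OF I[of 1] I[of 0]] by simp
qed

lemma Dd_slice_integrable:
 assumes s: "s1 <= s" "s <= s2"
 shows "sint (\<lambda>y. Dd y s)"
proof -
 have "sint (\<lambda>y. quad0 (\<lambda>_ _. 0) (\<lambda>_ _. 0) (\<lambda>_ _. 0) (\<lambda>_ _. 0) (\<lambda>_ _. 0)
   (\<lambda>y s. (w y s)^2 + w y s * g y s - 2 * k0c p * (w y s)^2 + 2 * G y s) (\<lambda>_ _. 0) y s)"
  by (intro quad0_slice_integrable) (intro strip_intros s)+
 from set_integral_add(1)[OF set_integrable_mult_right[OF Lf_integrable[OF s, of 0], of 2] this]
 show ?thesis by (rule set_integrable_cong[THEN iffD1, rotated 3]) (auto simp: quad0_def En_def Dd_def field_simps)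
qed

text \<open>The weight \<open>s powr e * (bt / s)\<close> is smallest at the upper end; bounding it
  there extracts the unweighted integral at the cost of a power of \<open>s2\<close>.\<close>

lemma diss_Dd:
 assumes e: "e <= 0" and be: "bt >= 1"
 shows "cdis p * s2 powr (e - 1) * (BINT x. Dd (snd x) (fst x)) <=
  (BINT x. fst x powr e * diss (bt / fst x) (snd x) (fst x))"
proof -
 have cont: "continuous_on {s1..s2} (\<lambda>s. s powr e)" "continuous_on {s1..s2} (\<lambda>s. bt / s)"
  using s1 by (intro continuous_intros; auto)+
 have "(BINT x. (cdis p * s2 powr (e - 1)) * Dd (snd x) (fst x)) <=
  (BINT x. fst x powr e * diss (bt / fst x) (snd x) (fst x))"
 proof (rule set_integral_mono)
  show "bint (\<lambda>x. (cdis p * s2 powr (e - 1)) * Dd (snd x) (fst x))"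
   by (rule set_integrable_mult_right) (use Dd_box_integrable in simp)
  show "bint (\<lambda>x. fst x powr e * diss (bt / fst x) (snd x) (fst x))" using diss_integrable[OF cont] by (simp add: case_prod_beta')
  fix x :: "real \<times> real" assume "x \<in> obox"
  then have *: "s1 <= fst x" "fst x <= s2" "- 1 < snd x" "snd x < 1" by auto
  have f: "0 < fst x" by (rule spos[OF *(1)])
  have "s2 powr (e - 1) <= fst x powr (e - 1)" using e f * by (intro powr_mono2') auto
  also have "... = fst x powr e * (1 / fst x)" using f by (simp add: powr_diff)
  also have "... <= fst x powr e * (bt / fst x)" using be f by (intro mult_left_mono divide_right_mono) auto
  finally have "s2 powr (e - 1) * (cdis p * Dd (snd x) (fst x)) <= fst x powr e * (bt / fst x) * (cdis p * Dd (snd x) (fst x))"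
   using Dd_nonneg[OF *(1,3,4)] cdis_pos[OF p] by (intro mult_right_mono) auto
  also have "... = fst x powr e * (bt / fst x * cdis p * Dd (snd x) (fst x))" by simp
  also have "... <= fst x powr e * diss (bt / fst x) (snd x) (fst x)"
   using diss_nonneg(3)[OF *(1,3,4), of "bt / fst x"] be f by (intro mult_left_mono) (auto simp: Dd_def)
  finally show "cdis p * s2 powr (e - 1) * Dd (snd x) (fst x) <= fst x powr e * diss (bt / fst x) (snd x) (fst x)" by (simp add: mult_ac)
 qed
 then show ?thesis by simp
qed

lemma Dd_time: "set_integrable lborel {s1..s2} (\<lambda>s. LINT y:{- 1<..<1}|lborel. Dd y s)"
proof -
 have "integrable lborel2 (\<lambda>(s, y). indicat_real {s1..s2} s * (indicat_real {- 1<..<1} y * Dd y s))"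
  using Dd_box_integrable by (simp add: set_integrable_def case_prod_beta' indicator_times mult.assoc)
 from lborel_pair.integrable_fst'[OF this]
 show ?thesis by (simp add: set_integrable_def set_lebesgue_integral_def)
qed

text \<open>If the slice integral were larger throughout a window of length \<open>ln 2\<close>, its
  time integral would exceed \<open>M\<close>. The length is chosen so that
  \<open>exp (- s) <= 2 * exp (- s2)\<close>, which is what \<open>tip_bound\<close>
  requires.\<close>

lemma good_time:
 assumes l: "s1 <= s2 - ln 2" and M: "(BINT x. Dd (snd x) (fst x)) <= M"
 obtains s where "s2 - ln 2 <= s" "s <= s2" "(SINT y. Dd y s) <= M / ln 2 + 1"
proof (rule ccontr)
 assume "\<not> thesis"
 then have gt: "M / ln 2 + 1 < (SINT y. Dd y s)" if "s2 - ln 2 <= s" "s <= s2" for s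
  using that \<open>!!s. _ ==> _ ==> _ ==> thesis\<close> by fastforce
 let ?D = "\<lambda>s. LINT y:{- 1<..<1}|lborel. Dd y s"
 have D0: "0 <= ?D s" if "s1 <= s" for s
  unfolding set_lebesgue_integral_def using Dd_nonneg[OF that] by (intro integral_nonneg_AE AE_I2) (auto split: split_indicator)
 have I: "set_integrable lborel {s2 - ln 2..s2} ?D" by (rule set_integrable_subset[OF Dd_time]) (use l in auto)
 have "M + ln 2 = (LINT s:{s2 - ln 2..s2}|lborel. M / ln 2 + 1)" by (simp add: set_lebesgue_integral_def distrib_left)
 also have "... <= (LINT s:{s2 - ln 2..s2}|lborel. ?D s)"
  by (rule set_integral_mono[OF _ I]) (use gt in "auto intro!: borel_integrable_atLeastAtMost' less_imp_le")
 also have "... <= (LINT s:{s1..s2}|lborel. ?D s)" by (rule set_integral_mono_domain[OF Dd_time]) (use l D0 in auto)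
 also have "... = (BINT x. Dd (snd x) (fst x))" by (rule obox_Fubini) (use Dd_box_integrable in "simp add: case_prod_beta'")
 finally have "M + ln 2 <= M" using M by linarith
 moreover have "0 < ln (2::real)" by simp
 ultimately show False by linarith
qed

lemma lam_bound: "s1 <= s ==> abs (lam p a s) <= expo p * (1 + abs a)"
proof -
 assume s: "s1 <= s"
 have k: "0 < expo p" by (rule expo_pos[OF p])
 have "\<bar>a * expo p / (2 * s)\<bar> = abs a * expo p * (1 / (2 * s))" using s s1 k by (simp add: abs_mult)
 also have "... <= abs a * expo p * 1" using s s1 k by (intro mult_left_mono) auto
 finally have "\<bar>a * expo p / (2 * s)\<bar> <= abs a * expo p" by simp
 moreover have "abs (lam p a s) <= abs (expo p) + \<bar>a * expo p / (2 * s)\<bar>" unfolding lam_def by (rule abs_triangle_ineq4)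
 moreover have "expo p * (1 + abs a) = expo p + abs a * expo p" by (simp add: algebra_simps)
 ultimately show ?thesis using k by linarith
qed

lemma inner_Dd:
 assumes s: "s1 <= s" and y: "- (1 / 2) <= y" "y <= 1 / 2"
 shows "(z y s)^2 + (wy y s)^2 + (w y s)^2 + w y s * g y s <= (4 / 3) powr (expo p + 1) * Dd y s"
proof -
 define R where "R = 1 - y^2"
 have "abs y <= 1 / 2" using y by (simp add: abs_le_iff)
 then have "y^2 <= (1 / 2)^2" using power_mono[of "abs y" "1 / 2" 2] by simp
 then have R: "3 / 4 <= R" "R <= 1" by (auto simp: R_def power2_eq_square)
 have k: "0 < expo p" by (rule expo_pos[OF p])
 define Q where "Q = (z y s)^2 + (wy y s)^2 + (w y s)^2 + w y s * g y s"
 have wg: "0 <= w y s * g y s" by (rule wg_nonneg[OF s])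
 have Q: "0 <= Q" using wg by (simp add: Q_def)
 have rho: "rho p y = R powr expo p" by (simp add: rho_def R_def expo_def)
 have le1: "R * X <= X" if "0 <= X" for X using mult_right_mono[OF R(2) that] by simp
 have "R * Q <= (z y s)^2 + R * (wy y s)^2 + (w y s)^2 + w y s * g y s"
  using le1[of "(z y s)^2"] le1[of "(w y s)^2"] le1[OF wg] unfolding Q_def distrib_left by simp
 then have "R powr expo p * (R * Q) <= Dd y s" unfolding Dd_def rho R_def[symmetric] by (intro mult_left_mono) auto
 moreover have "R powr expo p * (R * Q) = R powr (expo p + 1) * Q" using R by (simp add: powr_add)
 moreover have "(3 / 4) powr (expo p + 1) * Q <= R powr (expo p + 1) * Q" using R k Q by (intro mult_right_mono powr_mono2) auto
 ultimately have "(3 / 4) powr (expo p + 1) * Q <= Dd y s" by linarith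
 then have "(4 / 3) powr (expo p + 1) * ((3 / 4) powr (expo p + 1) * Q) <= (4 / 3) powr (expo p + 1) * Dd y s"
  by (intro mult_left_mono) auto
 moreover have "(4 / 3) powr (expo p + 1) * (3 / 4) powr (expo p + 1) = (1 :: real)" by (simp flip: powr_mult)
 ultimately show ?thesis by (simp add: Q_def mult.assoc[symmetric])
qed

lemma v_inner:
 assumes s: "s1 <= s" and y: "- (1 / 2) <= y" "y <= 1 / 2" and j: "j \<in> {1, - 1}"
 shows "abs (v j y s) <= (3 + expo p * (1 + abs a)) * (1 + (4 / 3) powr (expo p + 1) * Dd y s)"
proof -
 define Q where "Q = (z y s)^2 + (wy y s)^2 + (w y s)^2 + w y s * g y s"
 define La where "La = expo p * (1 + abs a)"
 have La: "0 <= La" using expo_pos[OF p] by (simp add: La_def)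
 have wg: "0 <= w y s * g y s" by (rule wg_nonneg[OF s])
 have ab: "abs t <= 1 + t^2" for t :: real using sum_squares_bound[of 1 "abs t"] by (simp add: abs_le_iff) (smt (verit) zero_le_power2)
 have pieces: "(z y s)^2 <= Q" "(wy y s)^2 <= Q" "(w y s)^2 <= Q" using wg by (auto simp: Q_def)
 have 1: "abs (z y s) <= 1 + Q" "abs (w y s) <= 1 + Q" "abs (wy y s) <= 1 + Q"
  using ab[of "z y s"] ab[of "w y s"] ab[of "wy y s"] pieces by linarith+
 have lw: "\<bar>lam p a s * w y s\<bar> <= La * (1 + Q)"
  unfolding abs_mult La_def using lam_bound[OF s] 1 expo_pos[OF p] by (intro mult_mono) auto
 have "abs (v j y s) <= abs (z y s) + \<bar>lam p a s * w y s\<bar> + 2 * abs (wy y s)"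
 proof -
  have "\<bar>(1 + y) * wy y s\<bar> <= 2 * abs (wy y s)" "\<bar>(1 - y) * wy y s\<bar> <= 2 * abs (wy y s)"
   unfolding abs_mult using y by (intro mult_right_mono; auto)+
  then show ?thesis using j v_z[of y s] by auto
 qed
 also have "... <= (1 + Q) + La * (1 + Q) + 2 * (1 + Q)" by (intro add_mono 1 lw mult_left_mono) auto
 also have "... = (3 + La) * (1 + Q)" by (simp add: algebra_simps)
 also have "... <= (3 + La) * (1 + (4 / 3) powr (expo p + 1) * Dd y s)"
  using inner_Dd[OF s y] La by (intro mult_left_mono) (auto simp: Q_def)
 finally show ?thesis by (simp add: La_def)
qed

lemma inner_integral:
 assumes s: "s1 <= s" "s <= s2" and f: "set_integrable lborel {- (1 / 2)..1 / 2} f" and c: "0 <= c"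
  and le: "!!y. - (1 / 2) <= y ==> y <= 1 / 2 ==> f y <= c * (1 + H * Dd y s)" and H: "0 <= H"
 shows "(LINT y:{- (1 / 2)..1 / 2}|lborel. f y) <= c * (1 + H * (SINT y. Dd y s))"
proof -
 note D = Dd_slice_integrable[OF s]
 have D': "set_integrable lborel {- (1 / 2)..1 / 2} (\<lambda>y. Dd y s)" by (rule set_integrable_subset[OF D]) auto
 have one: "set_integrable lborel {- (1 / 2)..1 / 2::real} (\<lambda>y. 1 :: real)" by (rule borel_integrable_atLeastAtMost') simp
 have "(LINT y:{- (1 / 2)..1 / 2}|lborel. f y) <= (LINT y:{- (1 / 2)..1 / 2}|lborel. c * (1 + H * Dd y s))"
  by (rule set_integral_mono[OF f]) (use le one D' in "auto intro!: set_integrable_mult_right set_integral_add(1)")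
 also have "... = c * (1 + H * (LINT y:{- (1 / 2)..1 / 2}|lborel. Dd y s))"
  using one D' by (simp add: set_integral_add(2)) (simp add: set_lebesgue_integral_def)
 also have "... <= c * (1 + H * (SINT y. Dd y s))"
  using c H by (intro mult_left_mono add_left_mono set_integral_mono_domain[OF D] Dd_nonneg[OF s(1)]) auto
 finally show ?thesis .
qed

text \<open>The one-dimensional Sobolev inequality on an interval of length 1: a value of
  \<open>w\<close> is at most the mean of \<open>abs w\<close> plus the integral of
  \<open>abs wy\<close>.\<close>

lemma w_inner:
 assumes s: "s1 <= s" "s <= s2" and y0: "- (1 / 2) <= y0" "y0 <= 1 / 2"
 shows "abs (w y0 s) <= (4 + expo p * (1 + abs a)) * (1 + (4 / 3) powr (expo p + 1) * (SINT y. Dd y s))"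
proof -
 define H where "H = (4 / 3) powr (expo p + 1)"
 define c where "c = 3 + expo p * (1 + abs a)"
 have c: "0 <= c" using expo_pos[OF p] by (simp add: c_def)
 have H: "0 <= H" by (simp add: H_def)
 let ?J = "{- (1 / 2)..1 / 2} :: real set"
 define W where "W y = abs (v 1 y s) / 2 + abs (v (- 1) y s) / 2" for y
 have vI: "set_integrable lborel ?J (\<lambda>y. abs (v j y s))" if "abs j = 1" for j
  by (rule set_integrable_subset[OF v_abs_integrable[OF that s]]) auto
 have WI: "set_integrable lborel ?J W" unfolding W_def[abs_def] using vI by (intro set_integral_add(1) set_integrable_divide) auto
 note WH = set_borel_integral_eq_integral[OF WI]
 have W0: "0 <= W y" for y by (simp add: W_def)
 note acd = w_fixed_time_acd[OF s]
 have wyW: "norm (wy y s) <= W y" for y unfolding wy_def W_def by simp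
 have step: "\<bar>w d s - w c s\<bar> <= integral ?J W" if cd: "- (1 / 2) <= c" "c <= d" "d <= 1 / 2" for c d
 proof -
  have i: "W integrable_on {c..d}" by (rule integrable_on_subinterval[OF WH(1)]) (use cd in auto)
  have "norm (integral {c..d} (\<lambda>y. wy y s)) <= integral {c..d} W"
   by (rule integral_norm_bound_integral[OF acd_integrable[OF acd] i]) (use cd wyW in auto)
  also have "... <= integral ?J W" by (rule integral_subset_le[OF _ i WH(1)]) (use cd W0 in auto)
  finally show ?thesis using acd_diff[OF acd, of c d] cd by simp
 qed
 have pt: "abs (w y0 s) <= abs (w y s) + integral ?J W" if "y \<in> ?J" for y
  using step[of y y0] step[of y0 y] that y0 by (cases "y <= y0") auto
 have wc: "continuous_on ?J (\<lambda>y. abs (w y s))"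
  using acd_continuous[OF acd] by (intro continuous_on_rabs) (auto elim: continuous_on_subset)
 have wI: "set_integrable lborel ?J (\<lambda>y. abs (w y s))" by (rule borel_integrable_atLeastAtMost'[OF wc])
 have cI: "set_integrable lborel ?J (\<lambda>y. b :: real)" for b by (rule borel_integrable_atLeastAtMost') simp
 have len: "(LINT y:?J|lborel. b) = b" for b :: real by (simp add: set_lebesgue_integral_def)
 have "abs (w y0 s) = (LINT y:?J|lborel. abs (w y0 s))" by (simp only: len)
 also have "... <= (LINT y:?J|lborel. abs (w y s) + integral ?J W)" by (rule set_integral_mono[OF cI set_integral_add(1)[OF wI cI] pt])
 also have "... = (LINT y:?J|lborel. abs (w y s)) + (LINT y:?J|lborel. W y)" unfolding set_integral_add(2)[OF wI cI] len WH(2) ..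
 also have "(LINT y:?J|lborel. abs (w y s)) <= 1 * (1 + H * (SINT y. Dd y s))"
 proof (rule inner_integral[OF s wI _ _ H])
  fix y :: real assume y: "- (1 / 2) <= y" "y <= 1 / 2"
  have "abs (w y s) <= 1 + (w y s)^2" using sum_squares_bound[of 1 "abs (w y s)"] by simp
  also have "(w y s)^2 <= (z y s)^2 + (wy y s)^2 + (w y s)^2 + w y s * g y s" using wg_nonneg[OF s(1)] by simp
  also have "... <= H * Dd y s" unfolding H_def by (rule inner_Dd[OF s(1) y])
  finally show "abs (w y s) <= 1 * (1 + H * Dd y s)" by simp
 qed simp
 also have "(LINT y:?J|lborel. W y) <= c * (1 + H * (SINT y. Dd y s))"
 proof (rule inner_integral[OF s WI c _ H])
  fix y :: real assume y: "- (1 / 2) <= y" "y <= 1 / 2"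
  show "W y <= c * (1 + H * Dd y s)" using v_inner[OF s(1) y, of 1] v_inner[OF s(1) y, of "- 1"] unfolding W_def c_def H_def by simp
 qed
 finally show ?thesis unfolding c_def H_def by (simp add: algebra_simps)
qed

lemma tip_estimate:
 assumes d: "exp (- s1) <= 2 * exp (- s2)"
  and Cg: "Cg >= 0" "!!s w. s >= 1 ==>
   \<bar>E2 p a s * phi p a s * nonlin p a (phi p a s * w)\<bar> <= E2 p a s * Qn p a (phi p a s * w) + Cg * s powr abs a"
  and M1: "(SINT y. Dd y s1) <= M1"
  and M2: "(BINT x. Dd (snd x) (fst x)) <= M2"
  and Ph: "!!s. s1 <= s ==> s <= s2 ==> phi p a s <= Ph"
 defines "H == (4 / 3) powr (expo p + 1)" and "c == 4 + expo p * (1 + abs a)"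
 shows "\<bar>u x0 (T0 - exp (- s2))\<bar> <= Ph * (2 * c * (1 + H * M1) + H * M2 + Cg * s2 powr abs a)"
proof -
 let ?J = "{- (1 / 2)..1 / 2} :: real set"
 let ?D = "\<lambda>s. LINT y:{- 1<..<1}|lborel. Dd y s"
 have H: "0 <= H" by (simp add: H_def)
 have c: "4 <= c" using expo_pos[OF p] by (simp add: c_def)
 have ph: "0 < phi p a s" if "s1 <= s" for s by (rule phi_pos[OF spos[OF that]])
 have Ph1: "phi p a s1 <= Ph" "0 <= Ph" using Ph[of s1] ph[of s1] s12 by auto
 have D0: "0 <= ?D s" if "s1 <= s" for s
  unfolding set_lebesgue_integral_def using Dd_nonneg[OF that] by (intro integral_nonneg_AE AE_I2) (auto split: split_indicator)
 have ss: "s2 - s1 <= 1"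
 proof -
  have "exp (s2 - s1) <= 2" using d by (simp add: exp_diff exp_minus field_simps)
  then have "s2 - s1 <= ln 2" using ln_ge_iff[of 2 "s2 - s1"] by simp
  then show ?thesis using ln_le_minus_one[of 2] by simp
 qed
 define N where "N = c * (1 + H * M1)"
 have HM: "1 + H * ?D s1 <= 1 + H * M1" using mult_left_mono[OF M1 H] by simp
 have cN: "c * (1 + H * ?D s1) <= N" unfolding N_def using HM c by (intro mult_left_mono) auto
 have N0: "0 <= N" using cN D0[of s1] H c by (smt (verit) mult_nonneg_nonneg order_refl)
 have e1: "0 <= 1 - exp (s1 - s2)" "1 - exp (s1 - s2) <= 1 / 2"
 proof -
  show "0 <= 1 - exp (s1 - s2)" using s12 by simp
  have "exp (s1 - s2) * 2 = exp s1 * (2 * exp (- s2))" by (simp add: exp_diff exp_minus field_simps)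
  also have "... >= exp s1 * exp (- s1)" using d by (intro mult_left_mono) auto
  finally have "1 <= exp (s1 - s2) * 2" by (simp flip: exp_add)
  then show "1 - exp (s1 - s2) <= 1 / 2" by simp
 qed
 have a1: "\<bar>w (1 - exp (s1 - s2)) s1\<bar> <= N"
  using w_inner[of s1 "1 - exp (s1 - s2)"] e1 s12 cN unfolding H_def[symmetric] c_def[symmetric] by simp
 have a2: "(LINT y:?J|lborel. abs (v (- 1) y s1)) <= N"
 proof -
  have "(LINT y:?J|lborel. abs (v (- 1) y s1)) <= (c - 1) * (1 + H * ?D s1)"
  proof (rule inner_integral[OF _ s12])
   show "set_integrable lborel ?J (\<lambda>y. abs (v (- 1) y s1))" by (rule set_integrable_subset[OF v_abs_integrable]) (use s12 in auto)
   fix y :: real assume y: "- (1 / 2) <= y" "y <= 1 / 2"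
   show "abs (v (- 1) y s1) <= (c - 1) * (1 + H * Dd y s1)" using v_inner[OF _ y, of s1 "- 1"] unfolding H_def c_def by simp
  qed (use c H in auto)
  also have "... <= c * (1 + H * ?D s1)" using D0[of s1] H by (intro mult_right_mono) auto
  finally show ?thesis using cN by linarith
 qed
 define Ga where "Ga s = integral ?J (\<lambda>y. abs (g y s))" for s
 have Ga: "Ga s <= H * ?D s + Cg * s2 powr abs a" if s: "s1 <= s" "s <= s2" for s
 proof -
  have gc: "continuous_on ?J (\<lambda>y. abs (g y s))"
   by (rule continuous_on_rabs, rule continuous_on_compose2[OF g_cont[unfolded case_prod_beta], of _ "\<lambda>y. (y, s)", simplified])
    (use s in "auto intro!: continuous_intros")
  have gI: "set_integrable lborel ?J (\<lambda>y. abs (g y s))" by (rule borel_integrable_atLeastAtMost'[OF gc])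
  define b where "b = Cg * s2 powr abs a"
  have cI: "set_integrable lborel ?J (\<lambda>y. b)" by (rule borel_integrable_atLeastAtMost') simp
  have D': "set_integrable lborel ?J (\<lambda>y. Dd y s)" by (rule set_integrable_subset[OF Dd_slice_integrable[OF s]]) auto
  have "Ga s = (LINT y:?J|lborel. abs (g y s))" unfolding Ga_def using set_borel_integral_eq_integral(2)[OF gI] by simp
  also have "... <= (LINT y:?J|lborel. H * Dd y s + b)"
  proof (rule set_integral_mono[OF gI])
   show "set_integrable lborel ?J (\<lambda>y. H * Dd y s + b)" by (intro set_integral_add(1) cI set_integrable_mult_right) (use D' in simp)
   fix y assume y: "y \<in> ?J"
   have "g y s = E2 p a s * phi p a s * nonlin p a (phi p a s * w y s)" using ph[OF s(1)] by (simp add: g_def E2_def power2_eq_square)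
   note geq = this
   have "1 <= s" using s s1 by simp
   then have "abs (g y s) <= w y s * g y s + Cg * s powr abs a"
    using Cg(2)[of s "w y s"] unfolding geq[symmetric] wg_E2[OF s(1), of y] by blast
   also have "Cg * s powr abs a <= b" unfolding b_def using s s1 Cg by (intro mult_left_mono powr_mono2) auto
   also have "w y s * g y s <= H * Dd y s" using inner_Dd[OF s(1), of y] y unfolding H_def by simp (smt (verit) zero_le_power2)
   finally show "abs (g y s) <= H * Dd y s + b" by simp
  qed
  also have "... = H * (LINT y:?J|lborel. Dd y s) + b"
  proof -
   have "(LINT y:?J|lborel. H * Dd y s + b) = (LINT y:?J|lborel. H * Dd y s) + (LINT y:?J|lborel. b)"
    by (rule set_integral_add(2)[OF set_integrable_mult_right cI]) (use D' in simp)
   moreover have "(LINT y:?J|lborel. b) = b" by (simp add: set_lebesgue_integral_def)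
   ultimately show ?thesis by simp
  qed
  also have "... <= H * ?D s + b"
   using H by (intro add_right_mono mult_left_mono set_integral_mono_domain[OF Dd_slice_integrable[OF s]] Dd_nonneg[OF s(1)]) auto
  finally show ?thesis by (simp add: b_def)
 qed
 have a3: "integral {s1..s2} (\<lambda>s. phi p a s * Ga s) <= Ph * (H * M2 + Cg * s2 powr abs a)"
 proof -
  note DI = set_borel_integral_eq_integral[OF Dd_time]
  define b where "b = Cg * s2 powr abs a"
  have b: "0 <= b" using Cg by (simp add: b_def)
  have iR: "(\<lambda>s. Ph * (H * ?D s + b)) integrable_on {s1..s2}"
   by (intro integrable_on_mult_right integrable_add DI(1) integrable_const_ivl)
  have "integral {s1..s2} (\<lambda>s. phi p a s * Ga s) <= integral {s1..s2} (\<lambda>s. Ph * (H * ?D s + b))"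
  proof (rule integral_le[OF _ iR])
   show "(\<lambda>s. phi p a s * Ga s) integrable_on {s1..s2}"
    unfolding Ga_def by (intro integrable_continuous_real continuous_on_mult phi_cont gint_cont)
   fix s assume "s \<in> {s1..s2}"
   then have s: "s1 <= s" "s <= s2" by auto
   have "0 <= Ga s" unfolding Ga_def
    by (cases "(\<lambda>y. abs (g y s)) integrable_on ?J") (auto intro: Henstock_Kurzweil_Integration.integral_nonneg simp: not_integrable_integral)
   then show "phi p a s * Ga s <= Ph * (H * ?D s + b)"
    using Ph[OF s] Ga[OF s] Ph1 unfolding b_def by (intro mult_mono) auto
  qed
  also have "... = Ph * (H * integral {s1..s2} ?D + b * (s2 - s1))"
  proof -
   have "integral {s1..s2} (\<lambda>s. H * ?D s + b) = integral {s1..s2} (\<lambda>s. H * ?D s) + integral {s1..s2} (\<lambda>s. b)"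
    by (rule Henstock_Kurzweil_Integration.integral_add[OF integrable_on_mult_right[OF DI(1)] integrable_const_ivl])
   then show ?thesis using s12 by (simp add: mult.commute)
  qed
  also have "... <= Ph * (H * M2 + b)"
  proof -
   have "integral {s1..s2} ?D = (BINT x. Dd (snd x) (fst x))"
    unfolding DI(2)[symmetric] by (rule obox_Fubini) (use Dd_box_integrable in "simp add: case_prod_beta'")
   then have "H * integral {s1..s2} ?D <= H * M2" using M2 H by (simp add: mult_left_mono)
   moreover have "b * (s2 - s1) <= b * 1" using b ss by (intro mult_left_mono) auto
   ultimately show ?thesis using Ph1 by (intro mult_left_mono) auto
  qed
  finally show ?thesis by (simp add: b_def)
 qed
 have b1: "phi p a s1 * \<bar>w (1 - exp (s1 - s2)) s1\<bar> <= Ph * N" using a1 Ph1 ph[of s1] N0 by (intro mult_mono) auto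
 have b2: "phi p a s1 / 2 * (LINT y:?J|lborel. abs (v (- 1) y s1)) <= Ph * N"
 proof -
  have "0 <= (LINT y:?J|lborel. abs (v (- 1) y s1))"
   unfolding set_lebesgue_integral_def by (intro integral_nonneg_AE AE_I2) (auto split: split_indicator)
  then show ?thesis using a2 Ph1 ph[of s1] N0 by (intro mult_mono) auto
 qed
 have b3: "0 <= Ph * (H * M2 + Cg * s2 powr abs a)"
 proof -
  have "0 <= (BINT x. Dd (snd x) (fst x))" unfolding set_lebesgue_integral_def using Dd_nonneg
   by (intro integral_nonneg_AE AE_I2) (auto split: split_indicator)
  then show ?thesis using M2 H Cg Ph1 by (intro mult_nonneg_nonneg add_nonneg_nonneg) auto
 qed
 have "\<bar>u x0 (T0 - exp (- s2))\<bar> <= Ph * N + Ph * N + 1 / 2 * (Ph * (H * M2 + Cg * s2 powr abs a))"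
  using tip_bound[OF d] b1 b2 a3 unfolding Ga_def by linarith
 also have "... <= Ph * N + Ph * N + Ph * (H * M2 + Cg * s2 powr abs a)" using b3 by linarith
 also have "... = Ph * (2 * c * (1 + H * M1) + H * M2 + Cg * s2 powr abs a)" by (simp add: N_def algebra_simps)
 finally show ?thesis .
qed

text \<open>All bounds on the right concern the solution in the original variables on a single time
  slice. They can therefore be taken uniformly for all cones that start from that slice, whatever
  their apex.\<close>

lemma Lf_upper:
 assumes s: "s1 <= s" "s <= s2" and nu: "0 <= nu" "nu <= be"
  and uB: "!!y. - 1 < y ==> y < 1 ==> \<bar>u (x0 + y * exp (- s)) (T0 - exp (- s))\<bar> <= B0"
  and PB: "!!j y. j \<in> {1, - 1} ==> - 1 < y ==> y < 1 ==> \<bar>P j (x0 + y * exp (- s)) (T0 - exp (- s))\<bar> <= B0"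
  and aB: "!!j. j \<in> {1, - 1} ==>
   (LINT xi:{x0 + j * (T0 - exp (- s)) - exp (- s)..x0 + j * (T0 - exp (- s)) + exp (- s)}|lborel. (al j xi)^2) <= BA"
  and B1: "1 / phi p a s <= B1" and B2: "E2 p a s <= B2" and B3: "!!x. abs x <= B0 ==> abs (nonlin_prim p a x) <= B3" and B4: "exp s <= B4"
 shows "Lf nu s <= 12 * B1^2 * (B4 * BA + 2 * B0^2)
   + 2 * ((2 * (expo p * (1 + abs a))^2 + k0c p + be^2 / 2) * (B0 * B1)^2 + B2 * B3)"
proof -
 define r t where "r = exp (- s)" and "t = T0 - exp (- s)"
 have r: "0 < r" "r <= 1" using s s1 by (auto simp: r_def)
 have ph: "0 < phi p a s" by (rule phi_pos[OF spos[OF s(1)]])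
 have B1': "0 < B1" using B1 ph by (smt (verit) divide_pos_pos zero_less_one)
 have B0: "0 <= B0" using uB[of 0] by simp
 have B3': "0 <= B3" using B3[of 0] B0 by simp
 define La c0 where "La = expo p * (1 + abs a)" and "c0 = (2 * La^2 + k0c p + be^2 / 2) * (B0 * B1)^2 + B2 * B3"
 define f where "f j y = (al j (x0 + j * t + r * y))^2" for j y
 have f: "sint (f j)" "(SINT y. f j y) <= B4 * BA" if j: "j \<in> {1, - 1}" for j
 proof -
  define X where "X = x0 + j * t"
  define F where "F xi = indicator {X - r..X + r} xi * (al j xi)^2" for xi
  have F: "integrable lborel F" using al_sq[of "X - r" "X + r" j] by (simp add: F_def[abs_def] set_integrable_def)
  have Fy: "F (X + r * y) = indicator {- 1..1} y * f j y" for y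
  proof -
   have "X + r * y \<in> {X - r..X + r} \<longleftrightarrow> y \<in> {- 1..1}"
    using r mult_le_cancel_left_pos[of r "- 1" y] mult_le_cancel_left_pos[of r y 1] by auto
   then show ?thesis by (simp add: F_def f_def X_def indicator_def)
  qed
  have "integrable lborel (\<lambda>y. F (X + r * y))" by (rule lborel_integrable_real_affine[OF F]) (use r in auto)
  then have I: "set_integrable lborel {- 1..1} (f j)" unfolding Fy by (simp add: set_integrable_def)
  show "sint (f j)" by (rule set_integrable_subset[OF I]) auto
  have FB: "(LINT xi|lborel. F xi) <= BA" using aB[OF j] by (simp add: F_def set_lebesgue_integral_def X_def t_def r_def)
  have F0: "0 <= (LINT xi|lborel. F xi)" by (intro integral_nonneg_AE AE_I2) (auto simp: F_def)
  have "(SINT y. f j y) <= (LINT y:{- 1..1}|lborel. f j y)" by (rule set_integral_mono_domain[OF I]) (auto simp: f_def)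
  also have "... = (LINT y|lborel. F (X + r * y))" by (simp add: Fy set_lebesgue_integral_def)
  also have "... = exp s * (LINT xi|lborel. F xi)" using lborel_integral_real_affine[of r F X] r by (simp add: r_def exp_minus field_simps)
  also have "... <= B4 * BA" using FB F0 B4 order_trans[OF exp_ge_zero B4] by (intro mult_mono) auto
  finally show "(SINT y. f j y) <= B4 * BA" .
 qed
 have pt: "rho p y * (En y s - nu * (w y s * z y s)) <= 6 * B1^2 * (f 1 y + f (- 1) y + 2 * B0^2) + c0" if y: "- 1 < y" "y < 1" for y
 proof -
  have R: "0 < 1 - y^2" "1 - y^2 <= 1" using one_minus_sq_pos[of y] y by auto
  have v: "(v j y s)^2 <= 2 * B1^2 * (f j y + B0^2)" if j: "j \<in> {1, - 1}" for j
  proof -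
   have arg: "x0 + y * exp (- s) + j * (T0 - exp (- s)) = x0 + j * t + r * y" by (simp add: t_def r_def)
   define a1 p1 where "a1 = al j (x0 + j * t + r * y)" and "p1 = P j (x0 + y * exp (- s)) (T0 - exp (- s))"
   have "abs p1 <= abs B0" using PB[OF j y] B0 by (simp add: p1_def)
   then have p1: "p1^2 <= B0^2" by (simp add: abs_le_square_iff)
   have "v j y s = (r * (1 / phi p a s)) * (a1 + p1)" unfolding v_def U_def arg by (simp add: a1_def p1_def r_def)
   then have "(v j y s)^2 = (r * (1 / phi p a s))^2 * (a1 + p1)^2" by (simp only: power_mult_distrib)
   also have "... <= B1^2 * (2 * (a1^2 + p1^2))"
   proof (rule mult_mono)
    have "r * (1 / phi p a s) <= 1 * B1" using r B1 ph by (intro mult_mono) auto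
    then show "(r * (1 / phi p a s))^2 <= B1^2" using r ph by (intro power_mono) auto
    show "(a1 + p1)^2 <= 2 * (a1^2 + p1^2)" using sum_squares_bound[of a1 p1] by (simp add: power2_sum)
   qed auto
   also have "... <= B1^2 * (2 * (f j y + B0^2))" using p1 by (intro mult_left_mono) (auto simp: f_def a1_def)
   finally show ?thesis by (simp add: algebra_simps)
  qed
  have w: "(w y s)^2 <= (B0 * B1)^2"
  proof -
   have "abs (w y s) = \<bar>u (x0 + y * exp (- s)) (T0 - exp (- s))\<bar> * (1 / phi p a s)" using ph by (simp add: w_def abs_divide)
   also have "... <= B0 * B1" using uB[OF y] B1 B0 ph by (intro mult_mono) auto
   finally have "abs (w y s) <= \<bar>B0 * B1\<bar>" by linarith
   then show ?thesis by (simp add: abs_le_square_iff)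
  qed
  have G: "- G y s <= B2 * B3"
  proof -
   have "abs (G y s) = E2 p a s * \<bar>nonlin_prim p a (u (x0 + y * exp (- s)) (T0 - exp (- s)))\<bar>"
    unfolding G_E2 phi_w[OF s(1)] by (simp add: abs_mult E2_nonneg)
   also have "... <= B2 * B3" using B2 B3[OF uB[OF y]] order_trans[OF E2_nonneg B2] by (intro mult_mono) auto
   finally show ?thesis by linarith
  qed
  have lam2: "(lam p a s)^2 <= La^2"
   using lam_bound[OF s(1)] expo_pos[OF p] unfolding La_def by (simp add: abs_le_square_iff[symmetric])
  define V where "V = (v 1 y s)^2 + (v (- 1) y s)^2"
  have qV: "(q y s)^2 <= V"
  proof -
   have 1: "\<bar>(1 - y) / 2\<bar> <= 1" "\<bar>(1 + y) / 2\<bar> <= 1" using y by auto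
   have "V - (q y s)^2 = (1 - ((1 - y) / 2)) * (v 1 y s)^2 + (1 - (1 + y) / 2) * (v (- 1) y s)^2
     + (1 - y) / 2 * ((1 + y) / 2) * (v 1 y s - v (- 1) y s)^2" unfolding V_def q_def by (simp add: field_simps power2_eq_square)
   also have "... >= 0" using y by (intro add_nonneg_nonneg mult_nonneg_nonneg) auto
   finally show ?thesis by simp
  qed
  have z2: "(z y s)^2 <= 2 * V + 2 * La^2 * (w y s)^2"
  proof -
   have "(z y s)^2 <= 2 * (q y s)^2 + 2 * (lam p a s * w y s)^2"
    unfolding z_def using sum_squares_bound[of "q y s" "- (lam p a s * w y s)"] by (simp add: power2_diff)
   also have "(lam p a s * w y s)^2 <= La^2 * (w y s)^2" unfolding power_mult_distrib by (intro mult_right_mono lam2) auto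
   finally show ?thesis using qV by linarith
  qed
  have wy2: "(1 - y^2) * (wy y s)^2 <= V"
  proof -
   have "(wy y s)^2 <= V"
    unfolding wy_def V_def using sum_squares_bound[of "v 1 y s" "- v (- 1) y s"] by (simp add: power_divide power2_diff) (smt (verit) zero_le_power2)
   moreover have "(1 - y^2) * (wy y s)^2 <= 1 * (wy y s)^2" using R by (intro mult_right_mono) auto
   ultimately show ?thesis by linarith
  qed
  have nuwz: "- (nu * (w y s * z y s)) <= (z y s)^2 / 2 + be^2 / 2 * (w y s)^2"
  proof -
   have "0 <= (z y s + nu * w y s)^2 / 2" by simp
   then have "- (nu * (w y s * z y s)) <= (z y s)^2 / 2 + nu^2 / 2 * (w y s)^2" by (simp add: power2_sum power_mult_distrib algebra_simps)
   also have "nu^2 / 2 * (w y s)^2 <= be^2 / 2 * (w y s)^2" using nu by (intro mult_right_mono divide_right_mono power_mono) auto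
   finally show ?thesis by simp
  qed
  have V: "V <= 2 * B1^2 * (f 1 y + f (- 1) y + 2 * B0^2)" using v[of 1] v[of "- 1"] unfolding V_def by (simp add: algebra_simps)
  have V0: "0 <= V" by (simp add: V_def)
  have "En y s - nu * (w y s * z y s) <= 3 * V + (2 * La^2 + k0c p + be^2 / 2) * (w y s)^2 + B2 * B3"
   unfolding En_def distrib_right using z2 wy2 nuwz G V0 by linarith
  also have "... <= 3 * (2 * B1^2 * (f 1 y + f (- 1) y + 2 * B0^2)) + c0"
   unfolding c0_def using V mult_left_mono[OF w, of "2 * La^2 + k0c p + be^2 / 2"] k0c_pos[OF p] by simp
  finally have le: "En y s - nu * (w y s * z y s) <= 6 * B1^2 * (f 1 y + f (- 1) y + 2 * B0^2) + c0" by simp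
  have nn: "0 <= 6 * B1^2 * (f 1 y + f (- 1) y + 2 * B0^2) + c0" using k0c_pos[OF p] B3' order_trans[OF E2_nonneg B2]
   by (auto simp: c0_def f_def intro!: add_nonneg_nonneg mult_nonneg_nonneg)
  have rho: "0 <= rho p y" "rho p y <= 1" using rho_nonneg[of p y] rho_le_1[of y p] p y by auto
  have "rho p y * (En y s - nu * (w y s * z y s)) <= rho p y * (6 * B1^2 * (f 1 y + f (- 1) y + 2 * B0^2) + c0)"
   by (rule mult_left_mono[OF le rho(1)])
  also have "... <= 1 * (6 * B1^2 * (f 1 y + f (- 1) y + 2 * B0^2) + c0)" by (rule mult_right_mono[OF rho(2) nn])
  finally show ?thesis by simp
 qed
 let ?J = "{- 1<..<1} :: real set"
 have cI: "set_integrable lborel ?J (\<lambda>y. b :: real)" for b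
  by (rule set_integrable_subset[OF borel_integrable_atLeastAtMost'[of "- 1" 1]]) auto
 have len: "(LINT y:?J|lborel. b) = 2 * b" for b :: real by (simp add: set_lebesgue_integral_def)
 have f1: "set_integrable lborel ?J (f 1)" "set_integrable lborel ?J (f (- 1))" by (rule f(1); simp)+
 have I2: "set_integrable lborel ?J (\<lambda>y. f 1 y + f (- 1) y + 2 * B0^2)" by (intro set_integral_add(1) f1 cI)
 have I3: "set_integrable lborel ?J (\<lambda>y. 6 * B1^2 * (f 1 y + f (- 1) y + 2 * B0^2))"
  by (rule set_integrable_mult_right) (use I2 in simp)
 have "Lf nu s <= (LINT y:?J|lborel. 6 * B1^2 * (f 1 y + f (- 1) y + 2 * B0^2) + c0)"
  unfolding Lf_def by (rule set_integral_mono[OF Lf_integrable[OF s] set_integral_add(1)[OF I3 cI]]) (use pt in auto)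
 also have "... = 6 * B1^2 * (LINT y:?J|lborel. f 1 y + f (- 1) y + 2 * B0^2) + 2 * c0" unfolding set_integral_add(2)[OF I3 cI] len by simp
 also have "(LINT y:?J|lborel. f 1 y + f (- 1) y + 2 * B0^2) = (LINT y:?J|lborel. f 1 y) + (LINT y:?J|lborel. f (- 1) y) + 4 * B0^2"
  unfolding set_integral_add(2)[OF set_integral_add(1)[OF f1] cI] set_integral_add(2)[OF f1] len by simp
 also have "6 * B1^2 * ((LINT y:?J|lborel. f 1 y) + (LINT y:?J|lborel. f (- 1) y) + 4 * B0^2) + 2 * c0
   <= 6 * B1^2 * (B4 * BA + B4 * BA + 4 * B0^2) + 2 * c0"
  using f(2)[of 1] f(2)[of "- 1"] by (intro add_right_mono mult_left_mono add_mono) auto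
 also have "... = 12 * B1^2 * (B4 * BA + 2 * B0^2) + 2 * c0" by (simp add: algebra_simps)
 finally show ?thesis by (simp add: c0_def La_def)
qed

end

context wave1d
begin

text \<open>
 The energy estimate is applied in a cone with apex \<open>(x, T1)\<close> slightly above the given point \<open>(x, t)\<close>,
 but still inside the domain; this is where the point is required to be non characteristic.
\<close>

lemma pointwise_bound:
 fixes x0 \<delta>0 t0 :: real
 assumes Tb: "0 < T x0" and d0: "0 < \<delta>0" "\<delta>0 < 1" and t0: "t0 < T x0"
  and nc: "!!x t. t0 <= t ==> t < T x0 - \<delta>0 * \<bar>x - x0\<bar> ==> (x, t) \<in> infl_dom T"
 obtains t1 C q where "0 <= t1" "t1 < T x0" "T x0 - t1 <= exp (- 1)" "0 <= C" "0 <= q"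
  "!!T0 s y. T0 <= T x0 ==> - 1 <= y ==> y <= 1 ==> t1 <= T0 - exp (- s) ==>
    \<bar>u (x0 + y * exp (- s)) (T0 - exp (- s))\<bar> <= C * phi p a s * s powr q"
proof -
 obtain bt Cc S where ok: "crude_ok p a bt Cc S" by (rule crude_ok_exists[OF p])
 have ok': "bt >= 1" "Cc >= 0" "S >= 1" using ok by (auto simp: crude_ok_def)
 obtain Cg where Cg: "Cg >= 0" "!!s w. s >= 1 ==>
   \<bar>E2 p a s * phi p a s * nonlin p a (phi p a s * w)\<bar> <= E2 p a s * Qn p a (phi p a s * w) + Cg * s powr abs a"
  by (rule source_growth[OF p], rule that)
 have ep: "0 < expo p" by (rule expo_pos[OF p])
 \<comment> \<open>For a point at distance \<open>ta\<close> below \<open>T0\<close> the apex is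
   raised by \<open>kk * ta\<close>. Half of the gap \<open>1 - \<delta>0\<close> is a raise after
   which the apex still lies under the non characteristic cone, since
   \<open>\<delta>0 < 1 - kk\<close>.\<close>
 define kk where "kk = (1 - \<delta>0) / 2"
 have kk: "0 < kk" "kk <= 1 / 2" "\<delta>0 < 1 - kk" using d0 by (auto simp: kk_def field_simps)
 \<comment> \<open>At time \<open>tb\<close> the cones used below reach at most
   \<open>L = et * (1 + kk / 2)\<close> away from \<open>x0\<close>, while the non characteristic
   cone has half-width \<open>et / \<delta>0\<close> there; this inequality says that the former is
   smaller.\<close>
 have kd: "\<delta>0 * (1 + kk / 2) < 1"
 proof -
  have "(1 - \<delta>0) * (4 - \<delta>0) > 0" using d0 by simp
  then show ?thesis by (simp add: kk_def field_simps)
 qed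
 define m where "m = - ln kk"
 have m: "0 <= m" using kk by (simp add: m_def)
 define et where "et = min (exp (- (S + 1))) (min (T x0 / 2) ((T x0 - t0) / 2))"
 have et: "0 < et" "et <= exp (- (S + 1))" "et < T x0" "et < T x0 - t0" using Tb t0 by (auto simp: et_def min_def)
 \<comment> \<open>One base time for all cones: the starting value of the functional is then bounded
   by data of the solution on a fixed compact interval.\<close>
 define tb where "tb = T x0 - et"
 have tb: "0 < tb" "t0 < tb" using et by (auto simp: tb_def)
 define L where "L = et * (1 + kk / 2)"
 have L: "0 < L" "\<delta>0 * L < et"
 proof -
  show "0 < L" using et kk by (simp add: L_def)
  have "\<delta>0 * L = (\<delta>0 * (1 + kk / 2)) * et" by (simp add: L_def)
  also have "... < 1 * et" using kd et by (intro mult_strict_right_mono) auto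
  finally show "\<delta>0 * L < et" by simp
 qed
 have base: "(X, tb) \<in> infl_dom T" if "X \<in> {x0 - L..x0 + L}" for X
 proof (rule nc)
  have "\<bar>X - x0\<bar> <= L" using that by (simp add: abs_le_iff)
  then have "\<delta>0 * \<bar>X - x0\<bar> <= \<delta>0 * L" using d0 by (intro mult_left_mono) auto
  then show "tb < T x0 - \<delta>0 * \<bar>X - x0\<bar>" using L by (simp add: tb_def)
 qed (use tb in simp)
 obtain Bu where Bu: "Bu > 0" "!!X. X \<in> {x0 - L..x0 + L} ==> abs (u X tb) <= Bu"
  by (rule compact_bounded_real[OF compact_Icc[of "x0 - L" "x0 + L"] u_cont_compose[of _ "\<lambda>X. X" "\<lambda>_. tb"]])
   (auto intro: base)
 have Pb: "\<exists>B>0. \<forall>X\<in>{x0 - L..x0 + L}. abs (P j X tb) <= B" if "abs j = 1" for j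
  by (rule compact_bounded_real[OF compact_Icc[of "x0 - L" "x0 + L"] P_cont_compose[OF that, of _ "\<lambda>X. X" "\<lambda>_. tb"]])
   (auto intro: base)
 obtain Bp Bm where Bp: "!!X. X \<in> {x0 - L..x0 + L} ==> abs (P 1 X tb) <= Bp" and Bm: "!!X. X \<in> {x0 - L..x0 + L} ==> abs (P (- 1) X tb) <= Bm"
  using Pb[of 1] Pb[of "- 1"] by fastforce
 define B0 where "B0 = max Bu (max Bp Bm)"
 define I where "I j = (LINT xi:{x0 - L + j * tb..x0 + L + j * tb}|lborel. (al j xi)^2)" for j
 have I0: "0 <= I j" for j unfolding I_def set_lebesgue_integral_def by (intro integral_nonneg_AE AE_I2) (auto split: split_indicator)
 define BA where "BA = I 1 + I (- 1)"
 have IB: "I j <= BA" if "j \<in> {1, - 1}" for j using that I0[of 1] I0[of "- 1"] by (auto simp: BA_def)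
 define j1 where "j1 = - ln (et / 2)"
 have phc: "continuous_on {1..j1} (phi p a)"
 proof (intro continuous_at_imp_continuous_on ballI)
  fix s assume "s \<in> {1..j1}"
  then show "isCont (phi p a) s" by (intro DERIV_isCont[OF DERIV_phi]) auto
 qed
 have phn: "phi p a s ~= 0" if "s \<in> {1..j1}" for s using phi_pos[of s p a] that by simp
 have c1: "continuous_on {1..j1} (\<lambda>s. 1 / phi p a s)" and c2: "continuous_on {1..j1} (E2 p a)"
  unfolding E2_def using phn by (intro continuous_intros phc; simp)+
 obtain B1 where B1': "B1 > 0" and B1: "!!s. s \<in> {1..j1} ==> \<bar>1 / phi p a s\<bar> <= B1"
  by (rule compact_bounded_real[OF compact_Icc c1], rule that)
 obtain B2 where B2': "B2 > 0" and B2: "!!s. s \<in> {1..j1} ==> abs (E2 p a s) <= B2"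
  by (rule compact_bounded_real[OF compact_Icc c2], rule that)
 have c3: "continuous_on {- B0..B0} (nonlin_prim p a)" using DERIV_nonlin_prim[OF p] by (meson DERIV_isCont continuous_at_imp_continuous_on)
 obtain B3 where B3': "B3 > 0" and B3: "!!x. x \<in> {- B0..B0} ==> abs (nonlin_prim p a x) <= B3"
  by (rule compact_bounded_real[OF compact_Icc c3], rule that)
 define K0 where "K0 = 12 * B1^2 * (exp j1 * BA + 2 * B0^2)
   + 2 * ((2 * (expo p * (1 + abs a))^2 + k0c p + bt^2 / 2) * (B0 * B1)^2 + B2 * B3)"
 define Kb where "Kb = abs K0 + 2 * Cc + 1"
 have Kb: "0 <= Kb" using ok' by (simp add: Kb_def)
 define e where "e = - ((1 / expo p + 2) * bt)"
 have e0: "e <= 0"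
 proof -
  have "1 / expo p + 2 > 0" using ep by (simp add: add_pos_pos)
  then show ?thesis using ok' by (simp add: e_def)
 qed
 have cd: "0 < cdis p" by (rule cdis_pos[OF p])
 define M where "M = Kb / cdis p"
 have M: "0 <= M" using Kb cd by (simp add: M_def)
 define H where "H = (4 / 3) powr (expo p + 1)"
 have H: "0 <= H" by (simp add: H_def)
 define c where "c = 4 + expo p * (1 + abs a)"
 have c: "0 <= c" using ep by (simp add: c_def)
 define Ct where "Ct = 2 * c * (1 + H * (M / ln 2 + 1)) + H * M + Cg"
 have Ct: "0 <= Ct" using c H M Cg by (simp add: Ct_def)
 \<comment> \<open>\<open>1 - e\<close> is the loss in the space-time bound and \<open>abs a\<close>
   the one in the source estimate; \<open>q\<close> adds the loss in comparing \<open>phi\<close> at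
   similarity times that differ by at most \<open>m\<close>.\<close>
 define b where "b = 1 - e + abs a"
 define q where "q = abs a * expo p + b"
 have bq: "0 <= b" "0 <= q" using e0 ep by (auto simp: b_def q_def)
 show ?thesis
 proof (rule that[of "T x0 - et / 2" "exp (expo p * m) * Ct * (1 + m) powr q" q])
  show "0 <= T x0 - et / 2" "T x0 - et / 2 < T x0" using et by auto
  have e1: "et <= exp (- 1)" using et(2) ok' order_trans[of et "exp (- (S + 1))" "exp (- 1)"] by simp
  then show "T x0 - (T x0 - et / 2) <= exp (- 1)" using et by simp
  show "0 <= exp (expo p * m) * Ct * (1 + m) powr q" using Ct by simp
  show "0 <= q" by (rule bq(2))
  fix T0 s y :: real assume T0: "T0 <= T x0" and y: "- 1 <= y" "y <= 1" and s: "T x0 - et / 2 <= T0 - exp (- s)"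
  define ta where "ta = exp (- s)"
  define x t where "x = x0 + y * ta" and "t = T0 - ta"
  define T1 where "T1 = t + kk * ta"
  have ta: "0 < ta" "ta <= et / 2" using s T0 by (auto simp: ta_def)
  have kt: "0 < kk * ta" "kk * ta <= ta / 2" using ta kk by auto
  have xx: "\<bar>x - x0\<bar> <= ta"
  proof -
   have "abs y * ta <= 1 * ta" using y ta by (intro mult_right_mono) auto
   then show ?thesis using ta by (simp add: x_def abs_mult)
  qed
  have s1: "1 <= s"
  proof -
   have "exp (- s) <= exp (- 1)" using ta e1 et unfolding ta_def by linarith
   then show ?thesis by simp
  qed
  have tt: "tb + et / 2 <= t" using s by (simp add: tb_def t_def ta_def)
  have T1b: "et / 2 <= T1 - tb" "T1 - tb <= et" using tt kt T0 ta unfolding T1_def tb_def t_def by linarith+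
  have apex: "T1 < T x"
  proof -
   have "\<delta>0 * \<bar>x - x0\<bar> <= \<delta>0 * ta" using xx d0 by (intro mult_left_mono) auto
   also have "... < (1 - kk) * ta" using kk ta by (intro mult_strict_right_mono) auto
   finally have "T1 < T x0 - \<delta>0 * \<bar>x - x0\<bar>" using T0 by (simp add: T1_def t_def algebra_simps)
   moreover have "t0 <= T1" using T1b tb et by linarith
   ultimately have "(x, T1) \<in> infl_dom T" by (rule nc[rotated])
   then show ?thesis by (simp add: infl_dom_def)
  qed
  \<comment> \<open>The similarity times, seen from the apex \<open>(x, T1)\<close>, of the base
    slice and of the given point: \<open>T1 - exp (- r1) = tb\<close> and
    \<open>T1 - exp (- r2) = t\<close>. Hence \<open>r2\<close> exceeds \<open>s\<close> by the
    fixed amount \<open>m\<close>, with \<open>exp (- m) = kk\<close>.\<close>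
  define r1 r2 where "r1 = - ln (T1 - tb)" and "r2 = s + m"
  have T1p: "0 < T1 - tb" using T1b et by linarith
  have er1: "exp (- r1) = T1 - tb" using T1p by (simp add: r1_def)
  have er2: "exp (- r2) = kk * ta" using kk by (simp add: r2_def m_def ta_def exp_diff exp_minus field_simps exp_add)
  have r1S: "S + 1 <= r1"
  proof -
   have "exp (- r1) <= exp (- (S + 1))" using er1 T1b et by linarith
   then show ?thesis by simp
  qed
  have r1j: "r1 <= j1" unfolding r1_def j1_def using T1b et T1p by simp
  have r12: "r1 <= r2 - ln 2"
  proof -
   have "exp (- (r2 - ln 2)) = 2 * (kk * ta)" using er2 by (simp add: exp_diff exp_minus field_simps)
   also have "... <= et / 2" using kt ta by linarith
   also have "... <= exp (- r1)" using er1 T1b by simp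
   finally show ?thesis by simp
  qed
  have ln2: "0 < ln (2::real)" by simp
  have r1': "1 <= r1" "S <= r1" "r1 <= r2" using r1S ok' r12 ln2 by linarith+
  have T1pos: "exp (- r1) < T1" using er1 tb by simp
  interpret c: cone p a T u al A x T1 r1 r2 by (rule cone_below[OF apex T1pos r1'(1,3)])
  have Tr1: "T1 - exp (- r1) = tb" using er1 by simp
  have slice: "x + y' * exp (- r1) \<in> {x0 - L..x0 + L}" if "- 1 <= y'" "y' <= 1" for y'
  proof -
   have "abs y' * (T1 - tb) <= 1 * (T1 - tb)" using that T1p by (intro mult_right_mono) auto
   then have "\<bar>x + y' * exp (- r1) - x0\<bar> <= ta + (T1 - tb)"
   proof -
    have "\<bar>y' * (T1 - tb)\<bar> <= T1 - tb" using \<open>\<bar>y'\<bar> * (T1 - tb) <= 1 * (T1 - tb)\<close> T1p by (simp add: abs_mult)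
    moreover have "x + y' * (T1 - tb) - x0 = (x - x0) + y' * (T1 - tb)" by simp
    ultimately show ?thesis using xx abs_triangle_ineq[of "x - x0" "y' * (T1 - tb)"] unfolding er1 by linarith
   qed
   also have "... = T0 + kk * ta - tb" by (simp add: T1_def t_def)
   also have "... <= et + kk * (et / 2)" using T0 mult_left_mono[OF ta(2) less_imp_le[OF kk(1)]] unfolding tb_def by linarith
   also have "... = L" by (simp add: L_def algebra_simps)
   finally show ?thesis by (auto simp: abs_le_iff)
  qed
  have nu: "0 <= bt / r1" "bt / r1 <= bt" using ok' r1' by (auto simp: divide_le_eq mult_le_cancel_left1)
  have Lf: "c.Lf (bt / r1) r1 <= K0" unfolding K0_def
  proof (rule c.Lf_upper[OF order_refl r1'(3) nu], unfold Tr1)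
   fix y' :: real assume "- 1 < y'" "y' < 1"
   then have sl: "x + y' * exp (- r1) \<in> {x0 - L..x0 + L}" by (intro slice) auto
   show "\<bar>u (x + y' * exp (- r1)) tb\<bar> <= B0" using Bu(2)[OF sl] by (simp add: B0_def)
   show "\<bar>P j (x + y' * exp (- r1)) tb\<bar> <= B0" if "j \<in> {1, - 1}" for j using that Bp[OF sl] Bm[OF sl] by (auto simp: B0_def)
  next
   fix j :: real assume j: "j \<in> {1, - 1}"
   have "(LINT xi:{x + j * tb - exp (- r1)..x + j * tb + exp (- r1)}|lborel. (al j xi)^2) <= I j"
    unfolding I_def by (rule set_integral_mono_domain[OF al_sq]) (use slice[of "- 1"] slice[of 1] in auto)
   then show "(LINT xi:{x + j * tb - exp (- r1)..x + j * tb + exp (- r1)}|lborel. (al j xi)^2) <= BA" using IB[OF j] by linarith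
  next
   show "1 / phi p a r1 <= B1" "E2 p a r1 <= B2" using order_trans[OF abs_ge_self B1] order_trans[OF abs_ge_self B2] r1' r1j by simp_all
   show "abs (nonlin_prim p a x) <= B3" if "abs x <= B0" for x using B3[of x] that by (auto simp: abs_le_iff)
   show "exp r1 <= exp j1" using r1j by simp
  qed
  have "r1 powr e * c.Lf (bt / r1) r1 <= 1 * abs K0"
  proof -
   have "r1 powr e * c.Lf (bt / r1) r1 <= r1 powr e * abs K0" using Lf by (intro mult_left_mono) auto
   also have "... <= 1 * abs K0" using powr_mono[OF e0, of r1] r1' by (intro mult_right_mono) auto
   finally show ?thesis .
  qed
  moreover have "2 * Cc * exp (- r1) <= 2 * Cc * 1" using ok' r1' by (intro mult_left_mono) auto
  ultimately have st: "(LINT z:({r1..r2} \<times> {- 1<..<1})|lborel2. fst z powr e * c.diss (bt / fst z) (snd z) (fst z)) <= Kb"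
   using spacetime_bound[OF ok r1'(2) apex T1pos r1'(3)] unfolding e_def[symmetric] Kb_def by linarith
  have r2p: "0 < r2" "1 <= r2" using r1' by auto
  have DM: "(LINT z:({r1..r2} \<times> {- 1<..<1})|lborel2. c.Dd (snd z) (fst z)) <= M * r2 powr (1 - e)"
  proof -
   define D where "D = (LINT z:({r1..r2} \<times> {- 1<..<1})|lborel2. c.Dd (snd z) (fst z))"
   have "cdis p * r2 powr (e - 1) * D <= Kb" using c.diss_Dd[OF e0 ok'(1)] st unfolding D_def by linarith
   then have "(r2 powr (1 - e) / cdis p) * (cdis p * r2 powr (e - 1) * D) <= (r2 powr (1 - e) / cdis p) * Kb"
    using cd by (intro mult_left_mono) auto
   moreover have "(r2 powr (1 - e) / cdis p) * (cdis p * r2 powr (e - 1) * D) = (r2 powr (1 - e) * r2 powr (e - 1)) * D" using cd by simp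
   moreover have "r2 powr (1 - e) * r2 powr (e - 1) = 1" using r2p by (simp flip: powr_add)
   ultimately show ?thesis by (simp add: D_def M_def mult.commute)
  qed
  obtain r where r: "r2 - ln 2 <= r" "r <= r2" "(SINT y. c.Dd y r) <= M * r2 powr (1 - e) / ln 2 + 1" by (rule c.good_time[OF r12 DM])
  have r1r: "r1 <= r" "1 <= r" using r(1) r12 r1' by linarith+
  have "exp (- r) <= exp (- r1)" using r1r by simp
  then have erT: "exp (- r) < T1" using T1pos by linarith
  interpret c2: cone p a T u al A x T1 r r2 by (rule cone_below[OF apex erT r1r(2) r(2)])
  have DM2: "(LINT z:({r..r2} \<times> {- 1<..<1})|lborel2. c.Dd (snd z) (fst z)) <= M * r2 powr (1 - e)"
  proof -
   have "(LINT z:({r..r2} \<times> {- 1<..<1})|lborel2. c.Dd (snd z) (fst z)) <=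
    (LINT z:({r1..r2} \<times> {- 1<..<1})|lborel2. c.Dd (snd z) (fst z))"
    by (rule set_integral_mono_domain[OF c.Dd_box_integrable]) (use r1r c.Dd_nonneg in auto)
   then show ?thesis using DM by linarith
  qed
  define Ph where "Ph = exp (expo p * m) * phi p a s * r2 powr (abs a * expo p)"
  have Ph0: "0 <= Ph" using phi_pos[of s p a] s1 by (simp add: Ph_def)
  have phPh: "phi p a r' <= Ph" if "r <= r'" "r' <= r2" for r'
   unfolding Ph_def r2_def using that r1r by (intro phi_compare[OF p _ _ s1 m]) (auto simp: r2_def)
  have er: "exp (- r) <= 2 * exp (- r2)"
  proof -
   have "exp (- r) <= exp (- (r2 - ln 2))" using r by simp
   then show ?thesis by (simp add: exp_diff exp_minus field_simps)
  qed
  define Z where "Z = r2 powr b"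
  have Z: "r2 powr (1 - e) <= Z" "r2 powr abs a <= Z" "1 <= Z"
   using r2p e0 powr_mono[of "1 - e" b r2] powr_mono[of "abs a" b r2] powr_mono[of 0 b r2] bq by (auto simp: Z_def b_def)
  have MZ: "M * r2 powr (1 - e) <= M * Z" using Z M by (intro mult_left_mono) auto
  have "T1 - exp (- r2) = t" using er2 by (simp add: T1_def)
  then have "abs (u x t) <= Ph * (2 * c * (1 + H * (M * r2 powr (1 - e) / ln 2 + 1)) + H * (M * r2 powr (1 - e)) + Cg * r2 powr abs a)"
   using c2.tip_estimate[OF er Cg r(3) DM2 phPh] unfolding H_def c_def by simp
  also have "... <= Ph * (Ct * Z)"
  proof (rule mult_left_mono[OF _ Ph0])
   have "M * r2 powr (1 - e) / ln 2 + 1 <= (M / ln 2 + 1) * Z" using divide_right_mono[OF MZ, of "ln 2"] Z ln2 by (simp add: distrib_right)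
   then have "H * (M * r2 powr (1 - e) / ln 2 + 1) <= H * ((M / ln 2 + 1) * Z)" by (rule mult_left_mono[OF _ H])
   then have "1 + H * (M * r2 powr (1 - e) / ln 2 + 1) <= (1 + H * (M / ln 2 + 1)) * Z" using Z by (simp add: algebra_simps)
   then have "2 * c * (1 + H * (M * r2 powr (1 - e) / ln 2 + 1)) <= 2 * c * ((1 + H * (M / ln 2 + 1)) * Z)"
    using c by (intro mult_left_mono) auto
   moreover have "H * (M * r2 powr (1 - e)) <= H * (M * Z)" by (rule mult_left_mono[OF MZ H])
   moreover have "Cg * r2 powr abs a <= Cg * Z" using Z Cg by (intro mult_left_mono) auto
   moreover have "Ct * Z = 2 * c * ((1 + H * (M / ln 2 + 1)) * Z) + H * (M * Z) + Cg * Z" by (simp add: Ct_def algebra_simps)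
   ultimately show "2 * c * (1 + H * (M * r2 powr (1 - e) / ln 2 + 1)) + H * (M * r2 powr (1 - e)) + Cg * r2 powr abs a <= Ct * Z"
    by linarith
  qed
  also have "... = exp (expo p * m) * phi p a s * Ct * r2 powr q" by (simp add: Ph_def Z_def q_def powr_add)
  also have "... <= exp (expo p * m) * phi p a s * Ct * ((1 + m) powr q * s powr q)"
  proof (rule mult_left_mono)
   have "r2 <= (1 + m) * s" using mult_left_mono[OF s1 m] by (simp add: r2_def algebra_simps)
   then have "r2 powr q <= ((1 + m) * s) powr q" using r2p bq by (intro powr_mono2) auto
   then show "r2 powr q <= (1 + m) powr q * s powr q" using m s1 by (simp add: powr_mult)
   show "0 <= exp (expo p * m) * phi p a s * Ct" using phi_pos[of s p a] s1 Ct by simp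
  qed
  also have "... = exp (expo p * m) * Ct * (1 + m) powr q * phi p a s * s powr q" by simp
  finally show "\<bar>u (x0 + y * exp (- s)) (T0 - exp (- s))\<bar> <= exp (expo p * m) * Ct * (1 + m) powr q * phi p a s * s powr q"
   unfolding x_def t_def ta_def .
 qed
qed

end

section \<open>From the integral notion of solution to the locale \<open>wave1d\<close>\<close>

lemma L2_locu_borel:
 assumes "v \<in> L2_locu"
 obtains v' where "v' \<in> borel_measurable borel" "AE x in lborel. v x = v' x"
  "!!x y. set_integrable lborel {x..y} (\<lambda>z. (v' z)^2)"
proof -
 have vm: "v \<in> borel_measurable lebesgue" and fin: "(SUP d. \<integral>\<^sup>+ x \<in> {x. \<bar>x - d\<bar> <= 1}. ennreal (abs (v x)^2) \<partial>lebesgue) < \<infinity>"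
  using assms by (auto simp: L2_locu_def)
 obtain v' where v': "v' \<in> borel_measurable borel" "AE x in lborel. v x = v' x" using completion_ex_borel_measurable_real[OF vm] by auto
 note [measurable] = v'(1)
 define N where "N A = (\<integral>\<^sup>+ x. ennreal ((v' x)^2) * indicator A x \<partial>lborel)" for A
 have win: "N {d..d + 1} < \<infinity>" for d
 proof -
  have "N {d..d + 1} <= (\<integral>\<^sup>+ x. ennreal ((v' x)^2) * indicator {x. \<bar>x - d\<bar> <= 1} x \<partial>lborel)"
   unfolding N_def by (intro nn_integral_mono) (auto split: split_indicator)
  also have "... = (\<integral>\<^sup>+ x. ennreal (abs (v x)^2) * indicator {x. \<bar>x - d\<bar> <= 1} x \<partial>lborel)"
   by (rule nn_integral_cong_AE) (use v'(2) in eventually_elim, simp)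
  also have "... = (\<integral>\<^sup>+ x. ennreal (abs (v x)^2) * indicator {x. \<bar>x - d\<bar> <= 1} x \<partial>lebesgue)"
   by (simp add: nn_integral_completion)
  also have "... <= (SUP d. \<integral>\<^sup>+ x \<in> {x. \<bar>x - d\<bar> <= 1}. ennreal (abs (v x)^2) \<partial>lebesgue)"
   by (rule SUP_upper) simp
  finally show ?thesis using fin by (rule order_le_less_trans)
 qed
 have steps: "N {x..x + real n} < \<infinity>" for x n
 proof (induction n)
  case 0
  have "N {x..x + real 0} <= N {x..x + 1}" unfolding N_def by (intro nn_integral_mono) (auto split: split_indicator)
  then show ?case using win[of x] by (rule order_le_less_trans)
 next
  case (Suc n)
  have "N {x..x + real (Suc n)} <= (\<integral>\<^sup>+ z. ennreal ((v' z)^2) * indicator {x..x + real n} z + ennreal ((v' z)^2) * indicator {x + real n..x + real n + 1} z \<partial>lborel)"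
   unfolding N_def by (intro nn_integral_mono) (auto split: split_indicator)
  also have "... = N {x..x + real n} + N {x + real n..x + real n + 1}" unfolding N_def by (rule nn_integral_add) measurable
  also have "... < \<infinity>" using Suc.IH win[of "x + real n"] by simp
  finally show ?case .
 qed
 have "set_integrable lborel {x..y} (\<lambda>z. (v' z)^2)" for x y
 proof -
  obtain n where n: "y <= x + real n" using real_arch_simple[of "y - x"] by (auto simp: algebra_simps)
  have "(\<integral>\<^sup>+ z. ennreal (norm (indicator {x..y} z *\<^sub>R (v' z)\<^sup>2)) \<partial>lborel) <= N {x..x + real n}"
   unfolding N_def using n by (intro nn_integral_mono) (auto split: split_indicator)
  also have "... < \<infinity>" by (rule steps)
  finally show ?thesis unfolding set_integrable_def by (intro integrableI_bounded) measurable
 qed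
 with v' show ?thesis by (rule that)
qed

text \<open>A tent of mass 1 on \<open>{- 1..1}\<close>, written with positive parts so that its
  primitive \<open>ramp\<close>, a continuously differentiable step from 0 to 1, follows from one
  rule for the square of a positive part.\<close>

definition hat :: "real => real" where "hat x = max 0 (x + 1) - 2 * max 0 x + max 0 (x - 1)"

definition ramp :: "real => real" where "ramp x = ((max 0 (x + 1))^2 - 2 * (max 0 x)^2 + (max 0 (x - 1))^2) / 2"

lemma DERIV_max_sq: "((\<lambda>x. (max 0 x)^2) has_real_derivative 2 * max 0 x) (at (x::real))"
proof -
 consider "x > 0" | "x < 0" | "x = 0" by linarith
 then show ?thesis
 proof cases
  case 1
  have "((\<lambda>x. x^2) has_real_derivative 2 * max 0 x) (at x)" using 1 by (auto intro!: derivative_eq_intros)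
  then show ?thesis by (rule has_field_derivative_transform_within_open[of _ _ _ "{0<..}"]) (use 1 in auto)
 next
  case 2
  have "((\<lambda>x. 0) has_real_derivative 2 * max 0 x) (at x)" using 2 by (auto intro!: derivative_eq_intros)
  then show ?thesis by (rule has_field_derivative_transform_within_open[of _ _ _ "{..<0}"]) (use 2 in auto)
 next
  case 3
  have "((\<lambda>h::real. (max 0 h)^2 / h) \<longlongrightarrow> 0) (at 0)"
  proof (rule Lim_null_comparison)
   show "eventually (\<lambda>h. norm ((max 0 h)^2 / h) <= abs h) (at (0::real))"
    by (rule eventually_mono[OF eventually_True]) (auto simp: max_def power2_eq_square)
   show "((\<lambda>h::real. abs h) \<longlongrightarrow> 0) (at 0)" by (auto intro!: tendsto_eq_intros)
  qed
  then show ?thesis using 3 by (simp add: DERIV_def)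
 qed
qed

lemma DERIV_ramp: "(ramp has_real_derivative hat x) (at x)"
proof -
 have s: "((\<lambda>x. (max 0 (x + c))^2) has_real_derivative 2 * max 0 (x + c)) (at x)" for c
  using DERIV_shift[THEN iffD1, OF DERIV_max_sq[of "x + c"]] by simp
 have "((\<lambda>x. ((max 0 (x + 1))^2 - 2 * (max 0 x)^2 + (max 0 (x + - 1))^2) / 2) has_real_derivative
   (2 * max 0 (x + 1) - 2 * (2 * max 0 x) + 2 * max 0 (x + - 1)) / 2) (at x)"
  by (intro DERIV_cdivide DERIV_add DERIV_diff DERIV_cmult s DERIV_max_sq)
 then show ?thesis unfolding ramp_def[abs_def] hat_def by (simp add: add_divide_distrib diff_divide_distrib)
qed

lemma ramp_simps: "x <= - 1 ==> ramp x = 0" "x >= 1 ==> ramp x = 1" by (simp_all add: ramp_def max_def power2_eq_square algebra_simps)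

lemma hat_cont: "continuous_on S hat" unfolding hat_def[abs_def] by (intro continuous_intros)

lemma hat_outside: "abs x >= 1 ==> hat x = 0" by (auto simp: hat_def max_def abs_if split: if_splits)

lemma hat_bounds: "0 <= hat x" "hat x <= 1" by (auto simp: hat_def max_def)

lemma ramp_bounds: "0 <= ramp x" "ramp x <= 1"
proof -
 have mono: "ramp x <= ramp y" if "x <= y" for x y by (rule DERIV_nonneg_imp_nondecreasing[OF that]) (use DERIV_ramp hat_bounds in blast)
 show "0 <= ramp x" using mono[of "min x (- 1)" x] ramp_simps(1)[of "min x (- 1)"] by simp
 show "ramp x <= 1" using mono[of x "max x 1"] ramp_simps(2)[of "max x 1"] by simp
qed

lemma hat_indicator: "hat y = indicator {- 1..1} y * hat y"
 using hat_outside[of y] by (cases "abs y <= 1") (auto simp: indicator_def abs_le_iff)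

lemma hat_integrable:
 assumes "continuous_on UNIV f"
 shows "integrable lborel (\<lambda>y. f y * hat y)"
proof -
 have "set_integrable lborel {- 1..1} (\<lambda>y. f y * hat y)"
  by (intro borel_integrable_atLeastAtMost' continuous_intros hat_cont continuous_on_subset[OF assms]) auto
 moreover have "indicator {- 1..1} y * (f y * hat y) = f y * hat y" for y using hat_indicator[of y] by (simp add: mult.left_commute)
 ultimately show ?thesis by (simp add: set_integrable_def)
qed

lemma integral_hat: "(LINT y|lborel. hat y) = 1"
proof -
 have "(LINT y|lborel. indicator {- 1..1} y *\<^sub>R hat y) = ramp 1 - ramp (- 1)" by (rule integral_FTC_atLeastAtMost)
   (auto intro: hat_cont simp: has_real_derivative_iff_has_vector_derivative[symmetric] DERIV_ramp has_field_derivative_at_within)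
 then show ?thesis using hat_indicator by (simp add: ramp_simps)
qed

lemma hat_approx:
 assumes f: "continuous_on UNIV (f :: real => real)"
 shows "(\<lambda>n. LINT y|lborel. f (a + y / real (Suc n)) * hat y) \<longlonglongrightarrow> f a"
proof -
 obtain M where M: "M > 0" "!!x. x \<in> {a - 1..a + 1} ==> abs (f x) <= M"
  by (rule compact_bounded_real[OF compact_Icc[of "a - 1" "a + 1"] continuous_on_subset[OF f]]) auto
 have c: "continuous_on UNIV (\<lambda>y. f (a + y / real (Suc n)))" for n by (intro continuous_on_compose2[OF f] continuous_intros) auto
 have "(\<lambda>n. LINT y|lborel. f (a + y / real (Suc n)) * hat y) \<longlonglongrightarrow> (LINT y|lborel. f a * hat y)"
 proof (rule integral_dominated_convergence[where w = "\<lambda>y. M * indicator {- 1..1} y"])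
  show "integrable lborel (\<lambda>y. M * indicat_real {- 1..1::real} y)" by (intro integrable_mult_right integrable_real_indicator) auto
  show "(\<lambda>y. f a * hat y) \<in> borel_measurable lborel" "!!n. (\<lambda>y. f (a + y / real (Suc n)) * hat y) \<in> borel_measurable lborel"
   using hat_integrable[OF c] hat_integrable[of "\<lambda>_. f a"] by (auto intro: borel_measurable_integrable)
  show "AE y in lborel. (\<lambda>n. f (a + y / real (Suc n)) * hat y) \<longlonglongrightarrow> f a * hat y"
  proof (intro AE_I2 tendsto_mult_right)
   fix y
   have "(\<lambda>n. y / real (Suc n)) \<longlonglongrightarrow> 0"
    using tendsto_mult[OF tendsto_const[of y] LIMSEQ_inverse_real_of_nat] by (simp add: divide_inverse)
   then have "(\<lambda>n. a + y / real (Suc n)) \<longlonglongrightarrow> a" using tendsto_add[OF tendsto_const[of a]] by fastforce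
   moreover have "isCont f a" using f by (simp add: continuous_on_eq_continuous_at)
   ultimately show "(\<lambda>n. f (a + y / real (Suc n))) \<longlonglongrightarrow> f a" by (rule isCont_tendsto_compose[rotated])
  qed
  show "AE y in lborel. norm (f (a + y / real (Suc n)) * hat y) <= M * indicat_real {- 1..1} y" for n
  proof (intro AE_I2)
   fix y :: real
   show "norm (f (a + y / real (Suc n)) * hat y) <= M * indicat_real {- 1..1} y"
   proof (cases "abs y <= 1")
    case True
    have "\<bar>y / real (Suc n)\<bar> <= 1" using True by (simp add: abs_mult divide_le_eq)
    then have "a + y / real (Suc n) \<in> {a - 1..a + 1}" unfolding abs_le_iff atLeastAtMost_iff by linarith
    then have "\<bar>f (a + y / real (Suc n))\<bar> <= M" by (rule M)
    then have "\<bar>f (a + y / real (Suc n))\<bar> * abs (hat y) <= M * 1" using hat_bounds[of y] M(1) by (intro mult_mono) auto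
    then show ?thesis using True by (auto simp: abs_mult indicator_def abs_le_iff)
   next
    case False
    then show ?thesis using hat_outside[of y] M(1) by (simp add: indicator_def)
   qed
  qed
 qed
 then show ?thesis by (simp add: integral_hat)
qed

text \<open>The test function \<open>xi n\<close> is a difference of two steep ramps and tends to
  the indicator of \<open>{a..b}\<close>, while its derivative is an approximate identity at
  \<open>a\<close> minus one at \<open>b\<close>. Continuity of \<open>f\<close> gives the limit on
  one side, dominated convergence on the other.\<close>

lemma weak_deriv_primitive:
 assumes wd: "weak_deriv f g" and f: "continuous_on UNIV f"
  and g': "g' \<in> borel_measurable borel" "AE x in lborel. g x = g' x" "!!x y. set_integrable lborel {x..y} g'"
  and ab: "a < b"
 shows "f b - f a = integral {a..b} g'"
proof -
 note [measurable] = g'(1)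
 define xi where "xi n x = ramp (real (Suc n) * (x - a)) - ramp (real (Suc n) * (x - b))" for n x
 define I where "I c n = (LINT y|lborel. f (c + y / real (Suc n)) * hat y)" for c n
 have D: "(xi n has_real_derivative real (Suc n) * hat (real (Suc n) * (x - a)) - real (Suc n) * hat (real (Suc n) * (x - b))) (at x)" for n x
  unfolding xi_def[abs_def] by (auto intro!: derivative_eq_intros DERIV_chain2[OF DERIV_ramp] simp del: of_nat_Suc)
 have part: "integrable lborel (\<lambda>x. f x * (real (Suc n) * hat (real (Suc n) * (x - c))))"
  "(LINT x|lborel. f x * (real (Suc n) * hat (real (Suc n) * (x - c)))) = I c n" for n c
 proof -
  let ?n = "real (Suc n)"
  define F where "F x = f x * (?n * hat (?n * (x - c)))" for x
  have eq: "F (c + (1 / ?n) * y) = ?n * (f (c + y / ?n) * hat y)" for y by (simp add: F_def del: of_nat_Suc)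
  have "integrable lborel (\<lambda>y. f (c + y / ?n) * hat y)"
   by (intro hat_integrable continuous_on_compose2[OF f] continuous_intros) auto
  then have "integrable lborel (\<lambda>y. F (c + (1 / ?n) * y))" unfolding eq by (rule integrable_mult_right)
  then have "integrable lborel F" by (subst (asm) lborel_integrable_real_affine_iff) simp_all
  then show "integrable lborel (\<lambda>x. f x * (?n * hat (?n * (x - c))))" by (simp add: F_def[abs_def])
  have "(LINT x|lborel. F x) = \<bar>1 / ?n\<bar> *\<^sub>R (LINT y|lborel. F (c + (1 / ?n) * y))"
   by (rule lborel_integral_real_affine) simp
  then show "(LINT x|lborel. f x * (?n * hat (?n * (x - c)))) = I c n" unfolding eq I_def by (simp add: F_def del: of_nat_Suc)
 qed
 have xim [measurable]: "xi n \<in> borel_measurable borel" for n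
  using D by (intro borel_measurable_continuous_onI) (meson DERIV_isCont continuous_at_imp_continuous_on)
 have xiout: "xi n x = 0" if "abs x > abs a + abs b + 1" for n x
 proof -
  have n: "1 <= real (Suc n)" by simp
  have "(a + 1 <= x & b + 1 <= x) \<or> (x <= a - 1 & x <= b - 1)" using that by (simp only: abs_if split: if_splits) linarith+
  then consider "x >= a + 1" "x >= b + 1" | "x <= a - 1" "x <= b - 1" by blast
  then show ?thesis
  proof cases
   case 1
   have "1 * 1 <= real (Suc n) * (x - a)" "1 * 1 <= real (Suc n) * (x - b)" using 1 n by (intro mult_mono; simp)+
   then show ?thesis by (simp add: xi_def ramp_simps)
  next
   case 2
   have "1 * 1 <= real (Suc n) * (a - x)" "1 * 1 <= real (Suc n) * (b - x)" using 2 n by (intro mult_mono; simp)+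
   then have "real (Suc n) * (x - a) <= - 1" "real (Suc n) * (x - b) <= - 1" by (simp_all add: algebra_simps)
   then show ?thesis unfolding xi_def by (simp add: ramp_simps)
  qed
 qed
 have eqn: "I a n - I b n = - (LINT x|lborel. g' x * xi n x)" for n
 proof -
  have "xi n C1_differentiable_on UNIV" unfolding C1_differentiable_on_def
   by (intro exI[of _ "\<lambda>x. real (Suc n) * hat (real (Suc n) * (x - a)) - real (Suc n) * hat (real (Suc n) * (x - b))"] conjI ballI)
    (use D in "auto simp: has_real_derivative_iff_has_vector_derivative[symmetric] intro!: continuous_intros continuous_on_compose2[OF hat_cont]")
  then have w: "(LINT x|lebesgue. f x * deriv (xi n) x) = - (LINT x|lebesgue. g x * xi n x)"
   using wd xiout[of _ n] unfolding weak_deriv_def by blast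
  have d: "deriv (xi n) x = real (Suc n) * hat (real (Suc n) * (x - a)) - real (Suc n) * hat (real (Suc n) * (x - b))" for x
   by (rule DERIV_imp_deriv[OF D])
  have dd: "f x * deriv (xi n) x = f x * (real (Suc n) * hat (real (Suc n) * (x - a))) - f x * (real (Suc n) * hat (real (Suc n) * (x - b)))" for x
   unfolding d by (rule right_diff_distrib)
  have J: "integrable lborel (\<lambda>x. f x * (real (Suc n) * hat (real (Suc n) * (x - a))) - f x * (real (Suc n) * hat (real (Suc n) * (x - b))))"
   by (intro Bochner_Integration.integrable_diff part(1))
  have "(LINT x|lebesgue. f x * deriv (xi n) x) =
   (LINT x|lborel. f x * (real (Suc n) * hat (real (Suc n) * (x - a))) - f x * (real (Suc n) * hat (real (Suc n) * (x - b))))"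
   unfolding dd by (rule integral_completion) (rule borel_measurable_integrable[OF J])
  also have "... = I a n - I b n" using part by simp
  finally have L: "(LINT x|lebesgue. f x * deriv (xi n) x) = I a n - I b n" .
  have gm: "(\<lambda>x. g' x * xi n x) \<in> borel_measurable borel" by measurable
  have "(LINT x|lebesgue. g x * xi n x) = (LINT x|lebesgue. g' x * xi n x)"
  proof (rule integral_cong_AE)
   have ae: "AE x in lebesgue. g x * xi n x = g' x * xi n x" by (rule AE_completion) (use g'(2) in eventually_elim, simp)
   show m2: "(\<lambda>x. g' x * xi n x) \<in> borel_measurable lebesgue" using gm by (intro measurable_completion) simp
   show "(\<lambda>x. g x * xi n x) \<in> borel_measurable lebesgue"
    by (rule borel_measurable_AE[OF m2]) (use ae in eventually_elim, rule sym)
   show "AE x in lebesgue. g x * xi n x = g' x * xi n x" by (rule ae)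
  qed
  also have "... = (LINT x|lborel. g' x * xi n x)" by (rule integral_completion) (use gm in simp)
  finally show ?thesis using w L by simp
 qed
 have lim1: "(\<lambda>n. I a n - I b n) \<longlonglongrightarrow> f a - f b" unfolding I_def by (intro tendsto_diff hat_approx f)
 have "(\<lambda>n. LINT x|lborel. g' x * xi n x) \<longlonglongrightarrow> (LINT x|lborel. g' x * indicator {a..b} x)"
 proof (rule integral_dominated_convergence[where w = "\<lambda>x. abs (g' x) * indicator {a - 1..b + 1} x"])
  show "integrable lborel (\<lambda>x. abs (g' x) * indicat_real {a - 1..b + 1} x)"
   using set_integrable_abs[OF g'(3)[of "a - 1" "b + 1"]] by (simp add: set_integrable_def mult.commute)
  show "(\<lambda>x. g' x * indicat_real {a..b} x) \<in> borel_measurable lborel" "!!n. (\<lambda>x. g' x * xi n x) \<in> borel_measurable lborel"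
   by measurable
  have "AE x in lborel. x ~= a & x ~= b" using AE_lborel_singleton[of a] AE_lborel_singleton[of b] by eventually_elim simp
  then show "AE x in lborel. (\<lambda>n. g' x * xi n x) \<longlonglongrightarrow> g' x * indicat_real {a..b} x"
  proof eventually_elim
   case (elim x)
   have big: "eventually (\<lambda>n. real (Suc n) * c >= 1) sequentially" if "c > 0" for c
   proof -
    obtain N where N: "1 / c < real N" using reals_Archimedean2 by blast
    show ?thesis unfolding eventually_sequentially
    proof (intro exI[of _ N] allI impI)
     fix n assume "N <= n"
     then have "1 / c <= real (Suc n)" using N by simp
     then show "1 <= real (Suc n) * c" using that by (simp add: divide_le_eq del: of_nat_Suc)
    qed
   qed
   have r: "eventually (\<lambda>n. ramp (real (Suc n) * (x - c)) = (if c < x then 1 else 0)) sequentially" if "x ~= c" for c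
   proof (cases "c < x")
    case True
    then show ?thesis using big[of "x - c"] by (auto elim!: eventually_mono simp: ramp_simps simp del: of_nat_Suc)
   next
    case False
    then have "eventually (\<lambda>n. real (Suc n) * (c - x) >= 1) sequentially" using that big[of "c - x"] by simp
    then show ?thesis
    proof eventually_elim
     case (elim n)
     then have "real (Suc n) * (x - c) <= - 1" by (simp add: algebra_simps del: of_nat_Suc)
     then show ?case using False by (simp add: ramp_simps del: of_nat_Suc)
    qed
   qed
   have "eventually (\<lambda>n. g' x * xi n x = g' x * indicat_real {a..b} x) sequentially"
    using r[OF elim[THEN conjunct1]] r[OF elim[THEN conjunct2]]
   proof eventually_elim
    case (elim n)
    then show ?case using ab \<open>x ~= a & x ~= b\<close> unfolding xi_def by (auto simp del: of_nat_Suc)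
   qed
   then show ?case by (rule tendsto_eventually)
  qed
  show "AE x in lborel. norm (g' x * xi n x) <= abs (g' x) * indicat_real {a - 1..b + 1} x" for n
  proof (intro AE_I2)
   fix x
   have n: "1 <= real (Suc n)" by simp
   have "abs (xi n x) <= indicat_real {a - 1..b + 1} x"
   proof (cases "x \<in> {a - 1..b + 1}")
    case True
    then show ?thesis using ramp_bounds[of "real (Suc n) * (x - a)"] ramp_bounds[of "real (Suc n) * (x - b)"]
     by (simp add: xi_def abs_le_iff del: of_nat_Suc)
   next
    case False
    then consider "x >= b + 1" | "x <= a - 1" by fastforce
    then have "xi n x = 0"
    proof cases
     case 1
     have "1 * 1 <= real (Suc n) * (x - a)" "1 * 1 <= real (Suc n) * (x - b)" using 1 n ab by (intro mult_mono; simp)+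
     then show ?thesis by (simp add: xi_def ramp_simps)
    next
     case 2
     have "1 * 1 <= real (Suc n) * (a - x)" "1 * 1 <= real (Suc n) * (b - x)" using 2 n ab by (intro mult_mono; simp)+
     then have "real (Suc n) * (x - a) <= - 1" "real (Suc n) * (x - b) <= - 1" by (simp_all add: algebra_simps)
     then show ?thesis unfolding xi_def by (simp add: ramp_simps)
    qed
    then show ?thesis by simp
   qed
   then show "norm (g' x * xi n x) <= abs (g' x) * indicat_real {a - 1..b + 1} x" by (simp add: abs_mult mult_left_mono)
  qed
 qed
 then have "(\<lambda>n. - (LINT x|lborel. g' x * xi n x)) \<longlonglongrightarrow> - (LINT x|lborel. g' x * indicator {a..b} x)"
  by (rule tendsto_minus)
 then have "f a - f b = - (LINT x|lborel. g' x * indicator {a..b} x)" using LIMSEQ_unique[OF lim1] unfolding eqn by blast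
 moreover have "(LINT x|lborel. g' x * indicator {a..b} x) = integral {a..b} g'"
  using set_borel_integral_eq_integral(2)[OF g'(3)] by (simp add: set_lebesgue_integral_def mult.commute)
 ultimately show ?thesis by simp
qed

lemma lebesgue_lborel_cong:
 fixes f f' :: "'a::euclidean_space => real"
 assumes f': "f' \<in> borel_measurable lborel" and ae: "AE x in lborel. f x = f' x"
 shows "f \<in> borel_measurable lebesgue" "(LINT x|lebesgue. f x) = (LINT x|lborel. f' x)"
  "integrable lborel f' ==> integrable lebesgue f"
proof -
 have m': "f' \<in> borel_measurable lebesgue" by (rule measurable_completion[OF f'])
 have ae1: "AE x in lebesgue. f' x = f x" by (rule AE_completion) (use ae in eventually_elim, rule sym)
 show m: "f \<in> borel_measurable lebesgue" by (rule borel_measurable_AE[OF m' ae1])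
 show "(LINT x|lebesgue. f x) = (LINT x|lborel. f' x)" using integral_cong_AE[OF m' m ae1] integral_completion[OF f'] by simp
 show "integrable lebesgue f" if "integrable lborel f'"
 proof -
  have "integrable lebesgue f'" using that f' by (simp add: integrable_completion)
  then show ?thesis by (rule integrable_cong_AE_imp[OF _ m ae1])
 qed
qed

lemma set_integral_lebesgue_eq_HK:
 fixes f f' :: "real => real"
 assumes f': "set_integrable lborel {l..r} f'" and ae: "AE x in lborel. f x = f' x"
 shows "(LINT x:{l..r}|lebesgue. f x) = integral {l..r} f'"
proof -
 have "(LINT x:{l..r}|lebesgue. f x) = (LINT x:{l..r}|lborel. f' x)" unfolding set_lebesgue_integral_def
  by (rule lebesgue_lborel_cong(2)) (use f' ae in "auto simp: set_integrable_def intro: borel_measurable_integrable")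
 then show ?thesis using set_borel_integral_eq_integral(2)[OF f'] by simp
qed

lemma wave1d_of_blowup:
 assumes p: "p > 1" and bl: "blowup_solution p a T u"
 obtains al A where "wave1d p a T u al A"
proof -
 obtain u0 u1 where Tpos: "!!x. 0 < T x" and lip: "1-lipschitz_on UNIV T" and u0: "u0 \<in> H1_locu" and u1: "u1 \<in> L2_locu"
  and ws: "wave_solution p a T u0 u1 u" using bl unfolding blowup_solution_def by blast
 have T_lip: "\<bar>T x - T y\<bar> <= \<bar>x - y\<bar>" for x y using lipschitz_onD[OF lip, of x y] by (simp add: dist_real_def)
 have u_cont: "continuous_on (infl_dom T) (\<lambda>(x, t). u x t)" using ws by (simp add: wave_solution_def)
 have rep: "u x t = (u0 (x + t) + u0 (x - t)) / 2
       + (LINT z:{x - t..x + t}|lebesgue. u1 z) / 2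
       + (LINT ta:{0..t}|lebesgue.
         (LINT z:{x - (t - ta)..x + (t - ta)}|lebesgue. nonlin p a (u z ta))) / 2" if "(x, t) \<in> infl_dom T" for x t
  using ws that by (auto simp: wave_solution_def)
 obtain gg where gg: "gg \<in> L2_locu" "weak_deriv u0 gg" using u0 by (auto simp: H1_locu_def)
 obtain g' where g': "g' \<in> borel_measurable borel" "AE x in lborel. gg x = g' x" "!!x y. set_integrable lborel {x..y} (\<lambda>z. (g' z)^2)"
  by (rule L2_locu_borel[OF gg(1)], rule that)
 obtain v' where v': "v' \<in> borel_measurable borel" "AE x in lborel. u1 x = v' x" "!!x y. set_integrable lborel {x..y} (\<lambda>z. (v' z)^2)"
  by (rule L2_locu_borel[OF u1], rule that)
 note [measurable] = g'(1) v'(1)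
 have gI: "set_integrable lborel {x..y} g'" and vI: "set_integrable lborel {x..y} v'" for x y
  by (rule square_integrable_imp_integrable; fact)+
 note gH = set_borel_integral_eq_integral(1)[OF gI] and vH = set_borel_integral_eq_integral(1)[OF vI]
 \<comment> \<open>At time 0 both integrals in d'Alembert's formula vanish, which identifies
   \<open>u0\<close> pointwise with the continuous function \<open>u\<close>; the weak derivative
   therefore integrates back to \<open>u0\<close> itself.\<close>
 have "u0 x = u x 0" for x
 proof -
  have pt: "(LINT z:{c..c}|lebesgue. f z) = 0" for c and f :: "real => real" unfolding set_lebesgue_integral_def
   by (rule integral_eq_zero_AE, rule AE_completion) (use AE_lborel_singleton[of c] in eventually_elim, auto)
  have "(x, 0) \<in> infl_dom T" using Tpos by (simp add: infl_dom_def)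
  from rep[OF this] show ?thesis using pt[of x] pt[of 0] by simp
 qed
 then have u0_eq: "u0 = (\<lambda>x. u x 0)" by auto
 have u0c: "continuous_on UNIV u0" unfolding u0_eq
  using continuous_on_compose2[OF u_cont continuous_on_Pair[OF continuous_on_id continuous_on_const[of UNIV 0]]] Tpos
  by (auto simp: infl_dom_def)
 have u0d: "u0 y - u0 x = integral {x..y} g'" if "x <= y" for x y
  using weak_deriv_primitive[OF gg(2) u0c g'(1,2) gI, of x y] that by (cases "x = y") auto
 define V where "V x = (if 0 <= x then integral {0..x} v' else - integral {x..0} v')" for x
 have Vd: "V y - V x = integral {x..y} v'" if "x <= y" for x y
 proof -
  have c: "integral {x..z} v' + integral {z..y} v' = integral {x..y} v'" if "x <= z" "z <= y" for x y z
   by (rule Henstock_Kurzweil_Integration.integral_combine[OF that vH])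
  consider "0 <= x" | "x < 0" "0 <= y" | "y < 0" by linarith
  then show ?thesis using c[of 0 x y] c[of x 0 y] c[of x y 0] \<open>x <= y\<close> by cases (auto simp: V_def)
 qed
 define al where "al j x = v' x + j * g' x" for j x
 define A where "A j x = V x + j * u0 x" for j x
 have "wave1d p a T u al A"
 proof unfold_locales
  show "1 < p" "continuous_on (infl_dom T) (\<lambda>(x, t). u x t)" by (fact p u_cont)+
  show "\<bar>T x - T y\<bar> <= \<bar>x - y\<bar>" for x y by (rule T_lip)
  show "al j \<in> borel_measurable borel" for j unfolding al_def[abs_def] by measurable
  then have [measurable]: "al j \<in> borel_measurable borel" for j .
  show "set_integrable lborel {x..y} (\<lambda>z. (al j z)^2)" for j x y
  proof -
   have "set_integrable lborel {x..y} (\<lambda>z. 2 * (v' z)^2 + 2 * j^2 * (g' z)^2)"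
    by (intro set_integral_add(1) set_integrable_mult_right v'(3) g'(3))
   then show ?thesis
   proof (rule set_integrable_bound)
    show "set_borel_measurable lborel {x..y} (\<lambda>z. (al j z)^2)" unfolding set_borel_measurable_def by measurable
    have "(al j z)^2 <= 2 * (v' z)^2 + 2 * j^2 * (g' z)^2" for z
     using sum_squares_bound[of "v' z" "j * g' z"] by (simp add: al_def power2_sum power_mult_distrib)
    then show "AE z in lborel. z \<in> {x..y} --> norm ((al j z)^2) <= norm (2 * (v' z)^2 + 2 * j^2 * (g' z)^2)" by simp
   qed
  qed
  show "A j y - A j x = integral {x..y} (al j)" if "x <= y" for j x y
  proof -
   have "integral {x..y} (al j) = integral {x..y} v' + integral {x..y} (\<lambda>z. j * g' z)"
    unfolding al_def[abs_def] by (rule Henstock_Kurzweil_Integration.integral_add[OF vH integrable_on_mult_right[OF gH]])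
   then show ?thesis using Vd[OF that] u0d[OF that] by (simp add: A_def algebra_simps)
  qed
  fix x t assume xt: "(x, t) \<in> infl_dom T"
  then have t: "0 <= t" by (simp add: infl_dom_def)
  have dom: "(z, ta) \<in> infl_dom T" if "\<bar>z - x\<bar> <= t - ta" "0 <= ta" for z ta
   using xt T_lip[of z x] that by (auto simp: infl_dom_def)
  define h where "h z ta = nonlin p a (u z ta)" for z ta
  have hc: "continuous_on (infl_dom T) (\<lambda>z. h (fst z) (snd z))"
   using continuous_on_compose2[OF continuous_nonlin[OF p] u_cont] by (simp add: h_def case_prod_beta)
  have slice: "continuous_on {x - (t - ta)..x + (t - ta)} (\<lambda>z. h z ta)" if "0 <= ta" for ta
  proof -
   have "continuous_on {x - (t - ta)..x + (t - ta)} (\<lambda>z. h (fst (z, ta)) (snd (z, ta)))"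
    by (rule continuous_on_compose2[OF hc]) (use that in "auto intro!: continuous_intros dom simp: abs_le_iff")
   then show ?thesis by simp
  qed
  \<comment> \<open>Rescaled to a fixed interval, the inner integral is continuous in
    \<open>ta\<close>. This makes the outer Lebesgue integral agree with the Henstock-Kurzweil
    integral in the locale.\<close>
  define q where "q ta = integral {x - (t - ta)..x + (t - ta)} (\<lambda>z. h z ta)" for ta
  have q: "q ta = (t - ta) * integral {- 1..1} (\<lambda>y. h (x + (t - ta) * y) ta)" if ta: "0 <= ta" "ta <= t" for ta
  proof -
   have "((\<lambda>y. (t - ta) *\<^sub>R h (x + (t - ta) * y) ta) has_integral integral {x + (t - ta) * (- 1)..x + (t - ta) * 1} (\<lambda>z. h z ta)) {- 1..1}"
   proof (rule has_integral_substitution[where c = "x - (t - ta)" and d = "x + (t - ta)"])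
    show "(\<lambda>y. x + (t - ta) * y) ` {- 1..1} \<subseteq> {x - (t - ta)..x + (t - ta)}"
    proof safe
     fix y :: real assume y: "y \<in> {- 1..1}"
     have "(t - ta) * (- 1) <= (t - ta) * y" "(t - ta) * y <= (t - ta) * 1" using y ta by (intro mult_left_mono; simp)+
     then show "x + (t - ta) * y \<in> {x - (t - ta)..x + (t - ta)}" by simp
    qed
   qed (use ta slice[of ta] in "auto intro!: derivative_eq_intros")
   then have "integral {- 1..1} (\<lambda>y. (t - ta) *\<^sub>R h (x + (t - ta) * y) ta) = q ta"
    unfolding q_def by (subst integral_unique) (simp_all add: algebra_simps)
   then show ?thesis by simp
  qed
  have "continuous_on ({0..t} \<times> cbox (- 1) 1) (\<lambda>z. h (fst (x + (t - fst z) * snd z, fst z)) (snd (x + (t - fst z) * snd z, fst z)))"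
  proof (rule continuous_on_compose2[OF hc])
   show "(\<lambda>z. (x + (t - fst z) * snd z, fst z)) ` ({0..t} \<times> cbox (- 1) 1) \<subseteq> infl_dom T"
   proof safe
    fix ta y :: real assume *: "ta \<in> {0..t}" "y \<in> cbox (- 1) 1"
    have "\<bar>t - ta\<bar> * abs y <= (t - ta) * 1" using * by (intro mult_mono) auto
    then show "(x + (t - fst (ta, y)) * snd (ta, y), fst (ta, y)) \<in> infl_dom T" using * by (intro dom) (auto simp: abs_mult)
   qed
  qed (intro continuous_intros)
  then have "continuous_on {0..t} (\<lambda>ta. integral (cbox (- 1) 1) (\<lambda>y. h (x + (t - ta) * y) ta))"
   by (intro integral_continuous_on_param) (simp add: case_prod_beta)
  then have "continuous_on {0..t} (\<lambda>ta. (t - ta) * integral {- 1..1} (\<lambda>y. h (x + (t - ta) * y) ta))"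
   by (intro continuous_intros) simp
  then have qc: "continuous_on {0..t} q" by (rule continuous_on_eq) (simp add: q)
  have inner: "(LINT z:{x - (t - ta)..x + (t - ta)}|lebesgue. nonlin p a (u z ta)) = q ta" if "ta \<in> {0..t}" for ta
   unfolding q_def h_def[symmetric]
   by (rule set_lebesgue_integral_eq_integral(2)[OF absolutely_integrable_continuous_real[OF slice]]) (use that in auto)
  have "(LINT ta:{0..t}|lebesgue. (LINT z:{x - (t - ta)..x + (t - ta)}|lebesgue. nonlin p a (u z ta))) = (LINT ta:{0..t}|lebesgue. q ta)"
   by (rule set_lebesgue_integral_cong) (use inner in auto)
  also have "... = integral {0..t} q" by (rule set_lebesgue_integral_eq_integral(2)[OF absolutely_integrable_continuous_real[OF qc]])
  finally have D: "(LINT ta:{0..t}|lebesgue. (LINT z:{x - (t - ta)..x + (t - ta)}|lebesgue. nonlin p a (u z ta))) = integral {0..t} q" .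
  have "(LINT z:{x - t..x + t}|lebesgue. u1 z) = V (x + t) - V (x - t)"
   unfolding set_integral_lebesgue_eq_HK[OF vI v'(2)] using t by (intro Vd[symmetric]) simp
  then show "u x t = (A 1 (x + t) - A (- 1) (x - t)
    + integral {0..t} (\<lambda>ta. integral {x - (t - ta)..x + (t - ta)} (\<lambda>z. nonlin p a (u z ta)))) / 2"
   unfolding rep[OF xt] D A_def q_def h_def by (simp add: field_simps)
 qed
 then show ?thesis by (rule that)
qed

section \<open>Classical derivatives, and the conclusion\<close>

lemma psi_phi: "psi p a T0 (T0 - exp (- s)) = phi p a s"
proof -
 have "exp (- s) powr (- 2 / (p - 1)) = exp (2 * s / (p - 1))" by (simp add: exp_powr_real)
 then show ?thesis by (simp add: psi_def phi_def)
qed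

context cone
begin

lemma sim_var_w: "sim_var p a u x0 T0 = w" by (intro ext) (simp add: sim_var_def w_def psi_phi)

lemma classical_derivatives:
 assumes s: "s1 <= s" "s <= s2" and y: "- 1 <= y" "y <= 1"
  and A: "!!j. j \<in> {1, - 1} ==> (A j has_real_derivative al j (x0 + y * exp (- s) + j * (T0 - exp (- s)))) (at (x0 + y * exp (- s) + j * (T0 - exp (- s))))"
 shows "d_s w y s = z y s" "d_y w y s = wy y s"
proof -
 define X t where "X = x0 + y * exp (- s)" and "t = T0 - exp (- s)"
 have xt: "0 < t" "t < T X" using dom[OF y s] by (auto simp: X_def t_def)
 have D: "((\<lambda>(x, t). u x t) has_derivative (\<lambda>(dx, dt). (U 1 X t * (dx + dt) - U (- 1) X t * (dx - dt)) / 2)) (at (X, t))"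
 proof (rule u_has_derivative[OF _ _ xt])
  show "(A 1 has_real_derivative al 1 (X + t)) (at (X + t))" using A[of 1, folded X_def t_def] by simp
  show "(A (- 1) has_real_derivative al (- 1) (X - t)) (at (X - t))" using A[of "- 1", folded X_def t_def] by simp
 qed
 have ph: "phi p a s > 0" by (rule phi_pos[OF spos[OF s(1)]])
 have uw: "u X t / phi p a s = w y s" by (simp add: w_def X_def t_def)
 have vv: "exp (- s) * U j X t / phi p a s = v j y s" for j by (simp add: v_def X_def t_def)
 have curve: "((\<lambda>r. u (x0 + y * exp (- r)) (T0 - exp (- r))) has_real_derivative
   exp (- s) * ((1 - y) * U 1 X t + (1 + y) * U (- 1) X t) / 2) (at s)"
 proof -
  have "((\<lambda>r. (x0 + y * exp (- r), T0 - exp (- r))) has_derivative (\<lambda>h. (- (y * exp (- s) * h), exp (- s) * h))) (at s)"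
   by (auto intro!: derivative_eq_intros simp: algebra_simps)
  from has_derivative_compose[OF this, folded X_def t_def, OF D]
  have "((\<lambda>r. u (x0 + y * exp (- r)) (T0 - exp (- r))) has_derivative
   (\<lambda>h. (U 1 X t * (- (y * exp (- s) * h) + exp (- s) * h) - U (- 1) X t * (- (y * exp (- s) * h) - exp (- s) * h)) / 2)) (at s)"
   by (simp only: prod.case)
  then show ?thesis unfolding has_field_derivative_def by (rule has_derivative_eq_rhs) (simp add: fun_eq_iff field_simps)
 qed
 have "((\<lambda>r. w y r) has_real_derivative z y s) (at s)"
 proof -
  have "((\<lambda>r. u (x0 + y * exp (- r)) (T0 - exp (- r)) / phi p a r) has_real_derivative
   (exp (- s) * ((1 - y) * U 1 X t + (1 + y) * U (- 1) X t) / 2 * phi p a s - u X t * (lam p a s * phi p a s)) / (phi p a s * phi p a s)) (at s)"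
   using DERIV_divide[OF curve DERIV_phi[OF spos[OF s(1)]]] ph by (simp add: X_def t_def)
  moreover have "(exp (- s) * ((1 - y) * U 1 X t + (1 + y) * U (- 1) X t) / 2 * phi p a s - u X t * (lam p a s * phi p a s)) / (phi p a s * phi p a s)
    = z y s" unfolding z_def q_def uw[symmetric] vv[symmetric] using ph by (simp add: field_simps)
  ultimately show ?thesis unfolding w_def by simp
 qed
 then show "d_s w y s = z y s" unfolding d_s_def by (rule DERIV_imp_deriv)
 have curve': "((\<lambda>r. u (x0 + r * exp (- s)) t) has_real_derivative exp (- s) * (U 1 X t - U (- 1) X t) / 2) (at y)"
 proof -
  have "((\<lambda>r. (x0 + r * exp (- s), t)) has_derivative (\<lambda>h. (exp (- s) * h, 0))) (at y)"
   by (auto intro!: derivative_eq_intros simp: algebra_simps)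
  from has_derivative_compose[OF this, folded X_def t_def, OF D]
  have "((\<lambda>r. u (x0 + r * exp (- s)) t) has_derivative
   (\<lambda>h. (U 1 X t * (exp (- s) * h + 0) - U (- 1) X t * (exp (- s) * h - 0)) / 2)) (at y)" by (simp only: prod.case)
  then show ?thesis unfolding has_field_derivative_def by (rule has_derivative_eq_rhs) (simp add: fun_eq_iff field_simps)
 qed
 have "((\<lambda>r. w r s) has_real_derivative wy y s) (at y)"
 proof -
  have "((\<lambda>r. u (x0 + r * exp (- s)) t / phi p a s) has_real_derivative exp (- s) * (U 1 X t - U (- 1) X t) / 2 / phi p a s) (at y)"
   by (rule DERIV_cdivide[OF curve'])
  moreover have "exp (- s) * (U 1 X t - U (- 1) X t) / 2 / phi p a s = wy y s"
   unfolding wy_def vv[symmetric] by (simp add: diff_divide_distrib right_diff_distrib)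
  ultimately show ?thesis unfolding w_def t_def by simp
 qed
 then show "d_y w y s = wy y s" unfolding d_y_def by (rule DERIV_imp_deriv)
qed

text \<open>Differentiability of \<open>u\<close> can fail only where \<open>x + t\<close> or
  \<open>x - t\<close> lies in a null set of the line, fixed by the data. The null set is enlarged
  to a Borel set so that exceptional points can be handled both on each time slice and, by Fubini's
  theorem, in the plane.\<close>

lemma exceptional_set:
 obtains N where "N \<in> sets borel" "!!s y. s1 <= s ==> s <= s2 ==> - 1 <= y ==> y <= 1 ==>
   x0 + y * exp (- s) + (T0 - exp (- s)) \<notin> N ==> x0 + y * exp (- s) - (T0 - exp (- s)) \<notin> N ==>
   d_s w y s = z y s & d_y w y s = wy y s"
  "AE x in lborel. x \<notin> N"
proof -
 have "\<exists>N. N \<in> null_sets lborel & {x. \<not> (A j has_real_derivative al j x) (at x)} \<subseteq> N" for j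
 proof -
  have "negligible {x. \<not> (A j has_real_derivative al j x) (at x)}"
   by (rule indefinite_integral_differentiable_ae[OF A]) (use set_borel_integral_eq_integral(1)[OF al_int] in auto)
  then show ?thesis by (auto simp: negligible_iff_null_sets null_sets_completion_iff2)
 qed
 then obtain N where N: "!!j. N j \<in> null_sets lborel" "!!j. {x. \<not> (A j has_real_derivative al j x) (at x)} \<subseteq> N j"
  by metis
 show ?thesis
 proof (rule that[of "N 1 \<union> N (- 1)"])
  have n: "N 1 \<union> N (- 1) \<in> null_sets lborel" using N(1) by auto
  then show "N 1 \<union> N (- 1) \<in> sets borel" by auto
  show "AE x in lborel. x \<notin> N 1 \<union> N (- 1)" by (rule AE_not_in[OF n])
  fix s y :: real assume *: "s1 <= s" "s <= s2" "- 1 <= y" "y <= 1"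
   "x0 + y * exp (- s) + (T0 - exp (- s)) \<notin> N 1 \<union> N (- 1)" "x0 + y * exp (- s) - (T0 - exp (- s)) \<notin> N 1 \<union> N (- 1)"
  have "(A j has_real_derivative al j (x0 + y * exp (- s) + j * (T0 - exp (- s)))) (at (x0 + y * exp (- s) + j * (T0 - exp (- s))))" if "j \<in> {1, - 1}" for j
  proof -
   have "x0 + y * exp (- s) + j * (T0 - exp (- s)) \<notin> N j"
   proof (cases "j = 1")
    case True
    then show ?thesis using *(5) by simp
   next
    case False
    then have "j = - 1" using that by simp
    then have "x0 + y * exp (- s) + j * (T0 - exp (- s)) = x0 + y * exp (- s) - (T0 - exp (- s))"
     by (simp only: mult_minus1 diff_conv_add_uminus[of _ "T0 - exp (- s)"])
    then show ?thesis using *(6) \<open>j = - 1\<close> by (metis UnCI)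
   qed
   then show ?thesis using N(2)[of j] by blast
  qed
  then show "d_s w y s = z y s & d_y w y s = wy y s" using classical_derivatives[OF *(1-4)] by blast
 qed
qed

lemma classical_ae:
 assumes s: "s1 <= s" "s <= s2"
 shows "AE y in lborel. y \<in> {- 1..1} --> y \<in> {- 1<..<1} & d_s w y s = z y s & d_y w y s = wy y s"
proof -
 obtain N where N: "N \<in> sets borel" "!!s y. s1 <= s ==> s <= s2 ==> - 1 <= y ==> y <= 1 ==>
   x0 + y * exp (- s) + (T0 - exp (- s)) \<notin> N ==> x0 + y * exp (- s) - (T0 - exp (- s)) \<notin> N ==>
   d_s w y s = z y s & d_y w y s = wy y s"
  "AE x in lborel. x \<notin> N" by (rule exceptional_set, rule that)
 have aff: "AE y in lborel. c + exp (- s) * y \<notin> N" for c by (rule AE_borel_affine) (use N in auto)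
 from aff[of "x0 + (T0 - exp (- s))"] aff[of "x0 - (T0 - exp (- s))"] AE_lborel_singleton[of 1] AE_lborel_singleton[of "- 1"]
 show ?thesis
 proof eventually_elim
  case (elim y)
  have e: "x0 + y * exp (- s) + (T0 - exp (- s)) = x0 + (T0 - exp (- s)) + exp (- s) * y"
   "x0 + y * exp (- s) - (T0 - exp (- s)) = x0 - (T0 - exp (- s)) + exp (- s) * y" by simp_all
  show ?case
  proof
   assume "y \<in> {- 1..1}"
   then show "y \<in> {- 1<..<1} & d_s w y s = z y s & d_y w y s = wy y s" using N(2)[OF s, of y] elim unfolding e by auto
  qed
 qed
qed

lemma slice_integral:
 fixes F f :: "real => real"
 assumes s: "s1 <= s" "s <= s2" and F: "sint F"
  and eq: "!!y. y \<in> {- 1<..<1} ==> d_s w y s = z y s ==> d_y w y s = wy y s ==> f y = F y"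
 shows "(LINT y:{- 1..1}|lebesgue. f y) = (SINT y. F y)" unfolding set_lebesgue_integral_def
proof (rule lebesgue_lborel_cong(2))
 show "(\<lambda>y. indicat_real {- 1<..<1} y *\<^sub>R F y) \<in> borel_measurable lborel"
  using F unfolding set_integrable_def by (rule borel_measurable_integrable)
 show "AE y in lborel. indicat_real {- 1..1} y *\<^sub>R f y = indicat_real {- 1<..<1} y *\<^sub>R F y"
  using classical_ae[OF s] by eventually_elim (auto simp: indicator_def eq)
qed

lemma lyap_Lf:
 assumes s: "s1 <= s" "s <= s2"
 shows "lyap p a \<theta> w s = exp ((p + 3) / sqrt s) * Lf (s powr (- 3 / 2)) s + \<theta> * exp (- s)"
proof -
 have sp: "0 < s" by (rule spos[OF s(1)])
 have k: "(p + 1) / (p - 1)^2 = k0c p"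
 proof -
  define d where "d = p - 1"
  have "0 < d" "p = d + 1" using p by (simp_all add: d_def)
  then show ?thesis by (simp add: k0c_def expo_def field_simps power2_eq_square)
 qed
 have E: "exp (- (2 * (p + 1) * s / (p - 1))) * s powr (2 * a / (p - 1)) = E2 p a s"
 proof -
  have "2 * (p + 1) * s / (p - 1) = 2 * (1 + expo p) * s" using p by (simp add: expo_def field_simps)
  moreover have "2 * a / (p - 1) = a * expo p" by (simp add: expo_def)
  ultimately show ?thesis unfolding E2_eq[OF sp] by (simp add: algebra_simps)
 qed
 have I0: "sint (\<lambda>y. rho p y * En y s)" using Lf_integrable[OF s, of 0] by simp
 have I1: "sint (\<lambda>y. rho p y * (w y s * z y s))"
 proof -
  have eq: "rho p y * (w y s * z y s) = rho p y * En y s - rho p y * (En y s - 1 * (w y s * z y s))" for y by (simp add: algebra_simps)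
  show ?thesis unfolding eq by (rule set_integral_diff(1)[OF I0 Lf_integrable[OF s, of 1]])
 qed
 have E1: "E1 p a w s = (SINT y. rho p y * En y s)" unfolding E1_def k E
 proof (rule slice_integral[OF s I0])
  fix y assume "d_s w y s = z y s" "d_y w y s = wy y s"
  then show "(1 / 2 * (d_s w y s)^2 + 1 / 2 * (d_y w y s)^2 * (1 - y^2) + k0c p * (w y s)^2
    - E2 p a s * nonlin_prim p a (phi p a s * w y s)) * rho p y = rho p y * En y s" by (simp add: En_def G_E2 algebra_simps)
 qed
 have J: "(LINT y:{- 1..1}|lebesgue. w y s * d_s w y s * rho p y) = (SINT y. rho p y * (w y s * z y s))"
  by (rule slice_integral[OF s I1]) (simp add: mult_ac)
 have nu: "1 / (s * sqrt s) = s powr (- 3 / 2)"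
 proof -
  have "s powr (1 + 1 / 2) = s * sqrt s" using sp by (subst powr_add) (simp add: powr_half_sqrt)
  then show ?thesis using powr_minus_divide[of s "3 / 2"] by simp
 qed
 have "Lf nu s = (SINT y. rho p y * En y s) - nu * (SINT y. rho p y * (w y s * z y s))" for nu
 proof -
  have "Lf nu s = (SINT y. rho p y * En y s - nu * (rho p y * (w y s * z y s)))" unfolding Lf_def by (simp add: algebra_simps)
  also have "... = (SINT y. rho p y * En y s) - (SINT y. nu * (rho p y * (w y s * z y s)))"
   by (rule set_integral_diff(2)[OF I0 set_integrable_mult_right]) (use I1 in simp)
  finally show ?thesis by simp
 qed
 then show ?thesis unfolding lyap_def L0_def E1 J nu by simp
qed

text \<open>For each time the exceptional positions are null, hence null in the plane; there
  \<open>d_s w\<close> may be replaced by \<open>z\<close>, whose weighted square is integrable as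
  the case \<open>nu = 0\<close> of \<open>diss\<close>. The set carries the variables in the order
  \<open>(y, ta)\<close>, opposite to \<open>obox\<close>, which is why the product is
  swapped.\<close>

lemma dissipation_integral:
 shows "set_integrable lebesgue ({- 1..1} \<times> {s1..s2}) (\<lambda>(y, ta). (d_s w y ta)^2 * (rho p y / (1 - y^2)))"
  and "expo p * (LINT ta:{s1..s2}|lebesgue. (LINT y:{- 1..1}|lebesgue. (d_s w y ta)^2 * (rho p y / (1 - y^2)))) =
   (BINT x. rho1 p (snd x) * (expo p * (z (snd x) (fst x))^2))"
proof -
 obtain N where N: "N \<in> sets borel" "!!s y. s1 <= s ==> s <= s2 ==> - 1 <= y ==> y <= 1 ==>
   x0 + y * exp (- s) + (T0 - exp (- s)) \<notin> N ==> x0 + y * exp (- s) - (T0 - exp (- s)) \<notin> N ==>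
   d_s w y s = z y s & d_y w y s = wy y s"
  "AE x in lborel. x \<notin> N" by (rule exceptional_set, rule that)
 note [measurable] = N(1)
 have k: "0 < expo p" by (rule expo_pos[OF p])
 have Z: "bint (\<lambda>(s, y). (z y s)^2 * rho1 p y)"
  using diss_integrable[of "\<lambda>_. 1 / expo p" "\<lambda>_. 0"] k by (simp add: diss_def case_prod_beta' mult_ac)
 have sw: "integrable lborel2 (\<lambda>(y, s). indicat_real obox (s, y) *\<^sub>R ((z y s)^2 * rho1 p y))"
  using lborel_pair.integrable_product_swap[OF Z[unfolded set_integrable_def]] by (simp add: case_prod_beta')
 have "AE s in lborel. AE y in lborel. x0 + y * exp (- s) + (T0 - exp (- s)) \<notin> N & x0 + y * exp (- s) - (T0 - exp (- s)) \<notin> N & y ~= 1 & y ~= - 1"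
 proof (rule AE_I2)
  fix s
  have aff: "AE y in lborel. c + exp (- s) * y \<notin> N" for c by (rule AE_borel_affine) (use N in auto)
  from aff[of "x0 + (T0 - exp (- s))"] aff[of "x0 - (T0 - exp (- s))"] AE_lborel_singleton[of 1] AE_lborel_singleton[of "- 1"]
  show "AE y in lborel. x0 + y * exp (- s) + (T0 - exp (- s)) \<notin> N & x0 + y * exp (- s) - (T0 - exp (- s)) \<notin> N & y ~= 1 & y ~= - 1"
   by eventually_elim (simp add: algebra_simps)
 qed
 then have "AE y in lborel. AE s in lborel. x0 + y * exp (- s) + (T0 - exp (- s)) \<notin> N & x0 + y * exp (- s) - (T0 - exp (- s)) \<notin> N & y ~= 1 & y ~= - 1"
  by (subst lborel_pair.AE_commute[symmetric]) measurable
 then have "AE x in lborel. AE y in lborel. x0 + fst (x, y) * exp (- snd (x, y)) + (T0 - exp (- snd (x, y))) \<notin> N &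
   x0 + fst (x, y) * exp (- snd (x, y)) - (T0 - exp (- snd (x, y))) \<notin> N & fst (x, y) ~= 1 & fst (x, y) ~= - 1" by simp
 moreover have "Measurable.pred lborel2 (\<lambda>x. x0 + fst x * exp (- snd x) + (T0 - exp (- snd x)) \<notin> N &
   x0 + fst x * exp (- snd x) - (T0 - exp (- snd x)) \<notin> N & fst x ~= 1 & fst x ~= - 1)" by measurable
 ultimately have ae: "AE x in lborel2. x0 + fst x * exp (- snd x) + (T0 - exp (- snd x)) \<notin> N &
   x0 + fst x * exp (- snd x) - (T0 - exp (- snd x)) \<notin> N & fst x ~= 1 & fst x ~= - 1"
  by (intro lborel_pair.AE_pair_measure predE)
 show "set_integrable lebesgue ({- 1..1} \<times> {s1..s2}) (\<lambda>(y, ta). (d_s w y ta)^2 * (rho p y / (1 - y^2)))"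
  unfolding set_integrable_def
 proof (rule lebesgue_lborel_cong(3))
  show i: "integrable lborel (\<lambda>(y, s). indicat_real obox (s, y) *\<^sub>R ((z y s)^2 * rho1 p y))"
   using sw by (simp add: lborel_prod)
  then show "(\<lambda>(y, s). indicat_real obox (s, y) *\<^sub>R ((z y s)^2 * rho1 p y)) \<in> borel_measurable lborel"
   by (rule borel_measurable_integrable)
  show "AE x in lborel. indicat_real ({- 1..1} \<times> {s1..s2}) x *\<^sub>R (case x of (y, ta) => (d_s w y ta)^2 * (rho p y / (1 - y^2))) =
     (case x of (y, s) => indicat_real obox (s, y) *\<^sub>R ((z y s)^2 * rho1 p y))" using ae unfolding lborel_prod
  proof eventually_elim
   case (elim x)
   obtain y s where x: "x = (y, s)" by fastforce
   show ?case
   proof (cases "- 1 <= y & y <= 1 & s1 <= s & s <= s2")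
    case True
    then have "d_s w y s = z y s" using N(2)[of s y] elim by (simp add: x)
    then show ?thesis using True elim by (simp add: x rho1_def indicator_def less_le)
   next
    case False
    then show ?thesis by (auto simp: x indicator_def)
   qed
  qed
 qed
 define D where "D ta = (SINT y. (z y ta)^2 * rho1 p y)" for ta
 have DI: "set_integrable lborel {s1..s2} D"
 proof -
  have "integrable lborel2 (\<lambda>(s, y). indicat_real {s1..s2} s * (indicat_real {- 1<..<1} y * ((z y s)^2 * rho1 p y)))"
   using Z by (simp add: set_integrable_def case_prod_beta' indicator_times mult.assoc)
  from lborel_pair.integrable_fst'[OF this]
  show ?thesis by (simp add: set_integrable_def set_lebesgue_integral_def D_def[abs_def])
 qed
 have aeI: "AE s in lborel. s \<in> {s1..s2} --> sint (\<lambda>y. (z y s)^2 * rho1 p y)"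
 proof -
  have "integrable lborel2 (\<lambda>(s, y). indicat_real {s1..s2} s * (indicat_real {- 1<..<1} y * ((z y s)^2 * rho1 p y)))"
   using Z by (simp add: set_integrable_def case_prod_beta' indicator_times mult.assoc)
  from lborel_pair.AE_integrable_fst'[OF this]
  show ?thesis by eventually_elim (auto simp: set_integrable_def)
 qed
 have "(LINT ta:{s1..s2}|lebesgue. (LINT y:{- 1..1}|lebesgue. (d_s w y ta)^2 * (rho p y / (1 - y^2)))) = (LINT ta:{s1..s2}|lborel. D ta)"
  unfolding set_lebesgue_integral_def[of _ "{s1..s2}"]
 proof (rule lebesgue_lborel_cong(2))
  show "(\<lambda>ta. indicat_real {s1..s2} ta *\<^sub>R D ta) \<in> borel_measurable lborel"
   using DI unfolding set_integrable_def by (rule borel_measurable_integrable)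
  show "AE ta in lborel. indicat_real {s1..s2} ta *\<^sub>R (LINT y:{- 1..1}|lebesgue. (d_s w y ta)^2 * (rho p y / (1 - y^2))) = indicat_real {s1..s2} ta *\<^sub>R D ta"
   using aeI
  proof eventually_elim
   case (elim ta)
   show ?case
   proof (cases "ta \<in> {s1..s2}")
    case True
    then have "(LINT y:{- 1..1}|lebesgue. (d_s w y ta)^2 * (rho p y / (1 - y^2))) = D ta"
     unfolding D_def using elim by (intro slice_integral) (auto simp: rho1_def)
    then show ?thesis by simp
   qed simp
  qed
 qed
 also have "... = (BINT x. (z (snd x) (fst x))^2 * rho1 p (snd x))" unfolding D_def by (rule obox_Fubini[OF Z])
 finally have "(LINT ta:{s1..s2}|lebesgue. (LINT y:{- 1..1}|lebesgue. (d_s w y ta)^2 * (rho p y / (1 - y^2)))) =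
   (BINT x. (z (snd x) (fst x))^2 * rho1 p (snd x))" .
 moreover have "(BINT x. rho1 p (snd x) * (expo p * (z (snd x) (fst x))^2)) =
   expo p * (BINT x. (z (snd x) (fst x))^2 * rho1 p (snd x))" by (subst set_integral_mult_right[symmetric]) (simp add: mult_ac)
 ultimately show "expo p * (LINT ta:{s1..s2}|lebesgue. (LINT y:{- 1..1}|lebesgue. (d_s w y ta)^2 * (rho p y / (1 - y^2)))) =
   (BINT x. rho1 p (snd x) * (expo p * (z (snd x) (fst x))^2))" by simp
qed

end

theorem theorem3:
  fixes p a x\<^sub>0 :: real and T :: "real \<Rightarrow> real" and u :: "real \<Rightarrow> real \<Rightarrow> real"
  assumes "p > 1"
    and "blowup_solution p a T u"
    and "non_characteristic T x\<^sub>0"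
  shows "\<exists>\<theta>\<^sub>0. \<forall>\<theta> \<ge> \<theta>\<^sub>0. \<exists>t\<^sub>1. 0 \<le> t\<^sub>1 \<and> t\<^sub>1 < T x\<^sub>0 \<and>
    (\<forall>T\<^sub>0 s. t\<^sub>1 < T\<^sub>0 \<and> T\<^sub>0 \<le> T x\<^sub>0 \<and> - ln (T\<^sub>0 - t\<^sub>1) \<le> s \<longrightarrow>
      (let w = sim_var p a u x\<^sub>0 T\<^sub>0 in
        set_integrable lebesgue ({-1..1} \<times> {s..s + 1})
          (\<lambda>(y, \<tau>). (d_s w y \<tau>)\<^sup>2 * (rho p y / (1 - y\<^sup>2))) \<and>
        lyap p a \<theta> w (s + 1) - lyap p a \<theta> w s
          \<le> - (2 / (p - 1)) * (LINT \<tau>:{s..s + 1}|lebesgue.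
               (LINT y:{-1..1}|lebesgue. (d_s w y \<tau>)\<^sup>2 * (rho p y / (1 - y\<^sup>2))))))"
proof -
 obtain al A where "wave1d p a T u al A" by (rule wave1d_of_blowup[OF assms(1,2)])
 then interpret wave1d p a T u al A .
 have Tpos: "0 < T x\<^sub>0" using assms(2) by (simp add: blowup_solution_def)
 obtain \<delta> t0 where d: "0 < \<delta>" "\<delta> < 1" and t0: "t0 < T x\<^sub>0"
  and sub: "{(x, t). t < T x\<^sub>0 - \<delta> * \<bar>x - x\<^sub>0\<bar>} \<inter> {(x, t). t0 <= t} \<subseteq> infl_dom T"
  using assms(3) unfolding non_characteristic_def by auto
 have nc: "(x, t) \<in> infl_dom T" if "t0 <= t" "t < T x\<^sub>0 - \<delta> * \<bar>x - x\<^sub>0\<bar>" for x t using sub that by auto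
 obtain t1 C q where t1: "0 <= t1" "t1 < T x\<^sub>0" "T x\<^sub>0 - t1 <= exp (- 1)" and Cq: "0 <= C" "0 <= q"
  and pw: "!!T0 s y. T0 <= T x\<^sub>0 ==> - 1 <= y ==> y <= 1 ==> t1 <= T0 - exp (- s) ==>
    \<bar>u (x\<^sub>0 + y * exp (- s)) (T0 - exp (- s))\<bar> <= C * phi p a s * s powr q"
  by (rule pointwise_bound[OF Tpos d t0 nc], assumption+, rule that)
 obtain Cr S where ok: "refined_ok p a (q + 1) Cr S" by (rule refined_ok_exists[OF assms(1), of "q + 1"]) (use Cq in auto)
 have Cr: "0 <= Cr" "1 <= S" using ok by (auto simp: refined_ok_def)
 \<comment> \<open>Over one unit of time \<open>\<theta> * exp (- s)\<close> decreases by
   \<open>\<theta> * e1 * exp (- s)\<close>, and the decay estimate leaves at most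
   \<open>K * exp (- s)\<close> to be compensated. This gives the threshold \<open>K / e1\<close>,
   which involves no particular \<open>s\<close>.\<close>
 define K where "K = 2 * exp (p + 3) * Cr"
 define e1 where "e1 = 1 - exp (- 1 :: real)"
 have e1: "0 < e1" by (simp add: e1_def)
 \<comment> \<open>From \<open>C <= s\<close> on, the constant of the pointwise bound is absorbed
   into one more power of \<open>s\<close>; this is why the refined estimate was taken with exponent
   \<open>q + 1\<close>.\<close>
 define S' where "S' = max S (max 1 C)"
 define t\<^sub>1 where "t\<^sub>1 = max (max t1 t0) (max (T x\<^sub>0 - exp (- S')) (T x\<^sub>0 / 2))"
 have tt: "t1 <= t\<^sub>1" "t0 <= t\<^sub>1" "T x\<^sub>0 - exp (- S') <= t\<^sub>1" "0 < t\<^sub>1" "t\<^sub>1 < T x\<^sub>0"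
  using t1 t0 Tpos by (auto simp: t\<^sub>1_def)
 show ?thesis
 proof (rule exI[of _ "K / e1"], intro allI impI, rule exI[of _ t\<^sub>1], intro conjI allI impI)
  fix \<theta> assume \<theta>: "K / e1 <= \<theta>"
  show "0 <= t\<^sub>1" "t\<^sub>1 < T x\<^sub>0" using tt by auto
  fix T\<^sub>0 s :: real assume *: "t\<^sub>1 < T\<^sub>0 & T\<^sub>0 <= T x\<^sub>0 & - ln (T\<^sub>0 - t\<^sub>1) <= s"
  have es: "exp (- r) <= T\<^sub>0 - t\<^sub>1" if "s <= r" for r
  proof -
   have "exp (- r) <= exp (ln (T\<^sub>0 - t\<^sub>1))" using * that by (subst exp_le_cancel_iff) linarith
   then show ?thesis using * by simp
  qed
  have sS: "S' <= s"
  proof -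
   have "exp (- s) <= exp (- S')" using es[of s] * tt by linarith
   then show ?thesis by simp
  qed
  have s: "1 <= s" "S <= s" "C <= s" using sS by (auto simp: S'_def)
  interpret c: cone p a T u al A x\<^sub>0 T\<^sub>0 s "s + 1"
  proof unfold_locales
   fix y r :: real assume yr: "- 1 <= y" "y <= 1" "s <= r" "r <= s + 1"
   have p0: "t\<^sub>1 <= T\<^sub>0 - exp (- r)" using es[OF yr(3)] by linarith
   have "\<bar>y * exp (- r)\<bar> <= 1 * exp (- r)" unfolding abs_mult using yr by (intro mult_mono) auto
   then have "\<delta> * \<bar>y * exp (- r)\<bar> <= \<delta> * exp (- r)" using d by (intro mult_left_mono) auto
   also have "... < 1 * exp (- r)" using d by (intro mult_strict_right_mono) auto
   finally have "T\<^sub>0 - exp (- r) < T x\<^sub>0 - \<delta> * \<bar>x\<^sub>0 + y * exp (- r) - x\<^sub>0\<bar>" using * by simp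
   then have "(x\<^sub>0 + y * exp (- r), T\<^sub>0 - exp (- r)) \<in> infl_dom T" using p0 tt by (intro nc) auto
   then show "0 < T\<^sub>0 - exp (- r) & T\<^sub>0 - exp (- r) < T (x\<^sub>0 + y * exp (- r))"
    using p0 tt by (auto simp: infl_dom_def)
  qed (use s in auto)
  have W: "\<bar>c.w y r\<bar> <= r powr (q + 1)" if r: "s <= r" "r <= s + 1" and y: "- 1 < y" "y < 1" for r y
  proof -
   have ph: "0 < phi p a r" using r s by (intro phi_pos) simp
   have "t1 <= T\<^sub>0 - exp (- r)" using es[OF r(1)] tt by linarith
   then have "\<bar>u (x\<^sub>0 + y * exp (- r)) (T\<^sub>0 - exp (- r))\<bar> <= C * phi p a r * r powr q" using * y by (intro pw) auto
   then have "\<bar>c.w y r\<bar> <= C * r powr q" using ph by (simp add: c.w_def abs_divide divide_le_eq mult_ac)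
   also have "... <= r * r powr q" using s r by (intro mult_right_mono) auto
   also have "... = r powr (q + 1)" using s r by (simp add: powr_add)
   finally show ?thesis .
  qed
  define D where "D = (LINT ta:{s..s + 1}|lebesgue. (LINT y:{-1..1}|lebesgue. (d_s c.w y ta)^2 * (rho p y / (1 - y^2))))"
  have ly: "lyap p a \<theta> c.w s = exp ((p + 3) / sqrt s) * c.Lf (s powr (- 3 / 2)) s + \<theta> * exp (- s)"
   "lyap p a \<theta> c.w (s + 1) = exp ((p + 3) / sqrt (s + 1)) * c.Lf ((s + 1) powr (- 3 / 2)) (s + 1) + \<theta> * exp (- (s + 1))"
   by (rule c.lyap_Lf; simp)+
  have "exp (- (s + 1)) = exp (- s) * exp (- 1)" by (simp flip: exp_add)
  then have "\<theta> * exp (- (s + 1)) - \<theta> * exp (- s) = - (\<theta> * e1 * exp (- s))" by (simp add: e1_def algebra_simps)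
  moreover have "K * exp (- s) <= \<theta> * e1 * exp (- s)" using \<theta> e1 by (intro mult_right_mono) (auto simp: divide_le_eq)
  moreover have "exp ((p + 3) / sqrt (s + 1)) * c.Lf ((s + 1) powr (- 3 / 2)) (s + 1) <= exp ((p + 3) / sqrt s) * c.Lf (s powr (- 3 / 2)) s + K * exp (- s) - expo p * D"
   using c.refined_decay[OF ok s(2) W] unfolding c.dissipation_integral(2)[symmetric] D_def K_def .
  ultimately have "lyap p a \<theta> c.w (s + 1) - lyap p a \<theta> c.w s <= - (2 / (p - 1)) * D" unfolding ly expo_def by linarith
  then show "let w = sim_var p a u x\<^sub>0 T\<^sub>0 in
    set_integrable lebesgue ({-1..1} \<times> {s..s + 1})
     (\<lambda>(y, ta). (d_s w y ta)^2 * (rho p y / (1 - y^2))) &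
    lyap p a \<theta> w (s + 1) - lyap p a \<theta> w s
     <= - (2 / (p - 1)) * (LINT ta:{s..s + 1}|lebesgue.
        (LINT y:{-1..1}|lebesgue. (d_s w y ta)^2 * (rho p y / (1 - y^2))))"
   unfolding Let_def c.sim_var_w D_def using c.dissipation_integral(1) by blast
 qed
qed

end
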